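(* For every Zoll contact form $\alpha_0$ on a closed manifold $M$ there exists a smooth family of contact forms $\{\alpha_\lambda\}_{\lambda\in(0,\lambda_0]}$ on $M$ (for some $\lambda_0>0$) which $C^1$-converges to $\alpha_0$ for $\lambda\to0$, and satisfies $$\rho_{\mathrm{sys}}(\alpha_\lambda)>\rho_{\mathrm{sys}}(\alpha_0)\qquad\forall\lambda\in(0,\lambda_0].$$
   Context: $M$ is a closed manifold of dimension $2n-1$, $n\ge1$. A contact form on $M$ is a smooth 1-form $\alpha$ with $\alpha\wedge d\alpha^{n-1}$ nowhere vanishing. The Reeb vector field $R_\alpha$ is defined by $\imath_{R_\alpha}d\alpha=0$, $\imath_{R_\alpha}\alpha=1$. $\mathrm{sys}(\alpha)>0$ is the minimum of the periods of the closed orbits of $R_\alpha$ ($+\infty$ if there are none). $\alpha$ is Zoll if all the orbits of its Reeb flow are closed and have the same minimal period. The systolic ratio is $\rho_{\mathrm{sys}}(\alpha)=\mathrm{sys}(\alpha)^n/\mathrm{vol}(M,\alpha\wedge d\alpha^{n-1})$, where the denominator is the total volume of $M$ with respect to $\alpha\wedge d\alpha^{n-1}$.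
   Formalization: The manifold is assumed to have dimension 2n-1 with n ≥ 2; for n = 1 the claim is false, since on a circle every contact form has systolic ratio 1 and on k circles Zoll forms already attain the maximum 1/k. *)

theory Defs
  imports "HOL-Analysis.Analysis" "HOL-Combinatorics.Permutations"
begin

primrec Ck_on :: "nat \<Rightarrow> 'a::euclidean_space set \<Rightarrow> ('a \<Rightarrow> 'b::real_normed_vector) \<Rightarrow> bool" where
  "Ck_on 0 U f \<longleftrightarrow> continuous_on U f"
| "Ck_on (Suc k) U f \<longleftrightarrow>
     (\<forall>x\<in>U. f differentiable (at x)) \<and> (\<forall>v. Ck_on k U (\<lambda>x. frechet_derivative f (at x) v))"

text \<open>Smoothness on an arbitrary set means local extendability to smooth functions on open sets; on
  open sets this is the usual notion. The generality is needed for parameters in a half-open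
  interval.\<close>

definition smooth_on :: "'a::euclidean_space set \<Rightarrow> ('a \<Rightarrow> 'b::real_normed_vector) \<Rightarrow> bool" where
  "smooth_on S f \<longleftrightarrow>
     (\<forall>x\<in>S. \<exists>U g. open U \<and> x \<in> U \<and> (\<forall>k. Ck_on k U g) \<and> (\<forall>y\<in>S \<inter> U. f y = g y))"


type_synonym ('m, 'e) chart = "'m set \<times> ('m \<Rightarrow> 'e)"

definition chart_image :: "('m, 'e) chart \<Rightarrow> 'e set" where
  "chart_image c = snd c ` fst c"

definition transition :: "('m, 'e) chart \<Rightarrow> ('m, 'e) chart \<Rightarrow> 'e \<Rightarrow> 'e" where
  "transition c d = snd d \<circ> inv_into (fst c) (snd c)"

definition overlap :: "('m, 'e) chart \<Rightarrow> ('m, 'e) chart \<Rightarrow> 'e set" where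
  "overlap c d = snd c ` (fst c \<inter> fst d)"

text \<open>The manifold is the whole type \<open>'m\<close>, so it is nonempty; second countability follows from
  compactness. All charts map onto open sets, so there is no boundary.\<close>

definition closed_manifold :: "('m::t2_space, 'e::euclidean_space) chart set \<Rightarrow> bool" where
  "closed_manifold A \<longleftrightarrow>
     compact (UNIV :: 'm set) \<and>
     (\<Union>c\<in>A. fst c) = UNIV \<and>
     (\<forall>c\<in>A. open (fst c) \<and> open (chart_image c) \<and>
        homeomorphism (fst c) (chart_image c) (snd c) (inv_into (fst c) (snd c))) \<and>
     (\<forall>c\<in>A. \<forall>d\<in>A. smooth_on (overlap c d) (transition c d))"


text \<open>A 1-form is given by its local representatives: \<open>\<alpha> c x v\<close> is the value of the form, read in the
  chart \<open>c\<close>, at the point with coordinates \<open>x\<close> on the vector with components \<open>v\<close>.\<close>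

type_synonym ('m, 'e) form1 = "('m, 'e) chart \<Rightarrow> 'e \<Rightarrow> 'e \<Rightarrow> real"

definition smooth_one_form ::
    "('m::t2_space, 'e::euclidean_space) chart set \<Rightarrow> ('m, 'e) form1 \<Rightarrow> bool" where
  "smooth_one_form A \<alpha> \<longleftrightarrow>
     (\<forall>c\<in>A. (\<forall>x\<in>chart_image c. linear (\<alpha> c x)) \<and>
             (\<forall>v. smooth_on (chart_image c) (\<lambda>x. \<alpha> c x v))) \<and>
     (\<forall>c\<in>A. \<forall>d\<in>A. \<forall>x\<in>overlap c d. \<forall>v.
        \<alpha> c x v = \<alpha> d (transition c d x) (frechet_derivative (transition c d) (at x) v))"

definition ext_deriv ::
    "('m, 'e::euclidean_space) form1 \<Rightarrow> ('m, 'e) chart \<Rightarrow> 'e \<Rightarrow> 'e \<Rightarrow> 'e \<Rightarrow> real" where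
  "ext_deriv \<alpha> c x u v =
     frechet_derivative (\<lambda>y. \<alpha> c y v) (at x) u - frechet_derivative (\<lambda>y. \<alpha> c y u) (at x) v"

text \<open>Alternating \<open>k\<close>-forms on a vector space are functions of \<open>v :: nat \<Rightarrow> 'e\<close> depending only on the
  arguments \<open>v 0, \<dots>, v (k - 1)\<close>. The wedge product is normalised by \<open>1 / (k! l!)\<close>, that is,
  \<open>dx\<^sub>1 \<and> \<dots> \<and> dx\<^sub>k\<close> is the determinant.\<close>

definition wedge ::
    "nat \<Rightarrow> nat \<Rightarrow> ((nat \<Rightarrow> 'e) \<Rightarrow> real) \<Rightarrow> ((nat \<Rightarrow> 'e) \<Rightarrow> real) \<Rightarrow> (nat \<Rightarrow> 'e) \<Rightarrow> real" where
  "wedge k l \<omega> \<eta> v =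
     (\<Sum>\<sigma> | \<sigma> permutes {..<k + l}.
        of_int (sign \<sigma>) * \<omega> (\<lambda>i. v (\<sigma> i)) * \<eta> (\<lambda>i. v (\<sigma> (k + i)))) / (fact k * fact l)"

primrec wedge_power2 :: "((nat \<Rightarrow> 'e) \<Rightarrow> real) \<Rightarrow> nat \<Rightarrow> (nat \<Rightarrow> 'e) \<Rightarrow> real" where
  "wedge_power2 \<omega> 0 = (\<lambda>v. 1)"
| "wedge_power2 \<omega> (Suc m) = wedge 2 (2 * m) \<omega> (wedge_power2 \<omega> m)"

text \<open>\<open>\<alpha> \<and> d\<alpha>\<^bsup>n-1\<^esup>\<close>\<close>

definition contact_volume_form ::
    "nat \<Rightarrow> ('m, 'e::euclidean_space) form1 \<Rightarrow> ('m, 'e) chart \<Rightarrow> 'e \<Rightarrow> (nat \<Rightarrow> 'e) \<Rightarrow> real" where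
  "contact_volume_form n \<alpha> c x =
     wedge 1 (2 * (n - 1)) (\<lambda>v. \<alpha> c x (v 0))
       (wedge_power2 (\<lambda>v. ext_deriv \<alpha> c x (v 0) (v 1)) (n - 1))"

definition contact_form ::
    "('m::t2_space, 'e::euclidean_space) chart set \<Rightarrow> nat \<Rightarrow> ('m, 'e) form1 \<Rightarrow> bool" where
  "contact_form A n \<alpha> \<longleftrightarrow>
     smooth_one_form A \<alpha> \<and>
     (\<forall>c\<in>A. \<forall>x\<in>chart_image c. \<exists>v. contact_volume_form n \<alpha> c x v \<noteq> 0)"


definition basis_enum :: "nat \<Rightarrow> 'e::euclidean_space" where
  "basis_enum = (SOME b. bij_betw b {..<DIM('e)} Basis)"

text \<open>The measure on the manifold induced by \<open>\<alpha> \<and> d\<alpha>\<^bsup>n-1\<^esup>\<close>. The manifold carries the orientation for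
  which this volume form is positive, hence the absolute value; it also makes the order of the
  standard basis irrelevant.\<close>

definition contact_measure ::
    "('m::t2_space, 'e::euclidean_space) chart set \<Rightarrow> nat \<Rightarrow> ('m, 'e) form1 \<Rightarrow> 'm measure" where
  "contact_measure A n \<alpha> =
     (THE \<mu>. sets \<mu> = sets borel \<and>
        (\<forall>c\<in>A. \<forall>B\<in>sets borel. B \<subseteq> fst c \<longrightarrow>
           emeasure \<mu> B =
             (\<integral>\<^sup>+x\<in>snd c ` B. ennreal \<bar>contact_volume_form n \<alpha> c x basis_enum\<bar> \<partial>lborel)))"

definition contact_volume ::
    "('m::t2_space, 'e::euclidean_space) chart set \<Rightarrow> nat \<Rightarrow> ('m, 'e) form1 \<Rightarrow> ennreal" where
  "contact_volume A n \<alpha> = emeasure (contact_measure A n \<alpha>) UNIV"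


definition reeb_field ::
    "('m, 'e::euclidean_space) form1 \<Rightarrow> ('m, 'e) chart \<Rightarrow> 'e \<Rightarrow> 'e" where
  "reeb_field \<alpha> c x = (THE r. (\<forall>v. ext_deriv \<alpha> c x r v = 0) \<and> \<alpha> c x r = 1)"

text \<open>Integral curves are parametrised by the whole real line: on a closed manifold every maximal
  integral curve is.\<close>

definition reeb_orbit ::
    "('m::t2_space, 'e::euclidean_space) chart set \<Rightarrow> ('m, 'e) form1 \<Rightarrow> (real \<Rightarrow> 'm) \<Rightarrow> bool" where
  "reeb_orbit A \<alpha> \<gamma> \<longleftrightarrow>
     continuous_on UNIV \<gamma> \<and>
     (\<forall>c\<in>A. \<forall>t. \<gamma> t \<in> fst c \<longrightarrow>
        ((snd c \<circ> \<gamma>) has_vector_derivative reeb_field \<alpha> c (snd c (\<gamma> t))) (at t))"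

definition is_period :: "(real \<Rightarrow> 'm) \<Rightarrow> real \<Rightarrow> bool" where
  "is_period \<gamma> T \<longleftrightarrow> T > 0 \<and> (\<forall>t. \<gamma> (t + T) = \<gamma> t)"

definition is_minimal_period :: "(real \<Rightarrow> 'm) \<Rightarrow> real \<Rightarrow> bool" where
  "is_minimal_period \<gamma> T \<longleftrightarrow> is_period \<gamma> T \<and> (\<forall>S. is_period \<gamma> S \<longrightarrow> T \<le> S)"

definition zoll_contact_form ::
    "('m::t2_space, 'e::euclidean_space) chart set \<Rightarrow> nat \<Rightarrow> ('m, 'e) form1 \<Rightarrow> bool" where
  "zoll_contact_form A n \<alpha> \<longleftrightarrow>
     contact_form A n \<alpha> \<and> (\<exists>T. \<forall>\<gamma>. reeb_orbit A \<alpha> \<gamma> \<longrightarrow> is_minimal_period \<gamma> T)"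

text \<open>If closed orbits exist, the infimum is attained for a contact form on a closed manifold; if there
  are none, it is \<open>\<infinity>\<close>.\<close>

definition sys :: "('m::t2_space, 'e::euclidean_space) chart set \<Rightarrow> ('m, 'e) form1 \<Rightarrow> ennreal" where
  "sys A \<alpha> = Inf {ennreal T | T. \<exists>\<gamma>. reeb_orbit A \<alpha> \<gamma> \<and> is_period \<gamma> T}"

text \<open>For \<open>n = 1\<close> the manifold is a finite union of circles, and the sum of their lengths is the
  volume. On \<open>k\<close> circles the ratio is at most \<open>1 / k\<close>, with equality for Zoll forms, so that Zoll
  forms are global maximisers. Statements about increasing the ratio need \<open>n \<ge> 2\<close>.\<close>

definition systolic_ratio ::
    "('m::t2_space, 'e::euclidean_space) chart set \<Rightarrow> nat \<Rightarrow> ('m, 'e) form1 \<Rightarrow> ennreal" where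
  "systolic_ratio A n \<alpha> = sys A \<alpha> ^ n / contact_volume A n \<alpha>"


definition smooth_family ::
    "('m::t2_space, 'e::euclidean_space) chart set \<Rightarrow> real set \<Rightarrow> (real \<Rightarrow> ('m, 'e) form1) \<Rightarrow> bool"
  where
  "smooth_family A I \<alpha> \<longleftrightarrow>
     (\<forall>c\<in>A. \<forall>v. smooth_on (I \<times> chart_image c) (\<lambda>(l, x). \<alpha> l c x v))"

text \<open>Convergence of 1-forms in the \<open>C\<^sup>1\<close> topology: on compact subsets of charts, all coefficients and
  their first partial derivatives converge uniformly.\<close>

definition C1_converges ::
    "('m::t2_space, 'e::euclidean_space) chart set \<Rightarrow>
     (real \<Rightarrow> ('m, 'e) form1) \<Rightarrow> ('m, 'e) form1 \<Rightarrow> real filter \<Rightarrow> bool" where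
  "C1_converges A \<alpha> \<beta> F \<longleftrightarrow>
     (\<forall>c\<in>A. \<forall>K. compact K \<and> K \<subseteq> chart_image c \<longrightarrow>
        (\<forall>v. uniform_limit K (\<lambda>l x. \<alpha> l c x v) (\<lambda>x. \<beta> c x v) F \<and>
          (\<forall>u. uniform_limit K (\<lambda>l x. frechet_derivative (\<lambda>y. \<alpha> l c y v) (at x) u)
                 (\<lambda>x. frechet_derivative (\<lambda>y. \<beta> c y v) (at x) u) F)))"

end

theory Submission imports Defs begin

text \<open>The form \<open>\<alpha>\<^sub>0\<close> is multiplied by a function \<open>1 + f\<close> supported in a small box around a point of the
  manifold. Here \<open>f\<close> is the difference of two bumps: a wide and very shallow positive one, and a narrow
  negative one, which is met before it and which is high enough to make the volume smaller. Only the
  closed orbits crossing the box matter. An orbit of the original flow starting in the box comes back to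
  it only after time close to the common period \<open>T\<close>, so a closed orbit of period less than \<open>T\<close> of the
  perturbed flow leaves and enters the box at points joined by an original orbit, and it is enough to show
  that it takes at least as long to cross the box as this original orbit does.

  If the perturbed orbit meets the negative bump, then the gradient of the wide bump displaces it
  sideways by much more than the width of the negative bump, while original orbits starting close to
  that bump stay close to the line through it: the two orbits cannot have the same end points. Otherwise
  the perturbed orbit only sees the positive bump, which slows it down. Comparing the action of the two
  orbits, the gain is the integral of \<open>f\<close>, and the error is quadratic in \<open>f\<close> and its gradient; it is
  absorbed because the square of the gradient of a nonnegative function is bounded by a multiple of
  the function.\<close>

subsection \<open>Functions of class \<open>C\<^sup>k\<close>\<close>

text \<open>Lowering the form by a negative bump alone decreases the volume, but it also speeds up
  the orbits through the bump. The wide bump keeps such orbits from closing up early: its gradient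
  pushes them sideways, along the contact hyperplane, and a nonzero direction in that hyperplane
  exists from dimension three on. Its cost in volume is compensated by making it much lower than the
  negative bump, by a factor that beats the ratio of the two supports. The comparison is between two
  arcs in one chart with common end points. Hence the flow enters only through existence, uniqueness
  and continuity, and the form mainly through one constant \<open>C\<close> of a fixed chart. Every
  length and height is a power of a parameter \<open>l\<close>, so that the requirements become
  \<open>B * l < 1\<close> for one large \<open>B\<close>. The perturbation is small in C^1 only:
  its second derivatives are of order \<open>k / d^2\<close>, which is unbounded for the chosen
  powers.\<close>

lemma Ck_on_cong_imp:
  assumes "open U" "\<And>x. x \<in> U \<Longrightarrow> f x = g x" "Ck_on k U f"
  shows "Ck_on k U g"
  using assms
proof (induction k arbitrary: f g)
  case 0
  then show ?case by (simp cong: continuous_on_cong)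
next
  case (Suc k)
  have d: "frechet_derivative f (at x) = frechet_derivative g (at x) \<and> g differentiable (at x)"
    if "x \<in> U" for x
  proof -
    have f: "(f has_derivative frechet_derivative f (at x)) (at x)"
      using Suc.prems that by (simp add: frechet_derivative_works)
    have "(g has_derivative frechet_derivative f (at x)) (at x)"
      by (rule has_derivative_transform_within_open[OF f \<open>open U\<close> that]) (use Suc.prems in auto)
    then show ?thesis by (metis differentiableI frechet_derivative_at)
  qed
  show ?case
    unfolding Ck_on.simps
  proof (intro conjI allI ballI)
    show "g differentiable (at x)" if "x \<in> U" for x using d[OF that] by simp
    show "Ck_on k U (\<lambda>x. frechet_derivative g (at x) v)" for v
      by (rule Suc.IH[where f = "\<lambda>x. frechet_derivative f (at x) v"]) (use Suc.prems d in auto)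
  qed
qed

lemma Ck_on_subset: "Ck_on k U f \<Longrightarrow> V \<subseteq> U \<Longrightarrow> Ck_on k V f"
  by (induction k arbitrary: f) (auto intro: continuous_on_subset)

lemma Ck_on_local:
  assumes "\<And>x. x \<in> U \<Longrightarrow> \<exists>V. open V \<and> x \<in> V \<and> Ck_on k (V \<inter> U) f"
    and "open U"
  shows "Ck_on k U f"
  using assms
proof (induction k arbitrary: f)
  case 0
  have "continuous (at x) f" if x: "x \<in> U" for x
  proof -
    obtain V where "open V" "x \<in> V" "continuous_on (V \<inter> U) f"
      using 0(1)[OF x] by auto
    then show ?thesis using 0 that by (simp add: continuous_on_eq_continuous_at open_Int)
  qed
  then show ?case using 0 by (simp add: continuous_at_imp_continuous_on)
next
  case (Suc k)
  have "Ck_on k U (\<lambda>x. frechet_derivative f (at x) v)" for v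
    using Suc.prems by (intro Suc.IH) (simp, blast)+
  then show ?case using Suc.prems by auto
qed

lemma Ck_on_SucI:
  assumes "open U" "\<And>x. x \<in> U \<Longrightarrow> (f has_derivative D x) (at x)" "\<And>v. Ck_on k U (\<lambda>x. D x v)"
  shows "Ck_on (Suc k) U f"
  unfolding Ck_on.simps
proof (intro conjI allI ballI)
  show "f differentiable (at x)" if "x \<in> U" for x using assms(2)[OF that] by (rule differentiableI)
  show "Ck_on k U (\<lambda>x. frechet_derivative f (at x) v)" for v
    by (rule Ck_on_cong_imp[OF assms(1) _ assms(3)[of v]]) (simp add: frechet_derivative_at[OF assms(2)])
qed

lemma Ck_on_Suc_imp: "Ck_on (Suc k) U f \<Longrightarrow> Ck_on k U f"
proof (induction k arbitrary: f)
  case 0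
  then show ?case
    by (simp add: continuous_at_imp_continuous_on differentiable_imp_continuous_within)
next
  case (Suc k)
  then show ?case by (metis Ck_on.simps(2))
qed

lemma Ck_on_const: "open U \<Longrightarrow> Ck_on k U (\<lambda>x. c)"
  by (induction k arbitrary: c) (auto simp: frechet_derivative_const)

lemma Ck_on_bounded_linear_compose:
  assumes "open U" "bounded_linear L" "Ck_on k U f"
  shows "Ck_on k U (\<lambda>x. L (f x))"
  using assms(3)
proof (induction k arbitrary: f)
  case 0
  then show ?case using assms bounded_linear.continuous_on by auto
next
  case (Suc k)
  show ?case
  proof (rule Ck_on_SucI[OF assms(1)])
    fix x assume "x \<in> U"
    then show "((\<lambda>x. L (f x)) has_derivative (\<lambda>v. L (frechet_derivative f (at x) v))) (at x)"
      using Suc.prems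
      by (intro bounded_linear.has_derivative[OF assms(2)]) (simp add: frechet_derivative_works)
  qed (use Suc in auto)
qed

lemma Ck_on_id: "open U \<Longrightarrow> Ck_on k U (\<lambda>x. x)"
proof (cases k)
  case (Suc j)
  assume "open U"
  then show ?thesis unfolding Suc
    by (intro Ck_on_SucI[where D = "\<lambda>x v. v"]) (auto intro: Ck_on_const)
qed auto

lemma Ck_on_linear:
  assumes "open U" "bounded_linear L"
  shows "Ck_on k U L"
  using Ck_on_bounded_linear_compose[OF assms Ck_on_id[OF assms(1)]] by simp

lemma Ck_on_add:
  assumes "open U" "Ck_on k U f" "Ck_on k U g"
  shows "Ck_on k U (\<lambda>x. f x + g x)"
  using assms(2,3)
proof (induction k arbitrary: f g)
  case 0
  then show ?case by (auto intro: continuous_intros)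
next
  case (Suc k)
  show ?case
  proof (rule Ck_on_SucI[OF assms(1)])
    fix x assume "x \<in> U"
    then show "((\<lambda>x. f x + g x) has_derivative
        (\<lambda>v. frechet_derivative f (at x) v + frechet_derivative g (at x) v)) (at x)"
      using Suc.prems by (intro has_derivative_add) (simp_all add: frechet_derivative_works)
  qed (use Suc in auto)
qed

lemma Ck_on_minus:
  assumes "open U" "Ck_on k U f"
  shows "Ck_on k U (\<lambda>x. - f x)"
  using Ck_on_bounded_linear_compose[OF assms(1) bounded_linear_minus[OF bounded_linear_ident] assms(2)] .

lemma Ck_on_diff:
  assumes "open U" "Ck_on k U f" "Ck_on k U g"
  shows "Ck_on k U (\<lambda>x. f x - g x)"
  using Ck_on_add[OF assms(1,2) Ck_on_minus[OF assms(1,3)]] by simp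

lemma Ck_on_sum:
  assumes "open U" "finite I" "\<And>i. i \<in> I \<Longrightarrow> Ck_on k U (f i)"
  shows "Ck_on k U (\<lambda>x. \<Sum>i\<in>I. f i x)"
  using assms(2,3)
  by (induction I rule: finite_induct) (auto intro!: Ck_on_const Ck_on_add assms(1))

lemma Ck_on_bilinear:
  assumes "open U" "bounded_bilinear B" "Ck_on k U f" "Ck_on k U g"
  shows "Ck_on k U (\<lambda>x. B (f x) (g x))"
  using assms(3,4)
proof (induction k arbitrary: f g)
  case 0
  then show ?case using bounded_bilinear.continuous_on[OF assms(2)] by auto
next
  case (Suc k)
  show ?case
  proof (rule Ck_on_SucI[OF assms(1)])
    fix x assume "x \<in> U"
    then show "((\<lambda>x. B (f x) (g x)) has_derivative
        (\<lambda>v. B (f x) (frechet_derivative g (at x) v) + B (frechet_derivative f (at x) v) (g x))) (at x)"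
      using Suc.prems
      by (intro bounded_bilinear.FDERIV[OF assms(2)]) (simp_all add: frechet_derivative_works)
  next
    fix v
    have f: "Ck_on k U f" and g: "Ck_on k U g" using Suc.prems by (blast intro: Ck_on_Suc_imp)+
    show "Ck_on k U (\<lambda>x. B (f x) (frechet_derivative g (at x) v) + B (frechet_derivative f (at x) v) (g x))"
      using Suc f g by (intro Ck_on_add[OF assms(1)] Suc.IH) auto
  qed
qed

text \<open>The chain rule evaluates the derivative of \<open>g\<close> in a direction that depends
  on \<open>x\<close>. Expanding this direction in the basis of the intermediate space leaves
  derivatives of \<open>g\<close> in constant directions, composed with \<open>f\<close>, and these
  are covered by the induction over all \<open>g\<close>.\<close>

lemma Ck_on_compose:
  fixes f :: "'a::euclidean_space \<Rightarrow> 'b::euclidean_space"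
  assumes "open U" "Ck_on k U f" "Ck_on k V g" "f ` U \<subseteq> V"
  shows "Ck_on k U (\<lambda>x. g (f x))"
  using assms(2,3)
proof (induction k arbitrary: g)
  case 0
  then show ?case using assms(4) by (auto intro: continuous_on_compose2)
next
  case (Suc k)
  let ?D = "\<lambda>x v. frechet_derivative g (at (f x)) (frechet_derivative f (at x) v)"
  have fx: "x \<in> U \<Longrightarrow> f x \<in> V" for x using assms(4) by auto
  have g: "(g has_derivative frechet_derivative g (at (f x))) (at (f x))" if "x \<in> U" for x
    using Suc.prems fx[OF that] by (simp add: frechet_derivative_works)
  show ?case
  proof (rule Ck_on_SucI[OF assms(1), where D = ?D])
    fix x assume x: "x \<in> U"
    have f: "(f has_derivative frechet_derivative f (at x)) (at x)"
      using Suc.prems x by (simp add: frechet_derivative_works)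
    show "((\<lambda>x. g (f x)) has_derivative ?D x) (at x)"
      by (rule has_derivative_compose[OF f g[OF x]])
  next
    fix v
    have *: "?D x v = (\<Sum>b\<in>Basis. (frechet_derivative f (at x) v \<bullet> b) *\<^sub>R frechet_derivative g (at (f x)) b)"
      if x: "x \<in> U" for x
    proof -
      interpret linear "frechet_derivative g (at (f x))"
        using g[OF x] by (rule has_derivative_linear)
      have "?D x v = frechet_derivative g (at (f x)) (\<Sum>b\<in>Basis. (frechet_derivative f (at x) v \<bullet> b) *\<^sub>R b)"
        by (simp add: euclidean_representation)
      then show ?thesis by (simp add: sum scaleR)
    qed
    have "Ck_on k U (\<lambda>x. \<Sum>b\<in>Basis. (frechet_derivative f (at x) v \<bullet> b) *\<^sub>R frechet_derivative g (at (f x)) b)"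
    proof (intro Ck_on_sum[OF assms(1)] finite_Basis Ck_on_bilinear[OF assms(1) bounded_bilinear_scaleR])
      fix b :: 'b
      show "Ck_on k U (\<lambda>x. frechet_derivative f (at x) v \<bullet> b)"
        using Suc.prems
        by (intro Ck_on_bilinear[OF assms(1) bounded_bilinear_inner] Ck_on_const[OF assms(1)]) auto
      show "Ck_on k U (\<lambda>x. frechet_derivative g (at (f x)) b)"
        using Suc.prems Ck_on_Suc_imp by (intro Suc.IH) auto
    qed
    then show "Ck_on k U (\<lambda>x. ?D x v)"
      by (rule Ck_on_cong_imp[OF assms(1), rotated]) (simp add: *)
  qed
qed

lemma Ck_on_power:
  fixes f :: "'a::euclidean_space \<Rightarrow> real"
  assumes "open U" "Ck_on k U f"
  shows "Ck_on k U (\<lambda>x. f x ^ m)"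
  by (induction m) (auto intro!: Ck_on_const Ck_on_bilinear[OF _ bounded_bilinear_mult] assms)

lemma Ck_on_inverse: "Ck_on k (- {0}) (inverse :: real \<Rightarrow> real)"
proof (induction k)
  case 0
  then show ?case by (auto intro!: continuous_intros)
next
  case (Suc k)
  have o: "open (- {0::real})" by auto
  show ?case
  proof (rule Ck_on_SucI[OF o])
    show "(inverse has_derivative (\<lambda>v. - (inverse x * v * inverse x))) (at x)" if "x \<in> - {0}" for x :: real
      using that by (intro has_derivative_inverse') auto
    show "Ck_on k (- {0}) (\<lambda>x. - (inverse x * v * inverse x))" for v :: real
      by (intro Ck_on_minus[OF o] Ck_on_bilinear[OF o bounded_bilinear_mult] Suc Ck_on_const[OF o])
  qed
qed

lemma Ck_on_fst: "open U \<Longrightarrow> Ck_on k U fst"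
  and Ck_on_snd: "open U \<Longrightarrow> Ck_on k U snd"
  by (auto intro: Ck_on_linear bounded_linear_fst bounded_linear_snd)

lemma smooth_on_open_iff:
  assumes "open S"
  shows "smooth_on S f \<longleftrightarrow> (\<forall>k. Ck_on k S f)"
proof
  assume s: "smooth_on S f"
  show "\<forall>k. Ck_on k S f"
  proof
    fix k
    show "Ck_on k S f"
    proof (rule Ck_on_local[OF _ assms])
      fix x assume "x \<in> S"
      then obtain U g where U: "open U" "x \<in> U" "Ck_on k U g" "\<forall>y\<in>S \<inter> U. f y = g y"
        using s unfolding smooth_on_def by meson
      have "Ck_on k (U \<inter> S) f"
        by (rule Ck_on_cong_imp[of _ g]) (use U assms in \<open>auto intro: Ck_on_subset\<close>)
      then show "\<exists>V. open V \<and> x \<in> V \<and> Ck_on k (V \<inter> S) f" using U by blast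
    qed
  qed
qed (use assms in \<open>auto simp: smooth_on_def\<close>)

subsection \<open>The function \<open>exp (- 1 / t)\<close>\<close>

definition flat :: "real \<Rightarrow> real" where
  "flat t = (if t > 0 then exp (- 1 / t) else 0)"

text \<open>Dividing by powers makes the family closed under differentiation up to linear
  combinations, so that smoothness follows for all \<open>m\<close> by one induction on the order.
  \<open>flat_quot 2\<close> is the derivative of \<open>flat\<close>.\<close>

definition flat_quot :: "nat \<Rightarrow> real \<Rightarrow> real" where
  "flat_quot m t = (if t > 0 then exp (- 1 / t) / t ^ m else 0)"

lemma flat_quot_0: "flat_quot 0 = flat"
  by (auto simp: flat_quot_def flat_def)

text \<open>With \<open>k = m + 1\<close>, the inequality \<open>x \<le> exp x\<close> at
  \<open>x = 1 / (t * k)\<close> is raised to the power \<open>k\<close>. Compared with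
  \<open>t ^ m\<close> one power of \<open>t\<close> is left over, which yields differentiability at
  0.\<close>

lemma flat_quot_le:
  assumes "t > 0"
  shows "flat_quot m t \<le> real (m + 1) ^ (m + 1) * t"
proof -
  define k where "k = m + 1"
  have k: "k > 0" by (simp add: k_def)
  have "1 / (t * real k) \<le> exp (1 / (t * real k))"
    using exp_ge_add_one_self[of "1 / (t * real k)"] by linarith
  then have "(1 / (t * real k)) ^ k \<le> exp (1 / (t * real k)) ^ k"
    using assms by (intro power_mono) auto
  also have "\<dots> = exp (1 / t)"
    using k by (simp flip: exp_of_nat_mult)
  finally have "1 / (t * real k) ^ k \<le> exp (1 / t)"
    by (simp add: power_divide)
  then have "exp (- 1 / t) \<le> (t * real k) ^ k"
    using assms k by (simp add: exp_minus field_simps)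
  then have "exp (- 1 / t) / t ^ m \<le> (t * real k) ^ k / t ^ m"
    using assms by (intro divide_right_mono) auto
  also have "\<dots> = real k ^ k * t"
  proof -
    have "(t * K) ^ (m + 1) / t ^ m = K ^ (m + 1) * t" for K
      using assms by (simp add: power_mult_distrib)
    then show ?thesis unfolding k_def .
  qed
  finally show ?thesis using assms by (simp add: flat_quot_def k_def)
qed

lemma flat_quot_nonneg: "flat_quot m t \<ge> 0"
  by (simp add: flat_quot_def)

lemma has_derivative_flat_quot:
  "(flat_quot m has_real_derivative flat_quot (m + 2) t - real m * flat_quot (m + 1) t) (at t)"
proof -
  consider "t > 0" | "t < 0" | "t = 0" by linarith
  then show ?thesis
  proof cases
    case 1
    have "((\<lambda>t. exp (- 1 / t) / t ^ m) has_real_derivative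
        flat_quot (m + 2) t - real m * flat_quot (m + 1) t) (at t)"
    proof -
      let ?E = "exp (- 1 / t)"
      have E: "((\<lambda>t. exp (- 1 / t)) has_real_derivative ?E * (1 / t\<^sup>2)) (at t)"
        using 1 by (auto intro!: derivative_eq_intros simp: power2_eq_square)
      have "((\<lambda>t. exp (- 1 / t) / t ^ m) has_real_derivative
          (?E * (1 / t\<^sup>2) * t ^ m - ?E * (real m * t ^ (m - Suc 0))) / (t ^ m * t ^ m)) (at t)"
        using 1 by (intro DERIV_divide E DERIV_pow) auto
      moreover have "(?E * (1 / t\<^sup>2) * t ^ m - ?E * (real m * t ^ (m - Suc 0))) / (t ^ m * t ^ m)
          = ?E / t ^ (m + 2) - real m * (?E / t ^ (m + 1))"
      proof (cases m)
        case (Suc j)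
        have "(a * (1 / t\<^sup>2) * (t * P) - a * (M * P)) / ((t * P) * (t * P)) = a / (t * (t * (t * P))) - M * (a / (t * (t * P)))"
          if "P \<noteq> 0" for a P M using that 1 by (simp add: divide_simps power2_eq_square) (simp add: algebra_simps)
        from this[of "t ^ j"] 1 show ?thesis by (simp add: Suc)
      qed (simp add: power2_eq_square)
      ultimately show ?thesis using 1 by (simp add: flat_quot_def)
    qed
    then show ?thesis
      by (rule has_field_derivative_transform_within_open[of _ _ _ "{0<..}"]) (use 1 in \<open>auto simp: flat_quot_def\<close>)
  next
    case 2
    have "((\<lambda>t. 0) has_real_derivative flat_quot (m + 2) t - real m * flat_quot (m + 1) t) (at t)"
      using 2 by (simp add: flat_quot_def)
    then show ?thesis
      by (rule has_field_derivative_transform_within_open[of _ _ _ "{..<0}"]) (use 2 in \<open>auto simp: flat_quot_def\<close>)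
  next
    case 3
    \<comment> \<open>At 0 the difference quotient of \<open>flat_quot m\<close> to the right is
      \<open>flat_quot (m + 1)\<close>, which is at most \<open>C * h\<close>; to the left it is
      0.\<close>
    define C where "C = real (m + 2) ^ (m + 2)"
    have "(\<lambda>h. (flat_quot m (0 + h) - flat_quot m 0) / h) \<midarrow>0\<rightarrow> 0"
    proof (rule Lim_null_comparison)
      show "\<forall>\<^sub>F h in at 0. norm ((flat_quot m (0 + h) - flat_quot m 0) / h) \<le> C * \<bar>h\<bar>"
      proof (rule always_eventually, rule allI)
        fix h :: real
        have "flat_quot m h / h = flat_quot (m + 1) h" if "h > 0"
          using that by (simp add: flat_quot_def field_simps)
        moreover have "flat_quot (m + 1) h \<le> C * h" if "h > 0"
          using flat_quot_le[OF that, of "m + 1"] by (simp add: C_def del: power_Suc)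
        moreover have "C \<ge> 0" by (simp add: C_def)
        ultimately show "norm ((flat_quot m (0 + h) - flat_quot m 0) / h) \<le> C * \<bar>h\<bar>"
          using flat_quot_nonneg[of "m + 1" h]
          by (cases "h > 0") (simp_all add: flat_quot_def mult.commute zero_le_mult_iff mult_le_0_iff)
      qed
      show "((\<lambda>h. C * \<bar>h\<bar>) \<longlongrightarrow> 0) (at 0)" by (auto intro!: tendsto_eq_intros)
    qed
    then show ?thesis using 3 by (simp add: DERIV_def flat_quot_def)
  qed
qed

lemma Ck_on_flat_quot: "Ck_on k UNIV (flat_quot m)"
proof (induction k arbitrary: m)
  case 0
  show ?case
    by (auto intro!: continuous_at_imp_continuous_on DERIV_isCont has_derivative_flat_quot)
next
  case (Suc k)
  show ?case
  proof (rule Ck_on_SucI[OF open_UNIV])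
    show "(flat_quot m has_derivative (\<lambda>v. v * (flat_quot (m + 2) t - real m * flat_quot (m + 1) t))) (at t)" for t
      using has_derivative_flat_quot[of m t] unfolding has_field_derivative_def
      by (rule has_derivative_eq_rhs) (rule ext, rule mult.commute)
    show "Ck_on k UNIV (\<lambda>t. v * (flat_quot (m + 2) t - real m * flat_quot (m + 1) t))" for v
      by (intro Ck_on_bilinear[OF _ bounded_bilinear_mult] Ck_on_diff Ck_on_const open_UNIV Suc)
  qed
qed

lemma Ck_on_flat: "Ck_on k UNIV flat"
  using Ck_on_flat_quot[of k 0] by (simp add: flat_quot_0)

lemma flat_has_derivative: "(flat has_real_derivative flat_quot 2 t) (at t)"
  using has_derivative_flat_quot[of 0 t] by (simp add: flat_quot_0 numeral_2_eq_2)

lemma flat_nonneg: "flat t \<ge> 0" and flat_le_1: "flat t \<le> 1" and flat_eq_0: "t \<le> 0 \<Longrightarrow> flat t = 0"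
  by (auto simp: flat_def)

lemma flat_mono: "s \<le> t \<Longrightarrow> flat s \<le> flat t"
  by (auto simp: flat_def frac_le)

lemma flat_quot_eq_0: "t \<le> 0 \<Longrightarrow> flat_quot m t = 0"
  by (simp add: flat_quot_def)

lemma flat_quot_bound:
  assumes "t \<le> 1"
  shows "flat_quot m t \<le> real (m + 1) ^ (m + 1)"
proof (cases "t > 0")
  case True
  have "real (m + 1) ^ (m + 1) * t \<le> real (m + 1) ^ (m + 1) * 1"
    using assms by (intro mult_left_mono) auto
  with flat_quot_le[OF True, of m] show ?thesis by linarith
qed (simp add: flat_quot_def)

text \<open>The square is \<open>exp (- 2 / t) / t^4\<close>, that is, \<open>flat_quot 4\<close>
  times \<open>flat\<close>; 3125 = 5^5 bounds the first factor.\<close>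

lemma flat_derivative_square_le:
  assumes "t \<le> 1"
  shows "(flat_quot 2 t)\<^sup>2 \<le> 3125 * flat t"
proof -
  have "(flat_quot 2 t)\<^sup>2 = flat_quot 4 t * flat t"
    by (simp add: flat_quot_def flat_def power2_eq_square) (simp add: field_simps power4_eq_xxxx)
  also have "\<dots> \<le> 3125 * flat t"
    using flat_quot_bound[OF assms, of 4] by (intro mult_right_mono flat_nonneg) auto
  finally show ?thesis .
qed

lemma flat_quot_2_lower:
  assumes "1 / 4 \<le> t" "t \<le> 1"
  shows "exp (- 4) \<le> flat_quot 2 t"
proof -
  have "exp (- 4) \<le> exp (- 1 / t)" using assms by (simp add: field_simps)
  also have "\<dots> \<le> exp (- 1 / t) / t\<^sup>2"
    using assms by (simp add: field_simps power_le_one mult_left_le)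
  finally show ?thesis using assms by (simp add: flat_quot_def)
qed

subsection \<open>Multilinear and alternating forms\<close>

definition multilinear_upto :: "nat \<Rightarrow> ((nat \<Rightarrow> 'e::real_vector) \<Rightarrow> real) \<Rightarrow> bool" where
  "multilinear_upto N \<Phi> \<longleftrightarrow>
     (\<forall>v. \<forall>i<N. linear (\<lambda>x. \<Phi> (v(i := x)))) \<and> (\<forall>v w. (\<forall>i<N. v i = w i) \<longrightarrow> \<Phi> v = \<Phi> w)"

definition alternating_upto :: "nat \<Rightarrow> ((nat \<Rightarrow> 'e) \<Rightarrow> real) \<Rightarrow> bool" where
  "alternating_upto N \<Phi> \<longleftrightarrow>
     (\<forall>v \<sigma>. \<sigma> permutes {..<N} \<longrightarrow> \<Phi> (v \<circ> \<sigma>) = of_int (sign \<sigma>) * \<Phi> v)"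

lemma multilinear_uptoD1: "multilinear_upto N \<Phi> \<Longrightarrow> i < N \<Longrightarrow> linear (\<lambda>x. \<Phi> (v(i := x)))"
  and multilinear_uptoD2: "multilinear_upto N \<Phi> \<Longrightarrow> (\<And>i. i < N \<Longrightarrow> v i = w i) \<Longrightarrow> \<Phi> v = \<Phi> w"
  by (auto simp: multilinear_upto_def)

lemma fun_upd_permutes:
  assumes "\<sigma> permutes S"
  shows "(\<lambda>i. (v(j := x)) (\<sigma> i)) = (\<lambda>i. v (\<sigma> i))(inv \<sigma> j := x)"
  using permutes_inverses[OF assms] by (auto simp: fun_eq_iff)

lemma multilinear_upto_wedge:
  assumes \<omega>: "multilinear_upto k \<omega>" and \<eta>: "multilinear_upto l \<eta>"
  shows "multilinear_upto (k + l) (wedge k l \<omega> \<eta>)"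
  unfolding multilinear_upto_def
proof (intro conjI allI impI)
  fix v :: "nat \<Rightarrow> 'a" and i assume i: "i < k + l"
  have "linear (\<lambda>x. of_int (sign \<sigma>) * \<omega> (\<lambda>j. (v(i := x)) (\<sigma> j)) * \<eta> (\<lambda>j. (v(i := x)) (\<sigma> (k + j))))"
    if \<sigma>: "\<sigma> permutes {..<k + l}" for \<sigma>
  proof -
    define j where "j = inv \<sigma> i"
    have j: "j < k + l"
      using permutes_in_image[OF permutes_inv[OF \<sigma>], of i] i by (simp add: j_def)
    have eq: "(\<lambda>i'. (v(i := x)) (\<sigma> i')) = (\<lambda>i'. v (\<sigma> i'))(j := x)" for x
      unfolding j_def by (rule fun_upd_permutes[OF \<sigma>])
    have eq': "(\<lambda>i'. (v(i := x)) (\<sigma> (k + i'))) = (\<lambda>i'. ((\<lambda>i'. v (\<sigma> i'))(j := x)) (k + i'))" for x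
      using eq[of x] by (simp add: fun_eq_iff)
    show ?thesis
    proof (cases "j < k")
      case True
      then have "\<And>x. (\<lambda>i'. ((\<lambda>i'. v (\<sigma> i'))(j := x)) (k + i')) = (\<lambda>i'. v (\<sigma> (k + i')))"
        by (auto simp: fun_eq_iff)
      moreover have "linear (\<lambda>x. of_int (sign \<sigma>) * \<omega> ((\<lambda>i'. v (\<sigma> i'))(j := x)) * \<eta> (\<lambda>i'. v (\<sigma> (k + i'))))"
        using multilinear_uptoD1[OF \<omega> True, of "\<lambda>i'. v (\<sigma> i')"]
        by (auto simp: linear_iff algebra_simps)
      ultimately show ?thesis unfolding eq eq' by simp
    next
      case False
      then have jl: "j - k < l" and jk: "k + (j - k) = j" using j by auto
      have "(\<lambda>i'. ((\<lambda>i'. v (\<sigma> i'))(j := x)) (k + i')) = (\<lambda>i'. v (\<sigma> (k + i')))(j - k := x)" for x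
        using jk by (auto simp: fun_eq_iff)
      moreover have "\<omega> ((\<lambda>i'. v (\<sigma> i'))(j := x)) = \<omega> (\<lambda>i'. v (\<sigma> i'))" for x
        by (rule multilinear_uptoD2[OF \<omega>]) (use False in auto)
      moreover have "linear (\<lambda>x. of_int (sign \<sigma>) * \<omega> (\<lambda>i'. v (\<sigma> i')) * \<eta> ((\<lambda>i'. v (\<sigma> (k + i')))(j - k := x)))"
        using multilinear_uptoD1[OF \<eta> jl, of "\<lambda>i'. v (\<sigma> (k + i'))"]
        by (auto simp: linear_iff algebra_simps)
      ultimately show ?thesis unfolding eq eq' by simp
    qed
  qed
  then have "linear (\<lambda>x. \<Sum>\<sigma> | \<sigma> permutes {..<k + l}. of_int (sign \<sigma>) * \<omega> (\<lambda>j. (v(i := x)) (\<sigma> j)) *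
      \<eta> (\<lambda>j. (v(i := x)) (\<sigma> (k + j))))"
    by (intro linear_compose_sum) auto
  from linear_compose_scale_right[OF this, of "1 / (fact k * fact l)"]
  show "linear (\<lambda>x. wedge k l \<omega> \<eta> (v(i := x)))"
    by (simp add: wedge_def)
next
  fix v w :: "nat \<Rightarrow> 'a" assume vw: "\<forall>i<k + l. v i = w i"
  have "\<omega> (\<lambda>i. v (\<sigma> i)) = \<omega> (\<lambda>i. w (\<sigma> i)) \<and> \<eta> (\<lambda>i. v (\<sigma> (k + i))) = \<eta> (\<lambda>i. w (\<sigma> (k + i)))"
    if \<sigma>: "\<sigma> permutes {..<k + l}" for \<sigma>
    using permutes_in_image[OF \<sigma>] vw
    by (intro conjI multilinear_uptoD2[OF \<omega>] multilinear_uptoD2[OF \<eta>]) auto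
  then show "wedge k l \<omega> \<eta> v = wedge k l \<omega> \<eta> w"
    unfolding wedge_def by (intro arg_cong2[where f = "(/)"] sum.cong) auto
qed

text \<open>Antisymmetrisation: composing the summation index with a permutation reorders the sum
  and changes all signs by the same factor, whatever the two factors of the product are.\<close>

lemma alternating_upto_wedge: "alternating_upto (k + l) (wedge k l \<omega> \<eta>)"
  unfolding alternating_upto_def
proof (intro allI impI)
  fix v :: "nat \<Rightarrow> 'a" and \<tau> assume \<tau>: "\<tau> permutes {..<k + l}"
  let ?T = "\<lambda>v \<sigma>. of_int (sign \<sigma>) * \<omega> (\<lambda>i. v (\<sigma> i)) * \<eta> (\<lambda>i. v (\<sigma> (k + i)))"
  let ?P = "{\<sigma>. \<sigma> permutes {..<k + l}}"
  have perm: "permutation \<sigma>" if "\<sigma> permutes {..<k + l}" for \<sigma>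
    using that by (rule permutes_imp_permutation[rotated]) simp
  have "sum (?T (v \<circ> \<tau>)) ?P = (\<Sum>\<sigma>\<in>?P. of_int (sign \<tau>) * ?T v \<sigma>)"
  proof (rule sum.reindex_bij_witness[of _ "\<lambda>\<sigma>. inv \<tau> \<circ> \<sigma>" "\<lambda>\<sigma>. \<tau> \<circ> \<sigma>"])
    fix \<sigma> assume \<sigma>: "\<sigma> \<in> ?P"
    show "inv \<tau> \<circ> (\<tau> \<circ> \<sigma>) = \<sigma>" "\<tau> \<circ> (inv \<tau> \<circ> \<sigma>) = \<sigma>"
      using permutes_inverses[OF \<tau>] by auto
    show "\<tau> \<circ> \<sigma> \<in> ?P" "inv \<tau> \<circ> \<sigma> \<in> ?P"
      using \<sigma> \<tau> by (auto intro: permutes_compose permutes_inv)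
    have "(of_int (sign \<tau>) * of_int (sign \<tau>) :: real) = 1"
      by (simp flip: of_int_mult)
    then show "of_int (sign \<tau>) * ?T v (\<tau> \<circ> \<sigma>) = ?T (v \<circ> \<tau>) \<sigma>"
      using \<sigma> perm \<tau> by (simp add: sign_compose flip: mult.assoc)
  qed
  then show "wedge k l \<omega> \<eta> (v \<circ> \<tau>) = of_int (sign \<tau>) * wedge k l \<omega> \<eta> v"
    by (simp add: wedge_def sum_distrib_left)
qed

lemma alternating_upto_eq_0:
  assumes "alternating_upto N \<Phi>" "i < N" "j < N" "i \<noteq> j" "v i = v j"
  shows "\<Phi> v = 0"
proof -
  have "v \<circ> Transposition.transpose i j = v"
    using assms(5) by (auto simp: fun_eq_iff Transposition.transpose_def)
  moreover have "Transposition.transpose i j permutes {..<N}"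
    using assms by (intro permutes_swap_id) auto
  ultimately have "\<Phi> v = of_int (sign (Transposition.transpose i j)) * \<Phi> v"
    using assms(1) unfolding alternating_upto_def by metis
  then show ?thesis using assms(4) by (simp add: sign_swap_id)
qed

text \<open>Multilinearity reduces the arguments to vectors among the \<open>b i\<close>, and
  alternation reduces these to \<open>b\<close> itself. The induction frees one slot at a time: the
  first \<open>k\<close> slots hold arbitrary vectors, the others basis vectors.\<close>

lemma top_form_determined:
  fixes \<Phi> :: "(nat \<Rightarrow> 'e::real_vector) \<Rightarrow> real"
  assumes ml: "multilinear_upto N \<Phi>" and alt: "alternating_upto N \<Phi>"
    and sp: "span (b ` {..<N}) = UNIV" and b: "\<Phi> b = 0"
  shows "\<Phi> u = 0"
proof -
  have all: "\<Phi> u = 0" if "k \<le> N" "\<forall>i. k \<le> i \<and> i < N \<longrightarrow> u i \<in> b ` {..<N}" for k u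
    using that
  proof (induction k arbitrary: u)
    case 0
    then have "\<forall>i<N. \<exists>s<N. u i = b s" by auto
    then obtain s where s: "\<And>i. i < N \<Longrightarrow> s i < N \<and> u i = b (s i)" by metis
    show ?case
    proof (cases "inj_on s {..<N}")
      case True
      define \<sigma> where "\<sigma> i = (if i < N then s i else i)" for i
      have "bij_betw s {..<N} {..<N}"
        using True s by (intro bij_betw_imageI endo_inj_surj) auto
      then have "bij_betw \<sigma> {..<N} {..<N}"
        by (subst bij_betw_cong[of _ _ s]) (auto simp: \<sigma>_def)
      then have "\<sigma> permutes {..<N}"
        by (rule bij_imp_permutes) (simp add: \<sigma>_def)
      then have "\<Phi> (b \<circ> \<sigma>) = 0" using alt b by (simp add: alternating_upto_def)
      moreover have "\<Phi> u = \<Phi> (b \<circ> \<sigma>)"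
        by (rule multilinear_uptoD2[OF ml]) (simp add: \<sigma>_def s)
      ultimately show ?thesis by simp
    next
      case False
      then obtain i j where "i < N" "j < N" "i \<noteq> j" "s i = s j" by (auto simp: inj_on_def)
      then show ?thesis using s by (intro alternating_upto_eq_0[OF alt, of i j]) auto
    qed
  next
    case (Suc k)
    have lin: "linear (\<lambda>x. \<Phi> (u(k := x)))"
      using Suc.prems by (intro multilinear_uptoD1[OF ml]) auto
    have "\<Phi> (u(k := x)) = 0" if "x \<in> b ` {..<N}" for x
    proof (rule Suc.IH)
      show "k \<le> N" using Suc.prems by simp
      show "\<forall>i. k \<le> i \<and> i < N \<longrightarrow> (u(k := x)) i \<in> b ` {..<N}"
      proof (intro allI impI)
        fix i assume i: "k \<le> i \<and> i < N"
        show "(u(k := x)) i \<in> b ` {..<N}"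
        proof (cases "i = k")
          case False
          then have "Suc k \<le> i" using i by simp
          then show ?thesis using i False Suc.prems(2) by simp
        qed (use that in simp)
      qed
    qed
    moreover have "u k \<in> span (b ` {..<N})" using sp by simp
    ultimately have "\<Phi> (u(k := u k)) = 0"
      by (rule linear_eq_0_on_span[OF lin])
    then show ?case by simp
  qed
  show ?thesis by (rule all[OF order_refl]) auto
qed

lemma top_form_nonzero_independent:
  fixes \<Phi> :: "(nat \<Rightarrow> 'e::euclidean_space) \<Rightarrow> real"
  assumes ml: "multilinear_upto N \<Phi>" and alt: "alternating_upto N \<Phi>"
    and N: "N = DIM('e)" and v: "\<Phi> v \<noteq> 0"
  shows "inj_on v {..<N}" "span (v ` {..<N}) = UNIV"
proof -
  show inj: "inj_on v {..<N}"
  proof (rule inj_onI, rule ccontr)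
    fix i j assume "i \<in> {..<N}" "j \<in> {..<N}" "v i = v j" "i \<noteq> j"
    then have "\<Phi> v = 0" by (intro alternating_upto_eq_0[OF alt, of i j]) auto
    with v show False by simp
  qed
  have "v j \<notin> span (v ` ({..<N} - {j}))" if j: "j < N" for j
  proof
    assume "v j \<in> span (v ` ({..<N} - {j}))"
    moreover have "\<Phi> (v(j := x)) = 0" if x: "x \<in> v ` ({..<N} - {j})" for x
    proof -
      obtain i where "i < N" "i \<noteq> j" "x = v i" using x by auto
      then show ?thesis using j by (intro alternating_upto_eq_0[OF alt, of i j]) auto
    qed
    ultimately have "\<Phi> (v(j := v j)) = 0"
      using linear_eq_0_on_span[OF multilinear_uptoD1[OF ml j], of _ v "v j"] by blast
    with v show False by simp
  qed
  moreover have "v ` ({..<N} - {j}) = v ` {..<N} - {v j}" if "j < N" for j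
    using inj that by (auto simp: inj_on_def)
  ultimately have "independent (v ` {..<N})" by (auto simp: dependent_def)
  moreover have "card (v ` {..<N}) = DIM('e)" using inj N by (simp add: card_image)
  ultimately show "span (v ` {..<N}) = UNIV"
    by (metis card_eq_dim dim_UNIV finite_imageI finite_lessThan order_refl subset_UNIV top.extremum_uniqueI)
qed

section \<open>The form alpha wedge B^m on a vector space and its kernel\<close>

lemma multilinear_upto_bilinear:
  assumes "bilinear B"
  shows "multilinear_upto 2 (\<lambda>v. B (v 0) (v 1))"
  unfolding multilinear_upto_def
proof (intro conjI allI impI)
  fix v :: "nat \<Rightarrow> 'a" and i :: nat assume "i < 2"
  then consider "i = 0" | "i = 1" by linarith
  then show "linear (\<lambda>x. B ((v(i := x)) 0) ((v(i := x)) 1))"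
    using assms by cases (auto simp: bilinear_def)
qed auto

lemma multilinear_upto_wedge_power2:
  assumes "multilinear_upto 2 \<omega>"
  shows "multilinear_upto (2 * m) (wedge_power2 \<omega> m)"
proof (induction m)
  case 0
  then show ?case by (simp add: multilinear_upto_def)
next
  case (Suc m)
  have "multilinear_upto (2 + 2 * m) (wedge 2 (2 * m) \<omega> (wedge_power2 \<omega> m))"
    by (rule multilinear_upto_wedge[OF assms Suc])
  then show ?case by simp
qed

definition covector_wedge_power ::
    "('e \<Rightarrow> real) \<Rightarrow> ('e \<Rightarrow> 'e \<Rightarrow> real) \<Rightarrow> nat \<Rightarrow> (nat \<Rightarrow> 'e) \<Rightarrow> real" where
  "covector_wedge_power \<alpha> B m = wedge 1 (2 * m) (\<lambda>v. \<alpha> (v 0)) (wedge_power2 (\<lambda>v. B (v 0) (v 1)) m)"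

lemma covector_wedge_power_forms:
  assumes "linear \<alpha>" "bilinear B"
  shows "multilinear_upto (2 * m + 1) (covector_wedge_power \<alpha> B m)"
    and "alternating_upto (2 * m + 1) (covector_wedge_power \<alpha> B m)"
proof -
  have "multilinear_upto 1 (\<lambda>v. \<alpha> (v 0))"
    using assms(1) by (auto simp: multilinear_upto_def)
  from multilinear_upto_wedge[OF this multilinear_upto_wedge_power2[OF multilinear_upto_bilinear[OF assms(2)]], of m]
  show "multilinear_upto (2 * m + 1) (covector_wedge_power \<alpha> B m)"
    by (simp add: covector_wedge_power_def)
  show "alternating_upto (2 * m + 1) (covector_wedge_power \<alpha> B m)"
    using alternating_upto_wedge[of 1 "2 * m"] by (simp add: covector_wedge_power_def)
qed

text \<open>In every term of the sum the argument \<open>w\<close> in position \<open>j\<close>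
  lands in exactly one of the two factors, and each factor vanishes as soon as \<open>w\<close> is
  among its arguments.\<close>

lemma wedge_eq_0:
  assumes j: "j < k + l"
    and \<omega>: "\<And>u i. i < k \<Longrightarrow> u i = w \<Longrightarrow> \<omega> u = 0" and \<eta>: "\<And>u i. i < l \<Longrightarrow> u i = w \<Longrightarrow> \<eta> u = 0"
    and v: "v j = w"
  shows "wedge k l \<omega> \<eta> v = 0"
proof -
  have "\<omega> (\<lambda>i. v (\<sigma> i)) = 0 \<or> \<eta> (\<lambda>i. v (\<sigma> (k + i))) = 0" if \<sigma>: "\<sigma> permutes {..<k + l}" for \<sigma>
  proof -
    have *: "\<sigma> (inv \<sigma> j) = j" "inv \<sigma> j < k + l"
      using permutes_inverses[OF \<sigma>] permutes_in_image[OF permutes_inv[OF \<sigma>], of j] j by auto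
    show ?thesis
    proof (cases "inv \<sigma> j < k")
      case True
      then show ?thesis using \<omega>[of "inv \<sigma> j" "\<lambda>i. v (\<sigma> i)"] * v by simp
    next
      case False
      then show ?thesis using \<eta>[of "inv \<sigma> j - k" "\<lambda>i. v (\<sigma> (k + i))"] * v by simp
    qed
  qed
  then have "(\<Sum>\<sigma> | \<sigma> permutes {..<k + l}. of_int (sign \<sigma>) * \<omega> (\<lambda>i. v (\<sigma> i)) * \<eta> (\<lambda>i. v (\<sigma> (k + i)))) = 0"
    by (intro sum.neutral) auto
  then show ?thesis by (simp add: wedge_def)
qed

lemma wedge_power2_eq_0:
  assumes "\<And>x. B w x = 0" "\<And>x. B x w = 0" "j < 2 * m" "v j = w"
  shows "wedge_power2 (\<lambda>v. B (v 0) (v 1)) m v = 0"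
  using assms(3,4)
proof (induction m arbitrary: v j)
  case (Suc m)
  have "wedge 2 (2 * m) (\<lambda>v. B (v 0) (v 1)) (wedge_power2 (\<lambda>v. B (v 0) (v 1)) m) v = 0"
  proof (rule wedge_eq_0[where w = w])
    show "j < 2 + 2 * m" "v j = w" using Suc.prems by auto
    show "B (u 0) (u 1) = 0" if "i < 2" "u i = w" for u :: "nat \<Rightarrow> 'a" and i
      using that assms(1,2) by (auto simp: less_2_cases_iff)
  qed (use Suc.IH in auto)
  then show ?case by simp
qed simp

text \<open>In the frame \<open>v\<close>, putting \<open>w\<close> into slot \<open>j\<close> kills
  the form, while by alternation only the \<open>j\<close>-th coefficient of \<open>w\<close>
  survives there. So all coefficients of \<open>w\<close> vanish.\<close>

lemma covector_wedge_power_nondegenerate: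
  fixes \<alpha> :: "'e::euclidean_space \<Rightarrow> real"
  assumes "linear \<alpha>" "bilinear B" and N: "DIM('e) = 2 * m + 1"
    and v: "covector_wedge_power \<alpha> B m v \<noteq> 0"
    and w: "\<alpha> w = 0" "\<And>x. B w x = 0" "\<And>x. B x w = 0"
  shows "w = 0"
proof -
  note forms = covector_wedge_power_forms[OF assms(1,2), of m]
  let ?\<Phi> = "covector_wedge_power \<alpha> B m" and ?N = "2 * m + 1"
  have inj: "inj_on v {..<?N}" and sp: "span (v ` {..<?N}) = UNIV"
    using top_form_nonzero_independent[OF forms _ v] N by auto
  obtain c where c: "w = (\<Sum>x\<in>v ` {..<?N}. c x *\<^sub>R x)"
    using span_finite[of "v ` {..<?N}"] sp by auto
  have c': "w = (\<Sum>i<?N. c (v i) *\<^sub>R v i)"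
    using c by (simp only: sum.reindex[OF inj] o_def)
  have "c (v j) = 0" if j: "j < ?N" for j
  proof -
    interpret linear "\<lambda>x. ?\<Phi> (v(j := x))" using forms(1) j by (rule multilinear_uptoD1)
    have "?\<Phi> (v(j := w)) = 0"
      unfolding covector_wedge_power_def
      by (rule wedge_eq_0[where w = w and j = j]) (use j w wedge_power2_eq_0[of B w] in auto)
    then have "0 = (\<Sum>i<?N. c (v i) * ?\<Phi> (v(j := v i)))"
      by (simp only: c' sum scaleR real_scaleR_def)
    also have "\<dots> = (\<Sum>i<?N. if i = j then c (v j) * ?\<Phi> v else 0)"
    proof (rule sum.cong)
      fix i assume "i \<in> {..<?N}"
      then show "c (v i) * ?\<Phi> (v(j := v i)) = (if i = j then c (v j) * ?\<Phi> v else 0)"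
        using j alternating_upto_eq_0[OF forms(2), of i j "v(j := v i)"] by auto
    qed simp
    also have "\<dots> = c (v j) * ?\<Phi> v" using j by (subst sum.delta) auto
    finally show ?thesis using v by simp
  qed
  then show ?thesis using c' by simp
qed

text \<open>Proportionality is asked only for the vectors that are inserted, because the exterior
  derivatives of a contact form and of a multiple of it are proportional only on the kernel of the
  form.\<close>

lemma wedge_power2_scale:
  assumes "\<And>i j. i < 2 * m \<Longrightarrow> j < 2 * m \<Longrightarrow> B' (v i) (v j) = c * B (v i) (v j)"
  shows "wedge_power2 (\<lambda>v. B' (v 0) (v 1)) m v = c ^ m * wedge_power2 (\<lambda>v. B (v 0) (v 1)) m v"
  using assms
proof (induction m arbitrary: v)
  case (Suc m)
  have "of_int (sign \<sigma>) * B' (v (\<sigma> 0)) (v (\<sigma> 1)) *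
        wedge_power2 (\<lambda>v. B' (v 0) (v 1)) m (\<lambda>i. v (\<sigma> (2 + i))) =
      c ^ Suc m * (of_int (sign \<sigma>) * B (v (\<sigma> 0)) (v (\<sigma> 1)) *
        wedge_power2 (\<lambda>v. B (v 0) (v 1)) m (\<lambda>i. v (\<sigma> (2 + i))))"
    if \<sigma>: "\<sigma> permutes {..<2 + 2 * m}" for \<sigma>
  proof -
    have lt: "\<sigma> i < 2 * Suc m" if "i < 2 * Suc m" for i
      using permutes_in_image[OF \<sigma>, of i] that by simp
    have "wedge_power2 (\<lambda>v. B' (v 0) (v 1)) m (\<lambda>i. v (\<sigma> (2 + i))) =
        c ^ m * wedge_power2 (\<lambda>v. B (v 0) (v 1)) m (\<lambda>i. v (\<sigma> (2 + i)))"
      by (rule Suc.IH) (intro Suc.prems lt; simp)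
    moreover have "B' (v (\<sigma> 0)) (v (\<sigma> 1)) = c * B (v (\<sigma> 0)) (v (\<sigma> 1))"
      by (intro Suc.prems lt) auto
    ultimately show ?thesis by simp
  qed
  then have "(\<Sum>\<sigma> | \<sigma> permutes {..<2 + 2 * m}. of_int (sign \<sigma>) * B' (v (\<sigma> 0)) (v (\<sigma> 1)) *
        wedge_power2 (\<lambda>v. B' (v 0) (v 1)) m (\<lambda>i. v (\<sigma> (2 + i)))) =
      c ^ Suc m * (\<Sum>\<sigma> | \<sigma> permutes {..<2 + 2 * m}. of_int (sign \<sigma>) * B (v (\<sigma> 0)) (v (\<sigma> 1)) *
        wedge_power2 (\<lambda>v. B (v 0) (v 1)) m (\<lambda>i. v (\<sigma> (2 + i))))"
    unfolding sum_distrib_left by (intro sum.cong refl) (simp only: mem_Collect_eq)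
  then show ?case unfolding wedge_power2.simps wedge_def by simp
qed simp

section \<open>Frames adapted to a covector, and conformal rescaling\<close>

lemma dim_kernel:
  fixes \<alpha> :: "'e::euclidean_space \<Rightarrow> real"
  assumes "linear \<alpha>" "\<alpha> r \<noteq> 0"
  shows "dim {x. \<alpha> x = 0} = DIM('e) - 1"
proof -
  define a where "a = (\<Sum>b\<in>Basis. \<alpha> b *\<^sub>R b)"
  interpret linear \<alpha> by fact
  have *: "\<alpha> x = a \<bullet> x" for x
  proof -
    have "\<alpha> x = \<alpha> (\<Sum>b\<in>Basis. (x \<bullet> b) *\<^sub>R b)" by (simp add: euclidean_representation)
    then show ?thesis by (simp add: sum scaleR a_def inner_sum_left inner_commute[of x] mult.commute)
  qed
  then have "a \<noteq> 0" using assms(2) by auto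
  then show ?thesis using dim_hyperplane[of a] by (simp add: *)
qed

lemma adapted_frame:
  fixes \<alpha> :: "'e::euclidean_space \<Rightarrow> real"
  assumes "linear \<alpha>" "\<alpha> r \<noteq> 0"
  obtains b where "b 0 = r" "\<And>i. 0 < i \<Longrightarrow> i < DIM('e) \<Longrightarrow> \<alpha> (b i) = 0" "span (b ` {..<DIM('e)}) = UNIV"
proof -
  interpret linear \<alpha> by fact
  let ?K = "{x. \<alpha> x = 0}"
  obtain S where S: "S \<subseteq> ?K" "independent S" "?K \<subseteq> span S" "card S = dim ?K"
    using basis_exists by blast
  have "finite S" using S(2) by (rule independent_imp_finite)
  then obtain h where h: "bij_betw h {0..<DIM('e) - 1} S"
    using ex_bij_betw_nat_finite S(4) dim_kernel[OF assms] by metis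
  define b where "b i = (case i of 0 \<Rightarrow> r | Suc j \<Rightarrow> h j)" for i
  have img: "h ` {0..<DIM('e) - 1} = S" using h by (simp add: bij_betw_def)
  have "{..<DIM('e)} = {..<Suc (DIM('e) - 1)}"
    by simp
  also have "\<dots> = insert 0 (Suc ` {0..<DIM('e) - 1})"
    by (simp only: lessThan_Suc_eq_insert_0 atLeast0LessThan)
  finally have "{..<DIM('e)} = insert 0 (Suc ` {0..<DIM('e) - 1})" .
  then have bimg: "b ` {..<DIM('e)} = insert r S"
    by (simp only: image_insert image_image img[symmetric]) (simp add: b_def)
  have "x \<in> span (insert r S)" for x
  proof -
    have "x - (\<alpha> x / \<alpha> r) *\<^sub>R r \<in> ?K" using assms(2) by (simp add: diff scaleR)
    then have "x - (\<alpha> x / \<alpha> r) *\<^sub>R r \<in> span (insert r S)"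
      using S(3) span_mono[of S "insert r S"] by auto
    then have "(x - (\<alpha> x / \<alpha> r) *\<^sub>R r) + (\<alpha> x / \<alpha> r) *\<^sub>R r \<in> span (insert r S)"
      by (rule span_add) (simp add: span_scale span_base)
    then show ?thesis by simp
  qed
  then have "span (b ` {..<DIM('e)}) = UNIV" using bimg by auto
  moreover have "\<alpha> (b i) = 0" if "0 < i" "i < DIM('e)" for i
  proof (cases i)
    case (Suc j)
    then have "j \<in> {0..<DIM('e) - 1}" using that by simp
    then have "h j \<in> S" using img by blast
    then show ?thesis using S(1) Suc by (auto simp: b_def)
  qed (use that in simp)
  moreover have "b 0 = r" by (simp add: b_def)
  ultimately show ?thesis using that by blast
qed

text \<open>The hypothesis on \<open>B'\<close> holds for the exterior derivative of
  \<open>g * \<alpha>\<close> at a point where \<open>g\<close> has the value \<open>c\<close>,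
  since \<open>dg \<and> \<alpha>\<close> vanishes on the kernel of \<alpha>. Top forms are
  determined by one frame, here by one whose vectors except the first lie in this kernel: a
  permutation that moves 0 contributes nothing, and the others evaluate the two-form on kernel
  vectors only.\<close>

lemma covector_wedge_power_conformal:
  fixes \<alpha> :: "'e::euclidean_space \<Rightarrow> real"
  assumes \<alpha>: "linear \<alpha>" and B: "bilinear B" "bilinear B'" and N: "DIM('e) = 2 * m + 1"
    and B': "\<And>u w. \<alpha> u = 0 \<Longrightarrow> \<alpha> w = 0 \<Longrightarrow> B' u w = c * B u w"
  shows "covector_wedge_power (\<lambda>x. c * \<alpha> x) B' m v = c ^ (m + 1) * covector_wedge_power \<alpha> B m v"
proof (cases "\<exists>r. \<alpha> r \<noteq> 0")
  case False
  then show ?thesis by (simp add: covector_wedge_power_def wedge_def)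
next
  case True
  then obtain r where r: "\<alpha> r \<noteq> 0" by blast
  obtain b where b: "b 0 = r" "\<And>i. 0 < i \<Longrightarrow> i < DIM('e) \<Longrightarrow> \<alpha> (b i) = 0"
    "span (b ` {..<DIM('e)}) = UNIV" using adapted_frame[OF \<alpha> r] by blast
  define \<Phi> where "\<Phi> v = covector_wedge_power (\<lambda>x. c * \<alpha> x) B' m v - c ^ (m + 1) * covector_wedge_power \<alpha> B m v" for v
  have c\<alpha>: "linear (\<lambda>x. c * \<alpha> x)" using \<alpha> by (auto simp: linear_iff algebra_simps)
  note f1 = covector_wedge_power_forms[OF \<alpha> B(1), of m]
  note f2 = covector_wedge_power_forms[OF c\<alpha> B(2), of m]
  have "\<Phi> v = 0"
  proof (rule top_form_determined[of "2 * m + 1" \<Phi> b])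
    show "multilinear_upto (2 * m + 1) \<Phi>"
      unfolding multilinear_upto_def \<Phi>_def
    proof (intro conjI allI impI)
      fix v :: "nat \<Rightarrow> 'e" and i assume i: "i < 2 * m + 1"
      show "linear (\<lambda>x. covector_wedge_power (\<lambda>x. c * \<alpha> x) B' m (v(i := x)) -
          c ^ (m + 1) * covector_wedge_power \<alpha> B m (v(i := x)))"
        using multilinear_uptoD1[OF f1(1) i, of v] multilinear_uptoD1[OF f2(1) i, of v]
        by (auto simp: linear_iff algebra_simps)
    next
      fix v w :: "nat \<Rightarrow> 'e" assume "\<forall>i<2 * m + 1. v i = w i"
      then show "covector_wedge_power (\<lambda>x. c * \<alpha> x) B' m v - c ^ (m + 1) * covector_wedge_power \<alpha> B m v =
          covector_wedge_power (\<lambda>x. c * \<alpha> x) B' m w - c ^ (m + 1) * covector_wedge_power \<alpha> B m w"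
        using multilinear_uptoD2[OF f1(1), of v w] multilinear_uptoD2[OF f2(1), of v w] by metis
    qed
    show "alternating_upto (2 * m + 1) \<Phi>"
      using f1(2) f2(2) unfolding alternating_upto_def \<Phi>_def by (simp add: algebra_simps)
    show "span (b ` {..<2 * m + 1}) = UNIV" using b(3) N by simp
    have "of_int (sign \<sigma>) * (c * \<alpha> (b (\<sigma> 0))) * wedge_power2 (\<lambda>v. B' (v 0) (v 1)) m (\<lambda>i. b (\<sigma> (1 + i))) =
        c ^ (m + 1) * (of_int (sign \<sigma>) * \<alpha> (b (\<sigma> 0)) * wedge_power2 (\<lambda>v. B (v 0) (v 1)) m (\<lambda>i. b (\<sigma> (1 + i))))"
      if \<sigma>: "\<sigma> permutes {..<1 + 2 * m}" for \<sigma>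
    proof (cases "\<sigma> 0 = 0")
      case True
      have "\<alpha> (b (\<sigma> (1 + i))) = 0" if "i < 2 * m" for i
      proof (rule b(2))
        show "\<sigma> (1 + i) < DIM('e)" using permutes_in_image[OF \<sigma>, of "1 + i"] that N by simp
        have "\<sigma> (1 + i) \<noteq> \<sigma> 0" using permutes_inj[OF \<sigma>] by (auto dest: injD)
        then show "0 < \<sigma> (1 + i)" using True by simp
      qed
      then have "wedge_power2 (\<lambda>v. B' (v 0) (v 1)) m (\<lambda>i. b (\<sigma> (1 + i))) =
          c ^ m * wedge_power2 (\<lambda>v. B (v 0) (v 1)) m (\<lambda>i. b (\<sigma> (1 + i)))"
        by (intro wedge_power2_scale B') auto
      then show ?thesis by simp
    next
      case False
      then have "\<alpha> (b (\<sigma> 0)) = 0"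
        using b(2)[of "\<sigma> 0"] permutes_in_image[OF \<sigma>, of 0] N by simp
      then show ?thesis by simp
    qed
    then have "(\<Sum>\<sigma> | \<sigma> permutes {..<1 + 2 * m}. of_int (sign \<sigma>) * (c * \<alpha> (b (\<sigma> 0))) *
          wedge_power2 (\<lambda>v. B' (v 0) (v 1)) m (\<lambda>i. b (\<sigma> (1 + i)))) =
        c ^ (m + 1) * (\<Sum>\<sigma> | \<sigma> permutes {..<1 + 2 * m}. of_int (sign \<sigma>) * \<alpha> (b (\<sigma> 0)) *
          wedge_power2 (\<lambda>v. B (v 0) (v 1)) m (\<lambda>i. b (\<sigma> (1 + i))))"
      unfolding sum_distrib_left by (intro sum.cong refl) (simp only: mem_Collect_eq)
    then show "\<Phi> b = 0"
      unfolding \<Phi>_def covector_wedge_power_def wedge_def by simp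
  qed
  then show ?thesis by (simp add: \<Phi>_def)
qed

subsection \<open>An index type for a Euclidean space\<close>

text \<open>The change of variables theorem and determinants are available only for types \<open>real ^ 'n\<close>, where
  \<open>'n\<close> is well-ordered.\<close>

typedef (overloaded) ('e::euclidean_space) bix = "Basis :: 'e set"
  by (rule nonempty_Basis[unfolded ex_in_conv[symmetric]])

definition bix_rank :: "'e::euclidean_space bix \<Rightarrow> nat" where
  "bix_rank = (SOME f. inj f)"

lemma finite_UNIV_bix: "finite (UNIV :: 'e::euclidean_space bix set)"
  unfolding type_definition.Abs_image[OF type_definition_bix, symmetric] by simp

lemma inj_bix_rank: "inj (bix_rank :: 'e::euclidean_space bix \<Rightarrow> nat)"
proof -
  have "\<exists>f :: 'e bix \<Rightarrow> nat. inj f" using finite_imp_inj_to_nat_seg[OF finite_UNIV_bix] by blast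
  then show ?thesis unfolding bix_rank_def by (rule someI_ex)
qed

instantiation bix :: (euclidean_space) "{finite, wellorder}"
begin

definition "less_eq_bix (i :: 'a bix) (j :: 'a bix) \<longleftrightarrow> bix_rank i \<le> bix_rank j"
definition "less_bix (i :: 'a bix) (j :: 'a bix) \<longleftrightarrow> bix_rank i < bix_rank j"

instance
proof
  fix i j k :: "'a bix"
  show "i < j \<longleftrightarrow> i \<le> j \<and> \<not> j \<le> i" "i \<le> i" "i \<le> j \<or> j \<le> i"
    unfolding less_eq_bix_def less_bix_def by linarith+
  show "i \<le> j \<Longrightarrow> j \<le> k \<Longrightarrow> i \<le> k"
    unfolding less_eq_bix_def by linarith
  show "i = j" if "i \<le> j" "j \<le> i"
    using that unfolding less_eq_bix_def by (intro injD[OF inj_bix_rank]) linarith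
  show "finite (UNIV :: 'a bix set)" by (rule finite_UNIV_bix)
next
  fix P :: "'a bix \<Rightarrow> bool" and a
  assume step: "\<And>x. (\<And>y. y < x \<Longrightarrow> P y) \<Longrightarrow> P x"
  show "P a"
    by (induction a rule: measure_induct_rule[of bix_rank]) (rule step, simp add: less_bix_def)
qed

end

lemma card_bix: "CARD('e::euclidean_space bix) = DIM('e)"
  by (rule type_definition.card[OF type_definition_bix])

lemma sum_bix: "(\<Sum>i\<in>UNIV. f (Rep_bix i)) = (\<Sum>b\<in>Basis. f b)"
  by (rule sum.reindex_bij_witness[of _ Abs_bix Rep_bix]) (auto simp: Rep_bix Rep_bix_inverse Abs_bix_inverse)

definition to_vec :: "'e::euclidean_space \<Rightarrow> real ^ 'e bix" where
  "to_vec x = (\<chi> i. x \<bullet> Rep_bix i)"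

definition of_vec :: "real ^ 'e bix \<Rightarrow> 'e::euclidean_space" where
  "of_vec y = (\<Sum>i\<in>UNIV. (y $ i) *\<^sub>R Rep_bix i)"

lemma of_vec_to_vec [simp]: "of_vec (to_vec x) = x"
  unfolding of_vec_def to_vec_def
  using sum_bix[of "\<lambda>b. (x \<bullet> b) *\<^sub>R b"] by (simp add: euclidean_representation)

lemma of_vec_inner: "of_vec y \<bullet> Rep_bix i = y $ i"
proof -
  have "of_vec y \<bullet> Rep_bix i = (\<Sum>j\<in>UNIV. if j = i then y $ i else 0)"
    unfolding of_vec_def inner_sum_left
    by (intro sum.cong refl) (auto simp: inner_Basis Rep_bix Rep_bix_inject)
  then show ?thesis by simp
qed

lemma to_vec_of_vec [simp]: "to_vec (of_vec y) = y"
  by (simp add: vec_eq_iff to_vec_def of_vec_inner)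

lemma linear_to_vec: "linear to_vec" and linear_of_vec: "linear of_vec"
  by (auto simp: linear_iff to_vec_def of_vec_def vec_eq_iff inner_add_left scaleR_add_left
      sum.distrib scaleR_sum_right)

text \<open>The matrix of \<open>B\<close> satisfies \<open>transpose M = - M\<close>, so its
  determinant equals \<open>(- 1) ^ N\<close> times itself and vanishes in odd dimension
  \<open>N\<close>.\<close>

lemma antisymmetric_odd_kernel:
  fixes B :: "'e::euclidean_space \<Rightarrow> 'e \<Rightarrow> real"
  assumes B: "bilinear B" and anti: "\<And>u v. B u v = - B v u" and odd: "odd DIM('e)"
  obtains r where "r \<noteq> 0" "\<And>v. B r v = 0"
proof -
  define M :: "real ^ 'e bix ^ 'e bix" where "M = (\<chi> i j. B (Rep_bix j) (Rep_bix i))"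
  have "Finite_Cartesian_Product.transpose M = (\<chi> i. (- 1) *s M $ i)"
    by (simp add: vec_eq_iff Finite_Cartesian_Product.transpose_def M_def) (intro allI anti)
  then have "det M = det (\<chi> i. (- 1) *s M $ i)" by (metis det_transpose)
  also have "\<dots> = (- 1) ^ DIM('e) * det M"
    using det_rows_mul[of "\<lambda>_. - 1" "\<lambda>i. M $ i"] by (simp add: card_bix)
  finally have "det M = 0" using odd by simp
  then have "\<not> invertible M" by (simp add: invertible_det_nz)
  then obtain x where x: "x \<noteq> 0" "M *v x = 0"
    using matrix_left_invertible_ker[of M] by (auto simp: invertible_left_inverse)
  show thesis
  proof
    show "of_vec x \<noteq> 0" using x(1) by (metis to_vec_of_vec linear_0 linear_to_vec)
    show "B (of_vec x) v = 0" for v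
    proof -
      interpret l: linear "\<lambda>u. B u w" for w using B by (simp add: bilinear_def)
      interpret r: linear "\<lambda>w. B u w" for u using B by (simp add: bilinear_def)
      have *: "B (of_vec x) (Rep_bix i) = 0" for i
      proof -
        have "B (of_vec x) (Rep_bix i) = (M *v x) $ i"
          unfolding of_vec_def l.sum by (simp add: l.scaleR M_def matrix_vector_mult_def mult.commute)
        then show ?thesis using x(2) by simp
      qed
      have "B (of_vec x) v = B (of_vec x) (of_vec (to_vec v))" by simp
      also have "\<dots> = 0" unfolding of_vec_def[of "to_vec v"] r.sum by (simp add: r.scaleR *)
      finally show ?thesis .
    qed
  qed
qed

text \<open>Odd dimension supplies a kernel vector of \<open>B\<close>, nondegeneracy makes \<alpha>
  nonzero on it, and scaling normalises it. Two solutions differ by a vector killed by both \<alpha>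
  and \<open>B\<close>.\<close>

lemma reeb_vector_unique_exists:
  fixes \<alpha> :: "'e::euclidean_space \<Rightarrow> real"
  assumes \<alpha>: "linear \<alpha>" and B: "bilinear B" and anti: "\<And>u v. B u v = - B v u"
    and N: "DIM('e) = 2 * m + 1" and v: "covector_wedge_power \<alpha> B m v \<noteq> 0"
  shows "\<exists>!r. (\<forall>v. B r v = 0) \<and> \<alpha> r = 1"
proof -
  interpret linear \<alpha> by fact
  interpret l: linear "\<lambda>u. B u v" for v using B by (simp add: bilinear_def)
  have nondeg: "w = 0" if "\<alpha> w = 0" "\<And>x. B w x = 0" for w
  proof (rule covector_wedge_power_nondegenerate[OF \<alpha> B N v that])
    show "B x w = 0" for x using anti[of x w] that(2)[of x] by linarith
  qed
  obtain r where r: "r \<noteq> 0" "\<And>v. B r v = 0"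
  proof (rule antisymmetric_odd_kernel[OF B anti])
    show "odd DIM('e)" using N by simp
  qed blast
  have "\<alpha> r \<noteq> 0" using nondeg r by blast
  show ?thesis
  proof (rule ex1I)
    show "(\<forall>v. B ((1 / \<alpha> r) *\<^sub>R r) v = 0) \<and> \<alpha> ((1 / \<alpha> r) *\<^sub>R r) = 1"
      using \<open>\<alpha> r \<noteq> 0\<close> r by (simp only: l.scaleR scaleR) simp
    fix s assume s: "(\<forall>v. B s v = 0) \<and> \<alpha> s = 1"
    have "s - (1 / \<alpha> r) *\<^sub>R r = 0"
      by (rule nondeg) (use s r \<open>\<alpha> r \<noteq> 0\<close> in \<open>simp_all only: l.diff l.scaleR diff scaleR\<close>, simp_all)
    then show "s = (1 / \<alpha> r) *\<^sub>R r" by simp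
  qed
qed

subsection \<open>Symmetry of second derivatives\<close>

abbreviation dir_deriv :: "('a::real_normed_vector \<Rightarrow> 'b::real_normed_vector) \<Rightarrow> 'a \<Rightarrow> 'a \<Rightarrow> 'b" where
  "dir_deriv f v x \<equiv> frechet_derivative f (at x) v"

lemma dir_deriv_along_line:
  fixes f :: "'a::real_normed_vector \<Rightarrow> real"
  assumes "f differentiable (at (w + s *\<^sub>R u))"
  shows "((\<lambda>s. f (w + s *\<^sub>R u)) has_real_derivative dir_deriv f u (w + s *\<^sub>R u)) (at s)"
proof -
  let ?D = "frechet_derivative f (at (w + s *\<^sub>R u))"
  have f: "(f has_derivative ?D) (at (w + s *\<^sub>R u))"
    using assms by (simp add: frechet_derivative_works)
  then interpret linear ?D by (rule has_derivative_linear)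
  have "((\<lambda>s. w + s *\<^sub>R u) has_derivative (\<lambda>s. s *\<^sub>R u)) (at s)"
    by (auto intro!: derivative_eq_intros)
  from has_derivative_compose[OF this f] show ?thesis
    unfolding has_field_derivative_def
    by (rule has_derivative_eq_rhs) (simp add: fun_eq_iff scaleR mult.commute)
qed

text \<open>Mean value theorem twice, first along \<open>u\<close> for the increment in the
  direction \<open>v\<close>, then along \<open>v\<close>. The second difference on the left is
  symmetric in \<open>u\<close> and \<open>v\<close>, so evaluating it in both orders on small
  parallelograms gives the symmetry of second derivatives.\<close>

lemma second_difference:
  fixes f :: "'a::euclidean_space \<Rightarrow> real"
  assumes U: "Ck_on (Suc (Suc k)) U f" and h: "h > 0"
    and sub: "\<And>s t. 0 \<le> s \<Longrightarrow> s \<le> h \<Longrightarrow> 0 \<le> t \<Longrightarrow> t \<le> h \<Longrightarrow> x + s *\<^sub>R u + t *\<^sub>R v \<in> U"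
  obtains s t where "0 \<le> s" "s \<le> h" "0 \<le> t" "t \<le> h"
    "f (x + h *\<^sub>R u + h *\<^sub>R v) - f (x + h *\<^sub>R u) - f (x + h *\<^sub>R v) + f x =
     h * h * dir_deriv (dir_deriv f u) v (x + s *\<^sub>R u + t *\<^sub>R v)"
proof -
  have f: "f differentiable (at y)" and df: "dir_deriv f u differentiable (at y)" if "y \<in> U" for y
    using U that by auto
  have der: "((\<lambda>s. f (x + h *\<^sub>R v + s *\<^sub>R u) - f (x + s *\<^sub>R u)) has_real_derivative
      dir_deriv f u (x + h *\<^sub>R v + s *\<^sub>R u) - dir_deriv f u (x + s *\<^sub>R u)) (at s)"
    if "0 \<le> s" "s \<le> h" for s
    using sub[of s h] sub[of s 0] that h
    by (intro DERIV_diff dir_deriv_along_line f) (simp_all add: algebra_simps)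
  obtain s where s: "0 < s" "s < h"
    "(f (x + h *\<^sub>R v + h *\<^sub>R u) - f (x + h *\<^sub>R u)) - (f (x + h *\<^sub>R v + 0 *\<^sub>R u) - f (x + 0 *\<^sub>R u)) =
      (h - 0) * (dir_deriv f u (x + h *\<^sub>R v + s *\<^sub>R u) - dir_deriv f u (x + s *\<^sub>R u))"
    using MVT2[OF h der] by blast
  have der2: "((\<lambda>t. dir_deriv f u (x + s *\<^sub>R u + t *\<^sub>R v)) has_real_derivative
      dir_deriv (dir_deriv f u) v (x + s *\<^sub>R u + t *\<^sub>R v)) (at t)" if "0 \<le> t" "t \<le> h" for t
    using that s by (intro dir_deriv_along_line df sub) auto
  obtain t where t: "0 < t" "t < h"
    "dir_deriv f u (x + s *\<^sub>R u + h *\<^sub>R v) - dir_deriv f u (x + s *\<^sub>R u + 0 *\<^sub>R v) =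
      (h - 0) * dir_deriv (dir_deriv f u) v (x + s *\<^sub>R u + t *\<^sub>R v)"
    using MVT2[OF h der2] by blast
  have comm: "x + h *\<^sub>R v + s *\<^sub>R u = x + s *\<^sub>R u + h *\<^sub>R v" for s by (simp add: algebra_simps)
  have "f (x + h *\<^sub>R u + h *\<^sub>R v) - f (x + h *\<^sub>R u) - f (x + h *\<^sub>R v) + f x =
      h * h * dir_deriv (dir_deriv f u) v (x + s *\<^sub>R u + t *\<^sub>R v)"
    using s(3) t(3) by (simp add: comm)
  then show ?thesis using that[of s t] s t by simp
qed

lemma second_derivative_symmetric_real:
  fixes f :: "'a::euclidean_space \<Rightarrow> real"
  assumes U: "open U" "Ck_on (Suc (Suc 0)) U f" and x: "x \<in> U"
  shows "dir_deriv (dir_deriv f u) v x = dir_deriv (dir_deriv f v) u x"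
proof (rule ccontr)
  let ?F = "dir_deriv (dir_deriv f u) v" and ?G = "dir_deriv (dir_deriv f v) u"
  assume "?F x \<noteq> ?G x"
  define e where "e = \<bar>?F x - ?G x\<bar> / 2"
  have e: "e > 0" using \<open>?F x \<noteq> ?G x\<close> by (simp add: e_def)
  have "continuous_on U ?F" "continuous_on U ?G" using U(2) by auto
  then have F: "isCont ?F x" and G: "isCont ?G x" using U(1) x by (simp_all add: continuous_on_eq_continuous_at)
  obtain r where r: "r > 0" "ball x r \<subseteq> U" using U(1) x openE by blast
  obtain d1 where d1: "d1 > 0" "\<And>y. dist y x < d1 \<Longrightarrow> dist (?F y) (?F x) < e"
    using F e unfolding continuous_at_eps_delta by blast
  obtain d2 where d2: "d2 > 0" "\<And>y. dist y x < d2 \<Longrightarrow> dist (?G y) (?G x) < e"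
    using G e unfolding continuous_at_eps_delta by blast
  define d where "d = min r (min d1 d2)"
  have d: "d > 0" "d \<le> r" "d \<le> d1" "d \<le> d2" using r d1 d2 by (auto simp: d_def)
  define N where "N = norm u + norm v + 1"
  define h where "h = d / (2 * N)"
  have n: "N > 0" using norm_ge_zero[of u] norm_ge_zero[of v] unfolding N_def by linarith
  have h: "h > 0" using d n by (simp add: h_def)
  have close: "dist (x + s *\<^sub>R u + t *\<^sub>R v) x < d" if "0 \<le> s" "s \<le> h" "0 \<le> t" "t \<le> h" for s t
  proof -
    have "norm (s *\<^sub>R u + t *\<^sub>R v) \<le> s * norm u + t * norm v"
      using norm_triangle_ineq[of "s *\<^sub>R u" "t *\<^sub>R v"] that by simp
    also have "\<dots> \<le> h * norm u + h * norm v"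
      using that by (intro add_mono mult_right_mono) auto
    also have "\<dots> \<le> h * N" using h unfolding N_def by (simp add: distrib_left)
    also have "\<dots> = d / 2" using n by (simp add: h_def)
    also have "\<dots> < d" using d by simp
    finally show ?thesis by (simp add: dist_norm add.assoc)
  qed
  have close': "dist (x + s *\<^sub>R v + t *\<^sub>R u) x < d" if "0 \<le> s" "s \<le> h" "0 \<le> t" "t \<le> h" for s t
    using close[OF that(3,4,1,2)] by (simp add: add_ac)
  have U': "y \<in> U" if "dist y x < d" for y
    using r(2) d(2) that by (auto simp: dist_commute)
  obtain s t where st: "0 \<le> s" "s \<le> h" "0 \<le> t" "t \<le> h"
    "f (x + h *\<^sub>R u + h *\<^sub>R v) - f (x + h *\<^sub>R u) - f (x + h *\<^sub>R v) + f x = h * h * ?F (x + s *\<^sub>R u + t *\<^sub>R v)"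
    by (rule second_difference[OF U(2) h, of x u v]) (use close U' in blast)+
  obtain s' t' where st': "0 \<le> s'" "s' \<le> h" "0 \<le> t'" "t' \<le> h"
    "f (x + h *\<^sub>R v + h *\<^sub>R u) - f (x + h *\<^sub>R v) - f (x + h *\<^sub>R u) + f x = h * h * ?G (x + s' *\<^sub>R v + t' *\<^sub>R u)"
    by (rule second_difference[OF U(2) h, of x v u]) (use close' U' in blast)+
  have "f (x + h *\<^sub>R v + h *\<^sub>R u) = f (x + h *\<^sub>R u + h *\<^sub>R v)" by (simp add: add_ac)
  then have "h * h * ?F (x + s *\<^sub>R u + t *\<^sub>R v) = h * h * ?G (x + s' *\<^sub>R v + t' *\<^sub>R u)"
    using st(5) st'(5) by linarith
  then have eq: "?F (x + s *\<^sub>R u + t *\<^sub>R v) = ?G (x + s' *\<^sub>R v + t' *\<^sub>R u)" using h by simp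
  have "dist (?F (x + s *\<^sub>R u + t *\<^sub>R v)) (?F x) < e"
    using close[OF st(1-4)] d by (intro d1) auto
  moreover have "dist (?G (x + s' *\<^sub>R v + t' *\<^sub>R u)) (?G x) < e"
    using close'[OF st'(1-4)] d by (intro d2) auto
  ultimately have "dist (?F x) (?G x) < 2 * e"
    unfolding eq by (simp add: dist_real_def)
  then show False by (simp add: e_def dist_real_def)
qed

lemma frechet_derivative_inner:
  assumes "f differentiable (at x)"
  shows "dir_deriv (\<lambda>y. f y \<bullet> b) v x = dir_deriv f v x \<bullet> b"
proof -
  have "(f has_derivative frechet_derivative f (at x)) (at x)"
    using assms by (simp add: frechet_derivative_works)
  then have "((\<lambda>y. f y \<bullet> b) has_derivative (\<lambda>v. frechet_derivative f (at x) v \<bullet> b)) (at x)"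
    by (rule has_derivative_inner_left)
  from fun_cong[OF frechet_derivative_at[OF this], of v] show ?thesis by simp
qed

lemma dir_deriv_cong:
  assumes "open U" "x \<in> U" "\<And>y. y \<in> U \<Longrightarrow> f y = g y"
  shows "dir_deriv f v x = dir_deriv g v x"
proof -
  have "(f has_derivative D) (at x) \<longleftrightarrow> (g has_derivative D) (at x)" for D
    using assms has_derivative_transform_within_open[of f D x UNIV U g]
      has_derivative_transform_within_open[of g D x UNIV U f] by auto
  then show ?thesis by (simp add: frechet_derivative_def)
qed

lemma second_derivative_symmetric:
  fixes f :: "'a::euclidean_space \<Rightarrow> 'b::euclidean_space"
  assumes U: "open U" "Ck_on (Suc (Suc 0)) U f" and x: "x \<in> U"
  shows "dir_deriv (dir_deriv f u) v x = dir_deriv (dir_deriv f v) u x"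
proof (rule euclidean_eqI)
  fix b :: 'b
  have f: "f differentiable (at y)" and df: "dir_deriv f w differentiable (at y)" if "y \<in> U" for y w
    using U that by auto
  have Ck: "Ck_on (Suc (Suc 0)) U (\<lambda>y. f y \<bullet> b)"
    by (rule Ck_on_bounded_linear_compose[OF U(1) bounded_linear_inner_left U(2)])
  have *: "dir_deriv (dir_deriv f u) v x \<bullet> b = dir_deriv (dir_deriv (\<lambda>y. f y \<bullet> b) u) v x" for u v
  proof -
    have "dir_deriv (dir_deriv f u) v x \<bullet> b = dir_deriv (\<lambda>y. dir_deriv f u y \<bullet> b) v x"
      by (simp add: frechet_derivative_inner df x)
    also have "\<dots> = dir_deriv (dir_deriv (\<lambda>y. f y \<bullet> b) u) v x"
      by (rule dir_deriv_cong[OF U(1) x]) (simp add: frechet_derivative_inner f)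
    finally show ?thesis .
  qed
  show "dir_deriv (dir_deriv f u) v x \<bullet> b = dir_deriv (dir_deriv f v) u x \<bullet> b"
    unfolding * by (rule second_derivative_symmetric_real[OF U(1) Ck x])
qed

subsection \<open>Charts of a closed manifold\<close>

abbreviation chart_inv :: "('m, 'e) chart \<Rightarrow> 'e \<Rightarrow> 'm" where
  "chart_inv c \<equiv> inv_into (fst c) (snd c)"

locale closed_mfd =
  fixes A :: "('m::t2_space, 'e::euclidean_space) chart set"
  assumes closed_mfd: "closed_manifold A"
begin

lemma compact_mfd: "compact (UNIV :: 'm set)"
  and charts_cover: "\<exists>c\<in>A. m \<in> fst c"
  using closed_mfd unfolding closed_manifold_def by auto

lemma
  assumes "c \<in> A"
  shows open_chart: "open (fst c)" and open_chart_image: "open (chart_image c)"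
    and chart_homeo: "homeomorphism (fst c) (chart_image c) (snd c) (chart_inv c)"
  using closed_mfd assms unfolding closed_manifold_def by auto

lemma
  assumes "c \<in> A"
  shows cont_chart: "continuous_on (fst c) (snd c)"
    and cont_chart_inv: "continuous_on (chart_image c) (chart_inv c)"
    and chart_inv_chart: "m \<in> fst c \<Longrightarrow> chart_inv c (snd c m) = m"
    and chart_chart_inv: "x \<in> chart_image c \<Longrightarrow> snd c (chart_inv c x) = x"
    and chart_inv_mem: "x \<in> chart_image c \<Longrightarrow> chart_inv c x \<in> fst c"
  using chart_homeo[OF assms] unfolding homeomorphism_def by auto

lemma chart_mem: "m \<in> fst c \<Longrightarrow> snd c m \<in> chart_image c"
  by (simp add: chart_image_def)

lemma overlap_iff:
  assumes "c \<in> A"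
  shows "x \<in> overlap c d \<longleftrightarrow> x \<in> chart_image c \<and> chart_inv c x \<in> fst d"
proof
  assume "x \<in> overlap c d"
  then obtain m where "m \<in> fst c" "m \<in> fst d" "x = snd c m" by (auto simp: overlap_def)
  then show "x \<in> chart_image c \<and> chart_inv c x \<in> fst d"
    using assms by (simp add: chart_inv_chart chart_mem)
next
  assume "x \<in> chart_image c \<and> chart_inv c x \<in> fst d"
  then show "x \<in> overlap c d"
    unfolding overlap_def using assms chart_chart_inv chart_inv_mem
    by (intro image_eqI[of _ _ "chart_inv c x"]) auto
qed

lemma open_overlap:
  assumes "c \<in> A" "d \<in> A"
  shows "open (overlap c d)"
proof -
  have "overlap c d = chart_image c \<inter> chart_inv c -` fst d"
    by (rule set_eqI) (simp add: overlap_iff[OF assms(1)])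
  then show ?thesis
    using continuous_open_preimage[OF cont_chart_inv open_chart_image open_chart] assms by simp
qed

lemma overlap_subset: "overlap c d \<subseteq> chart_image c"
  by (auto simp: overlap_def chart_image_def)

lemma transition_eq: "transition c d x = snd d (chart_inv c x)"
  by (simp add: transition_def)

lemma transition_chart: "c \<in> A \<Longrightarrow> m \<in> fst c \<Longrightarrow> transition c d (snd c m) = snd d m"
  by (simp add: transition_eq chart_inv_chart)

lemma transition_overlap:
  assumes "c \<in> A" "d \<in> A" "x \<in> overlap c d"
  shows "transition c d x \<in> overlap d c" "transition d c (transition c d x) = x"
  using assms(3) assms(1,2)
  by (simp_all add: overlap_iff transition_eq chart_inv_chart chart_mem chart_inv_mem chart_chart_inv)

lemma transition_smooth:
  assumes "c \<in> A" "d \<in> A"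
  shows "Ck_on k (overlap c d) (transition c d)"
proof -
  have "smooth_on (overlap c d) (transition c d)"
    using closed_mfd assms unfolding closed_manifold_def by blast
  then show ?thesis using open_overlap[OF assms] by (simp add: smooth_on_open_iff)
qed

lemma transition_has_derivative:
  assumes "c \<in> A" "d \<in> A" "x \<in> overlap c d"
  shows "(transition c d has_derivative frechet_derivative (transition c d) (at x)) (at x)"
  using transition_smooth[OF assms(1,2), of 1] assms(3)
  by (simp add: frechet_derivative_works)

lemma transition_derivative_inverse:
  assumes c: "c \<in> A" "d \<in> A" and x: "x \<in> overlap c d"
  shows "dir_deriv (transition d c) (dir_deriv (transition c d) v x) (transition c d x) = v"
proof -
  let ?T = "transition c d" and ?S = "transition d c"
  have "((\<lambda>y. ?S (?T y)) has_derivative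
      (\<lambda>v. frechet_derivative ?S (at (?T x)) (frechet_derivative ?T (at x) v))) (at x)"
    using has_derivative_compose[OF transition_has_derivative[OF c x]
        transition_has_derivative[OF c(2,1) transition_overlap(1)[OF c x]]] .
  moreover have "((\<lambda>y. ?S (?T y)) has_derivative (\<lambda>v. v)) (at x)"
    by (rule has_derivative_transform_within_open[OF has_derivative_ident open_overlap[OF c] x])
      (simp add: transition_overlap(2)[OF c])
  ultimately show ?thesis using has_derivative_unique by metis
qed

lemma chart_preimage_open:
  assumes "c \<in> A" "open V"
  shows "open {m \<in> fst c. snd c m \<in> V}"
proof -
  have "open (fst c \<inter> snd c -` V)"
    using assms by (intro continuous_open_preimage cont_chart open_chart)
  then show ?thesis by (simp add: vimage_def Int_def)
qed

end

subsection \<open>Smooth one-forms\<close>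

lemma contact_volume_form_eq:
  "contact_volume_form n \<alpha> c x = covector_wedge_power (\<alpha> c x) (ext_deriv \<alpha> c x) (n - 1)"
  by (simp add: contact_volume_form_def covector_wedge_power_def)

lemma wedge_power2_pullback:
  "wedge_power2 (\<lambda>v. B (L (v 0)) (L (v 1))) m v = wedge_power2 (\<lambda>v. B (v 0) (v 1)) m (\<lambda>i. L (v i))"
  by (induction m arbitrary: v) (simp_all add: wedge_def)

lemma covector_wedge_power_pullback:
  "covector_wedge_power (\<lambda>u. \<alpha> (L u)) (\<lambda>u w. B (L u) (L w)) m v =
   covector_wedge_power \<alpha> B m (\<lambda>i. L (v i))"
  unfolding covector_wedge_power_def wedge_power2_pullback[where B = B and L = L] by (simp add: wedge_def)

lemma ext_deriv_antisym: "ext_deriv \<alpha> c x u v = - ext_deriv \<alpha> c x v u"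
  by (simp add: ext_deriv_def)

locale one_form = closed_mfd A
  for A :: "('m::t2_space, 'e::euclidean_space) chart set" +
  fixes \<alpha> :: "('m, 'e) form1"
  assumes smooth_one_form: "smooth_one_form A \<alpha>"
begin

lemma form_linear: "c \<in> A \<Longrightarrow> x \<in> chart_image c \<Longrightarrow> linear (\<alpha> c x)"
  and form_smooth: "c \<in> A \<Longrightarrow> Ck_on k (chart_image c) (\<lambda>x. \<alpha> c x v)"
  and form_pullback: "c \<in> A \<Longrightarrow> d \<in> A \<Longrightarrow> x \<in> overlap c d \<Longrightarrow>
    \<alpha> c x v = \<alpha> d (transition c d x) (dir_deriv (transition c d) v x)"
proof -
  note * = smooth_one_form[unfolded smooth_one_form_def]
  show "c \<in> A \<Longrightarrow> x \<in> chart_image c \<Longrightarrow> linear (\<alpha> c x)" using * by blast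
  show "c \<in> A \<Longrightarrow> Ck_on k (chart_image c) (\<lambda>x. \<alpha> c x v)"
    using * smooth_on_open_iff[OF open_chart_image] by blast
  show "c \<in> A \<Longrightarrow> d \<in> A \<Longrightarrow> x \<in> overlap c d \<Longrightarrow>
    \<alpha> c x v = \<alpha> d (transition c d x) (dir_deriv (transition c d) v x)" using * by blast
qed

lemma form_differentiable:
  "c \<in> A \<Longrightarrow> x \<in> chart_image c \<Longrightarrow> (\<lambda>x. \<alpha> c x v) differentiable (at x)"
  using form_smooth[of c "Suc 0" v] by simp

lemma form_has_derivative:
  "c \<in> A \<Longrightarrow> x \<in> chart_image c \<Longrightarrow>
    ((\<lambda>x. \<alpha> c x v) has_derivative frechet_derivative (\<lambda>x. \<alpha> c x v) (at x)) (at x)"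
  using form_differentiable by (simp add: frechet_derivative_works)

lemma form_expand:
  assumes "c \<in> A" "x \<in> chart_image c"
  shows "\<alpha> c x v = (\<Sum>b\<in>Basis. (v \<bullet> b) * \<alpha> c x b)"
proof -
  interpret linear "\<alpha> c x" using form_linear[OF assms] .
  have "\<alpha> c x v = \<alpha> c x (\<Sum>b\<in>Basis. (v \<bullet> b) *\<^sub>R b)" by (simp add: euclidean_representation)
  then show ?thesis by (simp add: sum scaleR)
qed

lemma form_derivative_linear:
  assumes c: "c \<in> A" and x: "x \<in> chart_image c"
  shows "linear (\<lambda>v. dir_deriv (\<lambda>y. \<alpha> c y v) u x)"
proof (rule linearI)
  note lin = form_linear[OF c]
  have "((\<lambda>y. \<alpha> c y v + \<alpha> c y w) has_derivative
      (\<lambda>u. dir_deriv (\<lambda>y. \<alpha> c y v) u x + dir_deriv (\<lambda>y. \<alpha> c y w) u x)) (at x)" for v w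
    by (intro has_derivative_add form_has_derivative c x)
  then have 1: "((\<lambda>y. \<alpha> c y (v + w)) has_derivative
      (\<lambda>u. dir_deriv (\<lambda>y. \<alpha> c y v) u x + dir_deriv (\<lambda>y. \<alpha> c y w) u x)) (at x)" for v w
    by (rule has_derivative_transform_within_open[OF _ open_chart_image[OF c] x])
      (simp add: linear_add[OF lin])
  show "dir_deriv (\<lambda>y. \<alpha> c y (v + w)) u x = dir_deriv (\<lambda>y. \<alpha> c y v) u x + dir_deriv (\<lambda>y. \<alpha> c y w) u x" for v w
    using fun_cong[OF frechet_derivative_at[OF 1[of v w]], of u] by simp
  have "((\<lambda>y. r * \<alpha> c y v) has_derivative (\<lambda>u. r * dir_deriv (\<lambda>y. \<alpha> c y v) u x)) (at x)" for r v
    by (intro has_derivative_mult_right form_has_derivative c x)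
  then have 2: "((\<lambda>y. \<alpha> c y (r *\<^sub>R v)) has_derivative (\<lambda>u. r * dir_deriv (\<lambda>y. \<alpha> c y v) u x)) (at x)" for r v
    by (rule has_derivative_transform_within_open[OF _ open_chart_image[OF c] x])
      (simp add: linear_scale[OF lin])
  show "dir_deriv (\<lambda>y. \<alpha> c y (r *\<^sub>R v)) u x = r *\<^sub>R dir_deriv (\<lambda>y. \<alpha> c y v) u x" for r v
    using fun_cong[OF frechet_derivative_at[OF 2[of r v]], of u] by simp
qed

lemma form_derivative_linear':
  assumes "c \<in> A" "x \<in> chart_image c"
  shows "linear (\<lambda>u. dir_deriv (\<lambda>y. \<alpha> c y v) u x)"
  using has_derivative_linear[OF form_has_derivative[OF assms]] .

lemma ext_deriv_bilinear:
  assumes "c \<in> A" "x \<in> chart_image c"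
  shows "bilinear (ext_deriv \<alpha> c x)"
  unfolding bilinear_def ext_deriv_def
  using linear_compose_sub[OF form_derivative_linear[OF assms] form_derivative_linear'[OF assms]]
    linear_compose_sub[OF form_derivative_linear'[OF assms] form_derivative_linear[OF assms]]
  by blast

lemma ext_deriv_smooth:
  assumes "c \<in> A"
  shows "Ck_on k (chart_image c) (\<lambda>x. ext_deriv \<alpha> c x u v)"
  unfolding ext_deriv_def using form_smooth[OF assms, of "Suc k"]
  by (intro Ck_on_diff open_chart_image assms) auto

text \<open>Differentiating the transformation law of the form produces an extra term with the
  second derivative of the transition map. This term is symmetric and drops out of the
  antisymmetrised expression.\<close>

lemma ext_deriv_pullback:
  assumes c: "c \<in> A" "d \<in> A" and x: "x \<in> overlap c d"
  shows "ext_deriv \<alpha> c x u v =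
    ext_deriv \<alpha> d (transition c d x) (dir_deriv (transition c d) u x) (dir_deriv (transition c d) v x)"
proof -
  let ?T = "transition c d" and ?O = "overlap c d"
  have O: "open ?O" by (rule open_overlap[OF c])
  have Tx: "?T y \<in> chart_image d" if "y \<in> ?O" for y
    using transition_overlap(1)[OF c that] by (rule subsetD[OF overlap_subset])
  have T: "Ck_on (Suc (Suc 0)) ?O ?T" by (rule transition_smooth[OF c])
  have dT: "(dir_deriv ?T w has_derivative frechet_derivative (dir_deriv ?T w) (at x)) (at x)" for w
    using T x by (auto simp: frechet_derivative_works)
  have *: "dir_deriv (\<lambda>y. \<alpha> c y v) u x =
      dir_deriv (\<lambda>y. \<alpha> d y (dir_deriv ?T v x)) (dir_deriv ?T u x) (?T x) +
      \<alpha> d (?T x) (dir_deriv (dir_deriv ?T v) u x)" for u v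
  proof -
    have 1: "((\<lambda>y. \<Sum>b\<in>Basis. (dir_deriv ?T v y \<bullet> b) * \<alpha> d (?T y) b) has_derivative
        (\<lambda>u. \<Sum>b\<in>Basis. (dir_deriv ?T v x \<bullet> b) * dir_deriv (\<lambda>y. \<alpha> d y b) (dir_deriv ?T u x) (?T x) +
           (dir_deriv (dir_deriv ?T v) u x \<bullet> b) * \<alpha> d (?T x) b)) (at x)"
      by (intro has_derivative_sum has_derivative_mult has_derivative_inner_left dT
          has_derivative_compose[OF transition_has_derivative[OF c x] form_has_derivative[OF c(2) Tx[OF x]]])
    have "((\<lambda>y. \<alpha> c y v) has_derivative
        (\<lambda>u. \<Sum>b\<in>Basis. (dir_deriv ?T v x \<bullet> b) * dir_deriv (\<lambda>y. \<alpha> d y b) (dir_deriv ?T u x) (?T x) +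
           (dir_deriv (dir_deriv ?T v) u x \<bullet> b) * \<alpha> d (?T x) b)) (at x)"
      by (rule has_derivative_transform_within_open[OF 1 O x])
        (simp only: form_pullback[OF c] form_expand[OF c(2) Tx, symmetric])
    from fun_cong[OF frechet_derivative_at[OF this], of u]
    have "dir_deriv (\<lambda>y. \<alpha> c y v) u x =
        (\<Sum>b\<in>Basis. (dir_deriv ?T v x \<bullet> b) * dir_deriv (\<lambda>y. \<alpha> d y b) (dir_deriv ?T u x) (?T x)) +
           (\<Sum>b\<in>Basis. (dir_deriv (dir_deriv ?T v) u x \<bullet> b) * \<alpha> d (?T x) b)"
      by (simp only: sum.distrib)
    moreover have "(\<Sum>b\<in>Basis. (w \<bullet> b) * dir_deriv (\<lambda>y. \<alpha> d y b) (dir_deriv ?T u x) (?T x)) =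
        dir_deriv (\<lambda>y. \<alpha> d y w) (dir_deriv ?T u x) (?T x)" for w
    proof -
      interpret linear "\<lambda>w. dir_deriv (\<lambda>y. \<alpha> d y w) (dir_deriv ?T u x) (?T x)"
        by (rule form_derivative_linear[OF c(2) Tx[OF x]])
      show ?thesis
        using sum[of "\<lambda>b. (w \<bullet> b) *\<^sub>R b" Basis] by (simp add: euclidean_representation scaleR)
    qed
    ultimately show ?thesis by (simp add: form_expand[OF c(2) Tx[OF x], symmetric])
  qed
  have "dir_deriv (dir_deriv ?T v) u x = dir_deriv (dir_deriv ?T u) v x"
    by (rule second_derivative_symmetric[OF O T x])
  then show ?thesis unfolding ext_deriv_def * by simp
qed

lemma contact_volume_form_pullback:
  assumes c: "c \<in> A" "d \<in> A" and x: "x \<in> overlap c d"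
  shows "contact_volume_form n \<alpha> c x v =
    contact_volume_form n \<alpha> d (transition c d x) (\<lambda>i. dir_deriv (transition c d) (v i) x)"
proof -
  let ?L = "\<lambda>u. dir_deriv (transition c d) u x" and ?y = "transition c d x"
  have "\<alpha> c x = (\<lambda>u. \<alpha> d ?y (?L u))" "ext_deriv \<alpha> c x = (\<lambda>u w. ext_deriv \<alpha> d ?y (?L u) (?L w))"
    using form_pullback[OF assms] ext_deriv_pullback[OF assms] by (simp_all add: fun_eq_iff)
  then show ?thesis
    unfolding contact_volume_form_eq
    by (simp only: covector_wedge_power_pullback[where L = ?L])
qed

end

subsection \<open>Bounds on compact sets\<close>

lemma eventually_at_top_ex: "eventually P at_top \<Longrightarrow> \<exists>L::real. P L"
  by (auto simp: eventually_at_top_linorder)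

text \<open>Bounds are stated for all sufficiently large constants, so that finitely many of them
  hold with one common constant by \<open>eventually_conj\<close>.\<close>

lemma eventually_bounded_compact:
  fixes f :: "'a::topological_space \<Rightarrow> 'b::real_normed_vector"
  assumes "compact K" "continuous_on K f"
  shows "\<forall>\<^sub>F L in at_top. \<forall>x\<in>K. norm (f x) \<le> L"
proof -
  have "bounded (f ` K)" using assms by (intro compact_imp_bounded compact_continuous_image)
  then obtain B where B: "\<And>x. x \<in> K \<Longrightarrow> norm (f x) \<le> B" unfolding bounded_iff by blast
  show ?thesis
    using eventually_ge_at_top[of B]
  proof eventually_elim
    case (elim L)
    then show ?case using B order_trans by blast
  qed
qed

lemma linear_bound_Basis:
  fixes f :: "'e::euclidean_space \<Rightarrow> 'b::real_normed_vector"
  assumes "linear f" "\<And>b. b \<in> Basis \<Longrightarrow> norm (f b) \<le> M"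
  shows "norm (f v) \<le> real DIM('e) * M * norm v"
proof -
  interpret linear f by fact
  have "f v = f (\<Sum>b\<in>Basis. (v \<bullet> b) *\<^sub>R b)" by (simp add: euclidean_representation)
  also have "norm \<dots> = norm (\<Sum>b\<in>Basis. (v \<bullet> b) *\<^sub>R f b)" by (simp add: sum scaleR)
  also have "\<dots> \<le> (\<Sum>b\<in>(Basis :: 'e set). norm v * M)"
  proof (rule sum_norm_le)
    fix b :: 'e assume b: "b \<in> Basis"
    show "norm ((v \<bullet> b) *\<^sub>R f b) \<le> norm v * M"
      using assms(2)[OF b] Basis_le_norm[OF b, of v] by (simp add: mult_mono)
  qed
  finally show ?thesis by (simp add: mult_ac)
qed

lemma bilinear_bound_Basis:
  fixes B :: "'e::euclidean_space \<Rightarrow> 'e \<Rightarrow> real"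
  assumes B: "bilinear B" "\<And>b b'. b \<in> Basis \<Longrightarrow> b' \<in> Basis \<Longrightarrow> \<bar>B b b'\<bar> \<le> M"
  shows "\<bar>B u v\<bar> \<le> (real DIM('e))\<^sup>2 * M * norm u * norm v"
proof -
  have "\<bar>B b v\<bar> \<le> real DIM('e) * M * norm v" if "b \<in> Basis" for b
    using linear_bound_Basis[of "B b" M v] B that by (auto simp: bilinear_def)
  then have "\<bar>B u v\<bar> \<le> real DIM('e) * (real DIM('e) * M * norm v) * norm u"
    using linear_bound_Basis[of "\<lambda>u. B u v" "real DIM('e) * M * norm v" u] B by (auto simp: bilinear_def)
  then show ?thesis by (simp add: power2_eq_square mult_ac)
qed

lemma lipschitz_of_derivative_bound:
  fixes f :: "'e::euclidean_space \<Rightarrow> 'b::real_normed_vector"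
  assumes "convex K" "\<And>x. x \<in> K \<Longrightarrow> (f has_derivative D x) (at x)"
    and M: "\<And>x b. x \<in> K \<Longrightarrow> b \<in> Basis \<Longrightarrow> norm (D x b) \<le> M" and K: "x \<in> K" "y \<in> K"
  shows "norm (f x - f y) \<le> real DIM('e) * M * norm (x - y)"
proof (rule differentiable_bound[of K f D])
  show "onorm (D z) \<le> real DIM('e) * M" if "z \<in> K" for z
    using linear_bound_Basis[OF has_derivative_linear[OF assms(2)[OF that]] M[OF that]]
    by (intro onorm_le) auto
qed (use assms in \<open>auto intro: has_derivative_at_withinI\<close>)

lemma eventually_lipschitz_compact:
  fixes f :: "'e::euclidean_space \<Rightarrow> 'b::real_normed_vector"
  assumes K: "compact K" "convex K" "K \<subseteq> U" and f: "Ck_on (Suc 0) U f"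
  shows "\<forall>\<^sub>F L in at_top. \<forall>x\<in>K. \<forall>y\<in>K. norm (f x - f y) \<le> L * norm (x - y)"
proof -
  have "\<forall>\<^sub>F L in at_top. \<forall>b\<in>Basis. \<forall>x\<in>K. norm (dir_deriv f b x) \<le> L"
    using f K by (intro eventually_ball_finite ballI eventually_bounded_compact)
      (auto intro: continuous_on_subset)
  from eventually_at_top_ex[OF this] obtain M where M: "\<And>b x. b \<in> Basis \<Longrightarrow> x \<in> K \<Longrightarrow> norm (dir_deriv f b x) \<le> M"
    by blast
  have lip: "norm (f x - f y) \<le> real DIM('e) * M * norm (x - y)" if "x \<in> K" "y \<in> K" for x y
    by (rule lipschitz_of_derivative_bound[OF K(2) _ M _ ])
      (use f K that in \<open>auto simp: frechet_derivative_works\<close>)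
  show ?thesis
    using eventually_ge_at_top[of "real DIM('e) * M"]
  proof eventually_elim
    case (elim L)
    then show ?case using lip by (meson mult_right_mono norm_ge_zero order_trans)
  qed
qed

text \<open>Mean value inequality for \<open>f\<close> minus its linear part at \<open>x\<close>,
  whose derivative is at most \<open>L * norm (y - x)\<close> on the basis vectors along the
  segment.\<close>

lemma second_order_remainder:
  fixes f :: "'e::euclidean_space \<Rightarrow> real"
  assumes K: "convex K" and f: "\<And>x. x \<in> K \<Longrightarrow> (f has_derivative D x) (at x)"
    and L: "\<And>x y b. x \<in> K \<Longrightarrow> y \<in> K \<Longrightarrow> b \<in> Basis \<Longrightarrow> \<bar>D x b - D y b\<bar> \<le> L * norm (x - y)"
    and L0: "L \<ge> 0" and xy: "x \<in> K" "y \<in> K"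
  shows "\<bar>f y - f x - D x (y - x)\<bar> \<le> real DIM('e) * L * (norm (y - x))\<^sup>2"
proof -
  interpret linear "D x" using f[OF xy(1)] by (rule has_derivative_linear)
  have S: "closed_segment x y \<subseteq> K" using K xy by (simp add: closed_segment_subset)
  have "norm ((f y - D x y) - (f x - D x x)) \<le> real DIM('e) * (L * norm (y - x)) * norm (y - x)"
  proof (rule lipschitz_of_derivative_bound[of "closed_segment x y" "\<lambda>z. f z - D x z" "\<lambda>z v. D z v - D x v"])
    fix z assume z: "z \<in> closed_segment x y"
    show "((\<lambda>z. f z - D x z) has_derivative (\<lambda>v. D z v - D x v)) (at z)"
      using S z by (intro has_derivative_diff f linear_imp_has_derivative linear_axioms) auto
    fix b :: 'e assume "b \<in> Basis"
    then have "\<bar>D z b - D x b\<bar> \<le> L * norm (z - x)" using L S z xy by blast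
    also have "\<dots> \<le> L * norm (y - x)"
      using segment_bound(1)[OF z] L0 by (intro mult_left_mono) (simp_all add: norm_minus_commute)
    finally show "norm (D z b - D x b) \<le> L * norm (y - x)" by simp
  qed auto
  then show ?thesis by (simp add: diff power2_eq_square algebra_simps)
qed

subsection \<open>Reeb vector fields\<close>

locale contact = one_form A \<alpha>
  for A :: "('m::t2_space, 'e::euclidean_space) chart set" and \<alpha> :: "('m, 'e) form1" +
  fixes n :: nat
  assumes dim_eq: "DIM('e) = 2 * (n - 1) + 1" and contact: "contact_form A n \<alpha>"
begin

abbreviation R :: "('m, 'e) chart \<Rightarrow> 'e \<Rightarrow> 'e" where "R \<equiv> reeb_field \<alpha>"
abbreviation E :: "('m, 'e) chart \<Rightarrow> 'e \<Rightarrow> 'e \<Rightarrow> 'e \<Rightarrow> real" where "E \<equiv> ext_deriv \<alpha>"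

lemma contact_nonzero:
  assumes "c \<in> A" "x \<in> chart_image c"
  shows "\<exists>v. covector_wedge_power (\<alpha> c x) (E c x) (n - 1) v \<noteq> 0"
  using contact assms unfolding contact_form_def contact_volume_form_eq by blast

lemma reeb_ex1:
  assumes "c \<in> A" "x \<in> chart_image c"
  shows "\<exists>!r. (\<forall>v. E c x r v = 0) \<and> \<alpha> c x r = 1"
proof -
  obtain v where v: "covector_wedge_power (\<alpha> c x) (E c x) (n - 1) v \<noteq> 0"
    using contact_nonzero[OF assms] by blast
  show ?thesis
    by (rule reeb_vector_unique_exists[OF form_linear[OF assms] ext_deriv_bilinear[OF assms] _ dim_eq v])
      (rule ext_deriv_antisym)
qed

lemma
  assumes "c \<in> A" "x \<in> chart_image c"
  shows E_reeb: "E c x (R c x) v = 0" and form_reeb: "\<alpha> c x (R c x) = 1"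
  using theI'[OF reeb_ex1[OF assms]] by (auto simp: reeb_field_def)

lemma E_reeb':
  assumes "c \<in> A" "x \<in> chart_image c"
  shows "E c x v (R c x) = 0"
  using E_reeb[OF assms, of v] ext_deriv_antisym[of \<alpha> c x v] by simp

lemma reeb_eqI:
  assumes "c \<in> A" "x \<in> chart_image c" "\<And>v. E c x r v = 0" "\<alpha> c x r = 1"
  shows "R c x = r"
  unfolding reeb_field_def by (rule the1_equality[OF reeb_ex1[OF assms(1,2)]]) (use assms in blast)

text \<open>The linear map that sends \<open>r\<close> to the covector
  \<open>E c x r + \<alpha> c x r * \<alpha> c x\<close> is injective and sends the Reeb vector to
  \<alpha>, so one linear system stands for both Reeb equations. Testing it with the Reeb vector
  isolates \<open>\<alpha> c x r\<close>.\<close>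

lemma nondegenerate:
  assumes "c \<in> A" "x \<in> chart_image c" and r: "\<And>v. E c x r v + \<alpha> c x r * \<alpha> c x v = 0"
  shows "r = 0"
proof -
  obtain w where w: "covector_wedge_power (\<alpha> c x) (E c x) (n - 1) w \<noteq> 0"
    using contact_nonzero[OF assms(1,2)] by blast
  have "\<alpha> c x r = 0" using r[of "R c x"] E_reeb'[OF assms(1,2)] form_reeb[OF assms(1,2)] by simp
  moreover from this have E: "E c x r v = 0" for v using r[of v] by simp
  moreover have "E c x v r = 0" for v using E[of v] ext_deriv_antisym[of \<alpha> c x v r] by simp
  ultimately show ?thesis
    by (intro covector_wedge_power_nondegenerate[OF form_linear[OF assms(1,2)] ext_deriv_bilinear[OF assms(1,2)] dim_eq w])
qed

lemma reeb_pullback: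
  assumes c: "c \<in> A" "d \<in> A" and x: "x \<in> overlap c d"
  shows "dir_deriv (transition c d) (R c x) x = R d (transition c d x)"
proof -
  let ?T = "transition c d"
  have x': "x \<in> chart_image c" using x by (rule subsetD[OF overlap_subset])
  have Tx: "?T x \<in> overlap d c" "transition d c (?T x) = x" using transition_overlap[OF c x] by auto
  have Tx': "?T x \<in> chart_image d" using Tx(1) by (rule subsetD[OF overlap_subset])
  have "E d (?T x) (dir_deriv ?T (R c x) x) v = 0" for v
  proof -
    have "v = dir_deriv ?T (dir_deriv (transition d c) v (?T x)) x"
      using transition_derivative_inverse[OF c(2,1) Tx(1), of v] Tx(2) by simp
    then show ?thesis
      using ext_deriv_pullback[OF c x, of "R c x"] E_reeb[OF c(1) x'] by metis
  qed
  moreover have "\<alpha> d (?T x) (dir_deriv ?T (R c x) x) = 1"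
    using form_pullback[OF c x] form_reeb[OF c(1) x'] by metis
  ultimately show ?thesis using reeb_eqI[OF c(2) Tx'] by metis
qed

text \<open>Quantitative injectivity: the right side is continuous and positive on \<open>K\<close>
  times the unit sphere, and homogeneous in \<open>r\<close>.\<close>

lemma coercive:
  assumes c: "c \<in> A" and K: "compact K" "K \<subseteq> chart_image c"
  shows "\<exists>m>0. \<forall>x\<in>K. \<forall>r. m * norm r \<le> (\<Sum>b\<in>Basis. \<bar>E c x r b + \<alpha> c x r * \<alpha> c x b\<bar>)"
proof -
  define F where "F p = (\<Sum>b\<in>Basis. \<bar>E c (fst p) (snd p) b + \<alpha> c (fst p) (snd p) * \<alpha> c (fst p) b\<bar>)" for p
  have lin: "E c x r b = (\<Sum>i\<in>Basis. (r \<bullet> i) * E c x i b)" if "x \<in> chart_image c" for x r b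
  proof -
    interpret linear "\<lambda>r. E c x r b" using ext_deriv_bilinear[OF c that] by (simp add: bilinear_def)
    show ?thesis using sum[of "\<lambda>i. (r \<bullet> i) *\<^sub>R i" Basis] by (simp add: euclidean_representation scaleR)
  qed
  have cE: "continuous_on K (\<lambda>x. E c x i b)" and ca: "continuous_on K (\<lambda>x. \<alpha> c x b)" for i b
    using ext_deriv_smooth[OF c, of 0 i b] form_smooth[OF c, of 0 b] K(2)
    by (auto intro: continuous_on_subset)
  let ?S = "sphere (0::'e) 1"
  have fst: "continuous_on (K \<times> ?S) (\<lambda>p. f (fst p))" if "continuous_on K f" for f :: "'e \<Rightarrow> real"
    by (rule continuous_on_compose2[OF that continuous_on_fst[OF continuous_on_id]]) auto
  have "continuous_on (K \<times> ?S) (\<lambda>p. \<Sum>b\<in>Basis. \<bar>(\<Sum>i\<in>Basis. (snd p \<bullet> i) * E c (fst p) i b) +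
      (\<Sum>i\<in>Basis. (snd p \<bullet> i) * \<alpha> c (fst p) i) * \<alpha> c (fst p) b\<bar>)"
    by (intro continuous_intros fst cE ca)
  then have F: "continuous_on (K \<times> ?S) F"
    by (rule continuous_on_eq) (use K(2) in \<open>auto simp: F_def lin[symmetric] form_expand[OF c, symmetric] subset_iff\<close>)
  have hom: "F (x, s *\<^sub>R r) = \<bar>s\<bar> * F (x, r)" if "x \<in> K" for x s r
  proof -
    have x: "x \<in> chart_image c" using that K by auto
    interpret l: linear "\<lambda>r. E c x r b" for b using ext_deriv_bilinear[OF c x] by (simp add: bilinear_def)
    interpret a: linear "\<alpha> c x" using form_linear[OF c x] .
    have "E c x (s *\<^sub>R r) b + \<alpha> c x (s *\<^sub>R r) * \<alpha> c x b = s * (E c x r b + \<alpha> c x r * \<alpha> c x b)" for b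
      by (simp add: l.scaleR a.scaleR algebra_simps)
    then show ?thesis by (simp add: F_def abs_mult sum_distrib_left)
  qed
  show ?thesis
  proof (cases "K = {}")
    case False
    obtain e :: 'e where "e \<in> Basis" using nonempty_Basis by blast
    then have "e \<in> ?S" by simp
    then have "K \<times> ?S \<noteq> {}" using False by blast
    then obtain p where p: "p \<in> K \<times> ?S" "\<And>q. q \<in> K \<times> ?S \<Longrightarrow> F p \<le> F q"
      using continuous_attains_inf[OF compact_Times[OF K(1) compact_sphere] _ F] by blast
    obtain x r where xr: "p = (x, r)" "x \<in> K" "norm r = 1" using p(1) by auto
    have x: "x \<in> chart_image c" using xr K by auto
    have "F p \<noteq> 0"
    proof
      assume "F p = 0"
      then have z: "E c x r b + \<alpha> c x r * \<alpha> c x b = 0" if "b \<in> Basis" for b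
        using that by (auto simp: F_def xr sum_nonneg_eq_0_iff)
      have "linear (\<lambda>v. E c x r v + \<alpha> c x r * \<alpha> c x v)"
        using ext_deriv_bilinear[OF c x] form_linear[OF c x]
        by (auto simp: bilinear_def linear_iff algebra_simps)
      from linear_bound_Basis[OF this, of 0] z
      have "E c x r v + \<alpha> c x r * \<alpha> c x v = 0" for v by simp
      then have "r = 0" by (rule nondegenerate[OF c x])
      with xr show False by simp
    qed
    moreover have "F p \<ge> 0" by (simp add: F_def sum_nonneg)
    ultimately have "F p > 0" by simp
    moreover have "F p * norm r' \<le> F (y, r')" if "y \<in> K" for y r'
    proof (cases "r' = 0")
      case True
      then show ?thesis by (simp add: F_def sum_nonneg)
    next
      case False
      then have "F p \<le> F (y, (1 / norm r') *\<^sub>R r')" using that by (intro p(2)) auto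
      then have "F p \<le> F (y, r') / norm r'" using hom[OF that, of "1 / norm r'" r'] by simp
      then show ?thesis using False by (simp add: field_simps)
    qed
    ultimately show ?thesis by (auto simp: F_def)
  qed (auto intro: exI[of _ 1])
qed

text \<open>The Reeb vector solves a linear system with coefficients \<open>a i b x\<close> and
  right side \<alpha>. So the difference of two Reeb vectors solves the system at \<open>x\<close>
  whose right side is the change of \<alpha> minus the change of the coefficients applied to
  \<open>R c y\<close>; coercivity turns this into a Lipschitz bound. The last conjunct keeps
  coercivity available for comparing another vector with the Reeb vector.\<close>

lemma reeb_bounds:
  assumes c: "c \<in> A" and K: "compact K" "convex K" "K \<subseteq> chart_image c"
  shows "\<forall>\<^sub>F C in at_top. \<forall>x\<in>K. norm (R c x) \<le> C \<and> (\<forall>y\<in>K. norm (R c x - R c y) \<le> C * norm (x - y)) \<and>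
    (\<forall>r M. (\<forall>v. \<bar>E c x r v + \<alpha> c x r * \<alpha> c x v\<bar> \<le> M * norm v) \<longrightarrow> norm r \<le> C * M)"
proof -
  obtain m where m: "m > 0" and
    coer: "\<And>x r. x \<in> K \<Longrightarrow> m * norm r \<le> (\<Sum>b\<in>Basis. \<bar>E c x r b + \<alpha> c x r * \<alpha> c x b\<bar>)"
    using coercive[OF c K(1,3)] by blast
  have in_c: "x \<in> chart_image c" if "x \<in> K" for x using K that by auto
  define N where "N = real DIM('e)"
  have N: "N \<ge> 0" by (simp add: N_def)
  have coer': "norm r \<le> N / m * M" if "x \<in> K" "\<And>b. b \<in> Basis \<Longrightarrow> \<bar>E c x r b + \<alpha> c x r * \<alpha> c x b\<bar> \<le> M" for x r M
  proof -
    have "m * norm r \<le> N * M"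
      using coer[OF that(1), of r] sum_bounded_above[of Basis "\<lambda>b. \<bar>E c x r b + \<alpha> c x r * \<alpha> c x b\<bar>" M] that(2)
      by (simp add: N_def)
    then show ?thesis using m by (simp add: field_simps)
  qed
  define a where "a i b x = E c x i b + \<alpha> c x i * \<alpha> c x b" for i b x
  have a_smooth: "Ck_on (Suc 0) (chart_image c) (a i b)" for i b
    unfolding a_def by (intro Ck_on_add Ck_on_bilinear[OF _ bounded_bilinear_mult] ext_deriv_smooth form_smooth open_chart_image c)
  have "\<forall>\<^sub>F L in at_top. (\<forall>b\<in>Basis. \<forall>x\<in>K. norm (\<alpha> c x b) \<le> L) \<and>
      (\<forall>b\<in>Basis. \<forall>x\<in>K. \<forall>y\<in>K. norm (\<alpha> c x b - \<alpha> c y b) \<le> L * norm (x - y)) \<and>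
      (\<forall>i\<in>Basis. \<forall>b\<in>Basis. \<forall>x\<in>K. \<forall>y\<in>K. norm (a i b x - a i b y) \<le> L * norm (x - y)) \<and> L \<ge> 0"
    using form_smooth[OF c, of 0] K
    by (intro eventually_conj eventually_ball_finite ballI finite_Basis eventually_bounded_compact
        eventually_lipschitz_compact[OF K] form_smooth[OF c] a_smooth eventually_ge_at_top)
      (auto intro: continuous_on_subset)
  from eventually_at_top_ex[OF this, unfolded real_norm_def] obtain L where L: "\<And>b x. b \<in> Basis \<Longrightarrow> x \<in> K \<Longrightarrow> \<bar>\<alpha> c x b\<bar> \<le> L"
    "\<And>b x y. b \<in> Basis \<Longrightarrow> x \<in> K \<Longrightarrow> y \<in> K \<Longrightarrow> \<bar>\<alpha> c x b - \<alpha> c y b\<bar> \<le> L * norm (x - y)"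
    "\<And>i b x y. i \<in> Basis \<Longrightarrow> b \<in> Basis \<Longrightarrow> x \<in> K \<Longrightarrow> y \<in> K \<Longrightarrow> \<bar>a i b x - a i b y\<bar> \<le> L * norm (x - y)"
    "L \<ge> 0"
    by blast
  have bd: "norm (R c x) \<le> N / m * L" if "x \<in> K" for x
    using L(1) that E_reeb[OF c in_c[OF that]] form_reeb[OF c in_c[OF that]] by (intro coer') auto
  define C1 where "C1 = N / m * L"
  define C2 where "C2 = N / m * (L + N * L * C1)"
  have C1: "C1 \<ge> 0" using L(4) m N by (simp add: C1_def)
  have lip: "norm (R c x - R c y) \<le> C2 * norm (x - y)" if x: "x \<in> K" and y: "y \<in> K" for x y
  proof -
    have "\<bar>E c x (R c x - R c y) b + \<alpha> c x (R c x - R c y) * \<alpha> c x b\<bar> \<le> (L + N * L * C1) * norm (x - y)"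
      if b: "b \<in> Basis" for b
    proof -
      have lin: "linear (\<lambda>r. E c z r b + \<alpha> c z r * \<alpha> c z b)" if "z \<in> K" for z
        using ext_deriv_bilinear[OF c in_c[OF that]] form_linear[OF c in_c[OF that]]
        by (auto simp: bilinear_def linear_iff algebra_simps)
      let ?D = "\<lambda>r. (E c x r b + \<alpha> c x r * \<alpha> c x b) - (E c y r b + \<alpha> c y r * \<alpha> c y b)"
      have "\<bar>?D (R c y)\<bar> \<le> N * (L * norm (x - y)) * norm (R c y)"
        using linear_bound_Basis[OF linear_compose_sub[OF lin[OF x] lin[OF y]], of "L * norm (x - y)" "R c y"]
          L(3)[OF _ b x y] by (simp add: a_def N_def)
      also have "\<dots> \<le> N * (L * norm (x - y)) * C1"
        using bd[OF y] N L(4) by (intro mult_left_mono) (auto simp: C1_def)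
      finally have 1: "\<bar>?D (R c y)\<bar> \<le> N * L * C1 * norm (x - y)" by (simp add: mult_ac)
      have 2: "\<bar>\<alpha> c x b - \<alpha> c y b\<bar> \<le> L * norm (x - y)" by (rule L(2)[OF b x y])
      have 3: "E c x (R c x - R c y) b + \<alpha> c x (R c x - R c y) * \<alpha> c x b =
          (E c x (R c x) b + \<alpha> c x (R c x) * \<alpha> c x b) - (E c x (R c y) b + \<alpha> c x (R c y) * \<alpha> c x b)"
        by (rule linear_diff[OF lin[OF x]])
      have 4: "E c z (R c z) b + \<alpha> c z (R c z) * \<alpha> c z b = \<alpha> c z b" if "z \<in> K" for z
        by (simp add: E_reeb[OF c in_c[OF that]] form_reeb[OF c in_c[OF that]])
      have "E c x (R c x - R c y) b + \<alpha> c x (R c x - R c y) * \<alpha> c x b = (\<alpha> c x b - \<alpha> c y b) - ?D (R c y)"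
        unfolding 3 4[OF x] 4[OF y] by simp
      then show ?thesis using 1 2 by (simp add: distrib_right)
    qed
    from coer'[OF x this] show ?thesis by (simp add: C2_def mult_ac)
  qed
  show ?thesis
    using eventually_ge_at_top[of C1] eventually_ge_at_top[of C2] eventually_ge_at_top[of "N / m"]
  proof eventually_elim
    case (elim C)
    show ?case
    proof (intro ballI conjI allI impI)
      fix x assume x: "x \<in> K"
      show "norm (R c x) \<le> C" using bd[OF x] elim by (simp add: C1_def)
      show "norm (R c x - R c y) \<le> C * norm (x - y)" if "y \<in> K" for y
        using lip[OF x that] elim(2) mult_right_mono[of C2 C "norm (x - y)"]
        by (meson norm_ge_zero order_trans)
      fix r M assume rM: "\<forall>v. \<bar>E c x r v + \<alpha> c x r * \<alpha> c x v\<bar> \<le> M * norm v"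
      obtain e :: 'e where e: "e \<in> Basis" using nonempty_Basis by blast
      have M: "M \<ge> 0" using rM[rule_format, of e] e by simp
      have "norm r \<le> N / m * M"
      proof (rule coer'[OF x])
        show "\<bar>E c x r b + \<alpha> c x r * \<alpha> c x b\<bar> \<le> M" if "b \<in> Basis" for b
          using rM[rule_format, of b] that by simp
      qed
      also have "\<dots> \<le> C * M" using elim M by (intro mult_right_mono) auto
      finally show "norm r \<le> C * M" .
    qed
  qed
qed

end

subsection \<open>Quantitative local data of a contact form\<close>

text \<open>The components \<open>a\<close>, \<open>da\<close>, \<open>E\<close>, \<open>R\<close> are the local representatives of a contact form, of its
  partial derivatives (\<open>da x v u\<close> is the derivative of \<open>a x v\<close> in the direction \<open>u\<close>), of its exterior
  derivative and of its Reeb field.\<close>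

locale local_model =
  fixes a :: "'e::euclidean_space \<Rightarrow> 'e \<Rightarrow> real" and da E :: "'e \<Rightarrow> 'e \<Rightarrow> 'e \<Rightarrow> real"
    and R :: "'e \<Rightarrow> 'e" and x\<^sub>0 :: 'e and r C :: real
  assumes r: "r > 0" and C: "C \<ge> 1"
    and a_linear: "x \<in> cball x\<^sub>0 r \<Longrightarrow> linear (a x)"
    and E_bilinear: "x \<in> cball x\<^sub>0 r \<Longrightarrow> bilinear (E x)"
    and a_derivative: "x \<in> cball x\<^sub>0 r \<Longrightarrow> ((\<lambda>x. a x v) has_derivative da x v) (at x)"
    and E_eq: "E x u v = da x v u - da x u v"
    and E_R: "x \<in> cball x\<^sub>0 r \<Longrightarrow> E x (R x) v = 0"
    and a_R: "x \<in> cball x\<^sub>0 r \<Longrightarrow> a x (R x) = 1"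
    and a_lipschitz: "x \<in> cball x\<^sub>0 r \<Longrightarrow> y \<in> cball x\<^sub>0 r \<Longrightarrow> \<bar>a x v - a y v\<bar> \<le> C * norm (x - y) * norm v"
    and a_bound: "x \<in> cball x\<^sub>0 r \<Longrightarrow> \<bar>a x v\<bar> \<le> C * norm v"
    and da_linear: "x \<in> cball x\<^sub>0 r \<Longrightarrow> linear (\<lambda>v. da x v u)"
    and da_bound: "x \<in> cball x\<^sub>0 r \<Longrightarrow> \<bar>da x v u\<bar> \<le> C * norm v * norm u"
    and E_lipschitz: "x \<in> cball x\<^sub>0 r \<Longrightarrow> y \<in> cball x\<^sub>0 r \<Longrightarrow>
        \<bar>E x u v - E y u v\<bar> \<le> C * norm (x - y) * norm u * norm v"
    and E_bound: "x \<in> cball x\<^sub>0 r \<Longrightarrow> \<bar>E x u v\<bar> \<le> C * norm u * norm v"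
    and R_bound: "x \<in> cball x\<^sub>0 r \<Longrightarrow> norm (R x) \<le> C"
    and R_lipschitz: "x \<in> cball x\<^sub>0 r \<Longrightarrow> y \<in> cball x\<^sub>0 r \<Longrightarrow> norm (R x - R y) \<le> C * norm (x - y)"
    and E_a_coercive: "x \<in> cball x\<^sub>0 r \<Longrightarrow> (\<And>v. \<bar>E x w v + a x w * a x v\<bar> \<le> M * norm v) \<Longrightarrow> norm w \<le> C * M"
    and a_taylor: "x \<in> cball x\<^sub>0 r \<Longrightarrow> y \<in> cball x\<^sub>0 r \<Longrightarrow>
        \<bar>a y v - a x v - da x v (y - x)\<bar> \<le> C * (norm (y - x))\<^sup>2 * norm v"

context contact
begin

lemma eventually_form_bounds:
  assumes c: "c \<in> A" and K: "compact K" "convex K" "K \<subseteq> chart_image c"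
  shows "\<forall>\<^sub>F L in at_top. \<forall>b\<in>Basis. \<forall>b'\<in>Basis. \<forall>x\<in>K.
      \<bar>\<alpha> c x b\<bar> \<le> L \<and> \<bar>E c x b b'\<bar> \<le> L \<and> \<bar>dir_deriv (\<lambda>y. \<alpha> c y b) b' x\<bar> \<le> L \<and> (\<forall>y\<in>K. \<bar>\<alpha> c x b - \<alpha> c y b\<bar> \<le> L * norm (x - y) \<and>
        \<bar>E c x b b' - E c y b b'\<bar> \<le> L * norm (x - y) \<and>
        \<bar>dir_deriv (\<lambda>y. \<alpha> c y b) b' x - dir_deriv (\<lambda>y. \<alpha> c y b) b' y\<bar> \<le> L * norm (x - y))"
proof -
  have da: "Ck_on (Suc 0) (chart_image c) (\<lambda>x. dir_deriv (\<lambda>y. \<alpha> c y b) b' x)" for b b'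
    using form_smooth[OF c, of "Suc (Suc 0)" b] unfolding Ck_on.simps(2)[of "Suc 0"] by blast
  have cont: "continuous_on K f" if "Ck_on 0 (chart_image c) f" for f :: "'e \<Rightarrow> real"
    using that K(3) continuous_on_subset by auto
  have "\<forall>\<^sub>F L in at_top. (\<forall>b\<in>Basis. \<forall>x\<in>K. norm (\<alpha> c x b) \<le> L) \<and>
      (\<forall>b\<in>Basis. \<forall>b'\<in>Basis. \<forall>x\<in>K. norm (E c x b b') \<le> L) \<and>
      (\<forall>b\<in>Basis. \<forall>b'\<in>Basis. \<forall>x\<in>K. norm (dir_deriv (\<lambda>y. \<alpha> c y b) b' x) \<le> L) \<and>
      (\<forall>b\<in>Basis. \<forall>x\<in>K. \<forall>y\<in>K. norm (\<alpha> c x b - \<alpha> c y b) \<le> L * norm (x - y)) \<and>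
      (\<forall>b\<in>Basis. \<forall>b'\<in>Basis. \<forall>x\<in>K. \<forall>y\<in>K. norm (E c x b b' - E c y b b') \<le> L * norm (x - y)) \<and>
      (\<forall>b\<in>Basis. \<forall>b'\<in>Basis. \<forall>x\<in>K. \<forall>y\<in>K.
         norm (dir_deriv (\<lambda>y. \<alpha> c y b) b' x - dir_deriv (\<lambda>y. \<alpha> c y b) b' y) \<le> L * norm (x - y))"
    by (intro eventually_conj eventually_ball_finite ballI finite_Basis eventually_bounded_compact K
        eventually_lipschitz_compact[OF K] form_smooth[OF c] ext_deriv_smooth[OF c] da cont Ck_on_Suc_imp[OF da])
  then show ?thesis
    by eventually_elim (simp add: real_norm_def)
qed

lemma local_model_exists:
  assumes c: "c \<in> A" and x0: "x\<^sub>0 \<in> chart_image c"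
  obtains r C where "cball x\<^sub>0 r \<subseteq> chart_image c"
    "local_model (\<alpha> c) (\<lambda>x v u. dir_deriv (\<lambda>y. \<alpha> c y v) u x) (E c) (R c) x\<^sub>0 r C"
proof -
  obtain r where r: "r > 0" "cball x\<^sub>0 r \<subseteq> chart_image c"
    using open_chart_image[OF c] x0 open_contains_cball by blast
  let ?K = "cball x\<^sub>0 r" and ?da = "\<lambda>x v u. dir_deriv (\<lambda>y. \<alpha> c y v) u x"
  have in_c: "x \<in> chart_image c" if "x \<in> ?K" for x using r that by auto
  have "\<forall>\<^sub>F L in at_top. (\<forall>b\<in>Basis. \<forall>b'\<in>Basis. \<forall>x\<in>?K.
      \<bar>\<alpha> c x b\<bar> \<le> L \<and> \<bar>E c x b b'\<bar> \<le> L \<and> \<bar>?da x b b'\<bar> \<le> L \<and> (\<forall>y\<in>?K. \<bar>\<alpha> c x b - \<alpha> c y b\<bar> \<le> L * norm (x - y) \<and>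
        \<bar>E c x b b' - E c y b b'\<bar> \<le> L * norm (x - y) \<and>
        \<bar>?da x b b' - ?da y b b'\<bar> \<le> L * norm (x - y))) \<and> L \<ge> 0"
    by (intro eventually_conj eventually_form_bounds c eventually_ge_at_top) (use r in auto)
  from eventually_at_top_ex[OF this] obtain L where L0: "L \<ge> 0" and L: "\<And>b b' x. b \<in> Basis \<Longrightarrow> b' \<in> Basis \<Longrightarrow> x \<in> ?K \<Longrightarrow>
      \<bar>\<alpha> c x b\<bar> \<le> L \<and> \<bar>E c x b b'\<bar> \<le> L \<and> \<bar>?da x b b'\<bar> \<le> L \<and> (\<forall>y\<in>?K. \<bar>\<alpha> c x b - \<alpha> c y b\<bar> \<le> L * norm (x - y) \<and>
        \<bar>E c x b b' - E c y b b'\<bar> \<le> L * norm (x - y) \<and>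
        \<bar>?da x b b' - ?da y b b'\<bar> \<le> L * norm (x - y))" by blast
  obtain e :: 'e where e: "e \<in> Basis" using nonempty_Basis by blast
  \<comment> \<open>Passing from basis vectors to arbitrary arguments costs a factor
    \<open>N\<close> per argument, and the Taylor remainder costs one more through the mean value
    inequality. Hence the lower bound \<open>N\<^sup>2 * L\<close> for \<open>C\<close>.\<close>
  define N where "N = real DIM('e)"
  have N: "N \<ge> 1" using DIM_positive[where 'a = 'e] by (simp add: N_def Suc_leI)
  have "\<forall>\<^sub>F C in at_top. (\<forall>x\<in>?K. norm (R c x) \<le> C \<and> (\<forall>y\<in>?K. norm (R c x - R c y) \<le> C * norm (x - y)) \<and>
      (\<forall>r M. (\<forall>v. \<bar>E c x r v + \<alpha> c x r * \<alpha> c x v\<bar> \<le> M * norm v) \<longrightarrow> norm r \<le> C * M)) \<and> 1 \<le> C \<and> N\<^sup>2 * L \<le> C"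
    by (intro eventually_conj reeb_bounds c eventually_ge_at_top) (use r in auto)
  from eventually_at_top_ex[OF this] obtain C where C: "1 \<le> C" "N\<^sup>2 * L \<le> C"
    and RC: "\<And>x. x \<in> ?K \<Longrightarrow> norm (R c x) \<le> C \<and> (\<forall>y\<in>?K. norm (R c x - R c y) \<le> C * norm (x - y)) \<and>
      (\<forall>r M. (\<forall>v. \<bar>E c x r v + \<alpha> c x r * \<alpha> c x v\<bar> \<le> M * norm v) \<longrightarrow> norm r \<le> C * M)" by blast
  have NL: "N * L \<le> C"
  proof -
    have "N * L \<le> N * (N * L)" using N L0 by (intro mult_left_mono) (simp_all add: mult_le_cancel_right1)
    then show ?thesis using C(2) by (simp add: power2_eq_square)
  qed
  have lin_bd: "\<bar>f v\<bar> \<le> C * s * norm v" if "linear f" "\<And>b. b \<in> Basis \<Longrightarrow> \<bar>f b\<bar> \<le> L * s" "s \<ge> 0" for f :: "'e \<Rightarrow> real" and s v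
  proof -
    have "\<bar>f v\<bar> \<le> N * (L * s) * norm v"
      using linear_bound_Basis[OF that(1), of "L * s" v] that(2) by (simp add: N_def)
    also have "\<dots> \<le> C * s * norm v"
      using NL that(3) by (intro mult_right_mono) (simp_all add: mult_right_mono flip: mult.assoc)
    finally show ?thesis .
  qed
  have bil_bd: "\<bar>B u v\<bar> \<le> C * s * norm u * norm v"
    if "bilinear B" "\<And>b b'. b \<in> Basis \<Longrightarrow> b' \<in> Basis \<Longrightarrow> \<bar>B b b'\<bar> \<le> L * s" "s \<ge> 0" for B :: "'e \<Rightarrow> 'e \<Rightarrow> real" and s u v
  proof -
    have "\<bar>B u v\<bar> \<le> N\<^sup>2 * (L * s) * norm u * norm v"
      using bilinear_bound_Basis[OF that(1), of "L * s" u v] that(2) by (simp add: N_def)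
    also have "\<dots> \<le> C * s * norm u * norm v"
      using C(2) that(3) by (intro mult_right_mono) (simp_all add: mult_right_mono flip: mult.assoc)
    finally show ?thesis .
  qed
  have sub_bil: "bilinear (\<lambda>u v. B u v - B' u v)" if "bilinear B" "bilinear B'" for B B' :: "'e \<Rightarrow> 'e \<Rightarrow> real"
    using that unfolding bilinear_def by (auto intro: linear_compose_sub)
  have "local_model (\<alpha> c) ?da (E c) (R c) x\<^sub>0 r C"
  proof (rule local_model.intro)
    show "r > 0" "C \<ge> 1" by fact+
    fix x assume x: "x \<in> ?K"
    note xc = in_c[OF x]
    show "linear (\<alpha> c x)" "bilinear (E c x)"
      by (rule form_linear[OF c xc], rule ext_deriv_bilinear[OF c xc])
    show "((\<lambda>x. \<alpha> c x v) has_derivative ?da x v) (at x)" for v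
      by (rule form_has_derivative[OF c xc])
    show "E c x (R c x) v = 0" for v by (rule E_reeb[OF c xc])
    show "\<alpha> c x (R c x) = 1" by (rule form_reeb[OF c xc])
    show "\<bar>\<alpha> c x v\<bar> \<le> C * norm v" for v
      using lin_bd[OF form_linear[OF c xc], of 1 v] L[OF _ e x] by auto
    show "\<bar>E c x u v\<bar> \<le> C * norm u * norm v" for u v
      using bil_bd[OF ext_deriv_bilinear[OF c xc], of 1 u v] L[OF _ _ x] by auto
    show "linear (\<lambda>v. ?da x v u)" for u by (rule form_derivative_linear[OF c xc])
    have "bilinear (?da x)"
      unfolding bilinear_def using form_derivative_linear[OF c xc] form_derivative_linear'[OF c xc] by blast
    then show "\<bar>?da x v u\<bar> \<le> C * norm v * norm u" for u v
      using bil_bd[of "?da x" 1 v u] L[OF _ _ x] by auto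
    show "norm (R c x) \<le> C" using RC[OF x] by blast
    show "norm w \<le> C * M" if "\<And>v. \<bar>E c x w v + \<alpha> c x w * \<alpha> c x v\<bar> \<le> M * norm v" for w M
      using RC[OF x] that by blast
    fix y assume y: "y \<in> ?K"
    note yc = in_c[OF y]
    show "norm (R c x - R c y) \<le> C * norm (x - y)" using RC[OF x] y by blast
    show "\<bar>\<alpha> c x v - \<alpha> c y v\<bar> \<le> C * norm (x - y) * norm v" for v
      by (rule lin_bd[OF linear_compose_sub[OF form_linear[OF c xc] form_linear[OF c yc]]])
        (use L[OF _ e x] y in auto)
    show "\<bar>E c x u v - E c y u v\<bar> \<le> C * norm (x - y) * norm u * norm v" for u v
      by (rule bil_bd[OF sub_bil[OF ext_deriv_bilinear[OF c xc] ext_deriv_bilinear[OF c yc]]])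
        (use L[OF _ _ x] y in auto)
    show "\<bar>\<alpha> c y v - \<alpha> c x v - ?da x v (y - x)\<bar> \<le> C * (norm (y - x))\<^sup>2 * norm v" for v
    proof -
      have lin: "linear (\<lambda>v. \<alpha> c y v - \<alpha> c x v - ?da x v (y - x))"
        by (intro linear_compose_sub[OF linear_compose_sub[OF form_linear[OF c yc] form_linear[OF c xc]]]
            form_derivative_linear[OF c xc])
      have rem: "\<bar>\<alpha> c y b - \<alpha> c x b - ?da x b (y - x)\<bar> \<le> N * L * (norm (y - x))\<^sup>2" if b: "b \<in> Basis" for b
        unfolding N_def
        by (rule second_order_remainder[where K = ?K and D = "\<lambda>x. ?da x b" and f = "\<lambda>x. \<alpha> c x b"])
          (use L[OF b] L0 x y form_has_derivative[OF c in_c] in auto)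
      have "\<bar>\<alpha> c y v - \<alpha> c x v - ?da x v (y - x)\<bar> \<le> N * (N * L * (norm (y - x))\<^sup>2) * norm v"
        using linear_bound_Basis[OF lin, of "N * L * (norm (y - x))\<^sup>2" v] rem by (simp add: N_def)
      also have "\<dots> = N\<^sup>2 * L * (norm (y - x))\<^sup>2 * norm v" by (simp add: power2_eq_square)
      also have "\<dots> \<le> C * (norm (y - x))\<^sup>2 * norm v" using C(2) by (intro mult_right_mono) auto
      finally show ?thesis .
    qed
  qed (simp add: ext_deriv_def)
  with r(2) show ?thesis by (rule that)
qed

end

subsection \<open>Conformal changes\<close>

definition conformal :: "('m \<Rightarrow> real) \<Rightarrow> ('m, 'e) form1 \<Rightarrow> ('m, 'e) form1" where
  "conformal g \<alpha> = (\<lambda>c x v. g (chart_inv c x) * \<alpha> c x v)"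

locale conformal_contact = contact A \<alpha> n
  for A :: "('m::t2_space, 'e::euclidean_space) chart set" and \<alpha> :: "('m, 'e) form1" and n +
  fixes g :: "'m \<Rightarrow> real"
  assumes g_smooth: "c \<in> A \<Longrightarrow> Ck_on k (chart_image c) (\<lambda>x. g (chart_inv c x))"
    and g_pos: "g m > 0" and n_pos: "n \<ge> 1"
begin

abbreviation dg :: "('m, 'e) chart \<Rightarrow> 'e \<Rightarrow> 'e \<Rightarrow> real" where
  "dg c x u \<equiv> dir_deriv (\<lambda>x. g (chart_inv c x)) u x"

lemma g_has_derivative:
  "c \<in> A \<Longrightarrow> x \<in> chart_image c \<Longrightarrow>
    ((\<lambda>x. g (chart_inv c x)) has_derivative dg c x) (at x)"
  using g_smooth[of c "Suc 0"] by (simp add: frechet_derivative_works)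

lemma conformal_one_form: "one_form A (conformal g \<alpha>)"
proof
  show "smooth_one_form A (conformal g \<alpha>)"
    unfolding smooth_one_form_def conformal_def
  proof (intro conjI ballI allI)
    fix c assume c: "c \<in> A"
    show "linear (\<lambda>v. g (chart_inv c x) * \<alpha> c x v)" if "x \<in> chart_image c" for x
      using form_linear[OF c that] by (auto simp: linear_iff algebra_simps)
    show "smooth_on (chart_image c) (\<lambda>x. g (chart_inv c x) * \<alpha> c x v)" for v
      unfolding smooth_on_open_iff[OF open_chart_image[OF c]]
      by (intro allI Ck_on_bilinear[OF open_chart_image[OF c] bounded_bilinear_mult] g_smooth form_smooth c)
    fix d x v assume d: "d \<in> A" and x: "x \<in> overlap c d"
    have "chart_inv d (transition c d x) = chart_inv c x"
      using x c d by (simp add: overlap_iff transition_eq chart_inv_chart)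
    then show "g (chart_inv c x) * \<alpha> c x v = g (chart_inv d (transition c d x)) *
        \<alpha> d (transition c d x) (dir_deriv (transition c d) v x)"
      using form_pullback[OF c d x] by simp
  qed
qed

sublocale conf: one_form A "conformal g \<alpha>"
  by (rule conformal_one_form)

lemma conformal_ext_deriv:
  assumes "c \<in> A" "x \<in> chart_image c"
  shows "ext_deriv (conformal g \<alpha>) c x u v =
    g (chart_inv c x) * E c x u v + dg c x u * \<alpha> c x v - dg c x v * \<alpha> c x u"
proof -
  have "dir_deriv (\<lambda>y. conformal g \<alpha> c y v) u x =
      g (chart_inv c x) * dir_deriv (\<lambda>y. \<alpha> c y v) u x + dg c x u * \<alpha> c x v" for u v
    unfolding conformal_def
    using fun_cong[OF frechet_derivative_at[OF has_derivative_mult[OF g_has_derivative[OF assms]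
            form_has_derivative[OF assms, of v]]], of u] by simp
  then show ?thesis by (simp add: ext_deriv_def algebra_simps)
qed

lemma conformal_volume:
  assumes "c \<in> A" "x \<in> chart_image c"
  shows "contact_volume_form n (conformal g \<alpha>) c x v =
    g (chart_inv c x) ^ n * contact_volume_form n \<alpha> c x v"
proof -
  have "conformal g \<alpha> c x = (\<lambda>v. g (chart_inv c x) * \<alpha> c x v)" by (simp add: conformal_def)
  moreover have "Suc (n - 1) = n" using n_pos by simp
  ultimately show ?thesis
    unfolding contact_volume_form_eq
    using covector_wedge_power_conformal[OF form_linear[OF assms] ext_deriv_bilinear[OF assms]
        conf.ext_deriv_bilinear[OF assms] dim_eq, of "g (chart_inv c x)" v]
    by (simp add: conformal_ext_deriv[OF assms])
qed

sublocale conf: contact A "conformal g \<alpha>" n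
proof
  show "contact_form A n (conformal g \<alpha>)"
    unfolding contact_form_def
  proof (intro conjI ballI)
    show "smooth_one_form A (conformal g \<alpha>)" by (rule conf.smooth_one_form)
    fix c x assume c: "c \<in> A" and x: "x \<in> chart_image c"
    obtain v where "contact_volume_form n \<alpha> c x v \<noteq> 0"
      using contact_nonzero[OF c x] unfolding contact_volume_form_eq by blast
    moreover have "g (chart_inv c x) \<noteq> 0" using g_pos[of "chart_inv c x"] by simp
    ultimately show "\<exists>v. contact_volume_form n (conformal g \<alpha>) c x v \<noteq> 0"
      using conformal_volume[OF c x, of v] by (intro exI[of _ v]) simp
  qed
qed (rule dim_eq)

lemma
  assumes "c \<in> A" "x \<in> chart_image c"
  shows conformal_reeb_form: "\<alpha> c x (conf.R c x) = 1 / g (chart_inv c x)"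
    and conformal_reeb_E: "E c x (conf.R c x) v =
      dg c x v / (g (chart_inv c x))\<^sup>2 - dg c x (R c x) * \<alpha> c x v / (g (chart_inv c x))\<^sup>2"
proof -
  let ?g = "g (chart_inv c x)"
  have g: "?g > 0" by (rule g_pos)
  have "?g * \<alpha> c x (conf.R c x) = 1" using conf.form_reeb[OF assms] by (simp add: conformal_def)
  then show 1: "\<alpha> c x (conf.R c x) = 1 / ?g" using g by (simp add: field_simps)
  have 2: "?g * E c x (conf.R c x) v + dg c x (conf.R c x) * \<alpha> c x v - dg c x v / ?g = 0" for v
    using conf.E_reeb[OF assms, of v] unfolding conformal_ext_deriv[OF assms] 1 by simp
  \<comment> \<open>Inserting the old Reeb vector, which lies in the kernel of \<open>E\<close>,
    expresses the derivative of \<open>g\<close> along the new Reeb field through the one along the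
    old.\<close>
  have 3: "dg c x (conf.R c x) = dg c x (R c x) / ?g"
    using 2[of "R c x"] E_reeb'[OF assms] form_reeb[OF assms] by simp
  have "?g * E c x (conf.R c x) v = dg c x v / ?g - dg c x (R c x) * \<alpha> c x v / ?g"
    using 2[of v] unfolding 3 by simp
  then show "E c x (conf.R c x) v = dg c x v / ?g\<^sup>2 - dg c x (R c x) * \<alpha> c x v / ?g\<^sup>2"
    using g by (simp add: field_simps power2_eq_square)
qed

end

subsection \<open>Short-time ordinary differential equations\<close>

lemma vector_derivative_bound:
  fixes f :: "real \<Rightarrow> 'b::real_normed_vector"
  assumes S: "convex S" and f: "\<And>t. t \<in> S \<Longrightarrow> (f has_vector_derivative f' t) (at t within S)"
    and B: "\<And>t. t \<in> S \<Longrightarrow> norm (f' t) \<le> B" and ab: "a \<in> S" "b \<in> S"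
  shows "norm (f a - f b) \<le> B * \<bar>a - b\<bar>"
proof -
  have "norm (f a - f b) \<le> B * norm (a - b)"
  proof (rule differentiable_bound[OF S _ _ ab])
    show "(f has_derivative (\<lambda>h. h *\<^sub>R f' t)) (at t within S)" if "t \<in> S" for t
      using f[OF that] by (simp add: has_vector_derivative_def)
    show "onorm (\<lambda>h. h *\<^sub>R f' t) \<le> B" if "t \<in> S" for t
    proof (rule onorm_le)
      fix h :: real
      show "norm (h *\<^sub>R f' t) \<le> B * norm h"
        using mult_left_mono[OF B[OF that], of "\<bar>h\<bar>"] by (simp add: mult.commute)
    qed
  qed
  then show ?thesis by simp
qed

lemma has_vector_derivative_continuous_on':
  assumes "\<And>t. t \<in> S \<Longrightarrow> (f has_vector_derivative f' t) (at t within S)"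
  shows "continuous_on S f"
  unfolding continuous_on_eq_continuous_within using has_vector_derivative_continuous[OF assms] by blast

text \<open>Let the distance be maximal at time \<open>s\<close>. Between the start and
  \<open>s\<close> it changes by at most \<open>L * e \<le> 1 / 2\<close> times this maximum, so the
  maximum is at most twice the initial distance.\<close>

lemma ode_close:
  fixes y z :: "real \<Rightarrow> 'e::euclidean_space"
  assumes K: "\<And>u v. u \<in> K \<Longrightarrow> v \<in> K \<Longrightarrow> norm (X u - X v) \<le> L * norm (u - v)" and L: "L \<ge> 0" "L * e \<le> 1 / 2" and e: "e \<ge> 0"
    and y: "\<And>t. \<bar>t - t\<^sub>0\<bar> \<le> e \<Longrightarrow> y t \<in> K \<and> (y has_vector_derivative X (y t)) (at t within {t\<^sub>0 - e..t\<^sub>0 + e})"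
    and z: "\<And>t. \<bar>t - t\<^sub>0\<bar> \<le> e \<Longrightarrow> z t \<in> K \<and> (z has_vector_derivative X (z t)) (at t within {t\<^sub>0 - e..t\<^sub>0 + e})"
    and t: "\<bar>t - t\<^sub>0\<bar> \<le> e"
  shows "norm (y t - z t) \<le> 2 * norm (y t\<^sub>0 - z t\<^sub>0)"
proof -
  let ?S = "{t\<^sub>0 - e..t\<^sub>0 + e}"
  let ?u = "\<lambda>t. y t - z t"
  have S: "t \<in> ?S \<longleftrightarrow> \<bar>t - t\<^sub>0\<bar> \<le> e" for t by auto
  have der: "(?u has_vector_derivative X (y t) - X (z t)) (at t within ?S)" if "t \<in> ?S" for t
    using y[of t] z[of t] that unfolding S by (auto intro!: derivative_intros)
  have cont: "continuous_on ?S (\<lambda>t. norm (?u t))"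
    by (intro continuous_on_norm has_vector_derivative_continuous_on'[OF der])
  obtain s where s: "s \<in> ?S" "\<And>t. t \<in> ?S \<Longrightarrow> norm (?u t) \<le> norm (?u s)"
    using continuous_attains_sup[OF compact_Icc _ cont] e by auto
  have "norm (?u s - ?u t\<^sub>0) \<le> (L * norm (?u s)) * \<bar>s - t\<^sub>0\<bar>"
  proof (rule vector_derivative_bound[OF convex_real_interval(5) der])
    fix t assume t: "t \<in> ?S"
    have "norm (X (y t) - X (z t)) \<le> L * norm (?u t)"
      using y[of t] z[of t] t unfolding S by (intro K) auto
    also have "\<dots> \<le> L * norm (?u s)" using s(2)[OF t] L by (intro mult_left_mono) auto
    finally show "norm (X (y t) - X (z t)) \<le> L * norm (?u s)" .
  qed (use s e in auto)
  also have "\<dots> \<le> (L * norm (?u s)) * e" using s(1) L unfolding S by (intro mult_left_mono) auto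
  also have "\<dots> = (L * e) * norm (?u s)" by simp
  also have "\<dots> \<le> 1 / 2 * norm (?u s)" using L by (intro mult_right_mono) auto
  finally have "norm (?u s - ?u t\<^sub>0) \<le> 1 / 2 * norm (?u s)" .
  then have "norm (?u s) \<le> 2 * norm (?u t\<^sub>0)"
    using norm_triangle_ineq2[of "?u s" "?u t\<^sub>0"] by linarith
  then show ?thesis using s(2)[of t] t unfolding S by linarith
qed

lemma picard_local:
  fixes X :: "'e::euclidean_space \<Rightarrow> 'e"
  assumes lip: "\<And>u v. u \<in> cball x\<^sub>0 r \<Longrightarrow> v \<in> cball x\<^sub>0 r \<Longrightarrow> norm (X u - X v) \<le> C * norm (u - v)"
    and bd: "\<And>u. u \<in> cball x\<^sub>0 r \<Longrightarrow> norm (X u) \<le> C"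
    and C: "C \<ge> 0" and r: "r > 0" and e: "e > 0" "C * e \<le> r / 2" "C * e \<le> 1 / 2"
    and x: "x \<in> cball x\<^sub>0 (r / 2)"
  shows "\<exists>y. y 0 = x \<and> (\<forall>t\<in>{-e..e}. y t \<in> cball x\<^sub>0 r \<and> (y has_vector_derivative X (y t)) (at t within {-e..e}))"
proof -
  let ?B = "cball x\<^sub>0 r" and ?S = "{-e..e}"
  \<comment> \<open>Precomposition with the nearest-point projection onto the ball, which does not
    increase distances, gives a globally Lipschitz field. The solution found for it stays in the
    ball, where the two fields agree.\<close>
  define X' where "X' u = X (closest_point ?B u)" for u
  have B: "closed ?B" "convex ?B" "?B \<noteq> {}" using r by auto
  have cp: "closest_point ?B u \<in> ?B" for u using closest_point_in_set[OF B(1,3)] .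
  have lip': "norm (X' u - X' v) \<le> C * norm (u - v)" for u v
  proof -
    have "norm (X' u - X' v) \<le> C * dist (closest_point ?B u) (closest_point ?B v)"
      using lip[OF cp cp] by (simp add: X'_def dist_norm)
    also have "\<dots> \<le> C * dist u v" using C closest_point_lipschitz[OF B(2,1,3)] by (intro mult_left_mono) auto
    finally show ?thesis by (simp add: dist_norm)
  qed
  have cX: "continuous_on UNIV X'"
    by (rule lipschitz_on_continuous_on[of C]) (use lip' C in \<open>auto intro!: lipschitz_onI simp: dist_norm\<close>)
  define I where "I f t = integral {-e..t} (\<lambda>s. X' (f s)) - integral {-e..0} (\<lambda>s. X' (f s))" for f :: "real \<Rightarrow> 'e" and t
  \<comment> \<open>Times are clamped to the interval, so that the Picard operator acts on bounded
    continuous functions on the whole line, a complete space.\<close>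
  define cl where "cl t = max (-e) (min e t)" for t
  have cl: "cl t \<in> ?S" for t using e by (auto simp: cl_def)
  have cl_id: "cl t = t" if "t \<in> ?S" for t using that by (auto simp: cl_def)
  have cont_cl: "continuous_on UNIV cl" unfolding cl_def by (intro continuous_intros)
  have dI: "(I f has_vector_derivative X' (f t)) (at t within ?S)" if "continuous_on UNIV f" "t \<in> ?S" for f t
  proof -
    have "continuous_on ?S (\<lambda>s. X' (f s))"
      by (rule continuous_on_compose2[OF cX continuous_on_subset[OF that(1)]]) auto
    from has_vector_derivative_diff_const[THEN iffD2, OF integral_has_vector_derivative[OF this that(2)]]
    show ?thesis unfolding I_def .
  qed
  have cI: "continuous_on ?S (I f)" if "continuous_on UNIV f" for f
    by (rule has_vector_derivative_continuous_on'[OF dI[OF that]])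
  define P where "P f = Bcontfun (\<lambda>t. x + I (apply_bcontfun f) (cl t))" for f
  have cf: "continuous_on UNIV (apply_bcontfun f)" for f :: "real \<Rightarrow>\<^sub>C 'e"
    using continuous_on_apply_bcontfun .
  have "(\<lambda>t. x + I (apply_bcontfun f) (cl t)) \<in> bcontfun" for f
  proof -
    have c: "continuous_on UNIV (\<lambda>t. x + I (apply_bcontfun f) (cl t))"
      by (intro continuous_on_add continuous_on_const continuous_on_compose2[OF cI[OF cf] cont_cl]) (use cl in auto)
    have "bounded (I (apply_bcontfun f) ` ?S)"
      by (intro compact_imp_bounded compact_continuous_image cI cf) auto
    then have "bounded ((\<lambda>t. x + t) ` (I (apply_bcontfun f) ` ?S))" by (rule bounded_translation)
    then have "bounded (range (\<lambda>t. x + I (apply_bcontfun f) (cl t)))"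
      by (rule bounded_subset) (use cl in auto)
    with c show ?thesis by (simp add: bcontfun_def)
  qed
  then have P: "apply_bcontfun (P f) t = x + I (apply_bcontfun f) (cl t)" for f t
    by (simp add: P_def Bcontfun_inverse)
  have "\<exists>!f. f \<in> UNIV \<and> P f = f"
  proof (rule Banach_fix[of UNIV "1 / 2"])
    show "complete (UNIV :: (real \<Rightarrow>\<^sub>C 'e) set)" by (rule complete_UNIV)
    fix f g :: "real \<Rightarrow>\<^sub>C 'e"
    show "dist (P f) (P g) \<le> 1 / 2 * dist f g"
    proof (rule dist_bound)
      fix t
      let ?D = "\<lambda>t. I (apply_bcontfun f) t - I (apply_bcontfun g) t"
      have "norm (?D (cl t) - ?D 0) \<le> C * dist f g * \<bar>cl t - 0\<bar>"
      proof (rule vector_derivative_bound[of ?S])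
        show "(?D has_vector_derivative X' (f t) - X' (g t)) (at t within ?S)" if "t \<in> ?S" for t
          by (intro has_vector_derivative_diff dI cf that)
        show "norm (X' (f t) - X' (g t)) \<le> C * dist f g" for t
          using lip'[of "f t" "g t"] mult_left_mono[OF dist_bounded[of f t g] C]
          by (simp add: dist_norm)
      qed (use cl e in auto)
      also have "\<dots> \<le> C * dist f g * e"
        using cl[of t] C by (intro mult_left_mono) auto
      also have "\<dots> = C * e * dist f g" by simp
      also have "\<dots> \<le> 1 / 2 * dist f g" using e by (intro mult_right_mono) auto
      finally show "dist (apply_bcontfun (P f) t) (apply_bcontfun (P g) t) \<le> 1 / 2 * dist f g"
        by (simp add: P dist_norm I_def)
    qed
  qed auto
  then obtain f where f: "P f = f" by blast
  have ft: "f t = x + I (apply_bcontfun f) t" if "t \<in> ?S" for t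
    using P[of f t] cl_id[OF that] by (simp add: f)
  have f0: "f 0 = x" using ft[of 0] e by (simp add: I_def)
  have X'_bd: "norm (X' u) \<le> C" for u using bd[OF cp] by (simp add: X'_def)
  have df: "((apply_bcontfun f) has_vector_derivative X' (f t)) (at t within ?S)" if "t \<in> ?S" for t
  proof (rule has_vector_derivative_transform[OF that])
    show "((\<lambda>t. x + I (apply_bcontfun f) t) has_vector_derivative X' (f t)) (at t within ?S)"
      using has_vector_derivative_add[OF has_vector_derivative_const dI[OF cf that]] by simp
  qed (rule ft)
  have inB: "f t \<in> ?B" if t: "t \<in> ?S" for t
  proof -
    have "norm (f t - f 0) \<le> C * \<bar>t - 0\<bar>"
      by (rule vector_derivative_bound[of ?S, OF _ df X'_bd t]) (use e in auto)
    also have "\<dots> \<le> C * e" using t C by (intro mult_left_mono) auto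
    also have "\<dots> \<le> r / 2" by (rule e)
    finally have "dist (f t) x \<le> r / 2" by (simp add: dist_norm f0)
    then show ?thesis using x dist_triangle[of x\<^sub>0 "f t" x] by (simp add: dist_commute)
  qed
  have "X' (f t) = X (f t)" if "t \<in> ?S" for t
    using closest_point_self[OF inB[OF that]] by (simp add: X'_def)
  then show ?thesis using f0 inB df by (intro exI[of _ "apply_bcontfun f"]) auto
qed

subsection \<open>The flow of a vector field on a closed manifold\<close>

locale vfield = closed_mfd A
  for A :: "('m::t2_space, 'e::euclidean_space) chart set" +
  fixes X :: "('m, 'e) chart \<Rightarrow> 'e \<Rightarrow> 'e"
  assumes X_pullback: "c \<in> A \<Longrightarrow> d \<in> A \<Longrightarrow> x \<in> overlap c d \<Longrightarrow>
      dir_deriv (transition c d) (X c x) x = X d (transition c d x)"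
    and X_lipschitz: "c \<in> A \<Longrightarrow> x\<^sub>0 \<in> chart_image c \<Longrightarrow> \<exists>r>0. \<exists>C\<ge>0. cball x\<^sub>0 r \<subseteq> chart_image c \<and>
      (\<forall>x\<in>cball x\<^sub>0 r. norm (X c x) \<le> C \<and> (\<forall>y\<in>cball x\<^sub>0 r. norm (X c x - X c y) \<le> C * norm (x - y)))"
begin

definition integral_curve :: "real set \<Rightarrow> (real \<Rightarrow> 'm) \<Rightarrow> bool" where
  "integral_curve S \<gamma> \<longleftrightarrow> continuous_on S \<gamma> \<and>
     (\<forall>c\<in>A. \<forall>t\<in>S. \<gamma> t \<in> fst c \<longrightarrow> ((snd c \<circ> \<gamma>) has_vector_derivative X c (snd c (\<gamma> t))) (at t))"

lemma integral_curve_subset: "integral_curve S \<gamma> \<Longrightarrow> T \<subseteq> S \<Longrightarrow> integral_curve T \<gamma>"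
  unfolding integral_curve_def using continuous_on_subset by blast

lemma integral_curveD:
  "integral_curve S \<gamma> \<Longrightarrow> c \<in> A \<Longrightarrow> t \<in> S \<Longrightarrow> \<gamma> t \<in> fst c \<Longrightarrow>
    ((\<lambda>s. snd c (\<gamma> s)) has_vector_derivative X c (snd c (\<gamma> t))) (at t)"
  unfolding integral_curve_def comp_def by blast

lemma integral_curve_local:
  assumes S: "open S" and loc: "\<And>t. t \<in> S \<Longrightarrow> \<exists>J \<beta>. open J \<and> t \<in> J \<and> integral_curve J \<beta> \<and> (\<forall>s\<in>J. \<gamma> s = \<beta> s)"
  shows "integral_curve S \<gamma>"
  unfolding integral_curve_def
proof (intro conjI ballI impI)
  have "isCont \<gamma> t" if t: "t \<in> S" for t
  proof -
    obtain J \<beta> where J: "open J" "t \<in> J" "integral_curve J \<beta>" "\<forall>s\<in>J. \<gamma> s = \<beta> s" using loc[OF t] by blast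
    have "continuous_on J \<beta>" using J(3) unfolding integral_curve_def by blast
    then have "continuous_on J \<gamma>" by (rule continuous_on_eq) (use J(4) in simp)
    then show ?thesis using J(1,2) by (simp add: continuous_on_eq_continuous_at)
  qed
  then show "continuous_on S \<gamma>" by (simp add: continuous_at_imp_continuous_on)
  fix c t assume c: "c \<in> A" and t: "t \<in> S" and m: "\<gamma> t \<in> fst c"
  obtain J \<beta> where J: "open J" "t \<in> J" "integral_curve J \<beta>" "\<forall>s\<in>J. \<gamma> s = \<beta> s" using loc[OF t] by blast
  have "((\<lambda>s. snd c (\<beta> s)) has_vector_derivative X c (snd c (\<beta> t))) (at t)"
    by (rule integral_curveD[OF J(3) c J(2)]) (use J m in metis)
  then have "((\<lambda>s. snd c (\<gamma> s)) has_vector_derivative X c (snd c (\<beta> t))) (at t)"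
    by (rule has_vector_derivative_transform_within_open[OF _ J(1,2)]) (use J(4) in simp)
  then show "((snd c \<circ> \<gamma>) has_vector_derivative X c (snd c (\<gamma> t))) (at t)"
    using J by (simp add: comp_def)
qed

lemma integral_curve_shift:
  assumes "integral_curve S \<gamma>"
  shows "integral_curve {t. t + a \<in> S} (\<lambda>t. \<gamma> (t + a))"
  unfolding integral_curve_def
proof (intro conjI ballI impI)
  have "continuous_on S \<gamma>" using assms by (simp add: integral_curve_def)
  then show "continuous_on {t. t + a \<in> S} (\<lambda>t. \<gamma> (t + a))"
    by (rule continuous_on_compose2) (auto intro!: continuous_intros)
  fix c t assume c: "c \<in> A" and t: "t \<in> {t. t + a \<in> S}" and m: "\<gamma> (t + a) \<in> fst c"
  have "((\<lambda>s. snd c (\<gamma> s)) has_vector_derivative X c (snd c (\<gamma> (t + a)))) (at (t + a))"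
    by (rule integral_curveD[OF assms c _ m]) (use t in simp)
  moreover have "((\<lambda>s. s + a) has_vector_derivative 1) (at t)"
    by (auto intro!: derivative_eq_intros)
  ultimately have "((\<lambda>s. snd c (\<gamma> s)) \<circ> (\<lambda>s. s + a) has_vector_derivative 1 *\<^sub>R X c (snd c (\<gamma> (t + a)))) (at t)"
    by (intro vector_diff_chain_at)
  then show "((snd c \<circ> (\<lambda>t. \<gamma> (t + a))) has_vector_derivative X c (snd c (\<gamma> (t + a)))) (at t)"
    by (simp add: comp_def)
qed

text \<open>Integral curves are tested in all charts at once; the transformation law of the field
  lets a solution in a single chart pass this test.\<close>

lemma integral_curve_in_chart:
  assumes c: "c \<in> A" and S: "open S"
    and y: "\<And>t. t \<in> S \<Longrightarrow> y t \<in> chart_image c \<and> (y has_vector_derivative X c (y t)) (at t)"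
  shows "integral_curve S (\<lambda>t. chart_inv c (y t))"
  unfolding integral_curve_def
proof (intro conjI ballI impI)
  have cy: "continuous_on S y"
    using y by (auto intro!: continuous_at_imp_continuous_on has_vector_derivative_continuous)
  then show "continuous_on S (\<lambda>t. chart_inv c (y t))"
    using y by (intro continuous_on_compose2[OF cont_chart_inv[OF c]]) auto
  fix d t assume d: "d \<in> A" and t: "t \<in> S" and m: "chart_inv c (y t) \<in> fst d"
  have x: "y t \<in> overlap c d" using m y[OF t] overlap_iff[OF c] by blast
  have "((\<lambda>s. transition c d (y s)) has_vector_derivative dir_deriv (transition c d) (X c (y t)) (y t)) (at t)"
    using vector_derivative_diff_chain_within[of y "X c (y t)" t UNIV "transition c d"]
      y[OF t] has_derivative_at_withinI[OF transition_has_derivative[OF c d x]] by (simp add: comp_def)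
  then show "((snd d \<circ> (\<lambda>t. chart_inv c (y t))) has_vector_derivative X d (snd d (chart_inv c (y t)))) (at t)"
    unfolding X_pullback[OF c d x] by (simp add: comp_def transition_eq)
qed

text \<open>The solutions in a chart that start in the half ball are Lipschitz in the starting
  point, by \<open>ode_close\<close>, and in time, by the bound of the field. Together this gives
  joint continuity.\<close>

lemma local_flow:
  obtains W e \<phi> where "open W" "p \<in> W" "e > 0"
    "\<And>q. q \<in> W \<Longrightarrow> integral_curve {-e<..<e} (\<phi> q) \<and> \<phi> q 0 = q"
    "continuous_on (W \<times> {-e<..<e}) (\<lambda>(q, t). \<phi> q t)"
proof -
  obtain c where c: "c \<in> A" "p \<in> fst c" using charts_cover by blast
  define x\<^sub>0 where "x\<^sub>0 = snd c p"
  have x0: "x\<^sub>0 \<in> chart_image c" using c chart_mem by (simp add: x\<^sub>0_def)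
  obtain r C where r: "r > 0" "C \<ge> 0" "cball x\<^sub>0 r \<subseteq> chart_image c"
    and bd: "\<And>x. x \<in> cball x\<^sub>0 r \<Longrightarrow> norm (X c x) \<le> C"
    and lip: "\<And>x y. x \<in> cball x\<^sub>0 r \<Longrightarrow> y \<in> cball x\<^sub>0 r \<Longrightarrow> norm (X c x - X c y) \<le> C * norm (x - y)"
    using X_lipschitz[OF c(1) x0] by blast
  define e where "e = min (r / 2) (1 / 2) / (C + 1)"
  have e: "e > 0" using r by (simp add: e_def)
  have "C * e \<le> (C + 1) * e" using e by (simp add: algebra_simps)
  also have "\<dots> = min (r / 2) (1 / 2)" using r by (simp add: e_def)
  finally have Ce: "C * e \<le> r / 2" "C * e \<le> 1 / 2" by simp_all
  let ?S = "{-e..e}"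
  have "\<forall>x\<in>cball x\<^sub>0 (r / 2). \<exists>y. y 0 = x \<and> (\<forall>t\<in>?S. y t \<in> cball x\<^sub>0 r \<and>
      (y has_vector_derivative X c (y t)) (at t within ?S))"
    using picard_local[OF lip bd r(2,1) e Ce] by blast
  then obtain Y where Y0: "\<And>x. x \<in> cball x\<^sub>0 (r / 2) \<Longrightarrow> Y x 0 = x"
    and Y: "\<And>x t. x \<in> cball x\<^sub>0 (r / 2) \<Longrightarrow> t \<in> ?S \<Longrightarrow> Y x t \<in> cball x\<^sub>0 r \<and>
      (Y x has_vector_derivative X c (Y x t)) (at t within ?S)"
    by (metis (no_types, lifting))
  define W where "W = {m \<in> fst c. snd c m \<in> ball x\<^sub>0 (r / 2)}"
  define \<phi> where "\<phi> q t = chart_inv c (Y (snd c q) t)" for q t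
  have lipY: "norm (Y x t - Y x' t') \<le> 2 * norm (x - x') + C * \<bar>t - t'\<bar>"
    if x: "x \<in> cball x\<^sub>0 (r / 2)" "x' \<in> cball x\<^sub>0 (r / 2)" and t: "t \<in> ?S" "t' \<in> ?S" for x x' t t'
  proof -
    have YY: "Y z s \<in> cball x\<^sub>0 r \<and> (Y z has_vector_derivative X c (Y z s)) (at s within {0 - e..0 + e})"
      if "z \<in> cball x\<^sub>0 (r / 2)" "\<bar>s - 0\<bar> \<le> e" for z s
      using Y[of z s] that by (simp add: abs_le_iff)
    have 1: "norm (Y x t - Y x' t) \<le> 2 * norm (Y x 0 - Y x' 0)"
      by (rule ode_close[OF lip r(2) Ce(2) less_imp_le[OF e] YY[OF x(1)] YY[OF x(2)]]) (use t in auto)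
    have 2: "norm (Y x' t - Y x' t') \<le> C * \<bar>t - t'\<bar>"
      by (rule vector_derivative_bound[of ?S, OF _ _ _ t]) (use Y[OF x(2)] bd in auto)
    show ?thesis
      using 1 2 norm_triangle_ineq[of "Y x t - Y x' t" "Y x' t - Y x' t'"] Y0[OF x(1)] Y0[OF x(2)] by simp
  qed
  let ?D = "ball x\<^sub>0 (r / 2) \<times> {-e<..<e}"
  have "continuous_on ?D (\<lambda>z. Y (fst z) (snd z))"
  proof (rule lipschitz_on_continuous_on[of "2 + C"], rule lipschitz_onI)
    fix z w assume zw: "z \<in> ?D" "w \<in> ?D"
    have "norm (Y (fst z) (snd z) - Y (fst w) (snd w)) \<le> 2 * norm (fst z - fst w) + C * \<bar>snd z - snd w\<bar>"
      by (rule lipY) (use zw in auto)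
    also have "\<dots> \<le> 2 * norm (z - w) + C * norm (z - w)"
    proof -
      have "norm (fst z - fst w) \<le> norm (z - w)" by (metis fst_diff norm_fst_le prod.collapse)
      moreover have "\<bar>snd z - snd w\<bar> \<le> norm (z - w)" by (metis snd_diff norm_snd_le prod.collapse real_norm_def)
      ultimately show ?thesis using r(2) by (intro add_mono mult_left_mono) auto
    qed
    finally show "dist (Y (fst z) (snd z)) (Y (fst w) (snd w)) \<le> (2 + C) * dist z w"
      by (simp add: dist_norm algebra_simps)
  qed (use r in simp)
  moreover have "continuous_on (W \<times> {-e<..<e}) (\<lambda>z. (snd c (fst z), snd z))"
    by (intro continuous_on_Pair continuous_on_snd continuous_on_id
        continuous_on_compose2[OF cont_chart[OF c(1)] continuous_on_fst[OF continuous_on_id]]) (auto simp: W_def)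
  ultimately have "continuous_on (W \<times> {-e<..<e}) (\<lambda>z. Y (fst (snd c (fst z), snd z)) (snd (snd c (fst z), snd z)))"
    by (rule continuous_on_compose2) (auto simp: W_def)
  then have "continuous_on (W \<times> {-e<..<e}) (\<lambda>z. Y (snd c (fst z)) (snd z))" by simp
  then have "continuous_on (W \<times> {-e<..<e}) (\<lambda>z. chart_inv c (Y (snd c (fst z)) (snd z)))"
  proof (rule continuous_on_compose2[OF cont_chart_inv[OF c(1)]])
    show "(\<lambda>z. Y (snd c (fst z)) (snd z)) ` (W \<times> {-e<..<e}) \<subseteq> chart_image c"
    proof (rule image_subsetI)
      fix z assume "z \<in> W \<times> {-e<..<e}"
      then have "Y (snd c (fst z)) (snd z) \<in> cball x\<^sub>0 r" using Y by (auto simp: W_def)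
      then show "Y (snd c (fst z)) (snd z) \<in> chart_image c" using r(3) by blast
    qed
  qed
  then have "continuous_on (W \<times> {-e<..<e}) (\<lambda>(q, t). \<phi> q t)" by (simp add: \<phi>_def case_prod_beta')
  moreover have "open W" unfolding W_def by (rule chart_preimage_open[OF c(1)]) simp
  moreover have "p \<in> W" using c r by (simp add: W_def x\<^sub>0_def)
  moreover have "integral_curve {-e<..<e} (\<phi> q) \<and> \<phi> q 0 = q" if "q \<in> W" for q
  proof
    have q: "q \<in> fst c" "snd c q \<in> cball x\<^sub>0 (r / 2)" using that by (auto simp: W_def)
    show "\<phi> q 0 = q" using Y0[OF q(2)] q(1) c(1) by (simp add: \<phi>_def chart_inv_chart)
    show "integral_curve {-e<..<e} (\<phi> q)"
      unfolding \<phi>_def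
    proof (rule integral_curve_in_chart[OF c(1)])
      fix t assume t: "t \<in> {-e<..<e}"
      then have "t \<in> ?S" "at t within ?S = at t" by (auto intro: at_within_Icc_at)
      then show "Y (snd c q) t \<in> chart_image c \<and> (Y (snd c q) has_vector_derivative X c (Y (snd c q) t)) (at t)"
        using Y[OF q(2), of t] r(3) by auto
    qed simp
  qed
  ultimately show ?thesis using that e by blast
qed

lemma integral_curve_unique_local:
  assumes S: "open S" and \<gamma>: "integral_curve S \<gamma>" "integral_curve S \<beta>" and t: "t \<in> S" "\<gamma> t = \<beta> t"
  shows "\<exists>\<delta>>0. \<forall>s. \<bar>s - t\<bar> < \<delta> \<longrightarrow> s \<in> S \<and> \<gamma> s = \<beta> s"
proof -
  obtain c where c: "c \<in> A" "\<gamma> t \<in> fst c" using charts_cover by blast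
  define x\<^sub>0 where "x\<^sub>0 = snd c (\<gamma> t)"
  have x0: "x\<^sub>0 \<in> chart_image c" using c chart_mem by (simp add: x\<^sub>0_def)
  obtain r C where r: "r > 0" "C \<ge> 0" "cball x\<^sub>0 r \<subseteq> chart_image c"
    and lip: "\<And>x y. x \<in> cball x\<^sub>0 r \<Longrightarrow> y \<in> cball x\<^sub>0 r \<Longrightarrow> norm (X c x - X c y) \<le> C * norm (x - y)"
    using X_lipschitz[OF c(1) x0] by blast
  let ?V = "{m \<in> fst c. snd c m \<in> ball x\<^sub>0 r}"
  have V: "open ?V" by (rule chart_preimage_open[OF c(1)]) simp
  have op: "open (S \<inter> \<zeta> -` ?V)" if "integral_curve S \<zeta>" for \<zeta>
    using that V S unfolding integral_curve_def by (intro continuous_open_preimage) auto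
  have "open ((S \<inter> \<gamma> -` ?V) \<inter> (S \<inter> \<beta> -` ?V))" by (intro open_Int op \<gamma>)
  moreover have "t \<in> (S \<inter> \<gamma> -` ?V) \<inter> (S \<inter> \<beta> -` ?V)"
    using t c r x\<^sub>0_def by simp
  ultimately obtain d where d: "d > 0" "ball t d \<subseteq> (S \<inter> \<gamma> -` ?V) \<inter> (S \<inter> \<beta> -` ?V)"
    using openE by blast
  define e where "e = min (d / 2) (1 / (2 * (C + 1)))"
  have e: "e > 0" "e < d" using d r by (auto simp: e_def)
  have "e \<le> 1 / (2 * (C + 1))" by (simp add: e_def)
  then have "e * (2 * (C + 1)) \<le> 1" using r by (subst (asm) pos_le_divide_eq) auto
  then have Ce: "C * e \<le> 1 / 2" using e by (simp add: algebra_simps)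
  have in_V: "s \<in> S" "\<gamma> s \<in> ?V" "\<beta> s \<in> ?V" if "\<bar>s - t\<bar> \<le> e" for s
  proof -
    have "s \<in> ball t d" using that e by (simp add: dist_real_def abs_minus_commute)
    then show "s \<in> S" "\<gamma> s \<in> ?V" "\<beta> s \<in> ?V" using d(2) by auto
  qed
  have eq: "\<gamma> s = \<beta> s" if s: "\<bar>s - t\<bar> \<le> e" for s
  proof -
    have h: "snd c (\<zeta> s) \<in> cball x\<^sub>0 r \<and>
        ((\<lambda>s. snd c (\<zeta> s)) has_vector_derivative X c (snd c (\<zeta> s))) (at s within {t - e..t + e})"
      if "integral_curve S \<zeta>" "s \<in> S" "\<zeta> s \<in> ?V" for \<zeta> s
      using integral_curveD[OF that(1) c(1) that(2)] that(3) by (auto intro: has_vector_derivative_at_within)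
    have "norm (snd c (\<gamma> s) - snd c (\<beta> s)) \<le> 2 * norm (snd c (\<gamma> t) - snd c (\<beta> t))"
    proof (rule ode_close[OF lip r(2) Ce less_imp_le[OF e(1)] _ _ s])
      fix s assume s: "\<bar>s - t\<bar> \<le> e"
      show "snd c (\<gamma> s) \<in> cball x\<^sub>0 r \<and>
          ((\<lambda>s. snd c (\<gamma> s)) has_vector_derivative X c (snd c (\<gamma> s))) (at s within {t - e..t + e})"
        by (rule h[OF \<gamma>(1) in_V(1,2)[OF s]])
      show "snd c (\<beta> s) \<in> cball x\<^sub>0 r \<and>
          ((\<lambda>s. snd c (\<beta> s)) has_vector_derivative X c (snd c (\<beta> s))) (at s within {t - e..t + e})"
        by (rule h[OF \<gamma>(2) in_V(1,3)[OF s]])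
    qed
    then have "snd c (\<gamma> s) = snd c (\<beta> s)" using t(2) by simp
    then show ?thesis using in_V[OF s] chart_inv_chart[OF c(1)] by (metis (mono_tags, lifting) mem_Collect_eq)
  qed
  show ?thesis using eq in_V(1) e(1) by (intro exI[of _ e]) auto
qed

text \<open>The set of agreement is open by local uniqueness, and its complement is open because the
  manifold is Hausdorff.\<close>

lemma integral_curve_unique:
  assumes S: "open S" "connected S" and \<gamma>: "integral_curve S \<gamma>" "integral_curve S \<beta>"
    and t: "t \<in> S" "\<gamma> t = \<beta> t" and s: "s \<in> S"
  shows "\<gamma> s = \<beta> s"
proof (rule ccontr)
  assume neq: "\<gamma> s \<noteq> \<beta> s"
  let ?U = "{t \<in> S. \<gamma> t = \<beta> t}" and ?V = "{t \<in> S. \<gamma> t \<noteq> \<beta> t}"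
  have U: "open ?U"
    unfolding open_dist
  proof
    fix u assume "u \<in> ?U"
    then obtain \<delta> where "\<delta> > 0" "\<And>s. \<bar>s - u\<bar> < \<delta> \<Longrightarrow> s \<in> S \<and> \<gamma> s = \<beta> s"
      using integral_curve_unique_local[OF S(1) \<gamma>, of u] by blast
    then show "\<exists>e>0. \<forall>y. dist y u < e \<longrightarrow> y \<in> ?U"
      by (intro exI[of _ \<delta>]) (simp add: dist_real_def)
  qed
  have V: "open ?V"
  proof (subst open_subopen, intro ballI)
    fix u assume u: "u \<in> ?V"
    then obtain P Q where PQ: "open P" "open Q" "\<gamma> u \<in> P" "\<beta> u \<in> Q" "P \<inter> Q = {}"
      using hausdorff by (metis (mono_tags, lifting) mem_Collect_eq)
    have "open (S \<inter> \<gamma> -` P)" "open (S \<inter> \<beta> -` Q)"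
      using \<gamma> PQ S unfolding integral_curve_def by (auto intro!: continuous_open_preimage)
    then have "open ((S \<inter> \<gamma> -` P) \<inter> (S \<inter> \<beta> -` Q))" by (rule open_Int)
    moreover have "(S \<inter> \<gamma> -` P) \<inter> (S \<inter> \<beta> -` Q) \<subseteq> ?V" using PQ by auto
    ultimately show "\<exists>T. open T \<and> u \<in> T \<and> T \<subseteq> ?V"
      using u PQ by (intro exI[of _ "(S \<inter> \<gamma> -` P) \<inter> (S \<inter> \<beta> -` Q)"]) auto
  qed
  have "?U \<inter> S = {} \<or> ?V \<inter> S = {}" by (rule connectedD[OF S(2) U V]) auto
  then show False using t s neq by blast
qed

section \<open>Completeness and continuity of the flow\<close>

lemma uniform_existence: "\<exists>e>0. \<forall>p. \<exists>\<gamma>. integral_curve {-e<..<e} \<gamma> \<and> \<gamma> 0 = p"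
proof -
  have "\<forall>p. \<exists>W e. open W \<and> p \<in> W \<and> e > 0 \<and> (\<forall>q\<in>W. \<exists>\<gamma>. integral_curve {-e<..<e} \<gamma> \<and> \<gamma> 0 = q)"
    using local_flow by metis
  then obtain W e where W: "\<And>p. open (W p)" "\<And>p. p \<in> W p" "\<And>p. e p > (0::real)"
    "\<And>p q. q \<in> W p \<Longrightarrow> \<exists>\<gamma>. integral_curve {-e p<..<e p} \<gamma> \<and> \<gamma> 0 = q" by metis
  have "UNIV \<subseteq> (\<Union>p\<in>UNIV. W p)" using W(2) by blast
  then obtain F where F: "F \<subseteq> UNIV" "finite F" "UNIV \<subseteq> (\<Union>p\<in>F. W p)"
    by (rule compactE_image[OF compact_mfd W(1)])
  then have "F \<noteq> {}" by auto
  define e' where "e' = Min (e ` F)"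
  have "e' > 0" using F(2) \<open>F \<noteq> {}\<close> W(3) by (simp add: e'_def)
  moreover have "\<exists>\<gamma>. integral_curve {-e'<..<e'} \<gamma> \<and> \<gamma> 0 = q" for q
  proof -
    obtain p where p: "p \<in> F" "q \<in> W p" using F(3) by auto
    then have "e' \<le> e p" using F(2) by (simp add: e'_def)
    then show ?thesis using W(4)[OF p(2)] integral_curve_subset[of "{-e p<..<e p}" _ "{-e'<..<e'}"] by force
  qed
  ultimately show ?thesis by blast
qed

text \<open>A curve on \<open>(- a, a)\<close> is prolonged from the times
  \<open>u = a - e / 2\<close> and \<open>- u\<close> by curves of the uniform lifetime
  \<open>e\<close>. Each step gains \<open>e / 2\<close> on both sides, so finitely many steps reach
  any given time.\<close>

lemma global_existence: "\<exists>\<gamma>. integral_curve UNIV \<gamma> \<and> \<gamma> 0 = p"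
proof -
  obtain e where e: "e > 0" and ex: "\<And>p. \<exists>\<gamma>. integral_curve {-e<..<e} \<gamma> \<and> \<gamma> 0 = p"
    using uniform_existence by blast
  have ex': "\<exists>\<gamma>. integral_curve {t - e<..<t + e} \<gamma> \<and> \<gamma> t = p" for t p
  proof -
    obtain \<gamma> where \<gamma>: "integral_curve {-e<..<e} \<gamma>" "\<gamma> 0 = p" using ex by blast
    have "{s. s + (- t) \<in> {-e<..<e}} = {t - e<..<t + e}" by auto
    then show ?thesis using integral_curve_shift[OF \<gamma>(1), of "- t"] \<gamma>(2) by (intro exI[of _ "\<lambda>s. \<gamma> (s + (- t))"]) simp
  qed
  have step: "\<exists>\<gamma>'. integral_curve {-(a + e / 2)<..<a + e / 2} \<gamma>' \<and> \<gamma>' 0 = p"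
    if a: "a \<ge> e" and \<gamma>: "integral_curve {-a<..<a} \<gamma>" "\<gamma> 0 = p" for a \<gamma>
  proof -
    define u where "u = a - e / 2"
    have u: "0 < u" "u < a" using a e by (auto simp: u_def)
    obtain \<beta> where \<beta>: "integral_curve {u - e<..<u + e} \<beta>" "\<beta> u = \<gamma> u" using ex' by blast
    obtain \<zeta> where \<zeta>: "integral_curve {- u - e<..<- u + e} \<zeta>" "\<zeta> (- u) = \<gamma> (- u)" using ex' by blast
    let ?J = "{u - e / 2<..<a}" and ?J' = "{- a<..<- u + e / 2}"
    have J: "\<beta> s = \<gamma> s" if "s \<in> ?J" for s
      by (rule integral_curve_unique[of ?J _ _ u])
        (use that u a e \<beta> \<gamma> in \<open>auto intro!: integral_curve_subset[OF \<beta>(1)] integral_curve_subset[OF \<gamma>(1)] simp: u_def\<close>)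
    have J': "\<zeta> s = \<gamma> s" if "s \<in> ?J'" for s
      by (rule integral_curve_unique[of ?J' _ _ "- u"])
        (use that u a e \<zeta> \<gamma> in \<open>auto intro!: integral_curve_subset[OF \<zeta>(1)] integral_curve_subset[OF \<gamma>(1)] simp: u_def\<close>)
    define \<gamma>' where "\<gamma>' t = (if t \<ge> a then \<beta> t else if t \<le> - a then \<zeta> t else \<gamma> t)" for t
    have "integral_curve {-(a + e / 2)<..<a + e / 2} \<gamma>'"
    proof (rule integral_curve_local)
      fix t assume t: "t \<in> {-(a + e / 2)<..<a + e / 2}"
      consider "t \<ge> a" | "t \<le> - a" | "- a < t" "t < a" by linarith
      then show "\<exists>J \<beta>. open J \<and> t \<in> J \<and> integral_curve J \<beta> \<and> (\<forall>s\<in>J. \<gamma>' s = \<beta> s)"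
      proof cases
        case 1
        have "integral_curve {u - e / 2<..<u + e} \<beta>" by (rule integral_curve_subset[OF \<beta>(1)]) (use e in auto)
        moreover have "\<gamma>' s = \<beta> s" if "s \<in> {u - e / 2<..<u + e}" for s
          using that J[of s] u a e by (auto simp: \<gamma>'_def u_def)
        moreover have "t \<in> {u - e / 2<..<u + e}" using 1 t u e by (auto simp: u_def)
        ultimately show ?thesis by (intro exI[of _ "{u - e / 2<..<u + e}"] exI[of _ \<beta>]) auto
      next
        case 2
        have "integral_curve {- u - e<..<- u + e / 2} \<zeta>" by (rule integral_curve_subset[OF \<zeta>(1)]) (use e in auto)
        moreover have "\<gamma>' s = \<zeta> s" if "s \<in> {- u - e<..<- u + e / 2}" for s
          using that J'[of s] u a e by (auto simp: \<gamma>'_def u_def)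
        moreover have "t \<in> {- u - e<..<- u + e / 2}" using 2 t u e by (auto simp: u_def)
        ultimately show ?thesis by (intro exI[of _ "{- u - e<..<- u + e / 2}"] exI[of _ \<zeta>]) auto
      next
        case 3
        then show ?thesis using \<gamma>(1) by (intro exI[of _ "{-a<..<a}"] exI[of _ \<gamma>]) (auto simp: \<gamma>'_def)
      qed
    qed simp
    moreover have "\<gamma>' 0 = p" using a e \<gamma>(2) by (simp add: \<gamma>'_def)
    ultimately show ?thesis by blast
  qed
  let ?I = "\<lambda>k. {-(e + real k * (e / 2))<..<e + real k * (e / 2)}"
  have "\<exists>\<gamma>. integral_curve (?I k) \<gamma> \<and> \<gamma> 0 = p" for k
  proof (induction k)
    case 0
    then show ?case using ex[of p] by simp
  next
    case (Suc k)
    then obtain \<gamma> where "integral_curve (?I k) \<gamma>" "\<gamma> 0 = p" by blast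
    moreover have "e \<le> e + real k * (e / 2)" using e by simp
    ultimately have "\<exists>\<gamma>'. integral_curve {-(e + real k * (e / 2) + e / 2)<..<e + real k * (e / 2) + e / 2} \<gamma>' \<and> \<gamma>' 0 = p"
      by (intro step)
    moreover have "e + real k * (e / 2) + e / 2 = e + real (Suc k) * (e / 2)" by (simp add: field_simps)
    ultimately show ?case by metis
  qed
  then obtain \<gamma> where \<gamma>: "\<And>k. integral_curve (?I k) (\<gamma> k)" "\<And>k. \<gamma> k 0 = p" by metis
  define k where "k t = nat \<lceil>2 * \<bar>t\<bar> / e\<rceil>" for t
  have k: "t \<in> ?I (k t)" for t
  proof -
    have "2 * \<bar>t\<bar> / e \<le> real (k t)" using e unfolding k_def by linarith
    then have "\<bar>t\<bar> \<le> real (k t) * (e / 2)" using e by (simp add: field_simps)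
    then show ?thesis using e by auto
  qed
  have agree: "\<gamma> i s = \<gamma> j s" if "i \<le> j" "s \<in> ?I i" for i j s
  proof -
    have "real i * (e / 2) \<le> real j * (e / 2)" using that(1) e by (intro mult_right_mono) auto
    then have "?I i \<subseteq> ?I j" by (intro greaterThanLessThan_subseteq_greaterThanLessThan[THEN iffD2]) simp
    then have "integral_curve (?I i) (\<gamma> j)" by (rule integral_curve_subset[OF \<gamma>(1)[of j]])
    moreover have "0 < e + real i * (e / 2)" using e by (intro add_pos_nonneg) auto
    then have "0 \<in> ?I i" by simp
    moreover have "\<gamma> i 0 = \<gamma> j 0" by (simp only: \<gamma>(2))
    ultimately show ?thesis
      using integral_curve_unique[OF open_greaterThanLessThan connected_Ioo \<gamma>(1)[of i] _ _ _ that(2), of "\<gamma> j" 0] by blast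
  qed
  have "integral_curve UNIV (\<lambda>t. \<gamma> (k t) t)"
  proof (rule integral_curve_local)
    fix t :: real
    have "\<gamma> (k s) s = \<gamma> (k t) s" if "s \<in> ?I (k t)" for s
      using agree[of "k s" "k t" s] agree[of "k t" "k s" s] k[of s] that by (metis nle_le)
    then show "\<exists>J \<beta>. open J \<and> t \<in> J \<and> integral_curve J \<beta> \<and> (\<forall>s\<in>J. \<gamma> (k s) s = \<beta> s)"
      using k[of t] \<gamma>(1) by (intro exI[of _ "?I (k t)"] exI[of _ "\<gamma> (k t)"]) auto
  qed simp
  then show ?thesis using \<gamma>(2) by blast
qed

definition flow :: "'m \<Rightarrow> real \<Rightarrow> 'm" where
  "flow p = (SOME \<gamma>. integral_curve UNIV \<gamma> \<and> \<gamma> 0 = p)"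

lemma flow_curve: "integral_curve UNIV (flow p)" and flow_0 [simp]: "flow p 0 = p"
  using someI_ex[OF global_existence[of p]] by (auto simp: flow_def)

lemma flow_unique:
  assumes "open S" "connected S" "0 \<in> S" "integral_curve S \<gamma>" "t \<in> S"
  shows "\<gamma> t = flow (\<gamma> 0) t"
  by (rule integral_curve_unique[OF assms(1,2,4) integral_curve_subset[OF flow_curve] assms(3) _ assms(5)]) auto

lemma flow_unique':
  assumes "open S" "connected S" "s \<in> S" "integral_curve S \<gamma>" "t \<in> S"
  shows "\<gamma> t = flow (\<gamma> s) (t - s)"
  using flow_unique[of "{t. t + s \<in> S}" "\<lambda>t. \<gamma> (t + s)" "t - s"] assms integral_curve_shift[OF assms(4), of s]
proof -
  have eq: "{t. t + s \<in> S} = (\<lambda>t. t - s) ` S" by (auto simp: image_iff) (metis add_diff_cancel)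
  have "open {t. t + s \<in> S}" "connected {t. t + s \<in> S}"
    unfolding eq using assms open_translation_subtract
    by (auto intro!: connected_continuous_image continuous_intros)
  then show ?thesis
    using flow_unique[of "{t. t + s \<in> S}" "\<lambda>t. \<gamma> (t + s)" "t - s"] assms integral_curve_shift[OF assms(4), of s] by simp
qed

lemma flow_add: "flow p (s + t) = flow (flow p s) t"
  using flow_unique'[of UNIV s "flow p" "s + t"] flow_curve by simp

text \<open>Compactness makes the local result uniform: the flow is jointly continuous for times
  below some \<open>e'\<close>. Iterating a short time gives continuity in the initial point at
  every fixed time, and \<open>flow_add\<close> carries joint continuity at time 0 to any other
  time.\<close>

lemma continuous_flow: "continuous_on UNIV (\<lambda>(q, t). flow q t)"
proof -
  have "\<forall>p. \<exists>W e. open W \<and> p \<in> W \<and> e > 0 \<and> continuous_on (W \<times> {-e<..<e}) (\<lambda>(q, t). flow q t)"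
  proof
    fix p
    obtain W e \<phi> where W: "open W" "p \<in> W" "e > 0"
      "\<And>q. q \<in> W \<Longrightarrow> integral_curve {-e<..<e} (\<phi> q) \<and> \<phi> q 0 = q"
      "continuous_on (W \<times> {-e<..<e}) (\<lambda>(q, t). \<phi> q t)" using local_flow by metis
    have "\<phi> q t = flow q t" if "q \<in> W" "t \<in> {-e<..<e}" for q t
      using flow_unique[of "{-e<..<e}" "\<phi> q" t] W that by auto
    then have "continuous_on (W \<times> {-e<..<e}) (\<lambda>(q, t). flow q t)"
      by (intro continuous_on_eq[OF W(5)]) auto
    with W show "\<exists>W e. open W \<and> p \<in> W \<and> e > 0 \<and> continuous_on (W \<times> {-e<..<e}) (\<lambda>(q, t). flow q t)" by blast
  qed
  then obtain W e where W: "\<And>p. open (W p)" "\<And>p. p \<in> W p" "\<And>p. e p > (0::real)"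
    "\<And>p. continuous_on (W p \<times> {-e p<..<e p}) (\<lambda>(q, t). flow q t)" by metis
  have "UNIV \<subseteq> (\<Union>p\<in>UNIV. W p)" using W(2) by blast
  then obtain F where F: "F \<subseteq> UNIV" "finite F" "UNIV \<subseteq> (\<Union>p\<in>F. W p)"
    by (rule compactE_image[OF compact_mfd W(1)])
  then have "F \<noteq> {}" by auto
  define e' where "e' = Min (e ` F)"
  have e': "e' > 0" using F(2) \<open>F \<noteq> {}\<close> W(3) by (simp add: e'_def)
  have local: "isCont (\<lambda>(q, t). flow q t) (q, t)" if t: "\<bar>t\<bar> < e'" for q t
  proof -
    obtain p where p: "p \<in> F" "q \<in> W p" using F(3) by auto
    then have "e' \<le> e p" using F(2) by (simp add: e'_def)
    then have "(q, t) \<in> W p \<times> {-e p<..<e p}" using t p by auto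
    moreover have "open (W p \<times> {-e p<..<e p})" by (intro open_Times W) auto
    ultimately show ?thesis using W(4)[of p] continuous_on_eq_continuous_at by blast
  qed
  have short: "continuous_on UNIV (\<lambda>q. flow q s)" if "\<bar>s\<bar> < e'" for s
  proof (rule continuous_at_imp_continuous_on, rule ballI)
    fix q :: 'm
    have "isCont (\<lambda>q. (q, s)) q" by (intro continuous_intros)
    then have "isCont (\<lambda>q'. (\<lambda>(q, t). flow q t) (q', s)) q" by (rule isCont_o2) (rule local[OF that])
    then show "isCont (\<lambda>q. flow q s) q" by simp
  qed
  have iter: "continuous_on UNIV (\<lambda>q. flow q (real k * s))" if "\<bar>s\<bar> < e'" for k s
  proof (induction k)
    case (Suc k)
    have "flow q (real (Suc k) * s) = flow (flow q (real k * s)) s" for q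
      using flow_add[of q "real k * s" s] by (simp add: algebra_simps)
    then show ?case using continuous_on_compose2[OF short[OF that] Suc] by simp
  qed simp
  have long: "continuous_on UNIV (\<lambda>q. flow q t)" for t
  proof -
    obtain k :: nat where k: "\<bar>t\<bar> / e' < real k" using reals_Archimedean2 by blast
    then have "real k > 0" using e' by (metis abs_ge_zero divide_nonneg_pos order_le_less_trans)
    then have "\<bar>t / real k\<bar> < e'" "real k * (t / real k) = t" using k e' by (auto simp: field_simps)
    then show ?thesis using iter[of "t / real k" k] by simp
  qed
  show ?thesis
  proof (rule continuous_at_imp_continuous_on, rule ballI)
    fix z :: "'m \<times> real"
    obtain q t where z: "z = (q, t)" by (cases z)
    have "isCont (\<lambda>w. (flow (fst w) t, snd w - t)) z"
      using long[of t] by (intro continuous_intros isCont_o2[of _ fst "\<lambda>q. flow q t"])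
        (auto simp: continuous_on_eq_continuous_at)
    moreover have "isCont (\<lambda>(q, t). flow q t) (flow (fst z) t, snd z - t)"
      using local[of 0] e' z by simp
    ultimately have "isCont (\<lambda>w. (\<lambda>(q, t). flow q t) (flow (fst w) t, snd w - t)) z"
      by (rule isCont_o2)
    moreover have "(\<lambda>(q, t). flow q t) (flow (fst w) t, snd w - t) = (\<lambda>(q, t). flow q t) w" for w
      using flow_add[of "fst w" t "snd w - t"] by (simp add: case_prod_beta')
    ultimately show "isCont (\<lambda>(q, t). flow q t) z" by simp
  qed
qed

text \<open>For each time in the interval, disjoint neighbourhoods of \<open>p\<close> and of its
  image give a neighbourhood of \<open>p\<close> that does not return to itself at nearby times.
  Compactness of the interval leaves finitely many of them to intersect.\<close>

lemma no_early_return: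
  assumes p: "\<And>t. t \<in> {a..b} \<Longrightarrow> flow p t \<noteq> p"
  obtains W where "open W" "p \<in> W" "\<And>q t. q \<in> W \<Longrightarrow> t \<in> {a..b} \<Longrightarrow> flow q t \<notin> W"
proof -
  have "\<exists>J W. open J \<and> t \<in> J \<and> open W \<and> p \<in> W \<and> (\<forall>q\<in>W. \<forall>s\<in>J. flow q s \<notin> W)" if t: "t \<in> {a..b}" for t
  proof -
    obtain U V where UV: "open U" "open V" "flow p t \<in> U" "p \<in> V" "U \<inter> V = {}"
      using hausdorff[OF p[OF t]] by blast
    have "open ((\<lambda>(q, t). flow q t) -` U)" using UV(1) by (rule open_vimage[OF _ continuous_flow])
    moreover have "(p, t) \<in> (\<lambda>(q, t). flow q t) -` U" using UV by simp
    ultimately obtain P J where PJ: "open P" "open J" "p \<in> P" "t \<in> J" "P \<times> J \<subseteq> (\<lambda>(q, t). flow q t) -` U"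
      by (rule open_prod_elim) auto
    have "flow q s \<notin> P \<inter> V" if "q \<in> P \<inter> V" "s \<in> J" for q s
    proof -
      have "(q, s) \<in> P \<times> J" using that by simp
      then have "flow q s \<in> U" using PJ(5) by auto
      then show ?thesis using UV by blast
    qed
    then show ?thesis using PJ UV by (intro exI[of _ J] exI[of _ "P \<inter> V"]) auto
  qed
  then obtain J W where JW: "\<And>t. t \<in> {a..b} \<Longrightarrow> open (J t) \<and> t \<in> J t \<and> open (W t) \<and> p \<in> W t \<and>
      (\<forall>q\<in>W t. \<forall>s\<in>J t. flow q s \<notin> W t)" by metis
  have op: "\<And>t. t \<in> {a..b} \<Longrightarrow> open (J t)" using JW by blast
  have "{a..b} \<subseteq> (\<Union>t\<in>{a..b}. J t)" using JW by blast
  note cov = compactE_image[of "{a..b}" "{a..b}" J, OF compact_Icc op this, simplified]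
  obtain F where F: "F \<subseteq> {a..b}" "finite F" "{a..b} \<subseteq> (\<Union>t\<in>F. J t)"
    by (rule cov)
  show ?thesis
  proof
    show "open (\<Inter>t\<in>F. W t)" using F JW by (intro open_INT) auto
    show "p \<in> (\<Inter>t\<in>F. W t)" using F JW by auto
    fix q t assume q: "q \<in> (\<Inter>t\<in>F. W t)" and t: "t \<in> {a..b}"
    then obtain s where s: "s \<in> F" "t \<in> J s" using F(3) by blast
    then have "flow q t \<notin> W s" using JW[of s] F(1) q by blast
    then show "flow q t \<notin> (\<Inter>t\<in>F. W t)" using s by blast
  qed
qed

end

subsection \<open>Top forms and determinants\<close>

lemma alternating_of_swaps:
  assumes "\<And>v a b. a < N \<Longrightarrow> b < N \<Longrightarrow> a \<noteq> b \<Longrightarrow> \<Phi> (v \<circ> Transposition.transpose a b) = - \<Phi> v"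
  shows "alternating_upto N \<Phi>"
  unfolding alternating_upto_def
proof (intro allI impI)
  fix v :: "nat \<Rightarrow> 'a" and \<sigma> assume "\<sigma> permutes {..<N}"
  then show "\<Phi> (v \<circ> \<sigma>) = of_int (sign \<sigma>) * \<Phi> v"
    using finite_lessThan
  proof (induction \<sigma> arbitrary: v rule: permutes_induct)
    case (swap a b p)
    have "\<Phi> (v \<circ> (Transposition.transpose a b \<circ> p)) = \<Phi> ((v \<circ> Transposition.transpose a b) \<circ> p)"
      by (simp add: comp_assoc)
    also have "\<dots> = of_int (sign p) * \<Phi> (v \<circ> Transposition.transpose a b)" by (rule swap.IH)
    also have "\<dots> = - of_int (sign p) * \<Phi> v" using assms[of a b v] swap.hyps by simp
    also have "sign (Transposition.transpose a b \<circ> p) = - sign p"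
      using swap.hyps sign_compose[OF permutation_swap_id permutes_imp_permutation[OF finite_lessThan]]
      by (simp add: sign_swap_id)
    then have "- of_int (sign p) * \<Phi> v = of_int (sign (Transposition.transpose a b \<circ> p)) * \<Phi> v" by simp
    finally show ?case .
  qed simp
qed

lemma bij_basis_enum: "bij_betw (basis_enum :: nat \<Rightarrow> 'e::euclidean_space) {..<DIM('e)} Basis"
proof -
  have "\<exists>b. bij_betw b {0..<DIM('e)} (Basis :: 'e set)" by (rule ex_bij_betw_nat_finite[OF finite_Basis])
  then show ?thesis unfolding basis_enum_def atLeast0LessThan by (rule someI_ex)
qed

lemma span_basis_enum: "span (basis_enum ` {..<DIM('e)} :: 'e::euclidean_space set) = UNIV"
  using bij_basis_enum[where 'e = 'e] by (simp add: bij_betw_def)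

definition bix_index :: "'e::euclidean_space bix \<Rightarrow> nat" where
  "bix_index i = inv_into {..<DIM('e)} (basis_enum :: nat \<Rightarrow> 'e) (Rep_bix i)"

lemma bij_bix_index: "bij_betw (bix_index :: 'e::euclidean_space bix \<Rightarrow> nat) UNIV {..<DIM('e)}"
proof -
  have "bij_betw (Rep_bix :: 'e bix \<Rightarrow> 'e) UNIV Basis"
    by (rule bij_betw_byWitness[of _ Abs_bix]) (auto simp: Rep_bix Rep_bix_inverse Abs_bix_inverse)
  from bij_betw_trans[OF this bij_betw_inv_into[OF bij_basis_enum]]
  show ?thesis by (simp add: comp_def bix_index_def[abs_def])
qed

lemma basis_enum_bix_index: "basis_enum (bix_index i) = Rep_bix i"
  using bij_basis_enum unfolding bix_index_def bij_betw_def by (metis Rep_bix f_inv_into_f)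

definition vec_det :: "(nat \<Rightarrow> 'e::euclidean_space) \<Rightarrow> real" where
  "vec_det v = det (\<chi> i. to_vec (v (bix_index i)) :: real ^ 'e bix ^ 'e bix)"

lemma vec_det_forms:
  "multilinear_upto DIM('e) (vec_det :: (nat \<Rightarrow> 'e::euclidean_space) \<Rightarrow> real)"
  "alternating_upto DIM('e) (vec_det :: (nat \<Rightarrow> 'e) \<Rightarrow> real)"
proof -
  note bij = bij_bix_index[where 'e = 'e]
  have inj: "bix_index i = bix_index j \<longleftrightarrow> i = j" for i j :: "'e bix"
    using bij by (auto simp: bij_betw_def dest: injD)
  have ex: "\<exists>i :: 'e bix. bix_index i = a" if "a < DIM('e)" for a
    using bij that unfolding bij_betw_def by (metis imageE lessThan_iff)
  have lt: "bix_index (i :: 'e bix) < DIM('e)" for i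
    using bij unfolding bij_betw_def by blast
  show "multilinear_upto DIM('e) (vec_det :: (nat \<Rightarrow> 'e) \<Rightarrow> real)"
    unfolding multilinear_upto_def
  proof (intro conjI allI impI)
    fix v :: "nat \<Rightarrow> 'e" and a assume "a < DIM('e)"
    then obtain k :: "'e bix" where k: "bix_index k = a" using ex by blast
    have eq: "vec_det (v(a := x)) = det (\<chi> i. if i = k then to_vec x else to_vec (v (bix_index i)))" for x
      unfolding vec_det_def by (intro arg_cong[where f = det]) (auto simp: vec_eq_iff k[symmetric] inj)
    show "linear (\<lambda>x. vec_det (v(a := x)))"
      unfolding eq
    proof (rule linearI)
      let ?c = "\<lambda>i. to_vec (v (bix_index i))"
      fix x y :: 'e and r :: real
      show "det (\<chi> i. if i = k then to_vec (x + y) else ?c i) =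
          det (\<chi> i. if i = k then to_vec x else ?c i) + det (\<chi> i. if i = k then to_vec y else ?c i)"
        unfolding linear_add[OF linear_to_vec] by (rule det_row_add)
      show "det (\<chi> i. if i = k then to_vec (r *\<^sub>R x) else ?c i) = r *\<^sub>R det (\<chi> i. if i = k then to_vec x else ?c i)"
        unfolding linear_scale[OF linear_to_vec] scalar_mult_eq_scaleR[symmetric] real_scaleR_def by (rule det_row_mul)
    qed
  next
    fix v w :: "nat \<Rightarrow> 'e" assume "\<forall>i<DIM('e). v i = w i"
    then show "vec_det v = vec_det w" unfolding vec_det_def using lt by simp
  qed
  show "alternating_upto DIM('e) (vec_det :: (nat \<Rightarrow> 'e) \<Rightarrow> real)"
  proof (rule alternating_of_swaps)
    fix v :: "nat \<Rightarrow> 'e" and a b assume ab: "a < DIM('e)" "b < DIM('e)" "a \<noteq> b"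
    obtain k l :: "'e bix" where kl: "bix_index k = a" "bix_index l = b" using ex ab by metis
    then have "k \<noteq> l" using ab by auto
    let ?t = "Transposition.transpose k l"
    have t: "Transposition.transpose a b (bix_index i) = bix_index (?t i)" for i :: "'e bix"
      unfolding kl[symmetric] by (simp add: Transposition.transpose_def inj)
    have "vec_det (v \<circ> Transposition.transpose a b) = det (\<chi> i. (\<chi> i. to_vec (v (bix_index i))) $ ?t i)"
      unfolding vec_det_def by (intro arg_cong[where f = det]) (simp add: vec_eq_iff t)
    also have "\<dots> = of_int (sign ?t) * vec_det v"
      unfolding vec_det_def by (rule det_permute_rows) (simp add: permutes_swap_id)
    also have "\<dots> = - vec_det v" using \<open>k \<noteq> l\<close> by (simp add: sign_swap_id)
    finally show "vec_det (v \<circ> Transposition.transpose a b) = - vec_det v" .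
  qed
qed

definition linear_det :: "('e::euclidean_space \<Rightarrow> 'e) \<Rightarrow> real" where
  "linear_det L = det (matrix (\<lambda>y. to_vec (L (of_vec y))))"

lemma of_vec_axis: "of_vec (axis i 1) = Rep_bix i"
proof -
  have "of_vec (axis i 1) = (\<Sum>j\<in>UNIV. if j = i then Rep_bix i else 0)"
    unfolding of_vec_def by (intro sum.cong) (auto simp: axis_def)
  then show ?thesis by simp
qed

text \<open>Top forms are proportional: the combination \<Theta> of \<Phi> and the determinant
  vanishes on the standard basis, hence everywhere. This yields the Jacobian factor in the change of
  charts for the contact volume.\<close>

lemma top_form_linear_image:
  fixes \<Phi> :: "(nat \<Rightarrow> 'e::euclidean_space) \<Rightarrow> real"
  assumes ml: "multilinear_upto DIM('e) \<Phi>" and alt: "alternating_upto DIM('e) \<Phi>"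
  shows "\<Phi> (\<lambda>i. L (basis_enum i)) = linear_det L * \<Phi> basis_enum"
proof -
  define b :: "nat \<Rightarrow> 'e" where "b = basis_enum"
  define \<Theta> where "\<Theta> v = \<Phi> v * vec_det b - vec_det v * \<Phi> b" for v
  have "\<Theta> (\<lambda>i. L (b i)) = 0"
  proof (rule top_form_determined[where b = b and N = "DIM('e)"])
    show "multilinear_upto DIM('e) \<Theta>"
      unfolding multilinear_upto_def
    proof (intro conjI allI impI)
      fix v :: "nat \<Rightarrow> 'e" and i assume i: "i < DIM('e)"
      show "linear (\<lambda>x. \<Theta> (v(i := x)))"
        using multilinear_uptoD1[OF ml i, of v] multilinear_uptoD1[OF vec_det_forms(1) i, of v]
        by (auto simp: \<Theta>_def linear_iff algebra_simps)
    next
      fix v w :: "nat \<Rightarrow> 'e" assume vw: "\<forall>i<DIM('e). v i = w i"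
      then have "\<Phi> v = \<Phi> w" "vec_det v = vec_det w"
        by (auto intro: multilinear_uptoD2[OF ml] multilinear_uptoD2[OF vec_det_forms(1)])
      then show "\<Theta> v = \<Theta> w" by (simp add: \<Theta>_def)
    qed
    show "alternating_upto DIM('e) \<Theta>"
      unfolding alternating_upto_def
    proof (intro allI impI)
      fix v :: "nat \<Rightarrow> 'e" and \<sigma> assume "\<sigma> permutes {..<DIM('e)}"
      then have "\<Phi> (v \<circ> \<sigma>) = of_int (sign \<sigma>) * \<Phi> v" "vec_det (v \<circ> \<sigma>) = of_int (sign \<sigma>) * vec_det v"
        using alt vec_det_forms(2) unfolding alternating_upto_def by blast+
      then show "\<Theta> (v \<circ> \<sigma>) = of_int (sign \<sigma>) * \<Theta> v" by (simp add: \<Theta>_def algebra_simps)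
    qed
    show "span (b ` {..<DIM('e)}) = UNIV" unfolding b_def by (rule span_basis_enum)
  qed (simp add: \<Theta>_def)
  moreover have "vec_det b = 1"
  proof -
    have "(\<chi> i. to_vec (b (bix_index i)) :: real ^ 'e bix ^ 'e bix) = mat 1"
      by (simp add: b_def basis_enum_bix_index vec_eq_iff to_vec_def mat_def inner_Basis Rep_bix Rep_bix_inject)
    then show ?thesis by (simp add: vec_det_def)
  qed
  moreover have "vec_det (\<lambda>i. L (b i)) = linear_det L"
  proof -
    have "(\<chi> i. to_vec (L (b (bix_index i))) :: real ^ 'e bix ^ 'e bix) =
        Finite_Cartesian_Product.transpose (matrix (\<lambda>y. to_vec (L (of_vec y))))"
      by (simp add: b_def basis_enum_bix_index vec_eq_iff Finite_Cartesian_Product.transpose_def matrix_def of_vec_axis)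
    then show ?thesis by (simp add: vec_det_def linear_det_def det_transpose)
  qed
  ultimately show ?thesis by (simp add: \<Theta>_def b_def)
qed

subsection \<open>Change of variables in a Euclidean space\<close>

lemma bounded_linear_to_vec: "bounded_linear to_vec" and bounded_linear_of_vec: "bounded_linear of_vec"
  using linear_to_vec linear_of_vec by (simp_all add: linear_conv_bounded_linear)

lemma measurable_to_vec [measurable]: "to_vec \<in> borel_measurable borel"
  and measurable_of_vec [measurable]: "of_vec \<in> borel_measurable borel"
  by (rule borel_measurable_continuous_onI[OF linear_continuous_on[OF bounded_linear_to_vec]],
      rule borel_measurable_continuous_onI[OF linear_continuous_on[OF bounded_linear_of_vec]])

text \<open>Lebesgue measure is determined by boxes, and \<open>to_vec\<close> only renames the
  coordinates, so boxes correspond to boxes with the same side lengths.\<close>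

lemma distr_to_vec: "distr lborel borel (to_vec :: 'e::euclidean_space \<Rightarrow> _) = lborel"
proof (rule lborel_eqI[symmetric])
  fix l u :: "real ^ 'e bix" assume le: "\<And>b. b \<in> Basis \<Longrightarrow> l \<bullet> b \<le> u \<bullet> b"
  have ax: "l $ i \<le> u $ i" for i using le[of "axis i 1"] by (auto simp: inner_axis Basis_vec_def)
  have "to_vec -` box l u = box (of_vec l) (of_vec u :: 'e)"
  proof (rule set_eqI)
    fix x :: 'e
    have "x \<in> box (of_vec l) (of_vec u) \<longleftrightarrow> (\<forall>b\<in>Basis. of_vec l \<bullet> b < x \<bullet> b \<and> x \<bullet> b < of_vec u \<bullet> b)"
      by (simp add: mem_box)
    also have "\<dots> \<longleftrightarrow> (\<forall>i. l $ i < x \<bullet> Rep_bix i \<and> x \<bullet> Rep_bix i < u $ i)"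
      by (metis Rep_bix_cases UNIV_I Rep_bix of_vec_inner)
    also have "\<dots> \<longleftrightarrow> x \<in> to_vec -` box l u" by (simp add: mem_box_cart to_vec_def)
    finally show "x \<in> to_vec -` box l u \<longleftrightarrow> x \<in> box (of_vec l) (of_vec u)" by simp
  qed
  then have "emeasure (distr lborel borel (to_vec :: 'e \<Rightarrow> _)) (box l u) = emeasure lborel (box (of_vec l) (of_vec u :: 'e))"
    by (simp add: emeasure_distr)
  also have "\<dots> = (\<Prod>b\<in>Basis. (of_vec u - of_vec l :: 'e) \<bullet> b)"
    by (rule emeasure_lborel_box) (metis Rep_bix_cases of_vec_inner ax)
  also have "(\<Prod>b\<in>Basis. (of_vec u - of_vec l :: 'e) \<bullet> b) = (\<Prod>i\<in>UNIV. u $ i - l $ i)"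
    by (rule prod.reindex_bij_witness[of _ Rep_bix Abs_bix])
      (auto simp: Rep_bix Rep_bix_inverse Abs_bix_inverse inner_diff_left of_vec_inner[of _ "Abs_bix _", simplified Abs_bix_inverse] simp flip: of_vec_inner)
  also have "\<dots> = (\<Prod>b\<in>Basis. (u - l) \<bullet> b)"
    by (rule prod.reindex_bij_witness[of _ "\<lambda>b. SOME i. b = axis i 1" "\<lambda>i. axis i 1"])
      (auto simp: Basis_vec_def inner_axis axis_eq_axis)
  finally show "emeasure (distr lborel borel (to_vec :: 'e \<Rightarrow> _)) (box l u) = (\<Prod>b\<in>Basis. (u - l) \<bullet> b)" .
qed simp

lemma nn_integral_of_vec:
  fixes F :: "'e::euclidean_space \<Rightarrow> ennreal"
  assumes [measurable]: "F \<in> borel_measurable borel"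
  shows "(\<integral>\<^sup>+y. F (of_vec y) \<partial>lborel) = (\<integral>\<^sup>+x. F x \<partial>lborel)"
proof -
  have "(\<integral>\<^sup>+y. F (of_vec y) \<partial>lborel) = (\<integral>\<^sup>+y. F (of_vec y) \<partial>distr lborel borel to_vec)"
    by (simp add: distr_to_vec)
  also have "\<dots> = (\<integral>\<^sup>+x. F x \<partial>lborel)"
    by (subst nn_integral_distr) simp_all
  finally show ?thesis .
qed

lemma nn_integral_absolutely_integrable:
  fixes f :: "'e::euclidean_space \<Rightarrow> real"
  assumes f: "f absolutely_integrable_on S" "\<And>x. f x \<ge> 0"
  shows "(\<integral>\<^sup>+x\<in>S. ennreal (f x) \<partial>lborel) = ennreal (integral S f)"
proof -
  have i: "integrable lebesgue (\<lambda>x. indicator S x * f x)"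
    using f(1) by (simp add: set_integrable_def)
  have "(\<integral>\<^sup>+x\<in>S. ennreal (f x) \<partial>lborel) = (\<integral>\<^sup>+x\<in>S. ennreal (f x) \<partial>lebesgue)"
    by (rule nn_integral_completion[symmetric])
  also have "\<dots> = (\<integral>\<^sup>+x. ennreal (indicator S x * f x) \<partial>lebesgue)"
    by (intro nn_integral_cong) (simp add: indicator_def)
  also have "\<dots> = ennreal (LINT x|lebesgue. indicator S x * f x)"
    using i f(2) by (intro nn_integral_eq_integral) auto
  also have "(LINT x|lebesgue. indicator S x * f x) = integral S f"
    using set_lebesgue_integral_eq_integral(2)[OF f(1)] by (simp add: set_lebesgue_integral_def)
  finally show ?thesis .
qed

lemma absolutely_integrable_compact:
  fixes f :: "'e::euclidean_space \<Rightarrow> real"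
  assumes f: "continuous_on K f" and K: "compact K"
  shows "f absolutely_integrable_on K"
proof -
  have "integrable lborel (\<lambda>x. indicator K x *\<^sub>R f x)"
    by (rule borel_integrable_compact[OF K f])
  then have "integrable lebesgue (\<lambda>x. indicator K x *\<^sub>R f x)"
    by (subst integrable_completion) (auto dest: borel_measurable_integrable)
  then show ?thesis by (simp add: set_integrable_def)
qed

lemma absolutely_integrable_bounded:
  fixes f :: "'e::euclidean_space \<Rightarrow> real"
  assumes f: "continuous_on K f" and K: "compact K" and S: "S \<in> sets borel" "S \<subseteq> K"
  shows "f absolutely_integrable_on S"
proof -
  have "f absolutely_integrable_on K"
    by (rule absolutely_integrable_compact[OF f K])
  moreover have "S \<in> sets lebesgue" using S(1) by (intro sets_completionI_sets) simp
  ultimately show ?thesis using S(2) by (rule set_integrable_subset)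
qed

lemma open_sigma_compact:
  fixes S :: "'a::euclidean_space set"
  assumes "open S"
  shows "\<exists>K :: nat \<Rightarrow> 'a set. (\<forall>n. compact (K n)) \<and> (\<forall>n. K n \<subseteq> S) \<and> \<Union>(range K) = S"
proof (rule open_Union_compact_subsets[OF assms])
  fix C :: "nat \<Rightarrow> 'a set"
  assume "\<And>n. compact (C n)" "\<And>n. C n \<subseteq> S" "\<Union>(range C) = S"
  then show ?thesis by blast
qed

subsection \<open>The volume measure\<close>

text \<open>The absolute value in the transformation law makes this a density, which is integrated
  without reference to an orientation.\<close>

locale mfd_density = closed_mfd A
  for A :: "('m::t2_space, 'e::euclidean_space) chart set" +
  fixes w :: "('m, 'e) chart \<Rightarrow> 'e \<Rightarrow> real"
  assumes w_cont: "c \<in> A \<Longrightarrow> continuous_on (chart_image c) (w c)"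
    and w_nonneg: "w c x \<ge> 0"
    and w_pullback: "c \<in> A \<Longrightarrow> d \<in> A \<Longrightarrow> x \<in> overlap c d \<Longrightarrow>
      w c x = \<bar>linear_det (\<lambda>u. dir_deriv (transition c d) u x)\<bar> * w d (transition c d x)"
begin

text \<open>The image under the chart is a preimage under the inverse chart, which is continuous on
  an open set.\<close>

lemma chart_image_measurable:
  assumes c: "c \<in> A" and B: "B \<in> sets borel" "B \<subseteq> fst c"
  shows "snd c ` B \<in> sets borel"
proof -
  have "chart_inv c \<in> borel_measurable (restrict_space borel (chart_image c))"
    by (rule borel_measurable_continuous_on_restrict[OF cont_chart_inv[OF c]])
  then have "chart_inv c -` B \<inter> space (restrict_space borel (chart_image c)) \<in> sets (restrict_space borel (chart_image c))"
    using B(1) by (rule measurable_sets)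
  then have "chart_inv c -` B \<inter> chart_image c \<in> sets borel"
    using open_chart_image[OF c] by (simp add: space_restrict_space sets_restrict_space_iff)
  moreover have "chart_inv c -` B \<inter> chart_image c = snd c ` B"
  proof (intro equalityI subsetI)
    fix x assume "x \<in> chart_inv c -` B \<inter> chart_image c"
    then show "x \<in> snd c ` B" by (intro image_eqI[of _ _ "chart_inv c x"]) (simp_all add: chart_chart_inv[OF c])
  next
    fix x assume "x \<in> snd c ` B"
    then obtain m where "m \<in> B" "x = snd c m" by blast
    then show "x \<in> chart_inv c -` B \<inter> chart_image c"
      using B(2) by (simp add: chart_inv_chart[OF c] chart_mem subsetD)
  qed
  ultimately show ?thesis by simp
qed

lemma density_measurable:
  assumes c: "c \<in> A" and S: "S \<in> sets borel" "S \<subseteq> chart_image c"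
  shows "(\<lambda>x. ennreal (w c x) * indicator S x) \<in> borel_measurable borel"
proof -
  have "chart_image c \<in> sets borel" using open_chart_image[OF c] by simp
  then have "(\<lambda>x. indicator (chart_image c) x *\<^sub>R w c x) \<in> borel_measurable borel"
    by (rule borel_measurable_continuous_on_indicator[OF _ w_cont[OF c]])
  then have "(\<lambda>x. ennreal (indicator (chart_image c) x *\<^sub>R w c x) * indicator S x) \<in> borel_measurable borel"
    using S by measurable
  moreover have "ennreal (indicator (chart_image c) x *\<^sub>R w c x) * indicator S x = ennreal (w c x) * indicator S x" for x
    using S(2) by (auto simp: indicator_def)
  ultimately show ?thesis by simp
qed

definition chart_vol :: "('m, 'e) chart \<Rightarrow> 'm set \<Rightarrow> ennreal" where
  "chart_vol c B = (\<integral>\<^sup>+x\<in>snd c ` B. ennreal (w c x) \<partial>lborel)"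

lemma transition_image:
  assumes "c \<in> A" "B \<subseteq> fst c"
  shows "transition c d ` (snd c ` B) = snd d ` B"
  using assms by (force simp: image_image transition_chart)

text \<open>The set lies over a compact part of the overlap, where the weight is continuous. This
  makes it absolutely integrable, so the change of variables formula for real integrals applies
  after transport to \<open>real ^ 'e bix\<close>.\<close>

lemma chart_vol_compact:
  assumes c: "c \<in> A" "d \<in> A" and B: "B \<in> sets borel" "B \<subseteq> fst c \<inter> fst d"
    and K: "compact K" "K \<subseteq> overlap c d" "snd c ` B \<subseteq> K"
  shows "chart_vol c B = chart_vol d B"
proof -
  define S where "S = snd c ` B"
  define S' where "S' = snd d ` B"
  let ?T = "transition c d" and ?T' = "transition d c"
  let ?D = "\<lambda>x u. dir_deriv ?T u x" and ?D' = "\<lambda>x u. dir_deriv ?T' u x"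
  have S: "S \<in> sets borel" "S' \<in> sets borel"
    unfolding S_def S'_def using B by (auto intro!: chart_image_measurable c)
  have SO: "S \<subseteq> overlap c d" using K unfolding S_def by blast
  have SS: "S \<subseteq> chart_image c" "S' \<subseteq> chart_image d"
    using B(2) unfolding S_def S'_def chart_image_def by auto
  have TS: "?T ` S = S'" unfolding S_def S'_def using B(2) c by (intro transition_image) auto
  have S'O: "S' \<subseteq> overlap d c" using SO TS transition_overlap(1)[OF c] by blast
  let ?g = "\<lambda>y. to_vec (?T (of_vec y))" and ?h = "\<lambda>y. to_vec (?T' (of_vec y))"
  let ?g' = "\<lambda>y v. to_vec (?D (of_vec y) (of_vec v))" and ?h' = "\<lambda>y v. to_vec (?D' (of_vec y) (of_vec v))"
  have der: "((\<lambda>y. to_vec (transition c d (of_vec y))) has_derivative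
      (\<lambda>v. to_vec (dir_deriv (transition c d) (of_vec v) (of_vec y)))) (at y within Z)"
    if "c \<in> A" "d \<in> A" "of_vec y \<in> overlap c d" for c d y Z
    by (rule has_derivative_at_withinI, rule bounded_linear.has_derivative[OF bounded_linear_to_vec],
        rule has_derivative_compose[OF bounded_linear_imp_has_derivative[OF bounded_linear_of_vec] transition_has_derivative[OF that]])
  have K': "continuous_on K (w c)" using w_cont[OF c(1)] K(2) overlap_subset continuous_on_subset by (metis subset_trans)
  have mem: "y \<in> to_vec ` Z \<longleftrightarrow> of_vec y \<in> Z" for y and Z :: "'e set" by (auto simp: image_iff) (metis to_vec_of_vec)
  have cov: "(\<lambda>y. \<bar>det (matrix (?g' y))\<bar> * w d (of_vec (?g y))) absolutely_integrable_on (to_vec ` S) \<and>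
      integral (to_vec ` S) (\<lambda>y. \<bar>det (matrix (?g' y))\<bar> * w d (of_vec (?g y))) = b \<longleftrightarrow>
      (\<lambda>y. w d (of_vec y)) absolutely_integrable_on (to_vec ` S') \<and> integral (to_vec ` S') (\<lambda>y. w d (of_vec y)) = b" for b
  proof (rule cov_invertible_real)
    show "(?g has_derivative ?g' y) (at y within to_vec ` S)" if "y \<in> to_vec ` S" for y
      by (rule der[OF c]) (use that SO mem in blast)
    show "(?h has_derivative ?h' y) (at y within to_vec ` S')" if "y \<in> to_vec ` S'" for y
      by (rule der[OF c(2,1)]) (use that S'O mem in blast)
    show "?g y \<in> to_vec ` S' \<and> ?h (?g y) = y" if "y \<in> to_vec ` S" for y
    proof -
      have y: "of_vec y \<in> S" using that mem by blast
      then show ?thesis using transition_overlap(2)[OF c] SO TS by (auto simp: subset_iff)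
    qed
    show "?h y \<in> to_vec ` S \<and> ?g (?h y) = y" if "y \<in> to_vec ` S'" for y
    proof -
      have y: "of_vec y \<in> S'" using that mem by blast
      then obtain x where x: "x \<in> S" "of_vec y = ?T x" using TS by blast
      have "?T' (?T x) = x" using x(1) SO transition_overlap(2)[OF c] by blast
      moreover have "?T (?T' (of_vec y)) = of_vec y" using y S'O transition_overlap(2)[OF c(2,1)] by blast
      moreover have "to_vec (?T x) = y" using x(2) by (metis to_vec_of_vec)
      ultimately show ?thesis using x by simp
    qed
    show "?h' y \<circ> ?g' (?h y) = id" if "y \<in> to_vec ` S'" for y
    proof -
      have y: "of_vec y \<in> S'" using that mem by blast
      then have y': "of_vec y \<in> overlap d c" using S'O by blast
      have "?D' (of_vec y) (?D (?T' (of_vec y)) v) = v" for v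
        using transition_derivative_inverse[OF c transition_overlap(1)[OF c(2,1) y'], of v] transition_overlap(2)[OF c(2,1) y']
        by simp
      then show ?thesis by (simp add: fun_eq_iff)
    qed
  qed
  have eq: "\<bar>det (matrix (?g' y))\<bar> * w d (of_vec (?g y)) = w c (of_vec y)" if "y \<in> to_vec ` S" for y
  proof -
    have "of_vec y \<in> overlap c d" using that mem SO by blast
    then show ?thesis using w_pullback[OF c, of "of_vec y"] by (simp add: linear_det_def)
  qed
  have mS: "to_vec ` Z \<in> sets borel" if "Z \<in> sets borel" for Z :: "'e set"
  proof -
    have "to_vec ` Z = of_vec -` Z" using mem by blast
    then show ?thesis using measurable_sets[OF measurable_of_vec that] by simp
  qed
  have "(\<lambda>y. w c (of_vec y)) absolutely_integrable_on (to_vec ` S)"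
  proof (rule absolutely_integrable_bounded[of "to_vec ` K"])
    show "continuous_on (to_vec ` K) (\<lambda>y. w c (of_vec y))"
      by (rule continuous_on_compose2[OF K' linear_continuous_on[OF bounded_linear_of_vec]]) auto
    show "compact (to_vec ` K)"
      by (rule compact_continuous_image[OF linear_continuous_on[OF bounded_linear_to_vec] K(1)])
  qed (use mS S K in \<open>auto simp: S_def\<close>)
  moreover from this have "(\<lambda>y. \<bar>det (matrix (?g' y))\<bar> * w d (of_vec (?g y))) absolutely_integrable_on (to_vec ` S)"
    using eq by (subst set_integrable_cong[OF refl refl, where f' = "\<lambda>y. w c (of_vec y)"]) auto
  moreover have "integral (to_vec ` S) (\<lambda>y. \<bar>det (matrix (?g' y))\<bar> * w d (of_vec (?g y))) = integral (to_vec ` S) (\<lambda>y. w c (of_vec y))"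
    using eq by (rule integral_cong)
  ultimately have int: "(\<lambda>y. w c (of_vec y)) absolutely_integrable_on (to_vec ` S)"
    "(\<lambda>y. w d (of_vec y)) absolutely_integrable_on (to_vec ` S')"
    "integral (to_vec ` S') (\<lambda>y. w d (of_vec y)) = integral (to_vec ` S) (\<lambda>y. w c (of_vec y))"
    using cov by blast+
  have conv: "(\<integral>\<^sup>+x\<in>Z. ennreal (w c x) \<partial>lborel) = ennreal (integral (to_vec ` Z) (\<lambda>y. w c (of_vec y)))"
    if "c \<in> A" "Z \<in> sets borel" "Z \<subseteq> chart_image c" "(\<lambda>y. w c (of_vec y)) absolutely_integrable_on (to_vec ` Z)" for c Z
  proof -
    have "(\<integral>\<^sup>+x\<in>Z. ennreal (w c x) \<partial>lborel) = (\<integral>\<^sup>+y. ennreal (w c (of_vec y)) * indicator Z (of_vec y) \<partial>lborel)"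
      using nn_integral_of_vec[OF density_measurable[OF that(1-3)]] by simp
    also have "\<dots> = (\<integral>\<^sup>+y\<in>to_vec ` Z. ennreal (w c (of_vec y)) \<partial>lborel)"
      by (intro nn_integral_cong) (simp add: indicator_def mem)
    also have "\<dots> = ennreal (integral (to_vec ` Z) (\<lambda>y. w c (of_vec y)))"
      by (rule nn_integral_absolutely_integrable[OF that(4) w_nonneg])
    finally show ?thesis .
  qed
  show ?thesis
    unfolding chart_vol_def
    using conv[OF c(1) S(1) SS(1) int(1)] conv[OF c(2) S(2) SS(2) int(2)] int(3) by (simp add: S_def S'_def)
qed

lemma chart_vol_additive:
  assumes c: "c \<in> A" and B: "\<And>i :: nat. B i \<in> sets borel" "\<And>i. B i \<subseteq> fst c" and dis: "disjoint_family B"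
  shows "chart_vol c (\<Union>i. B i) = (\<Sum>i. chart_vol c (B i))"
proof -
  have inj: "inj_on (snd c) (fst c)" using chart_inv_chart[OF c] by (metis inj_on_inverseI)
  have dis': "disjoint_family (\<lambda>i. snd c ` B i)"
    unfolding disjoint_family_on_def
  proof (intro ballI impI)
    fix i j :: nat assume "i \<noteq> j"
    then have "B i \<inter> B j = {}" using dis by (auto simp: disjoint_family_on_def)
    then show "snd c ` B i \<inter> snd c ` B j = {}"
      using inj_on_image_Int[OF inj B(2) B(2), of i j] by simp
  qed
  have "chart_vol c (\<Union>i. B i) = (\<integral>\<^sup>+x. (\<Sum>i. ennreal (w c x) * indicator (snd c ` B i) x) \<partial>lborel)"
    unfolding chart_vol_def image_UN
  proof (intro nn_integral_cong)
    fix x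
    have "(\<Sum>i. indicator (snd c ` B i) x) = (indicator (\<Union>i. snd c ` B i) x :: ennreal)"
      by (rule suminf_indicator[OF dis'])
    then show "ennreal (w c x) * indicator (\<Union>i. snd c ` B i) x = (\<Sum>i. ennreal (w c x) * indicator (snd c ` B i) x)"
      by (simp add: ennreal_suminf_cmult)
  qed
  also have "\<dots> = (\<Sum>i. chart_vol c (B i))"
    unfolding chart_vol_def
  proof (rule nn_integral_suminf)
    fix i
    have "snd c ` B i \<subseteq> chart_image c" unfolding chart_image_def by (rule image_mono[OF B(2)])
    then show "(\<lambda>x. ennreal (w c x) * indicator (snd c ` B i) x) \<in> borel_measurable lborel"
      using density_measurable[OF c chart_image_measurable[OF c B(1,2)]] by simp
  qed
  finally show ?thesis .
qed

lemma chart_vol_empty [simp]: "chart_vol c {} = 0" by (simp add: chart_vol_def)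

text \<open>The overlap is exhausted by countably many compact sets. The differences of successive
  unions cut \<open>B\<close> into disjoint pieces to which \<open>chart_vol_compact\<close>
  applies, and countable additivity puts them together.\<close>

lemma chart_vol_eq:
  assumes c: "c \<in> A" "d \<in> A" and B: "B \<in> sets borel" "B \<subseteq> fst c \<inter> fst d"
  shows "chart_vol c B = chart_vol d B"
proof -
  from open_sigma_compact[OF open_overlap[OF c]] obtain K :: "nat \<Rightarrow> 'e set"
    where K0: "(\<forall>n. compact (K n)) \<and> (\<forall>n. K n \<subseteq> overlap c d) \<and> \<Union>(range K) = overlap c d" ..
  then have K: "\<And>n. compact (K n)" "\<And>n. K n \<subseteq> overlap c d" and UK: "\<Union>(range K) = overlap c d"
    by simp_all
  define P where "P i = {m \<in> B. snd c m \<in> disjointed K i}" for i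
  have SB: "snd c ` B \<subseteq> overlap c d" using B(2) by (auto simp: overlap_def)
  have mK: "K i \<in> sets borel" for i using K(1) by (simp add: borel_compact)
  have dK: "disjointed K i \<in> sets borel" for i
    using sets.range_disjointed_sets[of K borel] mK by auto
  have P: "P i \<in> sets borel" for i
  proof -
    have "snd c \<in> borel_measurable (restrict_space borel (fst c))"
      by (rule borel_measurable_continuous_on_restrict[OF cont_chart[OF c(1)]])
    then have "snd c -` disjointed K i \<inter> space (restrict_space borel (fst c)) \<in> sets (restrict_space borel (fst c))"
      using dK by (rule measurable_sets)
    then have "snd c -` disjointed K i \<inter> fst c \<in> sets borel"
      using open_chart[OF c(1)] by (simp add: space_restrict_space sets_restrict_space_iff)
    then have "B \<inter> (snd c -` disjointed K i \<inter> fst c) \<in> sets borel" using B(1) by (rule sets.Int[rotated])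
    moreover have "P i = B \<inter> (snd c -` disjointed K i \<inter> fst c)" using B(2) by (auto simp: P_def)
    ultimately show ?thesis by simp
  qed
  have sub: "P i \<subseteq> fst c \<inter> fst d" for i using B(2) by (auto simp: P_def)
  have dis: "disjoint_family P"
    using disjoint_family_disjointed[of K] by (auto simp: disjoint_family_on_def P_def)
  have "(\<Union>i. P i) = B"
  proof -
    have "(\<Union>i. disjointed K i) = overlap c d" using UK UN_disjointed_eq[of K] by simp
    then show ?thesis using SB by (force simp: P_def)
  qed
  moreover have "chart_vol c (P i) = chart_vol d (P i)" for i
  proof (rule chart_vol_compact[OF c P sub K(1,2)])
    show "snd c ` P i \<subseteq> K i" using disjointed_subset[of K i] by (auto simp: P_def)
  qed
  moreover have "chart_vol c (\<Union>i. P i) = (\<Sum>i. chart_vol c (P i))" "chart_vol d (\<Union>i. P i) = (\<Sum>i. chart_vol d (P i))"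
    by (rule chart_vol_additive[OF c(1) P _ dis], use sub in blast, rule chart_vol_additive[OF c(2) P _ dis], use sub in blast)
  ultimately show ?thesis by simp
qed

section \<open>Gluing the chart volumes to one measure\<close>

definition vol_measure :: "'m measure \<Rightarrow> bool" where
  "vol_measure \<mu> \<longleftrightarrow> sets \<mu> = sets borel \<and> (\<forall>c\<in>A. \<forall>B\<in>sets borel. B \<subseteq> fst c \<longrightarrow> emeasure \<mu> B = chart_vol c B)"

lemma finite_pieces:
  obtains k :: nat and c :: "nat \<Rightarrow> ('m, 'e) chart" and U :: "nat \<Rightarrow> 'm set"
  where "\<And>i. i < k \<Longrightarrow> c i \<in> A" "\<And>i. i < k \<Longrightarrow> U i \<subseteq> fst (c i)" "\<And>i. i < k \<Longrightarrow> U i \<in> sets borel"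
    "disjoint_family_on U {..<k}" "(\<Union>i<k. U i) = UNIV"
proof -
  have "UNIV \<subseteq> (\<Union>c\<in>A. fst c)" using charts_cover by blast
  obtain F where F: "F \<subseteq> A" "finite F" "UNIV \<subseteq> (\<Union>c\<in>F. fst c)"
  proof (rule compactE_image[OF compact_mfd])
    show "open (fst c)" if "c \<in> A" for c by (rule open_chart[OF that])
    show "UNIV \<subseteq> (\<Union>c\<in>A. fst c)" by fact
  qed
  obtain c where c: "bij_betw c {0..<card F} F" using ex_bij_betw_nat_finite[OF F(2)] by blast
  define U where "U i = fst (c i) - (\<Union>j<i. fst (c j))" for i
  have cA: "c i \<in> A" if "i < card F" for i using c F(1) that by (auto simp: bij_betw_def)
  have op: "open (fst (c i))" if "i < card F" for i using open_chart[OF cA[OF that]] .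
  show ?thesis
  proof
    show "c i \<in> A" if "i < card F" for i by (rule cA[OF that])
    show "U i \<subseteq> fst (c i)" for i by (auto simp: U_def)
    show "U i \<in> sets borel" if "i < card F" for i
      unfolding U_def using op that by (intro sets.Diff sets.finite_UN) auto
    show "disjoint_family_on U {..<card F}"
      unfolding disjoint_family_on_def U_def 
    proof (intro ballI impI)
      fix i j :: nat assume "i \<noteq> j"
      then consider "i < j" | "j < i" by linarith
      then show "(fst (c i) - (\<Union>j<i. fst (c j))) \<inter> (fst (c j) - (\<Union>i<j. fst (c i))) = {}"
        by cases auto
    qed
    have "m \<in> (\<Union>i<card F. U i)" for m
    proof -
      have "m \<in> (\<Union>c\<in>F. fst c)" using F(3) by blast
      then obtain d where d: "d \<in> F" "m \<in> fst d" by blast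
      then have "d \<in> c ` {0..<card F}" using c by (simp add: bij_betw_def)
      then have "\<exists>i<card F. m \<in> fst (c i)" using d(2) by auto
      then obtain i where i: "i < card F" "m \<in> fst (c i)" "\<And>j. j < i \<Longrightarrow> \<not> (j < card F \<and> m \<in> fst (c j))"
        using exists_least_iff[of "\<lambda>i. i < card F \<and> m \<in> fst (c i)"] by blast
      then show ?thesis by (auto simp: U_def intro!: bexI[of _ i])
    qed
    then show "(\<Union>i<card F. U i) = UNIV" by blast
  qed
qed

text \<open>\<open>contact_measure\<close> is a definite description, which gets its meaning from
  this statement. Finitely many disjoint Borel sets, each inside a chart, determine the measure as a
  sum of chart volumes, and \<open>chart_vol_eq\<close> shows that the sum gives the right value in
  every chart.\<close>

lemma vol_measure_exists_unique: "\<exists>!\<mu>. vol_measure \<mu>"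
proof -
  obtain k c U where U: "\<And>i. i < k \<Longrightarrow> c i \<in> A" "\<And>i. i < k \<Longrightarrow> U i \<subseteq> fst (c i)" "\<And>i. i < (k::nat) \<Longrightarrow> U i \<in> sets borel"
    "disjoint_family_on U {..<k}" "(\<Union>i<k. U i) = UNIV" using finite_pieces by metis
  define f where "f B = (\<Sum>i<k. chart_vol (c i) (B \<inter> U i))" for B
  define \<mu> where "\<mu> = measure_of UNIV (sets borel) f"
  have ca: "countably_additive (sets borel) f"
    unfolding countably_additive_def
  proof (intro allI impI)
    fix B :: "nat \<Rightarrow> 'm set" assume B: "range B \<subseteq> sets borel" "disjoint_family B" "\<Union> (range B) \<in> sets borel"
    have "chart_vol (c i) ((\<Union>j. B j) \<inter> U i) = (\<Sum>j. chart_vol (c i) (B j \<inter> U i))" if i: "i < k" for i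
    proof -
      have "chart_vol (c i) (\<Union>j. B j \<inter> U i) = (\<Sum>j. chart_vol (c i) (B j \<inter> U i))"
      proof (rule chart_vol_additive[OF U(1)[OF i]])
        show "B j \<inter> U i \<in> sets borel" for j using B(1) U(3)[OF i] by auto
        show "B j \<inter> U i \<subseteq> fst (c i)" for j using U(2)[OF i] by auto
        show "disjoint_family (\<lambda>j. B j \<inter> U i)" using B(2) by (auto simp: disjoint_family_on_def)
      qed
      then show ?thesis by simp
    qed
    then show "(\<Sum>j. f (B j)) = f (\<Union> (range B))"
      by (simp add: f_def suminf_sum[OF summableI])
  qed
  have sets_\<mu>: "sets \<mu> = sets borel"
    unfolding \<mu>_def using sigma_algebra.sets_measure_of_eq[OF sets.sigma_algebra_axioms[of "borel :: 'm measure"]] by simp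
  have em: "emeasure \<mu> B = f B" if "B \<in> sets borel" for B
  proof (rule emeasure_measure_of[OF \<mu>_def])
    show "positive (sets \<mu>) f" by (simp add: positive_def f_def)
    show "countably_additive (sets \<mu>) f" using ca sets_\<mu> by simp
    show "B \<in> sets \<mu>" using that sets_\<mu> by simp
  qed auto
  have "vol_measure \<mu>"
    unfolding vol_measure_def
  proof (intro conjI ballI impI sets_\<mu>)
    fix d B assume d: "d \<in> A" and B: "B \<in> sets borel" "B \<subseteq> fst d"
    have "f B = (\<Sum>i<k. chart_vol d (B \<inter> U i))"
      unfolding f_def using U B d by (intro sum.cong chart_vol_eq) auto
    also have "\<dots> = (\<Sum>i. chart_vol d (B \<inter> (if i < k then U i else {})))"
      by (subst suminf_finite[of "{..<k}"]) auto
    also have "\<dots> = chart_vol d (\<Union>i. B \<inter> (if i < k then U i else {}))"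
    proof (rule chart_vol_additive[OF d, symmetric])
      show "disjoint_family (\<lambda>i. B \<inter> (if i < k then U i else {}))"
        using U(4) by (auto simp: disjoint_family_on_def)
    qed (use B U in auto)
    also have "(\<Union>i. B \<inter> (if i < k then U i else {})) = B"
    proof -
      have "(\<Union>i. (if i < k then U i else {})) = (\<Union>i<k. U i)" by (auto split: if_splits)
      then show ?thesis using U(5) by auto
    qed
    finally show "emeasure \<mu> B = chart_vol d B" using em[OF B(1)] by simp
  qed
  moreover have "\<nu> = \<mu>" if "vol_measure \<nu>" for \<nu>
  proof (rule measure_eqI)
    show "sets \<nu> = sets \<mu>" using that sets_\<mu> by (simp add: vol_measure_def)
    fix B assume "B \<in> sets \<nu>"
    then have B: "B \<in> sets borel" using that by (simp add: vol_measure_def)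
    have "emeasure \<nu> B = emeasure \<nu> (\<Union>i<k. B \<inter> U i)" using U(5) by (simp flip: Int_UN_distrib)
    also have "\<dots> = (\<Sum>i<k. emeasure \<nu> (B \<inter> U i))"
      using that B U(3,4) by (intro sum_emeasure[symmetric]) (auto simp: vol_measure_def disjoint_family_on_def)
    also have "\<dots> = f B"
      unfolding f_def
    proof (rule sum.cong)
      fix i assume "i \<in> {..<k}"
      then have i: "i < k" by simp
      have "B \<inter> U i \<in> sets borel" "B \<inter> U i \<subseteq> fst (c i)" using B U(2,3)[OF i] by auto
      then show "emeasure \<nu> (B \<inter> U i) = chart_vol (c i) (B \<inter> U i)"
        using that U(1)[OF i] unfolding vol_measure_def by blast
    qed simp
    finally show "emeasure \<nu> B = emeasure \<mu> B" using em[OF B] by simp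
  qed
  ultimately show ?thesis by blast
qed

text \<open>Every point has a neighbourhood of finite volume, and finitely many of them cover.
  Finiteness is what turns a decrease of the volume inside one chart into a strict decrease of the
  total.\<close>

lemma vol_measure_finite:
  assumes \<mu>: "vol_measure \<mu>"
  shows "emeasure \<mu> UNIV < \<infinity>"
proof -
  have sm: "sets \<mu> = sets borel" using \<mu> by (simp add: vol_measure_def)
  have "\<exists>W. open W \<and> p \<in> W \<and> emeasure \<mu> W < \<infinity>" for p
  proof -
    obtain c where c: "c \<in> A" "p \<in> fst c" using charts_cover by blast
    obtain r where r: "r > 0" "cball (snd c p) r \<subseteq> chart_image c"
      using open_chart_image[OF c(1)] chart_mem[OF c(2)] open_contains_cball by blast
    define W where "W = {m \<in> fst c. snd c m \<in> ball (snd c p) r}"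
    have "open W" unfolding W_def by (rule chart_preimage_open[OF c(1)]) simp
    have "w c absolutely_integrable_on cball (snd c p) r"
      using absolutely_integrable_compact[OF continuous_on_subset[OF w_cont[OF c(1)] r(2)] compact_cball] .
    then have "(\<integral>\<^sup>+x\<in>cball (snd c p) r. ennreal (w c x) \<partial>lborel) < \<infinity>"
      by (subst nn_integral_absolutely_integrable) (auto simp: w_nonneg)
    moreover have "chart_vol c W \<le> (\<integral>\<^sup>+x\<in>cball (snd c p) r. ennreal (w c x) \<partial>lborel)"
      unfolding chart_vol_def by (intro nn_integral_mono) (auto simp: W_def indicator_def)
    ultimately have "chart_vol c W < \<infinity>" by (rule order_le_less_trans[rotated])
    then have "emeasure \<mu> W < \<infinity>"
      using \<mu> \<open>open W\<close> c by (auto simp: vol_measure_def W_def)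
    then show ?thesis using \<open>open W\<close> c r by (intro exI[of _ W]) (simp add: W_def)
  qed
  then obtain W where W: "\<And>p. open (W p)" "\<And>p. p \<in> W p" "\<And>p. emeasure \<mu> (W p) < \<infinity>" by metis
  have "UNIV \<subseteq> (\<Union>p\<in>UNIV. W p)" using W(2) by blast
  then obtain F where F: "F \<subseteq> UNIV" "finite F" "UNIV \<subseteq> (\<Union>p\<in>F. W p)"
    by (rule compactE_image[OF compact_mfd W(1)])
  have "emeasure \<mu> UNIV \<le> emeasure \<mu> (\<Union>p\<in>F. W p)" using F(3) by (intro emeasure_mono) (auto simp only: sm intro!: borel_open open_UN W)
  also have "\<dots> \<le> (\<Sum>p\<in>F. emeasure \<mu> (W p))"
    using F(2) W(1) by (intro emeasure_subadditive_finite) (auto simp: sm)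
  also have "\<dots> < \<infinity>" using F(2) W(3) by (simp add: less_top)
  finally show ?thesis .
qed

end

context contact
begin

definition weight :: "('m, 'e) chart \<Rightarrow> 'e \<Rightarrow> real" where
  "weight c x = \<bar>contact_volume_form n \<alpha> c x basis_enum\<bar>"

lemma form_forms:
  assumes "c \<in> A" "x \<in> chart_image c"
  shows "multilinear_upto DIM('e) (contact_volume_form n \<alpha> c x)"
    and "alternating_upto DIM('e) (contact_volume_form n \<alpha> c x)"
  using covector_wedge_power_forms[OF form_linear[OF assms] ext_deriv_bilinear[OF assms], of "n - 1"] dim_eq
  by (simp_all add: contact_volume_form_eq[abs_def])

lemma weight_pos:
  assumes "c \<in> A" "x \<in> chart_image c"
  shows "weight c x > 0"
proof -
  obtain v where "contact_volume_form n \<alpha> c x v \<noteq> 0"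
    using contact assms unfolding contact_form_def by blast
  then have "contact_volume_form n \<alpha> c x basis_enum \<noteq> 0"
    using top_form_determined[OF form_forms[OF assms] span_basis_enum] by blast
  then show ?thesis by (simp add: weight_def)
qed

lemma wedge_power2_continuous:
  assumes "\<And>u v. continuous_on S (\<lambda>x. B x u v)"
  shows "continuous_on S (\<lambda>x. wedge_power2 (\<lambda>v. B x (v 0) (v 1)) m v)"
proof (induction m arbitrary: v)
  case (Suc m)
  show ?case unfolding wedge_power2.simps wedge_def by (intro continuous_intros assms Suc) auto
qed simp

lemma weight_continuous:
  assumes c: "c \<in> A"
  shows "continuous_on (chart_image c) (weight c)"
proof -
  have "continuous_on (chart_image c) (\<lambda>x. E c x u v)" "continuous_on (chart_image c) (\<lambda>x. \<alpha> c x v)" for u v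
    using ext_deriv_smooth[OF c, of 0 u v] form_smooth[OF c, of 0 v] by simp_all
  then show ?thesis
    unfolding weight_def[abs_def] contact_volume_form_eq covector_wedge_power_def wedge_def
    by (intro continuous_intros wedge_power2_continuous) auto
qed

sublocale dens: mfd_density A weight
proof
  show "continuous_on (chart_image c) (weight c)" if "c \<in> A" for c by (rule weight_continuous[OF that])
  show "weight c x \<ge> 0" for c x by (simp add: weight_def)
  fix c d x assume c: "c \<in> A" "d \<in> A" and x: "x \<in> overlap c d"
  have "transition c d x \<in> chart_image d"
    using transition_overlap(1)[OF c x] by (rule subsetD[OF overlap_subset])
  then show "weight c x = \<bar>linear_det (\<lambda>u. dir_deriv (transition c d) u x)\<bar> * weight d (transition c d x)"
    unfolding weight_def contact_volume_form_pullback[OF c x]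
    using top_form_linear_image[OF form_forms[OF c(2)], of _ "\<lambda>u. dir_deriv (transition c d) u x"]
    by (simp add: abs_mult)
qed

lemma contact_measure: "dens.vol_measure (contact_measure A n \<alpha>)"
proof -
  have "contact_measure A n \<alpha> = (THE \<mu>. dens.vol_measure \<mu>)"
    unfolding contact_measure_def dens.vol_measure_def dens.chart_vol_def weight_def ..
  then show ?thesis using theI'[OF dens.vol_measure_exists_unique] by simp
qed

end

subsection \<open>Hitting times and integral inequalities\<close>

lemma first_hit:
  fixes \<phi> :: "real \<Rightarrow> real"
  assumes ab: "a \<le> b" and \<phi>: "continuous_on {a..b} \<phi>" "\<phi> a \<ge> c" "\<phi> b \<le> c"
  shows "\<exists>t\<in>{a..b}. \<phi> t = c \<and> (\<forall>u\<in>{a..t}. \<phi> u \<ge> c)"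
proof -
  let ?S = "{t \<in> {a..b}. \<phi> t \<le> c}"
  have "closed ?S" using continuous_closed_preimage[OF \<phi>(1) closed_atLeastAtMost closed_atMost, of c]
    by (simp add: vimage_def Int_def)
  then have "compact ({a..b} \<inter> ?S)" by (rule compact_Int_closed[OF compact_Icc])
  moreover have "{a..b} \<inter> ?S = ?S" by auto
  ultimately have S: "compact ?S" by simp
  have "?S \<noteq> {}" using ab \<phi>(3) by auto
  from compact_attains_inf[OF S this] obtain t where t: "t \<in> ?S" and t': "\<forall>u\<in>?S. t \<le> u"
    by (rule bexE)
  have ge: "\<phi> u \<ge> c" if "u \<in> {a..<t}" for u
  proof (rule ccontr)
    assume "\<not> \<phi> u \<ge> c"
    then have "u \<in> ?S" using that t by auto
    then have "t \<le> u" using t' by blast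
    then show False using that by auto
  qed
  have "\<phi> t = c"
  proof -
    have "continuous_on {a..t} \<phi>" using t by (intro continuous_on_subset[OF \<phi>(1)]) auto
    then obtain u where u: "a \<le> u" "u \<le> t" "\<phi> u = c"
      using IVT2'[of \<phi> t c a] t \<phi>(2) by auto
    then have "u \<in> ?S" using t by auto
    then have "t \<le> u" using t' by blast
    then show ?thesis using u by simp
  qed
  moreover have "\<forall>u\<in>{a..t}. \<phi> u \<ge> c"
  proof
    fix u assume u: "u \<in> {a..t}"
    show "\<phi> u \<ge> c"
      by (cases "u = t") (use u ge[of u] \<open>\<phi> t = c\<close> in auto)
  qed
  ultimately show ?thesis using t by blast
qed

lemma last_hit:
  fixes \<phi> :: "real \<Rightarrow> real"
  assumes ab: "a \<le> b" and \<phi>: "continuous_on {a..b} \<phi>" "\<phi> a \<le> c" "\<phi> b \<ge> c"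
  shows "\<exists>t\<in>{a..b}. \<phi> t = c \<and> (\<forall>u\<in>{t..b}. \<phi> u \<ge> c)"
proof -
  have "continuous_on {-b..-a} (\<lambda>t. \<phi> (- t))"
    by (rule continuous_on_compose2[OF \<phi>(1)]) (auto intro!: continuous_intros)
  then have "\<exists>t\<in>{-b..-a}. \<phi> (- t) = c \<and> (\<forall>u\<in>{-b..t}. \<phi> (- u) \<ge> c)"
    by (intro first_hit) (use ab \<phi> in auto)
  then obtain t where t: "t \<in> {-b..-a}" "\<phi> (- t) = c" "\<And>u. u \<in> {-b..t} \<Longrightarrow> \<phi> (- u) \<ge> c" by blast
  have "\<phi> u \<ge> c" if "u \<in> {- t..b}" for u using t(3)[of "- u"] that by simp
  then show ?thesis using t(1,2) by (intro bexI[of _ "- t"]) auto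
qed

lemma growth_lower:
  fixes \<phi> :: "real \<Rightarrow> real"
  assumes "a \<le> b" "\<And>t. t \<in> {a..b} \<Longrightarrow> (\<phi> has_vector_derivative \<phi>' t) (at t within {a..b})"
    and "\<And>t. t \<in> {a..b} \<Longrightarrow> m \<le> \<phi>' t"
  shows "m * (b - a) \<le> \<phi> b - \<phi> a"
proof -
  have "\<exists>t\<in>{a..b}. \<phi> b - \<phi> a = (b - a) *\<^sub>R \<phi>' t"
    by (rule mvt_very_simple[OF assms(1)]) (use assms(2) in \<open>auto simp: has_vector_derivative_def\<close>)
  then obtain t where "t \<in> {a..b}" "\<phi> b - \<phi> a = (b - a) * \<phi>' t" by auto
  then show ?thesis using assms(1,3) mult_left_mono[of m "\<phi>' t" "b - a"] by (simp add: mult.commute)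
qed

text \<open>Cauchy-Schwarz against the constant 1, in the form that the variance of \<psi> about its
  mean \<theta> is nonnegative.\<close>

lemma integral_square_le:
  fixes \<psi> :: "real \<Rightarrow> real"
  assumes \<psi>: "continuous_on {0..b} \<psi>" and b: "b > 0"
  shows "(integral {0..b} \<psi>)\<^sup>2 \<le> b * integral {0..b} (\<lambda>t. (\<psi> t)\<^sup>2)"
proof -
  define \<Phi> where "\<Phi> = integral {0..b} \<psi>"
  define \<theta> where "\<theta> = \<Phi> / b"
  have i: "\<psi> integrable_on {0..b}" "(\<lambda>t. (\<psi> t)\<^sup>2) integrable_on {0..b}"
    using \<psi> by (auto intro!: integrable_continuous_real continuous_intros)
  have c: "(\<lambda>t. \<theta>\<^sup>2) integrable_on {0..b}" by (rule integrable_const_ivl)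
  have m: "(\<lambda>t. 2 * \<theta> * \<psi> t) integrable_on {0..b}" using i(1) by (intro integrable_on_mult_right)
  have "0 \<le> integral {0..b} (\<lambda>t. (\<psi> t - \<theta>)\<^sup>2)"
    by (intro integral_nonneg integrable_continuous_real continuous_intros \<psi>) auto
  also have "(\<lambda>t. (\<psi> t - \<theta>)\<^sup>2) = (\<lambda>t. (\<psi> t)\<^sup>2 - 2 * \<theta> * \<psi> t + \<theta>\<^sup>2)"
    by (simp add: fun_eq_iff power2_diff algebra_simps)
  also have "integral {0..b} \<dots> = integral {0..b} (\<lambda>t. (\<psi> t)\<^sup>2) - 2 * \<theta> * \<Phi> + b * \<theta>\<^sup>2"
    using b by (subst integral_add[OF integrable_diff[OF i(2) m] c], subst integral_diff[OF i(2) m])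
      (simp add: \<Phi>_def)
  also have "\<dots> = integral {0..b} (\<lambda>t. (\<psi> t)\<^sup>2) - \<Phi>\<^sup>2 / b"
    using b by (simp add: \<theta>_def power2_eq_square field_simps)
  finally have "\<Phi>\<^sup>2 / b \<le> integral {0..b} (\<lambda>t. (\<psi> t)\<^sup>2)" by simp
  then show ?thesis using b by (simp add: \<Phi>_def field_simps)
qed

subsection \<open>The bump perturbation in a chart\<close>

locale bump_setup = local_model a da E R x\<^sub>0 r C
  for a :: "'e::euclidean_space \<Rightarrow> 'e \<Rightarrow> real" and da E R x\<^sub>0 r C +
  fixes e :: 'e and \<sigma> \<rho> d h k :: real
  assumes e_kernel: "a x\<^sub>0 e = 0" and e_norm: "norm e = 1 / 2"
    and pos: "\<sigma> > 0" "\<rho> > 0" "d > 0" "h > 0" "k > 0"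
begin

text \<open>\<open>s\<close> and \<open>z\<close> are affine coordinates along the Reeb direction at
  the centre \<open>x\<^sub>0\<close> and along the contact hyperplane there.\<close>

definition s :: "'e \<Rightarrow> real" where "s x = a x\<^sub>0 (x - x\<^sub>0)"
definition proj :: "'e \<Rightarrow> 'e" where "proj v = v - a x\<^sub>0 v *\<^sub>R R x\<^sub>0"
definition z :: "'e \<Rightarrow> 'e" where "z x = proj (x - x\<^sub>0)"
text \<open>The unit sublevel set is an ellipsoid around \<open>s = 3 * \<sigma>\<close>,
  \<open>z = \<rho> *\<^sub>R e\<close>, that of \<open>Q2\<close> one around
  \<open>s = - 3 * \<sigma>\<close>, \<open>z = 0\<close>. Orbits move towards growing
  \<open>s\<close> and so meet the second one first. The first centre is off the axis
  \<open>z = 0\<close> by \<open>\<rho> / 2\<close>, as \<open>norm e = 1 / 2\<close>: near the axis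
  its bump has a definite slope in the direction \<open>e\<close>.\<close>

definition Q1 :: "'e \<Rightarrow> real" where "Q1 x = (s x / \<sigma> - 3)\<^sup>2 + (norm (z x - \<rho> *\<^sub>R e) / \<rho>)\<^sup>2"
definition Q2 :: "'e \<Rightarrow> real" where "Q2 x = (s x / \<sigma> + 3)\<^sup>2 + (norm (z x) / d)\<^sup>2"
definition f :: "'e \<Rightarrow> real" where "f x = h * flat (1 - Q1 x) - k * flat (1 - Q2 x)"
definition dQ1 :: "'e \<Rightarrow> 'e \<Rightarrow> real" where
  "dQ1 x v = 2 * (s x / \<sigma> - 3) * (a x\<^sub>0 v / \<sigma>) + 2 * ((z x - \<rho> *\<^sub>R e) \<bullet> proj v) / \<rho>\<^sup>2"
definition dQ2 :: "'e \<Rightarrow> 'e \<Rightarrow> real" where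
  "dQ2 x v = 2 * (s x / \<sigma> + 3) * (a x\<^sub>0 v / \<sigma>) + 2 * (z x \<bullet> proj v) / d\<^sup>2"
definition df :: "'e \<Rightarrow> 'e \<Rightarrow> real" where
  "df x v = k * flat_quot 2 (1 - Q2 x) * dQ2 x v - h * flat_quot 2 (1 - Q1 x) * dQ1 x v"

lemma x0_mem: "x\<^sub>0 \<in> cball x\<^sub>0 r" using r by simp

lemma ell_linear: "linear (a x\<^sub>0)" by (rule a_linear[OF x0_mem])
lemma ell_bounded_linear: "bounded_linear (a x\<^sub>0)" using ell_linear by (simp add: linear_conv_bounded_linear)
lemma ell_bound: "\<bar>a x\<^sub>0 v\<bar> \<le> C * norm v" by (rule a_bound[OF x0_mem])
lemma ell_R: "a x\<^sub>0 (R x\<^sub>0) = 1" by (rule a_R[OF x0_mem])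

lemma proj_bounded_linear: "bounded_linear proj"
  unfolding proj_def[abs_def]
  by (intro bounded_linear_sub bounded_linear_ident bounded_linear_compose[OF bounded_linear_scaleR_left ell_bounded_linear])

lemma proj_bound: "norm (proj v) \<le> 2 * C\<^sup>2 * norm v"
proof -
  have "norm (proj v) \<le> norm v + \<bar>a x\<^sub>0 v\<bar> * norm (R x\<^sub>0)"
    unfolding proj_def using norm_triangle_ineq4[of v "a x\<^sub>0 v *\<^sub>R R x\<^sub>0"] by simp
  also have "\<dots> \<le> norm v + (C * norm v) * C"
    using ell_bound[of v] R_bound[OF x0_mem] C by (intro add_mono mult_mono) auto
  also have "\<dots> \<le> 2 * C\<^sup>2 * norm v"
  proof -
    have "1 * norm v \<le> C\<^sup>2 * norm v" using C by (intro mult_right_mono) (simp_all add: one_le_power)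
    then show ?thesis by (simp add: power2_eq_square)
  qed
  finally show ?thesis .
qed

lemma proj_R0: "proj (R x\<^sub>0) = 0" by (simp add: proj_def ell_R)
lemma proj_e: "proj e = e" by (simp add: proj_def e_kernel)

lemma decompose: "x - x\<^sub>0 = s x *\<^sub>R R x\<^sub>0 + z x" by (simp add: s_def z_def proj_def)

lemma dist_x0: "norm (x - x\<^sub>0) \<le> C * \<bar>s x\<bar> + norm (z x)"
proof -
  have "norm (x - x\<^sub>0) \<le> \<bar>s x\<bar> * norm (R x\<^sub>0) + norm (z x)"
    unfolding decompose[of x] using norm_triangle_ineq[of "s x *\<^sub>R R x\<^sub>0" "z x"] by simp
  moreover have "\<bar>s x\<bar> * norm (R x\<^sub>0) \<le> \<bar>s x\<bar> * C" using R_bound[OF x0_mem] by (intro mult_left_mono) auto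
  ultimately show ?thesis by (simp add: mult.commute)
qed

lemma s_derivative: "(s has_derivative a x\<^sub>0) (at x within S)"
  unfolding s_def[abs_def]
  using has_derivative_diff[OF bounded_linear_imp_has_derivative[OF ell_bounded_linear] has_derivative_const[of "a x\<^sub>0 x\<^sub>0"]]
  by (simp add: linear_diff[OF ell_linear])

lemma z_derivative: "(z has_derivative proj) (at x within S)"
  unfolding z_def[abs_def]
  using has_derivative_diff[OF bounded_linear_imp_has_derivative[OF proj_bounded_linear] has_derivative_const[of "proj x\<^sub>0"]]
  by (simp add: linear_diff[OF bounded_linear.linear[OF proj_bounded_linear]])

lemma norm_sq_derivative:
  "((\<lambda>x. (norm (z x - w) / c)\<^sup>2) has_derivative (\<lambda>v. 2 * ((z x - w) \<bullet> proj v) / c\<^sup>2)) (at x)"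
proof -
  have "((\<lambda>x. (z x - w) \<bullet> (z x - w)) has_derivative (\<lambda>v. (z x - w) \<bullet> proj v + proj v \<bullet> (z x - w))) (at x)"
  proof -
    have D: "((\<lambda>x. z x - w) has_derivative proj) (at x)"
      using has_derivative_diff[OF z_derivative has_derivative_const[of w]] by simp
    show ?thesis by (rule has_derivative_inner[OF D D])
  qed
  then have "((\<lambda>x. (z x - w) \<bullet> (z x - w) / c\<^sup>2) has_derivative (\<lambda>v. ((z x - w) \<bullet> proj v + proj v \<bullet> (z x - w)) / c\<^sup>2)) (at x)"
    by (rule bounded_linear.has_derivative[OF bounded_linear_divide])
  moreover have "(\<lambda>x. (norm (z x - w) / c)\<^sup>2) = (\<lambda>x. (z x - w) \<bullet> (z x - w) / c\<^sup>2)"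
    by (simp only: power_divide power2_norm_eq_inner)
  moreover have "((z x - w) \<bullet> proj v + proj v \<bullet> (z x - w)) / c\<^sup>2 = 2 * ((z x - w) \<bullet> proj v) / c\<^sup>2" for v
    unfolding inner_commute[of "proj v" "z x - w"] by simp
  ultimately show ?thesis by simp
qed

lemma sq_derivative:
  "((\<lambda>x. (s x / \<sigma> + c)\<^sup>2) has_derivative (\<lambda>v. 2 * (s x / \<sigma> + c) * (a x\<^sub>0 v / \<sigma>))) (at x)"
proof -
  have "((\<lambda>x. s x / \<sigma> + c) has_derivative (\<lambda>v. a x\<^sub>0 v / \<sigma>)) (at x)"
    using has_derivative_add[OF bounded_linear.has_derivative[OF bounded_linear_divide s_derivative] has_derivative_const[of c]] by simp
  from has_derivative_power[OF this, of 2] show ?thesis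
    by (rule has_derivative_eq_rhs) (simp add: fun_eq_iff)
qed

lemma Q_derivatives: "(Q1 has_derivative dQ1 x) (at x)" "(Q2 has_derivative dQ2 x) (at x)"
proof -
  show "(Q1 has_derivative dQ1 x) (at x)"
    unfolding Q1_def[abs_def] dQ1_def[abs_def]
    using has_derivative_add[OF sq_derivative[of "- 3"] norm_sq_derivative[of "\<rho> *\<^sub>R e" \<rho>]] by simp
  show "(Q2 has_derivative dQ2 x) (at x)"
    unfolding Q2_def[abs_def] dQ2_def[abs_def]
    using has_derivative_add[OF sq_derivative[of 3] norm_sq_derivative[of 0 d]] by simp
qed

lemma f_derivative: "(f has_derivative df x) (at x)"
proof -
  have flat: "((\<lambda>x. flat (1 - Q x)) has_derivative (\<lambda>v. flat_quot 2 (1 - Q x) * (- D v))) (at x)"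
    if "(Q has_derivative D) (at x)" for Q :: "'e \<Rightarrow> real" and D
  proof -
    have "((\<lambda>x. 1 - Q x) has_derivative (\<lambda>v. - D v)) (at x)"
      using has_derivative_diff[OF has_derivative_const[of 1] that] by simp
    from has_derivative_compose[OF this flat_has_derivative[unfolded has_field_derivative_def]]
    show ?thesis by simp
  qed
  have "(f has_derivative (\<lambda>v. h * (flat_quot 2 (1 - Q1 x) * (- dQ1 x v)) - k * (flat_quot 2 (1 - Q2 x) * (- dQ2 x v)))) (at x)"
    unfolding f_def[abs_def]
    by (intro has_derivative_diff has_derivative_mult_right flat Q_derivatives)
  then show ?thesis
    by (rule has_derivative_eq_rhs) (simp add: fun_eq_iff df_def)
qed

lemma continuous_s: "continuous_on S s"
  by (rule has_derivative_continuous_on[OF s_derivative])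

lemma continuous_z: "continuous_on S z"
  by (rule has_derivative_continuous_on[OF z_derivative])

lemma continuous_Q1: "continuous_on S Q1"
  by (rule has_derivative_continuous_on[OF has_derivative_at_withinI[OF Q_derivatives(1)]])

lemma continuous_Q2: "continuous_on S Q2"
  by (rule has_derivative_continuous_on[OF has_derivative_at_withinI[OF Q_derivatives(2)]])

lemma continuous_f: "continuous_on S f"
  by (rule has_derivative_continuous_on[OF has_derivative_at_withinI[OF f_derivative]])

text \<open>The width \<open>3 / 2 * \<rho>\<close> is the radius \<rho> of the first bump plus the
  distance \<open>\<rho> / 2\<close> of its centre from the axis.\<close>

lemma Q_support1: "Q1 x < 1 \<Longrightarrow> 2 * \<sigma> < s x \<and> s x < 4 * \<sigma> \<and> norm (z x) < 3 / 2 * \<rho>"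
  and Q_support2: "Q2 x < 1 \<Longrightarrow> - 4 * \<sigma> < s x \<and> s x < - 2 * \<sigma> \<and> norm (z x) < d"
proof -
  have sq: "(t - c)\<^sup>2 < 1 \<Longrightarrow> c - 1 < t \<and> t < c + 1" for t c :: real
    using abs_square_less_1[of "t - c"] by auto
  show "2 * \<sigma> < s x \<and> s x < 4 * \<sigma> \<and> norm (z x) < 3 / 2 * \<rho>" if Q: "Q1 x < 1"
  proof -
    have "(s x / \<sigma> - 3)\<^sup>2 < 1" "(norm (z x - \<rho> *\<^sub>R e) / \<rho>)\<^sup>2 < 1"
      using Q unfolding Q1_def by (smt (verit) zero_le_power2)+
    then have 1: "3 - 1 < s x / \<sigma>" "s x / \<sigma> < 3 + 1" and 2: "norm (z x - \<rho> *\<^sub>R e) / \<rho> < 1"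
      using sq[of "s x / \<sigma>" 3] abs_square_less_1[of "norm (z x - \<rho> *\<^sub>R e) / \<rho>"] pos by auto
    have "norm (z x) \<le> norm (z x - \<rho> *\<^sub>R e) + norm (\<rho> *\<^sub>R e)"
      using norm_triangle_ineq[of "z x - \<rho> *\<^sub>R e" "\<rho> *\<^sub>R e"] by simp
    then show ?thesis using 1 2 pos e_norm by (simp add: field_simps)
  qed
  show "- 4 * \<sigma> < s x \<and> s x < - 2 * \<sigma> \<and> norm (z x) < d" if Q: "Q2 x < 1"
  proof -
    have "(s x / \<sigma> - (- 3))\<^sup>2 < 1" "(norm (z x) / d)\<^sup>2 < 1"
      using Q unfolding Q2_def by (simp_all, (smt (verit) zero_le_power2)+)
    then have 1: "- 3 - 1 < s x / \<sigma>" "s x / \<sigma> < - 3 + 1" and 2: "norm (z x) / d < 1"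
      using sq[of "s x / \<sigma>" "- 3"] abs_square_less_1[of "norm (z x) / d"] pos by auto
    then show ?thesis using pos by (simp add: field_simps)
  qed
qed

lemma f_outside: "Q1 x \<ge> 1 \<Longrightarrow> Q2 x \<ge> 1 \<Longrightarrow> f x = 0 \<and> df x v = 0"
  by (simp add: f_def df_def flat_eq_0 flat_quot_eq_0)

lemma Q_nonneg: "Q1 x \<ge> 0" "Q2 x \<ge> 0" by (simp_all add: Q1_def Q2_def)

end

subsection \<open>Crossing times of the perturbed flow\<close>

text \<open>The constant \<open>K\<close> measures how much larger each scale is than the next one: the first bump
  displaces Reeb orbits by about \<open>\<sigma> * h / \<rho>\<close>, which is large compared with the width \<open>d\<close> of the second
  bump and with the drift \<open>\<sigma>\<^sup>2\<close> of the unperturbed orbits, but small compared with the width \<open>\<rho>\<close>.\<close>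

locale bump = bump_setup a da E R x\<^sub>0 r C e \<sigma> \<rho> d h k
  for a :: "'e::euclidean_space \<Rightarrow> 'e \<Rightarrow> real" and da E R x\<^sub>0 r C e \<sigma> \<rho> d h k +
  fixes K :: real and R' :: "'e \<Rightarrow> 'e"
  assumes r_small: "160 * C ^ 3 * r \<le> 1" and \<sigma>_r: "8 * C * \<sigma> \<le> r"
    and scales: "d \<le> \<rho>" "\<rho> \<le> \<sigma>"
    and amplitude: "16 * C ^ 5 * (162 * C\<^sup>2 * (h / \<rho> + k / d) + h + k) \<le> 1 / 80"
    and K: "K \<ge> 10 ^ 10 * C ^ 11"
    and K_d: "K * d \<le> \<sigma> * h / \<rho>" and K_\<sigma>2: "K * \<sigma>\<^sup>2 \<le> \<sigma> * h / \<rho>"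
    and K_\<rho>: "K * (\<sigma> * h / \<rho>) \<le> \<rho>" and K_\<sigma>: "K * \<sigma> \<le> 1"
    and R'_a: "x \<in> cball x\<^sub>0 r \<Longrightarrow> a x (R' x) = 1 / (1 + f x)"
    and R'_E: "x \<in> cball x\<^sub>0 r \<Longrightarrow>
        E x (R' x) v = df x v / (1 + f x)\<^sup>2 - df x (R x) * a x v / (1 + f x)\<^sup>2"
begin

definition \<Delta> :: real where "\<Delta> = \<sigma> * h / \<rho>"

lemma C_pow: "1 \<le> C ^ n" using C by (rule one_le_power)
lemma C_pow_mono: "m \<le> n \<Longrightarrow> C ^ m \<le> C ^ n" using C by (intro power_increasing) auto

lemma K_ge: "n \<le> 11 \<Longrightarrow> 10 ^ 10 * C ^ n \<le> K"
  using order_trans[OF mult_left_mono[OF C_pow_mono[of n 11], of "10 ^ 10"] K] by simp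

lemma \<Delta>_pos: "\<Delta> > 0" using pos by (simp add: \<Delta>_def)

lemma \<sigma>_small: "\<sigma> \<le> 1 / (10 ^ 10 * C)" "\<sigma> \<le> 1" "20 * C * \<sigma> \<le> 1 / 2"
proof -
  have "10 ^ 10 * C * \<sigma> \<le> K * \<sigma>" using K_ge[of 1] pos by (intro mult_right_mono) auto
  then have *: "10 ^ 10 * C * \<sigma> \<le> 1" using K_\<sigma> by linarith
  then show "\<sigma> \<le> 1 / (10 ^ 10 * C)" using C by (simp add: field_simps)
  show "20 * C * \<sigma> \<le> 1 / 2" using * by simp
  have "1 * \<sigma> \<le> C * \<sigma>" using C pos by (intro mult_right_mono) auto
  then show "\<sigma> \<le> 1" using * by simp
qed

lemma \<rho>_le_1: "\<rho> \<le> 1" using scales \<sigma>_small by linarith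

text \<open>\<open>B1\<close> and \<open>B2\<close> bound the norms of the two parts of
  \<open>df\<close> pointwise. The factor \<open>flat_quot 2\<close> is kept, rather than estimated
  by a constant, because the comparison of actions needs a bound whose square is controlled by the
  bump itself.\<close>

definition B1 :: "'e \<Rightarrow> real" where "B1 x = 6 * C\<^sup>2 * h * flat_quot 2 (1 - Q1 x) / \<rho>"
definition B2 :: "'e \<Rightarrow> real" where "B2 x = 6 * C\<^sup>2 * k * flat_quot 2 (1 - Q2 x) / d"

lemma B_nonneg: "B1 x \<ge> 0" "B2 x \<ge> 0"
  using pos C by (simp_all add: B1_def B2_def flat_quot_nonneg)

lemma flat_quot_2_le: "t \<le> 1 \<Longrightarrow> flat_quot 2 t \<le> 27"
  using flat_quot_bound[of t 2] by simp

text \<open>27 = 3^3 bounds \<open>flat_quot 2\<close> for arguments up to 1, and 162 = 6 *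
  27.\<close>

lemma B_le: "B1 x \<le> 162 * C\<^sup>2 * (h / \<rho>)" "B2 x \<le> 162 * C\<^sup>2 * (k / d)"
proof -
  have "6 * C\<^sup>2 * h / \<rho> * flat_quot 2 (1 - Q1 x) \<le> 6 * C\<^sup>2 * h / \<rho> * 27"
    using pos Q_nonneg[of x] by (intro mult_left_mono flat_quot_2_le) auto
  then show "B1 x \<le> 162 * C\<^sup>2 * (h / \<rho>)" by (simp add: B1_def)
  have "6 * C\<^sup>2 * k / d * flat_quot 2 (1 - Q2 x) \<le> 6 * C\<^sup>2 * k / d * 27"
    using pos Q_nonneg[of x] by (intro mult_left_mono flat_quot_2_le) auto
  then show "B2 x \<le> 162 * C\<^sup>2 * (k / d)" by (simp add: B2_def)
qed

lemma dQ_bound_aux: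
  assumes "\<bar>u\<bar> \<le> 1" "norm w \<le> c" "0 < c" "c \<le> \<sigma>"
  shows "\<bar>2 * u * (a x\<^sub>0 v / \<sigma>) + 2 * (w \<bullet> proj v) / c\<^sup>2\<bar> \<le> 6 * C\<^sup>2 / c * norm v"
proof -
  have "\<bar>2 * u * (a x\<^sub>0 v / \<sigma>)\<bar> = 2 * \<bar>u\<bar> * (\<bar>a x\<^sub>0 v\<bar> / \<sigma>)" using pos by (simp add: abs_mult)
  also have "\<dots> \<le> 2 * 1 * (C\<^sup>2 * norm v / c)"
  proof (intro mult_mono divide_mono)
    have "\<bar>a x\<^sub>0 v\<bar> \<le> C * norm v" by (rule ell_bound)
    also have "\<dots> \<le> C\<^sup>2 * norm v" using C by (intro mult_right_mono) (auto simp: power2_eq_square)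
    finally show "\<bar>a x\<^sub>0 v\<bar> \<le> C\<^sup>2 * norm v" .
  qed (use assms pos in auto)
  finally have 1: "\<bar>2 * u * (a x\<^sub>0 v / \<sigma>)\<bar> \<le> 2 * (C\<^sup>2 * norm v / c)" by simp
  have "\<bar>w \<bullet> proj v\<bar> \<le> norm w * norm (proj v)" by (rule Cauchy_Schwarz_ineq2)
  also have "\<dots> \<le> c * (2 * C\<^sup>2 * norm v)" using assms by (intro mult_mono proj_bound) auto
  finally have "\<bar>w \<bullet> proj v\<bar> / c\<^sup>2 \<le> c * (2 * C\<^sup>2 * norm v) / c\<^sup>2" by (rule divide_right_mono) simp
  also have "\<dots> = 2 * (C\<^sup>2 * norm v / c)" using assms by (simp add: power2_eq_square)
  finally have 2: "\<bar>2 * (w \<bullet> proj v) / c\<^sup>2\<bar> \<le> 4 * (C\<^sup>2 * norm v / c)" by (simp add: abs_mult)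
  have "\<bar>2 * u * (a x\<^sub>0 v / \<sigma>) + 2 * (w \<bullet> proj v) / c\<^sup>2\<bar> \<le> 2 * (C\<^sup>2 * norm v / c) + 4 * (C\<^sup>2 * norm v / c)"
    by (rule order_trans[OF abs_triangle_ineq add_mono[OF 1 2]])
  also have "\<dots> = 6 * C\<^sup>2 / c * norm v" by (simp add: field_simps)
  finally show ?thesis .
qed

lemma dQ1_bound:
  assumes "Q1 x \<le> 1"
  shows "\<bar>dQ1 x v\<bar> \<le> 6 * C\<^sup>2 / \<rho> * norm v"
proof -
  have "(s x / \<sigma> - 3)\<^sup>2 \<le> 1" "(norm (z x - \<rho> *\<^sub>R e) / \<rho>)\<^sup>2 \<le> 1"
    using assms zero_le_power2[of "s x / \<sigma> - 3"] zero_le_power2[of "norm (z x - \<rho> *\<^sub>R e) / \<rho>"]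
    unfolding Q1_def by linarith+
  then have "\<bar>s x / \<sigma> - 3\<bar> \<le> 1" "norm (z x - \<rho> *\<^sub>R e) \<le> \<rho>"
    using pos by (simp_all add: abs_square_le_1)
  then show ?thesis unfolding dQ1_def using pos scales by (intro dQ_bound_aux) auto
qed

lemma dQ2_bound:
  assumes "Q2 x \<le> 1"
  shows "\<bar>dQ2 x v\<bar> \<le> 6 * C\<^sup>2 / d * norm v"
proof -
  have "(s x / \<sigma> + 3)\<^sup>2 \<le> 1" "(norm (z x) / d)\<^sup>2 \<le> 1"
    using assms zero_le_power2[of "s x / \<sigma> + 3"] zero_le_power2[of "norm (z x) / d"]
    unfolding Q2_def by linarith+
  then have "\<bar>s x / \<sigma> + 3\<bar> \<le> 1" "norm (z x) \<le> d"
    using pos by (simp_all add: abs_square_le_1)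
  then show ?thesis unfolding dQ2_def using pos scales by (intro dQ_bound_aux) auto
qed

lemma df_bound: "\<bar>df x v\<bar> \<le> (B1 x + B2 x) * norm v"
proof -
  have 1: "\<bar>h * flat_quot 2 (1 - Q1 x) * dQ1 x v\<bar> \<le> B1 x * norm v"
  proof (cases "Q1 x \<le> 1")
    case True
    have "\<bar>h * flat_quot 2 (1 - Q1 x) * dQ1 x v\<bar> = h * flat_quot 2 (1 - Q1 x) * \<bar>dQ1 x v\<bar>"
      using pos flat_quot_nonneg by (simp add: abs_mult)
    also have "\<dots> \<le> h * flat_quot 2 (1 - Q1 x) * (6 * C\<^sup>2 / \<rho> * norm v)"
      using pos flat_quot_nonneg by (intro mult_left_mono dQ1_bound True) auto
    finally show ?thesis by (simp add: B1_def mult_ac)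
  qed (use B_nonneg in \<open>simp add: flat_quot_eq_0\<close>)
  have 2: "\<bar>k * flat_quot 2 (1 - Q2 x) * dQ2 x v\<bar> \<le> B2 x * norm v"
  proof (cases "Q2 x \<le> 1")
    case True
    have "\<bar>k * flat_quot 2 (1 - Q2 x) * dQ2 x v\<bar> = k * flat_quot 2 (1 - Q2 x) * \<bar>dQ2 x v\<bar>"
      using pos flat_quot_nonneg by (simp add: abs_mult)
    also have "\<dots> \<le> k * flat_quot 2 (1 - Q2 x) * (6 * C\<^sup>2 / d * norm v)"
      using pos flat_quot_nonneg by (intro mult_left_mono dQ2_bound True) auto
    finally show ?thesis by (simp add: B2_def mult_ac)
  qed (use B_nonneg in \<open>simp add: flat_quot_eq_0\<close>)
  show ?thesis
    unfolding df_def distrib_right using 1 2 by linarith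
qed

lemma f_bound: "\<bar>f x\<bar> \<le> h + k"
proof -
  have "h * flat (1 - Q1 x) \<le> h" "0 \<le> h * flat (1 - Q1 x)" "k * flat (1 - Q2 x) \<le> k" "0 \<le> k * flat (1 - Q2 x)"
    using pos flat_le_1 flat_nonneg by (simp_all add: mult_left_le)
  then show ?thesis unfolding f_def by linarith
qed

lemma hk_small: "h + k \<le> 1 / 2"
proof -
  have "h + k \<le> 162 * C\<^sup>2 * (h / \<rho> + k / d) + h + k" using pos by simp
  also have "\<dots> \<le> 16 * C ^ 5 * (162 * C\<^sup>2 * (h / \<rho> + k / d) + h + k)"
  proof -
    have "1 \<le> 16 * C ^ 5" using C_pow[of 5] by linarith
    moreover have "0 \<le> 162 * C\<^sup>2 * (h / \<rho> + k / d) + h + k" using pos by (intro add_nonneg_nonneg mult_nonneg_nonneg) auto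
    ultimately show ?thesis using mult_right_mono by fastforce
  qed
  finally show ?thesis using amplitude by linarith
qed

lemma g_bounds: "1 / 2 \<le> 1 + f x" "1 + f x \<le> 3 / 2"
  using f_bound[of x] hk_small by linarith+

text \<open>Coercivity reduces the claim to quantities known for both fields: their contractions
  with \<open>E\<close>, given by \<open>df\<close> and by 0, and the values of \<open>a\<close> on
  them, \<open>1 / (1 + f)\<close> and 1. The factor 8 is 2 times the bound 4 for
  \<open>1 / (1 + f)\<^sup>2\<close>.\<close>

lemma R'_diff:
  assumes x: "x \<in> cball x\<^sub>0 r"
  shows "norm (R' x - R x) \<le> 8 * C ^ 3 * (B1 x + B2 x + \<bar>f x\<bar>)"
proof -
  define g where "g = 1 + f x"
  have g: "1 / 2 \<le> g" using g_bounds by (simp add: g_def)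
  define B where "B = B1 x + B2 x"
  have B: "B \<ge> 0" "\<And>v. \<bar>df x v\<bar> \<le> B * norm v" using B_nonneg df_bound by (auto simp: B_def)
  have g2: "1 / 4 \<le> g\<^sup>2" using mult_mono[of "1/2" g "1/2" g] g by (simp add: power2_eq_square)
  have C2: "1 \<le> C\<^sup>2" by (rule C_pow)
  have "norm (R' x - R x) \<le> C * (8 * C\<^sup>2 * B + 2 * C * \<bar>f x\<bar>)"
  proof (rule E_a_coercive[OF x])
    fix v
    interpret l: linear "\<lambda>u. E x u v" using E_bilinear[OF x] by (simp add: bilinear_def)
    interpret a: linear "a x" by (rule a_linear[OF x])
    have "\<bar>df x (R x)\<bar> \<le> B * C"
      using B(2)[of "R x"] mult_left_mono[OF R_bound[OF x] B(1)] by linarith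
    then have "\<bar>df x (R x)\<bar> * \<bar>a x v\<bar> \<le> (B * C) * (C * norm v)"
      using a_bound[OF x, of v] B(1) C by (intro mult_mono) auto
    then have "\<bar>df x v - df x (R x) * a x v\<bar> \<le> B * norm v + C\<^sup>2 * B * norm v"
      using B(2)[of v] abs_triangle_ineq4[of "df x v" "df x (R x) * a x v"]
      by (simp add: abs_mult power2_eq_square mult_ac)
    also have "\<dots> \<le> 2 * C\<^sup>2 * B * norm v"
      using C2 B(1) mult_right_mono[of 1 "C\<^sup>2" "B * norm v"] by (simp add: mult_ac)
    finally have "\<bar>df x v - df x (R x) * a x v\<bar> / g\<^sup>2 \<le> 2 * C\<^sup>2 * B * norm v / (1 / 4)"
      using g2 B(1) by (intro frac_le) auto
    moreover have "E x (R' x - R x) v = (df x v - df x (R x) * a x v) / g\<^sup>2"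
      by (simp add: l.diff R'_E[OF x] E_R[OF x] diff_divide_distrib g_def)
    ultimately have 1: "\<bar>E x (R' x - R x) v\<bar> \<le> 8 * C\<^sup>2 * B * norm v" using g2 by (simp add: abs_divide)
    have "a x (R' x - R x) = - f x / g"
      using g by (simp add: a.diff R'_a[OF x] a_R[OF x] g_def field_simps)
    moreover have "\<bar>f x\<bar> / g \<le> \<bar>f x\<bar> / (1 / 2)" using g by (intro frac_le) auto
    ultimately have "\<bar>a x (R' x - R x)\<bar> \<le> 2 * \<bar>f x\<bar>" using g by (simp add: abs_divide)
    then have "\<bar>a x (R' x - R x) * a x v\<bar> \<le> 2 * \<bar>f x\<bar> * (C * norm v)"
      unfolding abs_mult using a_bound[OF x, of v] by (intro mult_mono) auto
    then show "\<bar>E x (R' x - R x) v + a x (R' x - R x) * a x v\<bar> \<le> (8 * C\<^sup>2 * B + 2 * C * \<bar>f x\<bar>) * norm v"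
      using order_trans[OF abs_triangle_ineq add_mono[OF 1]] unfolding distrib_right by (simp only: mult.assoc mult.left_commute)
  qed
  also have "\<dots> \<le> 8 * C ^ 3 * (B + \<bar>f x\<bar>)"
  proof -
    have "C\<^sup>2 * \<bar>f x\<bar> \<le> C ^ 3 * (4 * \<bar>f x\<bar>)" using C by (intro mult_mono C_pow_mono) auto
    then show ?thesis by (simp add: algebra_simps power2_eq_square power3_eq_cube)
  qed
  finally show ?thesis by (simp add: B_def)
qed

section \<open>Estimates shared by the original and the perturbed Reeb field\<close>

definition near :: "('e \<Rightarrow> 'e) \<Rightarrow> bool" where
  "near X \<longleftrightarrow> (\<forall>x\<in>cball x\<^sub>0 r. norm (X x - R x) \<le> 1 / (160 * C\<^sup>2))"

lemma near_R: "near R" using C by (simp add: near_def)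

lemma near_R': "near R'"
  unfolding near_def
proof
  fix x assume x: "x \<in> cball x\<^sub>0 r"
  have "B1 x + B2 x + \<bar>f x\<bar> \<le> 162 * C\<^sup>2 * (h / \<rho> + k / d) + h + k"
    using B_le[of x] f_bound[of x] by (simp add: distrib_left)
  then have "8 * C ^ 3 * (B1 x + B2 x + \<bar>f x\<bar>) \<le> 8 * C ^ 3 * (162 * C\<^sup>2 * (h / \<rho> + k / d) + h + k)"
    using C by (intro mult_left_mono) auto
  also have "\<dots> = 16 * C ^ 5 * (162 * C\<^sup>2 * (h / \<rho> + k / d) + h + k) / (2 * C\<^sup>2)"
    using C by (simp add: field_simps power_numeral_reduce)
  also have "\<dots> \<le> (1 / 80) / (2 * C\<^sup>2)" using amplitude by (intro divide_right_mono) auto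
  finally show "norm (R' x - R x) \<le> 1 / (160 * C\<^sup>2)" using R'_diff[OF x] by simp
qed

text \<open>The deviation of \<open>X\<close> from \<open>R\<close> and, by \<open>r_small\<close>,
  that of \<open>R\<close> from its value at the centre are each at most
  \<open>1 / (160 * C\<^sup>2)\<close>. Their sum \<open>1 / (80 * C\<^sup>2)\<close> becomes 1 / 40
  under the projection, whose norm is at most \<open>2 * C\<^sup>2\<close>.\<close>

lemma near_bounds:
  assumes X: "near X" and x: "x \<in> cball x\<^sub>0 r"
  shows "1 / 2 \<le> a x\<^sub>0 (X x)" "a x\<^sub>0 (X x) \<le> 3 / 2" "norm (proj (X x)) \<le> 1 / 40" "norm (X x) \<le> 2 * C"
proof -
  have C2: "C\<^sup>2 > 0" using C by simp
  have "C * norm (x - x\<^sub>0) \<le> C * r" using x C by (intro mult_left_mono) (auto simp: dist_norm norm_minus_commute)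
  also have "C * r \<le> 1 / (160 * C\<^sup>2)" using r_small C by (simp add: field_simps power2_eq_square power3_eq_cube)
  finally have "norm (R x - R x\<^sub>0) \<le> 1 / (160 * C\<^sup>2)" using R_lipschitz[OF x x0_mem] by linarith
  moreover have "norm (X x - R x) \<le> 1 / (160 * C\<^sup>2)" using X x by (simp add: near_def)
  ultimately have D: "norm (X x - R x\<^sub>0) \<le> 1 / (80 * C\<^sup>2)"
    using norm_triangle_ineq[of "X x - R x" "R x - R x\<^sub>0"] by (simp add: field_simps)
  have "\<bar>a x\<^sub>0 (X x - R x\<^sub>0)\<bar> \<le> C * (1 / (80 * C\<^sup>2))"
    using ell_bound[of "X x - R x\<^sub>0"] mult_left_mono[OF D, of C] C by linarith
  also have "\<dots> \<le> 1 / 2" using C by (simp add: field_simps power2_eq_square)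
  finally have "\<bar>a x\<^sub>0 (X x) - 1\<bar> \<le> 1 / 2" by (simp add: linear_diff[OF ell_linear] ell_R)
  then show "1 / 2 \<le> a x\<^sub>0 (X x)" "a x\<^sub>0 (X x) \<le> 3 / 2" by linarith+
  have "norm (proj (X x - R x\<^sub>0)) \<le> 2 * C\<^sup>2 * (1 / (80 * C\<^sup>2))"
    by (rule order_trans[OF proj_bound mult_left_mono[OF D]]) simp
  also have "\<dots> = 1 / 40" using C2 by simp
  finally show "norm (proj (X x)) \<le> 1 / 40"
    by (simp add: linear_diff[OF bounded_linear.linear[OF proj_bounded_linear]] proj_R0)
  have "1 \<le> 160 * C\<^sup>2" using C_pow[of 2] by linarith
  then have "1 / (160 * C\<^sup>2) \<le> 1" using frac_le[of 1 1 1 "160 * C\<^sup>2"] by simp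
  then have "norm (X x - R x) \<le> 1" using X x unfolding near_def by (meson order_trans)
  then show "norm (X x) \<le> 2 * C" using R_bound[OF x] C norm_triangle_ineq[of "X x - R x" "R x"] by simp
qed

definition curve :: "('e \<Rightarrow> 'e) \<Rightarrow> real \<Rightarrow> real \<Rightarrow> (real \<Rightarrow> 'e) \<Rightarrow> bool" where
  "curve X u v y \<longleftrightarrow> (\<forall>t\<in>{u..v}. y t \<in> cball x\<^sub>0 r \<and> (y has_vector_derivative X (y t)) (at t within {u..v}))"

lemma curveD:
  assumes "curve X u v y" "t \<in> {u..v}"
  shows "y t \<in> cball x\<^sub>0 r" "(y has_vector_derivative X (y t)) (at t within {u..v})"
  using assms by (auto simp: curve_def)

lemma curve_sub:
  assumes "curve X u v y" "u \<le> u'" "v' \<le> v"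
  shows "curve X u' v' y"
  unfolding curve_def
proof
  fix t assume "t \<in> {u'..v'}"
  then have "t \<in> {u..v}" using assms by auto
  then show "y t \<in> cball x\<^sub>0 r \<and> (y has_vector_derivative X (y t)) (at t within {u'..v'})"
    using curveD[OF assms(1), of t] assms
    by (auto intro: has_vector_derivative_within_subset[of y _ t "{u..v}" "{u'..v'}"])
qed

lemma curve_linear:
  assumes "curve X u v y" "t \<in> {u..v}" "bounded_linear L"
  shows "((\<lambda>t. L (y t - x\<^sub>0)) has_vector_derivative L (X (y t))) (at t within {u..v})"
proof -
  have "((\<lambda>t. y t - x\<^sub>0) has_vector_derivative X (y t)) (at t within {u..v})"
    using has_vector_derivative_diff[OF curveD(2)[OF assms(1,2)] has_vector_derivative_const[of x\<^sub>0]] by simp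
  then show ?thesis by (rule bounded_linear.has_vector_derivative[OF assms(3)])
qed

lemma curve_continuous: "curve X u v y \<Longrightarrow> continuous_on {u..v} y"
  by (rule has_vector_derivative_continuous_on'[OF curveD(2)])

text \<open>\<open>s\<close> serves as a clock for both fields: it runs at a speed between 1 / 2 and
  3 / 2.\<close>

lemma curve_s:
  assumes X: "near X" and y: "curve X u v y" and uv: "u \<le> v"
  shows "(v - u) / 2 \<le> s (y v) - s (y u)" "s (y v) - s (y u) \<le> 3 / 2 * (v - u)"
proof -
  have der: "((\<lambda>t. s (y t)) has_vector_derivative a x\<^sub>0 (X (y t))) (at t within {u..v})" if "t \<in> {u..v}" for t
    unfolding s_def by (rule curve_linear[OF y that ell_bounded_linear])
  have "1 / 2 * (v - u) \<le> s (y v) - s (y u)"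
    by (rule growth_lower[OF uv der near_bounds(1)[OF X curveD(1)[OF y]]])
  then show "(v - u) / 2 \<le> s (y v) - s (y u)" by simp
  have "- (3 / 2) * (v - u) \<le> - s (y v) - - s (y u)"
    by (rule growth_lower[OF uv has_vector_derivative_minus[OF der]])
      (use near_bounds(2)[OF X curveD(1)[OF y]] in auto)
  then show "s (y v) - s (y u) \<le> 3 / 2 * (v - u)" by linarith
qed

lemma curve_s_mono:
  assumes X: "near X" and y: "curve X u v y" and t: "t \<in> {u..v}"
  shows "s (y u) \<le> s (y t)" "s (y t) \<le> s (y v)"
proof -
  show "s (y u) \<le> s (y t)"
    using curve_s(1)[OF X curve_sub[OF y, of u t]] t by auto
  show "s (y t) \<le> s (y v)"
    using curve_s(1)[OF X curve_sub[OF y, of t v]] t by auto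
qed

lemma curve_z:
  assumes y: "curve X u v y" and uv: "u \<le> v" and B: "\<And>t. t \<in> {u..v} \<Longrightarrow> norm (proj (X (y t))) \<le> B"
  shows "norm (z (y v) - z (y u)) \<le> B * (v - u)"
proof -
  have der: "((\<lambda>t. z (y t)) has_vector_derivative proj (X (y t))) (at t within {u..v})" if "t \<in> {u..v}" for t
    unfolding z_def by (rule curve_linear[OF y that proj_bounded_linear])
  have "norm (z (y v) - z (y u)) \<le> B * \<bar>v - u\<bar>"
    by (rule vector_derivative_bound[of "{u..v}", OF _ der B]) (use uv in auto)
  then show ?thesis using uv by simp
qed

lemma in_box_close: "\<bar>s x\<bar> \<le> 5 * \<sigma> \<Longrightarrow> norm (z x) \<le> 3 * \<sigma> \<Longrightarrow> norm (x - x\<^sub>0) \<le> 8 * C * \<sigma>"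
proof -
  assume "\<bar>s x\<bar> \<le> 5 * \<sigma>" "norm (z x) \<le> 3 * \<sigma>"
  then have "norm (x - x\<^sub>0) \<le> C * (5 * \<sigma>) + 3 * \<sigma>"
    using dist_x0[of x] mult_left_mono[of "\<bar>s x\<bar>" "5 * \<sigma>" C] C by linarith
  moreover have "1 * (3 * \<sigma>) \<le> C * (3 * \<sigma>)" using C pos by (intro mult_right_mono) auto
  ultimately show ?thesis by simp
qed

text \<open>The Reeb vector at the centre has no transversal part, so by Lipschitz continuity the
  transversal speed in the box is of order \<sigma>. Over a crossing time of order \<sigma> this
  gives a drift of order \<open>\<sigma>\<^sup>2\<close>.\<close>

lemma proj_R:
  assumes x: "x \<in> cball x\<^sub>0 r" "norm (x - x\<^sub>0) \<le> 8 * C * \<sigma>"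
  shows "norm (proj (R x)) \<le> 16 * C ^ 4 * \<sigma>"
proof -
  have "norm (R x - R x\<^sub>0) \<le> C * (8 * C * \<sigma>)"
    using R_lipschitz[OF x(1) x0_mem] mult_left_mono[OF x(2), of C] C by linarith
  then have "norm (proj (R x - R x\<^sub>0)) \<le> 2 * C\<^sup>2 * (C * (8 * C * \<sigma>))"
    using proj_bound[of "R x - R x\<^sub>0"] mult_left_mono[of "norm (R x - R x\<^sub>0)" _ "2 * C\<^sup>2"] by fastforce
  then show ?thesis
    by (simp add: linear_diff[OF bounded_linear.linear[OF proj_bounded_linear]] proj_R0 power_numeral_reduce)
qed

lemma proj_R':
  assumes x: "x \<in> cball x\<^sub>0 r" "norm (x - x\<^sub>0) \<le> 8 * C * \<sigma>" and M: "B1 x + B2 x + \<bar>f x\<bar> \<le> M"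
  shows "norm (proj (R' x)) \<le> 16 * C ^ 4 * \<sigma> + 16 * C ^ 5 * M"
proof -
  have "norm (proj (R' x - R x)) \<le> 2 * C\<^sup>2 * (8 * C ^ 3 * M)"
  proof (rule order_trans[OF proj_bound mult_left_mono])
    show "norm (R' x - R x) \<le> 8 * C ^ 3 * M"
      by (rule order_trans[OF R'_diff[OF x(1)] mult_left_mono[OF M]]) (use C in auto)
  qed simp
  then have "norm (proj (R' x - R x)) \<le> 16 * C ^ 5 * M" by (simp add: power_numeral_reduce)
  moreover have "proj (R' x) = proj (R' x - R x) + proj (R x)"
    by (simp add: linear_diff[OF bounded_linear.linear[OF proj_bounded_linear]])
  ultimately show ?thesis
    using proj_R[OF x] norm_triangle_ineq[of "proj (R' x - R x)" "proj (R x)"] by simp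
qed

text \<open>\<open>s\<close> grows by \<open>10 * \<sigma>\<close> at a speed of at least 1 / 2,
  hence the time \<open>20 * \<sigma>\<close>; and the whole box lies within
  \<open>8 * C * \<sigma>\<close> of the centre.\<close>

lemma curve_box:
  assumes X: "near X" and y: "curve X 0 \<tau> y" and \<tau>: "\<tau> \<ge> 0"
    and ends: "s (y 0) = - 5 * \<sigma>" "s (y \<tau>) = 5 * \<sigma>" and zb: "\<forall>t\<in>{0..\<tau>}. norm (z (y t)) \<le> 3 * \<sigma>"
  shows "\<tau> \<le> 20 * \<sigma>" "\<tau> > 0" "t \<in> {0..\<tau>} \<Longrightarrow> norm (y t - x\<^sub>0) \<le> 8 * C * \<sigma>"
proof -
  show "\<tau> \<le> 20 * \<sigma>" "\<tau> > 0" using curve_s[OF X y \<tau>] ends pos by auto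
  show "norm (y t - x\<^sub>0) \<le> 8 * C * \<sigma>" if "t \<in> {0..\<tau>}"
    using curve_s_mono[OF X y that] ends zb[rule_format, OF that] by (intro in_box_close) auto
qed

section \<open>Sideways displacement of orbits that meet the second bump\<close>

lemma R'_eq_R:
  assumes "x \<in> cball x\<^sub>0 r" "Q1 x \<ge> 1" "Q2 x \<ge> 1"
  shows "R' x = R x"
  using R'_diff[OF assms(1)] f_outside[OF assms(2,3)] assms(2,3)
  by (simp add: B1_def B2_def flat_quot_eq_0)

lemma Q2_eq_1: "Q2 x = 1 \<Longrightarrow> s x \<le> - 2 * \<sigma> \<and> norm (z x) \<le> d"
proof -
  assume Q: "Q2 x = 1"
  have "(s x / \<sigma> + 3)\<^sup>2 \<le> 1" "(norm (z x) / d)\<^sup>2 \<le> 1"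
    using Q zero_le_power2[of "s x / \<sigma> + 3"] zero_le_power2[of "norm (z x) / d"]
    unfolding Q2_def by linarith+
  then have "\<bar>s x / \<sigma> + 3\<bar> \<le> 1" "norm (z x) \<le> d" using pos by (simp_all add: abs_square_le_1)
  then show ?thesis using pos by (auto simp: field_simps abs_le_iff)
qed

lemma Q1_ge_1: "s x \<le> 2 * \<sigma> \<Longrightarrow> Q1 x \<ge> 1"
  using Q_support1[of x] by linarith

lemma Q2_ge_1: "s x \<ge> - 2 * \<sigma> \<or> s x \<le> - 4 * \<sigma> \<Longrightarrow> Q2 x \<ge> 1"
  using Q_support2[of x] by linarith

lemma R_drift:
  assumes y: "curve X u v y" and uv: "0 \<le> u" "u \<le> v" "v \<le> 20 * \<sigma>"
    and R: "\<And>t. t \<in> {u..v} \<Longrightarrow> X (y t) = R (y t) \<and> norm (y t - x\<^sub>0) \<le> 8 * C * \<sigma>"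
  shows "norm (z (y v) - z (y u)) \<le> 320 * C ^ 4 * \<sigma>\<^sup>2"
proof -
  have "norm (z (y v) - z (y u)) \<le> 16 * C ^ 4 * \<sigma> * (v - u)"
    by (rule curve_z[OF y uv(2)]) (use R proj_R[OF curveD(1)[OF y]] in auto)
  also have "\<dots> \<le> 16 * C ^ 4 * \<sigma> * (20 * \<sigma>)" using uv pos by (intro mult_left_mono) auto
  finally show ?thesis by (simp add: power2_eq_square mult_ac)
qed

text \<open>\<open>E\<close> is frozen at the centre in order to have the derivative of an affine
  function of the point, \<open>m\<close> below. Freezing costs the term
  \<open>8 * C ^ 3 * \<sigma>\<close>. The other error contains \<open>a x e\<close>, which is of
  order \<sigma> because \<open>e\<close> is in the kernel at the centre; 2592 = 162 * 4 *
  4.\<close>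

lemma E0_rate:
  assumes x: "x \<in> cball x\<^sub>0 r" "norm (x - x\<^sub>0) \<le> 8 * C * \<sigma>" and Q2: "Q2 x \<ge> 1"
  shows "df x e / (1 + f x)\<^sup>2 - (8 * C ^ 3 * \<sigma> + 2592 * C ^ 5 * \<Delta>) \<le> E x\<^sub>0 (R' x) e"
proof -
  define g where "g = 1 + f x"
  have g: "1 / 2 \<le> g" using g_bounds by (simp add: g_def)
  have g2: "1 / 4 \<le> g\<^sup>2" using mult_mono[of "1/2" g "1/2" g] g by (simp add: power2_eq_square)
  have "\<bar>E x\<^sub>0 (R' x) e - E x (R' x) e\<bar> \<le> C * norm (x\<^sub>0 - x) * norm (R' x) * norm e"
    by (rule E_lipschitz[OF x0_mem x(1)])
  also have "\<dots> \<le> C * (8 * C * \<sigma>) * (2 * C) * (1 / 2)"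
    using x(2) near_bounds(4)[OF near_R' x(1)] C pos e_norm
    by (intro mult_mono) (auto simp: norm_minus_commute)
  also have "\<dots> = 8 * C ^ 3 * \<sigma>" by (simp add: power3_eq_cube)
  finally have 1: "\<bar>E x\<^sub>0 (R' x) e - E x (R' x) e\<bar> \<le> 8 * C ^ 3 * \<sigma>" .
  have "\<bar>a x e - a x\<^sub>0 e\<bar> \<le> C * norm (x - x\<^sub>0) * norm e" by (rule a_lipschitz[OF x(1) x0_mem])
  also have "\<dots> \<le> C * (8 * C * \<sigma>) * (1 / 2)" using x(2) C e_norm pos by (intro mult_mono) auto
  finally have ae: "\<bar>a x e\<bar> \<le> 4 * C\<^sup>2 * \<sigma>" by (simp add: e_kernel power2_eq_square)
  have "B2 x = 0" using Q2 by (simp add: B2_def flat_quot_eq_0)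
  then have "\<bar>df x (R x)\<bar> \<le> 162 * C\<^sup>2 * (h / \<rho>) * C"
    using df_bound[of x "R x"] mult_mono[OF B_le(1)[of x] R_bound[OF x(1)]] B_nonneg[of x] pos by auto
  then have "\<bar>df x (R x)\<bar> * \<bar>a x e\<bar> \<le> (162 * C\<^sup>2 * (h / \<rho>) * C) * (4 * C\<^sup>2 * \<sigma>)"
    using ae C pos by (intro mult_mono) auto
  then have "\<bar>df x (R x) * a x e\<bar> / g\<^sup>2 \<le> ((162 * C\<^sup>2 * (h / \<rho>) * C) * (4 * C\<^sup>2 * \<sigma>)) / (1 / 4)"
    using g2 C pos by (intro frac_le) (auto simp: abs_mult)
  also have "\<dots> = 2592 * C ^ 5 * \<Delta>" by (simp add: \<Delta>_def power_numeral_reduce field_simps)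
  finally have 2: "\<bar>df x (R x) * a x e / g\<^sup>2\<bar> \<le> 2592 * C ^ 5 * \<Delta>" using g2 by (simp add: abs_divide)
  have "E x (R' x) e = df x e / g\<^sup>2 - df x (R x) * a x e / g\<^sup>2" using R'_E[OF x(1)] by (simp add: g_def)
  then show ?thesis using 1 2 unfolding g_def[symmetric] by linarith
qed

text \<open>Within \<open>\<rho> / 8\<close> of the axis the centre of the first bump is still ahead
  in the direction \<open>e\<close>: as \<open>e \<bullet> e = 1 / 4\<close>, its component exceeds
  that of \<open>z x\<close> by at least
  \<open>\<rho> / 4 - \<rho> / 16 = 3 / 16 * \<rho>\<close>.\<close>

lemma df_e:
  assumes "Q2 x \<ge> 1" "norm (z x) \<le> \<rho> / 8"
  shows "3 / 8 * (h / \<rho>) * flat_quot 2 (1 - Q1 x) \<le> df x e"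
proof -
  define q where "q = flat_quot 2 (1 - Q1 x)"
  have q: "q \<ge> 0" by (simp add: q_def flat_quot_nonneg)
  have "\<bar>z x \<bullet> e\<bar> \<le> norm (z x) * norm e" by (rule Cauchy_Schwarz_ineq2)
  then have ze: "z x \<bullet> e \<le> \<rho> / 16" using assms(2) e_norm by simp
  have "e \<bullet> e = 1 / 4" by (simp add: e_norm power2_eq_square flip: power2_norm_eq_inner)
  then have dQ: "dQ1 x e = 2 * (z x \<bullet> e - \<rho> / 4) / \<rho>\<^sup>2"
    by (simp add: dQ1_def e_kernel proj_e inner_diff_left)
  have "df x e = - (h * q * dQ1 x e)" using assms(1) by (simp add: df_def flat_quot_eq_0 q_def)
  then have "df x e = 2 * h * q * (\<rho> / 4 - z x \<bullet> e) / \<rho>\<^sup>2"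
    unfolding dQ using pos by (simp add: field_simps)
  moreover have "2 * h * q * (3 / 16 * \<rho>) / \<rho>\<^sup>2 \<le> 2 * h * q * (\<rho> / 4 - z x \<bullet> e) / \<rho>\<^sup>2"
    using ze q pos by (intro divide_right_mono mult_left_mono) auto
  moreover have "2 * h * q * (3 / 16 * \<rho>) / \<rho>\<^sup>2 = 3 / 8 * (h / \<rho>) * q" using pos by (simp add: power2_eq_square)
  ultimately show ?thesis by (simp add: q_def)
qed

text \<open>Here \<open>Q1\<close> is at most 1 / 4 + 25 / 64 = 41 / 64, so the argument of the bump
  is at least 1 / 4; the constant 81 = 3^4 comes from \<open>exp 1 \<le> 3\<close>.\<close>

lemma flat_middle:
  assumes "5 / 2 * \<sigma> \<le> s x" "s x \<le> 7 / 2 * \<sigma>" "norm (z x) \<le> \<rho> / 8"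
  shows "1 / 81 \<le> flat_quot 2 (1 - Q1 x)"
proof -
  have "5 / 2 \<le> s x / \<sigma>" "s x / \<sigma> \<le> 7 / 2" using assms pos by (simp_all add: field_simps)
  then have "\<bar>s x / \<sigma> - 3\<bar> \<le> 1 / 2" by linarith
  then have 1: "(s x / \<sigma> - 3)\<^sup>2 \<le> (1 / 2)\<^sup>2" by (subst abs_le_square_iff[symmetric]) simp
  have "norm (z x - \<rho> *\<^sub>R e) \<le> norm (z x) + norm (\<rho> *\<^sub>R e)" by (rule norm_triangle_ineq4)
  also have "norm (\<rho> *\<^sub>R e) = \<rho> / 2" using e_norm pos by (simp only: norm_scaleR)
  also have "norm (z x) + \<rho> / 2 \<le> \<rho> / 8 + \<rho> / 2" using assms(3) by simp
  finally have "norm (z x - \<rho> *\<^sub>R e) / \<rho> \<le> 5 / 8" using pos by (simp add: field_simps)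
  then have "(norm (z x - \<rho> *\<^sub>R e) / \<rho>)\<^sup>2 \<le> (5 / 8)\<^sup>2" using pos by (intro power_mono) auto
  then have "Q1 x \<le> 41 / 64" using 1 unfolding Q1_def by (simp only: power_divide) simp
  then have "exp (- 4) \<le> flat_quot 2 (1 - Q1 x)" using Q_nonneg[of x] by (intro flat_quot_2_lower) auto
  moreover have "exp 1 ^ 4 \<le> (3 :: real) ^ 4" using exp_le by (intro power_mono) auto
  then have "exp 4 \<le> (81 :: real)" by (simp flip: exp_of_nat_mult)
  then have "1 / 81 \<le> exp (- 4 :: real)" by (simp add: exp_minus field_simps)
  ultimately show ?thesis by linarith
qed

lemma scale_facts:
  "10000000000 * (C * d) \<le> \<Delta>" "10000000000 * (C ^ 5 * \<sigma>\<^sup>2) \<le> \<Delta>" "10000000000 * (C ^ 11 * \<Delta>) \<le> \<rho>" "10000000000 * (C ^ 5 * \<sigma>) \<le> 1"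
proof -
  have "(10 ^ 10 * C ^ 1) * d \<le> K * d" "(10 ^ 10 * C ^ 5) * \<sigma>\<^sup>2 \<le> K * \<sigma>\<^sup>2"
    "(10 ^ 10 * C ^ 11) * \<Delta> \<le> K * \<Delta>" "(10 ^ 10 * C ^ 5) * \<sigma> \<le> K * \<sigma>"
    using pos \<Delta>_pos by (intro mult_right_mono K_ge; simp)+
  then show "10000000000 * (C * d) \<le> \<Delta>" "10000000000 * (C ^ 5 * \<sigma>\<^sup>2) \<le> \<Delta>" "10000000000 * (C ^ 11 * \<Delta>) \<le> \<rho>" "10000000000 * (C ^ 5 * \<sigma>) \<le> 1"
    using K_d K_\<sigma>2 K_\<rho> K_\<sigma> unfolding \<Delta>_def[symmetric] by (simp_all add: mult.assoc)
qed

text \<open>By the equation for the Reeb field, \<open>m\<close> grows along perturbed orbits at the rate of the derivative of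
  \<open>f\<close> in the direction \<open>e\<close>, and it is nearly constant along unperturbed ones.\<close>

definition m :: "'e \<Rightarrow> real" where "m x = E x\<^sub>0 (x - x\<^sub>0) e"

lemma E0_bounded_linear: "bounded_linear (\<lambda>u. E x\<^sub>0 u e)"
  using E_bilinear[OF x0_mem] by (simp add: bilinear_def linear_conv_bounded_linear)

lemma m_bound: "\<bar>m x\<bar> \<le> C / 2 * norm (z x)"
proof -
  interpret linear "\<lambda>u. E x\<^sub>0 u e" using bounded_linear.linear[OF E0_bounded_linear] .
  have "m x = E x\<^sub>0 (z x) e" unfolding m_def decompose[of x] by (simp add: add scaleR E_R[OF x0_mem])
  then show ?thesis using E_bound[OF x0_mem, of "z x" e] by (simp add: e_norm)
qed

text \<open>Up to the first contact with the second bump the orbit follows the original field, which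
  bounds its distance from the axis at the entrance. After the last contact only the first bump
  acts, and the value of \<open>m\<close> at the exit records its push, up to the contribution of
  the position at the last contact and the error rate \<eta>.\<close>

lemma displacement:
  assumes y: "curve R' 0 \<tau> y" and \<tau>: "\<tau> \<ge> 0"
    and ends: "s (y 0) = - 5 * \<sigma>" "s (y \<tau>) = 5 * \<sigma>" and zb: "\<forall>t\<in>{0..\<tau>}. norm (z (y t)) \<le> 3 * \<sigma>"
    and touch: "tt \<in> {0..\<tau>}" "Q2 (y tt) \<le> 1"
  shows "norm (z (y 0)) \<le> d + 320 * C ^ 4 * \<sigma>\<^sup>2"
    and "\<Delta> / 729 \<le> m (y \<tau>) + C / 2 * d + 20 * \<sigma> * (8 * C ^ 3 * \<sigma> + 2592 * C ^ 5 * \<Delta>)"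
proof -
  note box = curve_box[OF near_R' y \<tau> ends zb]
  have cy: "continuous_on {0..\<tau>} (\<lambda>t. Q2 (y t))"
    by (rule continuous_on_compose2[OF continuous_Q2[of UNIV] curve_continuous[OF y]]) auto
  have cs: "continuous_on {0..\<tau>} (\<lambda>t. s (y t))"
    by (rule continuous_on_compose2[OF continuous_s[of UNIV] curve_continuous[OF y]]) auto
  have in_ball: "y t \<in> cball x\<^sub>0 r" if "t \<in> {0..\<tau>}" for t using curveD(1)[OF y that] .
  have "\<exists>t\<in>{0..tt}. Q2 (y t) = 1 \<and> (\<forall>u\<in>{0..t}. Q2 (y u) \<ge> 1)"
    using touch ends pos
    by (intro first_hit continuous_on_subset[OF cy] Q2_ge_1) auto
  then obtain t1 where t1: "t1 \<in> {0..tt}" "Q2 (y t1) = 1" "\<And>u. u \<in> {0..t1} \<Longrightarrow> Q2 (y u) \<ge> 1" by blast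
  have y1: "curve R' 0 t1 y" using curve_sub[OF y, of 0 t1] t1 touch by auto
  have "norm (z (y t1) - z (y 0)) \<le> 320 * C ^ 4 * \<sigma>\<^sup>2"
  proof (rule R_drift[OF y1])
    fix t assume t: "t \<in> {0..t1}"
    then have t': "t \<in> {0..\<tau>}" using t1 touch by auto
    have "s (y t) \<le> - 2 * \<sigma>" using curve_s_mono(2)[OF near_R' y1 t] Q2_eq_1[OF t1(2)] by simp
    then have "Q1 (y t) \<ge> 1" using pos by (intro Q1_ge_1) auto
    then show "R' (y t) = R (y t) \<and> norm (y t - x\<^sub>0) \<le> 8 * C * \<sigma>"
      using R'_eq_R[OF in_ball[OF t'] _ t1(3)[OF t]] box(3)[OF t'] by simp
  qed (use t1 touch box in auto)
  moreover have "norm (z (y 0)) \<le> norm (z (y t1)) + norm (z (y t1) - z (y 0))"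
    using norm_triangle_sub[of "z (y 0)" "z (y t1)"] by (simp add: norm_minus_commute)
  ultimately show "norm (z (y 0)) \<le> d + 320 * C ^ 4 * \<sigma>\<^sup>2" using Q2_eq_1[OF t1(2)] by linarith
  have "\<exists>t\<in>{tt..\<tau>}. Q2 (y t) = 1 \<and> (\<forall>u\<in>{t..\<tau>}. Q2 (y u) \<ge> 1)"
    using touch ends pos
    by (intro last_hit continuous_on_subset[OF cy] Q2_ge_1) auto
  then obtain t2 where t2: "t2 \<in> {tt..\<tau>}" "Q2 (y t2) = 1" "\<And>u. u \<in> {t2..\<tau>} \<Longrightarrow> Q2 (y u) \<ge> 1" by blast
  have sub: "t \<in> {0..\<tau>}" if "t \<in> {t2..\<tau>}" for t using that t2 touch by auto
  have y2: "curve R' t2 \<tau> y" using curve_sub[OF y, of t2 \<tau>] t2 touch by auto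
  have st2: "s (y t2) \<le> - 2 * \<sigma>" "norm (z (y t2)) \<le> d" using Q2_eq_1[OF t2(2)] by auto
  have speed: "norm (proj (R' (y t))) \<le> 16 * C ^ 4 * \<sigma> + 16 * C ^ 5 * (163 * C\<^sup>2 * (h / \<rho>))" if t: "t \<in> {t2..\<tau>}" for t
  proof (rule proj_R'[OF in_ball[OF sub[OF t]] box(3)[OF sub[OF t]]])
    have "B2 (y t) = 0" "f (y t) = h * flat (1 - Q1 (y t))"
      using t2(3)[OF t] by (simp_all add: B2_def f_def flat_quot_eq_0 flat_eq_0)
    moreover have "0 \<le> h * flat (1 - Q1 (y t))" "h * flat (1 - Q1 (y t)) \<le> h"
      using pos flat_nonneg flat_le_1 by (simp_all add: mult_left_le)
    moreover have "h \<le> h / \<rho>" using \<rho>_le_1 pos by (simp add: field_simps)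
    moreover have "1 * (h / \<rho>) \<le> C\<^sup>2 * (h / \<rho>)" using C_pow[of 2] pos by (intro mult_right_mono) auto
    ultimately show "B1 (y t) + B2 (y t) + \<bar>f (y t)\<bar> \<le> 163 * C\<^sup>2 * (h / \<rho>)"
      using B_le(1)[of "y t"] by simp
  qed
  \<comment> \<open>The push itself must not carry the orbit out of the region around the axis where
    \<open>df_e\<close> and \<open>flat_middle\<close> apply; this is what \<Delta> being much
    smaller than \<rho> ensures.\<close>
  have zt: "norm (z (y t)) \<le> \<rho> / 8" if t: "t \<in> {t2..\<tau>}" for t
  proof -
    have "norm (z (y t) - z (y t2)) \<le> (16 * C ^ 4 * \<sigma> + 16 * C ^ 5 * (163 * C\<^sup>2 * (h / \<rho>))) * (t - t2)"
      by (rule curve_z[OF curve_sub[OF y2]]) (use t speed in auto)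
    also have "\<dots> \<le> (16 * C ^ 4 * \<sigma> + 16 * C ^ 5 * (163 * C\<^sup>2 * (h / \<rho>))) * (20 * \<sigma>)"
      using t t2 touch box(1) pos C by (intro mult_left_mono) auto
    also have "\<dots> = 320 * (C ^ 4 * \<sigma>\<^sup>2) + 52160 * (C ^ 7 * \<Delta>)"
      by (simp add: \<Delta>_def power_numeral_reduce algebra_simps)
    finally have 1: "norm (z (y t) - z (y t2)) \<le> 320 * (C ^ 4 * \<sigma>\<^sup>2) + 52160 * (C ^ 7 * \<Delta>)" .
    have "1 * d \<le> C * d" using C pos by (intro mult_right_mono) auto
    moreover have "C ^ 4 * \<sigma>\<^sup>2 \<le> C ^ 5 * \<sigma>\<^sup>2" by (intro mult_right_mono C_pow_mono) auto
    moreover have "1 * \<Delta> \<le> C ^ 7 * \<Delta>" using C_pow[of 7] \<Delta>_pos by (intro mult_right_mono) auto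
    moreover have "C ^ 7 * \<Delta> \<le> C ^ 11 * \<Delta>" using \<Delta>_pos by (intro mult_right_mono C_pow_mono) auto
    ultimately show ?thesis
      using 1 st2(2) scale_facts norm_triangle_sub[of "z (y t)" "z (y t2)"] pos by linarith
  qed
  define \<eta> where "\<eta> = 8 * C ^ 3 * \<sigma> + 2592 * C ^ 5 * \<Delta>"
  have \<eta>: "\<eta> \<ge> 0" using C pos \<Delta>_pos by (simp add: \<eta>_def)
  have dm: "((\<lambda>t. m (y t)) has_vector_derivative E x\<^sub>0 (R' (y t)) e) (at t within {u..v})"
    if "t2 \<le> u" "v \<le> \<tau>" "t \<in> {u..v}" for t u v
    unfolding m_def by (rule curve_linear[OF curve_sub[OF y2 that(1,2)] that(3) E0_bounded_linear])
  \<comment> \<open>The factor 4 / 9 is the lower bound for \<open>1 / (1 + f)\<^sup>2\<close> that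
    follows from \<open>1 + f \<le> 3 / 2\<close>.\<close>
  have rate: "3 / 8 * (h / \<rho>) * flat_quot 2 (1 - Q1 (y t)) * (4 / 9) - \<eta> \<le> E x\<^sub>0 (R' (y t)) e" if t: "t \<in> {t2..\<tau>}" for t
  proof -
    have nn: "0 \<le> 3 / 8 * (h / \<rho>) * flat_quot 2 (1 - Q1 (y t))" using pos flat_quot_nonneg by simp
    have g: "1 / 2 \<le> 1 + f (y t)" "1 + f (y t) \<le> 3 / 2" by (rule g_bounds)+
    then have "(1 + f (y t))\<^sup>2 \<le> (3 / 2)\<^sup>2" by (intro power_mono) auto
    then have g2: "(1 + f (y t))\<^sup>2 \<le> 9 / 4" by (simp add: power2_eq_square)
    have "3 / 8 * (h / \<rho>) * flat_quot 2 (1 - Q1 (y t)) / (9 / 4) \<le> df (y t) e / (1 + f (y t))\<^sup>2"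
      using g g2 nn df_e[OF t2(3)[OF t] zt[OF t]] by (intro frac_le) auto
    then show ?thesis
      using E0_rate[OF in_ball[OF sub[OF t]] box(3)[OF sub[OF t]] t2(3)[OF t]] by (simp add: \<eta>_def)
  qed
  have low: "- \<eta> * (v - u) \<le> m (y v) - m (y u)" if uv: "t2 \<le> u" "u \<le> v" "v \<le> \<tau>" for u v
  proof (rule growth_lower[OF uv(2) dm[OF uv(1,3)]])
    fix t assume "t \<in> {u..v}"
    then have "t \<in> {t2..\<tau>}" using uv by auto
    moreover have "0 \<le> 3 / 8 * (h / \<rho>) * flat_quot 2 (1 - Q1 (y t)) * (4 / 9)" using pos flat_quot_nonneg by simp
    ultimately show "- \<eta> \<le> E x\<^sub>0 (R' (y t)) e" using rate[of t] by linarith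
  qed
  have cs2: "continuous_on {u..v} (\<lambda>t. s (y t))" if "t2 \<le> u" "v \<le> \<tau>" for u v
    by (rule continuous_on_subset[OF cs]) (use that t2 touch in auto)
  \<comment> \<open>Between \<open>5 / 2 * \<sigma>\<close> and \<open>7 / 2 * \<sigma>\<close> lies
    the middle of the first bump. At a speed of at most 3 / 2 crossing it takes at least
    \<open>2 / 3 * \<sigma>\<close>, and the rate \<open>h / \<rho> / 486\<close> over this time
    gives \<open>\<Delta> / 729\<close>.\<close>
  obtain t3 where t3: "t2 \<le> t3" "t3 \<le> \<tau>" "s (y t3) = 5 / 2 * \<sigma>"
    using IVT'[of "\<lambda>t. s (y t)" t2 "5 / 2 * \<sigma>" \<tau>] st2(1) ends pos t2(1) cs2[of t2 \<tau>] by auto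
  obtain t4 where t4: "t3 \<le> t4" "t4 \<le> \<tau>" "s (y t4) = 7 / 2 * \<sigma>"
    using IVT'[of "\<lambda>t. s (y t)" t3 "7 / 2 * \<sigma>" \<tau>] t3 ends pos cs2[of t3 \<tau>] by auto
  have y34: "curve R' t3 t4 y" using curve_sub[OF y2] t3 t4 by auto
  have "\<sigma> \<le> 3 / 2 * (t4 - t3)" using curve_s(2)[OF near_R' y34 t4(1)] t3(3) t4(3) by simp
  then have len: "2 / 3 * \<sigma> \<le> t4 - t3" by simp
  have mid: "(h / \<rho> / 486 - \<eta>) * (t4 - t3) \<le> m (y t4) - m (y t3)"
  proof (rule growth_lower[OF t4(1) dm[OF t3(1) t4(2)]])
    fix t assume t: "t \<in> {t3..t4}"
    then have t': "t \<in> {t2..\<tau>}" using t3 t4 by auto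
    have "1 / 81 \<le> flat_quot 2 (1 - Q1 (y t))"
      using curve_s_mono[OF near_R' y34 t] t3(3) t4(3) zt[OF t'] by (intro flat_middle) auto
    then have le: "3 / 8 * (h / \<rho>) * (1 / 81) * (4 / 9) \<le> 3 / 8 * (h / \<rho>) * flat_quot 2 (1 - Q1 (y t)) * (4 / 9)"
      using pos by (intro mult_right_mono mult_left_mono) auto
    have eq: "3 / 8 * (h / \<rho>) * (1 / 81) * (4 / 9) = h / \<rho> / 486" by simp
    show "h / \<rho> / 486 - \<eta> \<le> E x\<^sub>0 (R' (y t)) e"
      by (rule order_trans[OF diff_right_mono[OF le[unfolded eq]] rate[OF t']])
  qed
  have "h / \<rho> / 486 * (2 / 3 * \<sigma>) \<le> h / \<rho> / 486 * (t4 - t3)" using len pos by (intro mult_left_mono) auto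
  then have "\<Delta> / 729 \<le> h / \<rho> / 486 * (t4 - t3)" by (simp add: \<Delta>_def mult.commute)
  moreover have "\<eta> * (\<tau> - t2) \<le> \<eta> * (20 * \<sigma>)" using \<eta> box(1) t2 touch by (intro mult_left_mono) auto
  moreover have "- \<eta> * (t3 - t2) + (h / \<rho> / 486 - \<eta>) * (t4 - t3) + - \<eta> * (\<tau> - t4) \<le> m (y \<tau>) - m (y t2)"
    using low[of t2 t3] mid low[of t4 \<tau>] t3 t4 by simp
  moreover have "- \<eta> * (t3 - t2) + (h / \<rho> / 486 - \<eta>) * (t4 - t3) + - \<eta> * (\<tau> - t4) =
      h / \<rho> / 486 * (t4 - t3) - \<eta> * (\<tau> - t2)" by (simp add: algebra_simps)
  moreover have "- (C / 2 * d) \<le> m (y t2)"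
    using m_bound[of "y t2"] mult_left_mono[OF st2(2), of "C / 2"] C by linarith
  ultimately show "\<Delta> / 729 \<le> m (y \<tau>) + C / 2 * d + 20 * \<sigma> * (8 * C ^ 3 * \<sigma> + 2592 * C ^ 5 * \<Delta>)"
    unfolding \<eta>_def[symmetric] mult.commute[of "20 * \<sigma>"] by linarith
qed

text \<open>The value of \<open>m\<close> at the common end point is computed along both orbits. The
  push makes it at least of order \<Delta>, whereas the unperturbed orbit starts within about
  \<open>d\<close> of the axis and drifts by order \<open>\<sigma>\<^sup>2\<close> only, which
  bounds it by a tiny fraction of \<Delta>.\<close>

lemma avoids_second_bump:
  assumes y: "curve R' 0 \<tau> y" and \<tau>: "\<tau> \<ge> 0"
    and ends: "s (y 0) = - 5 * \<sigma>" "s (y \<tau>) = 5 * \<sigma>" and zb: "\<forall>t\<in>{0..\<tau>}. norm (z (y t)) \<le> 3 * \<sigma>"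
    and y0: "curve R 0 \<tau>\<^sub>0 y\<^sub>0" and \<tau>0: "\<tau>\<^sub>0 \<ge> 0"
    and zb0: "\<forall>t\<in>{0..\<tau>\<^sub>0}. norm (z (y\<^sub>0 t)) \<le> 3 * \<sigma>"
    and match: "y\<^sub>0 0 = y 0" "y\<^sub>0 \<tau>\<^sub>0 = y \<tau>" and t: "t \<in> {0..\<tau>}"
  shows "Q2 (y t) > 1"
proof (rule ccontr)
  assume "\<not> Q2 (y t) > 1"
  then have touch: "Q2 (y t) \<le> 1" by simp
  note disp = displacement[OF y \<tau> ends zb t touch]
  have ends0: "s (y\<^sub>0 0) = - 5 * \<sigma>" "s (y\<^sub>0 \<tau>\<^sub>0) = 5 * \<sigma>" using ends match by simp_all
  note box = curve_box[OF near_R y0 \<tau>0 ends0 zb0]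
  have "norm (z (y\<^sub>0 \<tau>\<^sub>0) - z (y\<^sub>0 0)) \<le> 320 * C ^ 4 * \<sigma>\<^sup>2"
    by (rule R_drift[OF y0]) (use \<tau>0 box in auto)
  then have "norm (z (y \<tau>)) \<le> d + 640 * C ^ 4 * \<sigma>\<^sup>2"
    using disp(1) norm_triangle_sub[of "z (y\<^sub>0 \<tau>\<^sub>0)" "z (y\<^sub>0 0)"] unfolding match by simp
  then have "C / 2 * norm (z (y \<tau>)) \<le> C / 2 * (d + 640 * C ^ 4 * \<sigma>\<^sup>2)" using C by (intro mult_left_mono) auto
  then have "m (y \<tau>) \<le> C * d / 2 + 320 * (C ^ 5 * \<sigma>\<^sup>2)"
    using m_bound[of "y \<tau>"] by (simp add: power_numeral_reduce algebra_simps)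
  moreover have "20 * \<sigma> * (8 * C ^ 3 * \<sigma> + 2592 * C ^ 5 * \<Delta>) = 160 * (C ^ 3 * \<sigma>\<^sup>2) + 51840 * (C ^ 5 * \<sigma> * \<Delta>)"
    by (simp add: power2_eq_square algebra_simps)
  moreover have "C ^ 3 * \<sigma>\<^sup>2 \<le> C ^ 5 * \<sigma>\<^sup>2" by (intro mult_right_mono C_pow_mono) auto
  moreover have "10000000000 * (C ^ 5 * \<sigma>) * \<Delta> \<le> 1 * \<Delta>" using scale_facts(4) \<Delta>_pos by (intro mult_right_mono) auto
  then have "10000000000 * (C ^ 5 * \<sigma> * \<Delta>) \<le> \<Delta>" by (simp only: mult.assoc mult_1)
  moreover have "C / 2 * d = C * d / 2" by simp
  ultimately show False using disp(2) scale_facts(1,2) \<Delta>_pos by linarith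
qed

section \<open>Comparison of the actions of the two orbits\<close>

definition \<psi> :: "'e \<Rightarrow> real" where "\<psi> x = B1 x + f x"

lemma continuous_\<psi>: "continuous_on S \<psi>"
proof -
  have "continuous_on UNIV (flat_quot 2)"
    using Ck_on_flat_quot[of 0 2] by simp
  then have "continuous_on S (\<lambda>x. flat_quot 2 (1 - Q1 x))"
    by (rule continuous_on_compose2) (auto intro!: continuous_intros continuous_Q1)
  then show ?thesis
    unfolding \<psi>_def[abs_def] B1_def using pos by (intro continuous_intros continuous_f) auto
qed

context
  fixes x assumes x: "Q2 x \<ge> 1"
begin

lemma f_eq: "f x = h * flat (1 - Q1 x)"
  using x by (simp add: f_def flat_eq_0)

lemma f_nonneg: "f x \<ge> 0"
  using pos by (simp add: f_eq flat_nonneg)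

lemma R'_diff_\<psi>: "x \<in> cball x\<^sub>0 r \<Longrightarrow> norm (R' x - R x) \<le> 8 * C ^ 3 * \<psi> x"
  using R'_diff[of x] f_nonneg x by (simp add: \<psi>_def B2_def flat_quot_eq_0)

lemma \<psi>_nonneg: "\<psi> x \<ge> 0"
  using f_nonneg B_nonneg by (simp add: \<psi>_def)

text \<open>Since the derivative of the bump is controlled by the square root of the bump, the action gained
  along a curve is linear in \<open>f\<close>, whereas the action lost by displacing it is quadratic in \<open>\<psi>\<close>.\<close>

lemma \<psi>_square: "(\<psi> x)\<^sup>2 \<le> 225002 * C ^ 4 * (h / \<rho>\<^sup>2) * f x"
proof -
  define q where "q = flat_quot 2 (1 - Q1 x)"
  have q: "q\<^sup>2 \<le> 3125 * flat (1 - Q1 x)"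
    unfolding q_def using Q_nonneg[of x] by (intro flat_derivative_square_le) simp
  have "(B1 x)\<^sup>2 = 36 * C ^ 4 * (h / \<rho>\<^sup>2) * h * q\<^sup>2"
    using pos by (simp add: B1_def q_def power2_eq_square power_numeral_reduce field_simps)
  also have "\<dots> \<le> 36 * C ^ 4 * (h / \<rho>\<^sup>2) * h * (3125 * flat (1 - Q1 x))"
    using pos C by (intro mult_left_mono q) auto
  also have "\<dots> = 112500 * (C ^ 4 * (h / \<rho>\<^sup>2) * f x)" by (simp add: f_eq)
  finally have 1: "(B1 x)\<^sup>2 \<le> 112500 * (C ^ 4 * (h / \<rho>\<^sup>2) * f x)" .
  have "f x \<le> h" using pos flat_le_1 by (simp add: f_eq)
  moreover have "1 * h \<le> C ^ 4 * (h / \<rho>\<^sup>2)"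
  proof (rule mult_mono)
    have "\<rho>\<^sup>2 \<le> 1" using \<rho>_le_1 pos by (simp add: power_le_one)
    then show "h \<le> h / \<rho>\<^sup>2" using pos by (simp add: field_simps)
  qed (use C_pow pos in auto)
  ultimately have "f x * f x \<le> (C ^ 4 * (h / \<rho>\<^sup>2)) * f x"
    using f_nonneg by (intro mult_right_mono) auto
  then have 2: "(f x)\<^sup>2 \<le> C ^ 4 * (h / \<rho>\<^sup>2) * f x" by (simp add: power2_eq_square)
  have "(\<psi> x)\<^sup>2 \<le> 2 * (B1 x)\<^sup>2 + 2 * (f x)\<^sup>2"
    using zero_le_power2[of "B1 x - f x"] by (simp add: \<psi>_def power2_sum power2_diff)
  also have "\<dots> \<le> 225002 * (C ^ 4 * (h / \<rho>\<^sup>2) * f x)" using 1 2 by linarith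
  finally show ?thesis by (simp only: mult.assoc)
qed

end

text \<open>The pairing of the form along the original orbit with the difference of the orbits is
  the first-order difference of their actions. Since \<open>E\<close> vanishes on \<open>R\<close>,
  the arguments of \<open>da\<close> can be exchanged in its derivative; then the terms linear in
  the difference cancel against the Taylor expansion of \<open>a (y t) (R' (y t))\<close>. What
  remains is \<open>1 / (1 + f) - 1\<close> and errors of second order in the difference and
  \<psi>.\<close>

lemma action_derivative:
  assumes y: "curve R' 0 \<tau> y" and y0: "curve R 0 \<tau> y\<^sub>0" and t: "t \<in> {0..\<tau>}"
    and Q2: "Q2 (y t) \<ge> 1" and N: "norm (y t - y\<^sub>0 t) \<le> N"
  shows "\<exists>D. ((\<lambda>t. a (y\<^sub>0 t) (y t - y\<^sub>0 t)) has_vector_derivative D) (at t within {0..\<tau>}) \<and>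
    D \<le> - f (y t) / 2 + (8 * C ^ 4 * N * \<psi> (y t) + 3 * C\<^sup>2 * N\<^sup>2)"
proof -
  let ?x = "y\<^sub>0 t" and ?u = "y t - y\<^sub>0 t" and ?u' = "R' (y t) - R (y\<^sub>0 t)"
  have mem: "?x \<in> cball x\<^sub>0 r" "y t \<in> cball x\<^sub>0 r" using curveD(1)[OF y0 t] curveD(1)[OF y t] .
  interpret a: linear "a ?x" by (rule a_linear[OF mem(1)])
  interpret da: linear "\<lambda>v. da ?x v w" for w by (rule da_linear[OF mem(1)])
  have "bilinear (E ?x)" by (rule E_bilinear[OF mem(1)])
  \<comment> \<open>The covector varies with time, so the product rule is applied to its components
    in a fixed basis.\<close>
  have expand: "a (y\<^sub>0 v) w = (\<Sum>b\<in>Basis. (w \<bullet> b) * a (y\<^sub>0 v) b)" if "v \<in> {0..\<tau>}" for v w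
  proof -
    interpret v: linear "a (y\<^sub>0 v)" by (rule a_linear[OF curveD(1)[OF y0 that]])
    have "a (y\<^sub>0 v) w = a (y\<^sub>0 v) (\<Sum>b\<in>Basis. (w \<bullet> b) *\<^sub>R b)" by (simp only: euclidean_representation)
    then show ?thesis by (simp only: v.sum v.scaleR real_scaleR_def)
  qed
  define D where "D = a ?x ?u' + da ?x ?u (R ?x)"
  have du: "((\<lambda>t. y t - y\<^sub>0 t) has_vector_derivative ?u') (at t within {0..\<tau>})"
    by (rule has_vector_derivative_diff[OF curveD(2)[OF y t] curveD(2)[OF y0 t]])
  have db: "((\<lambda>t. a (y\<^sub>0 t) b) has_vector_derivative da ?x b (R ?x)) (at t within {0..\<tau>})" for b
  proof -
    note d = a_derivative[OF mem(1), of b]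
    show ?thesis
      using has_derivative_compose[OF curveD(2)[OF y0 t, unfolded has_vector_derivative_def] d]
      by (simp add: has_vector_derivative_def linear_scale[OF has_derivative_linear[OF d]])
  qed
  have "((\<lambda>t. \<Sum>b\<in>Basis. ((y t - y\<^sub>0 t) \<bullet> b) * a (y\<^sub>0 t) b) has_vector_derivative
      (\<Sum>b\<in>Basis. (?u \<bullet> b) * da ?x b (R ?x) + (?u' \<bullet> b) * a ?x b)) (at t within {0..\<tau>})"
    by (intro has_vector_derivative_sum has_vector_derivative_mult db
        bounded_linear.has_vector_derivative[OF bounded_linear_inner_left] du)
  moreover have "(\<Sum>b\<in>Basis. (?u \<bullet> b) * da ?x b (R ?x) + (?u' \<bullet> b) * a ?x b) = D"
  proof -
    have "da ?x ?u (R ?x) = da ?x (\<Sum>b\<in>Basis. (?u \<bullet> b) *\<^sub>R b) (R ?x)" by (simp only: euclidean_representation)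
    also have "\<dots> = (\<Sum>b\<in>Basis. (?u \<bullet> b) * da ?x b (R ?x))" by (simp only: da.sum da.scaleR real_scaleR_def)
    finally show ?thesis by (simp add: D_def expand[OF t, of ?u'] sum.distrib add.commute)
  qed
  ultimately have der: "((\<lambda>t. a (y\<^sub>0 t) (y t - y\<^sub>0 t)) has_vector_derivative D) (at t within {0..\<tau>})"
    using has_vector_derivative_transform[OF t expand] by simp
  have N0: "N \<ge> 0" using order_trans[OF norm_ge_zero N] .
  have f0: "f (y t) \<ge> 0" "\<psi> (y t) \<ge> 0" using f_nonneg[OF Q2] \<psi>_nonneg[OF Q2] .
  have sym: "da ?x ?u (R ?x) = da ?x (R ?x) ?u" using E_eq[of ?x "R ?x" ?u] E_R[OF mem(1), of ?u] by simp
  have "\<bar>a (y t) (R' (y t)) - a ?x (R' (y t)) - da ?x (R' (y t)) ?u\<bar> \<le> C * (norm ?u)\<^sup>2 * norm (R' (y t))"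
    by (rule a_taylor[OF mem])
  also have "\<dots> \<le> C * N\<^sup>2 * (2 * C)"
    using near_bounds(4)[OF near_R' mem(2)] C N by (intro mult_mono power_mono) auto
  finally have T: "\<bar>a (y t) (R' (y t)) - a ?x (R' (y t)) - da ?x (R' (y t)) ?u\<bar> \<le> 2 * (C\<^sup>2 * N\<^sup>2)"
    by (simp add: power2_eq_square mult_ac)
  have "norm ?u' \<le> norm (R' (y t) - R (y t)) + norm (R (y t) - R ?x)"
    using norm_triangle_ineq[of "R' (y t) - R (y t)" "R (y t) - R ?x"] by simp
  also have "\<dots> \<le> 8 * C ^ 3 * \<psi> (y t) + C * N"
    using R'_diff_\<psi>[OF Q2 mem(2)] R_lipschitz[OF mem(2,1)] mult_left_mono[OF N, of C] C by linarith
  finally have "C * norm ?u' * norm ?u \<le> C * (8 * C ^ 3 * \<psi> (y t) + C * N) * N"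
    using N0 N C f0 by (intro mult_mono) auto
  then have L: "\<bar>da ?x ?u' ?u\<bar> \<le> 8 * C ^ 4 * N * \<psi> (y t) + C\<^sup>2 * N\<^sup>2"
    using da_bound[OF mem(1), of ?u' ?u] by (simp add: power_numeral_reduce power2_eq_square algebra_simps)
  \<comment> \<open>The main term is \<open>- f / (1 + f)\<close>; away from the second bump
    \<open>f\<close> is nonnegative, and \<open>1 + f \<le> 2\<close> leaves at least half of
    it.\<close>
  have "f (y t) * (1 + f (y t)) \<le> f (y t) * 2" using g_bounds[of "y t"] f0 by (intro mult_left_mono) auto
  then have F: "1 / (1 + f (y t)) - 1 \<le> - f (y t) / 2" using f0 by (simp add: field_simps)
  have "D = (1 / (1 + f (y t)) - 1) - da ?x ?u' ?u -
      (a (y t) (R' (y t)) - a ?x (R' (y t)) - da ?x (R' (y t)) ?u)"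
    unfolding D_def sym by (simp add: a.diff da.diff R'_a[OF mem(2)] a_R[OF mem(1)])
  then have "D \<le> - f (y t) / 2 + (8 * C ^ 4 * N * \<psi> (y t) + 3 * C\<^sup>2 * N\<^sup>2)"
    using T L F by (simp only: mult.assoc)
  then show ?thesis using der by blast
qed

text \<open>If the perturbed orbit were faster, the original one would at time \<tau> still have to
  run forward to the common end point, which makes the pairing \<open>?A\<close> positive at \<tau>.
  Integrating its derivative gives at most \<open>- F / 2\<close> plus errors quadratic in the
  integral \<Phi> of \<psi>, and these are a small multiple of \<open>F\<close>.\<close>

theorem crossing_time:
  assumes y: "curve R' 0 \<tau> y" and \<tau>: "\<tau> \<ge> 0"
    and ends: "s (y 0) = - 5 * \<sigma>" "s (y \<tau>) = 5 * \<sigma>" and zb: "\<forall>t\<in>{0..\<tau>}. norm (z (y t)) \<le> 3 * \<sigma>"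
    and y0: "curve R 0 \<tau>\<^sub>0 y\<^sub>0" and \<tau>0: "\<tau>\<^sub>0 \<ge> 0"
    and zb0: "\<forall>t\<in>{0..\<tau>\<^sub>0}. norm (z (y\<^sub>0 t)) \<le> 3 * \<sigma>"
    and match: "y\<^sub>0 0 = y 0" "y\<^sub>0 \<tau>\<^sub>0 = y \<tau>"
  shows "\<tau>\<^sub>0 \<le> \<tau>"
proof (rule ccontr)
  assume "\<not> \<tau>\<^sub>0 \<le> \<tau>"
  then have less: "\<tau> < \<tau>\<^sub>0" by simp
  note box = curve_box[OF near_R' y \<tau> ends zb]
  have Q2: "Q2 (y t) \<ge> 1" if "t \<in> {0..\<tau>}" for t
    using avoids_second_bump[OF y \<tau> ends zb y0 \<tau>0 zb0 match that] by simp
  have y0': "curve R 0 \<tau> y\<^sub>0" using curve_sub[OF y0] less by auto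
  let ?u = "\<lambda>t. y t - y\<^sub>0 t"
  have cu: "continuous_on {0..\<tau>} ?u"
    by (intro continuous_intros curve_continuous[OF y] curve_continuous[OF y0'])
  obtain ts where ts: "ts \<in> {0..\<tau>}" "\<And>t. t \<in> {0..\<tau>} \<Longrightarrow> norm (?u t) \<le> norm (?u ts)"
    using continuous_attains_sup[of "{0..\<tau>}" "\<lambda>t. norm (?u t)"] continuous_on_norm[OF cu] \<tau> by auto
  define N where "N = norm (?u ts)"
  have N: "norm (?u t) \<le> N" if "t \<in> {0..\<tau>}" for t using ts(2)[OF that] by (simp add: N_def)
  have N0: "N \<ge> 0" by (simp add: N_def)
  have c\<psi>: "continuous_on {0..\<tau>} (\<lambda>t. \<psi> (y t))"
    by (rule continuous_on_compose2[OF continuous_\<psi>[of UNIV] curve_continuous[OF y]]) auto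
  have cf: "continuous_on {0..\<tau>} (\<lambda>t. f (y t))"
    by (rule continuous_on_compose2[OF continuous_f[of UNIV] curve_continuous[OF y]]) auto
  define \<Phi> where "\<Phi> = integral {0..\<tau>} (\<lambda>t. \<psi> (y t))"
  define F where "F = integral {0..\<tau>} (\<lambda>t. f (y t))"
  have i\<psi>: "(\<lambda>t. \<psi> (y t)) integrable_on {0..\<tau>}" by (rule integrable_continuous_real[OF c\<psi>])
  have if': "(\<lambda>t. f (y t)) integrable_on {0..\<tau>}" by (rule integrable_continuous_real[OF cf])
  have \<Phi>0: "\<Phi> \<ge> 0" unfolding \<Phi>_def by (rule integral_nonneg[OF i\<psi>]) (rule \<psi>_nonneg[OF Q2])
  have F0: "F \<ge> 0" unfolding F_def by (rule integral_nonneg[OF if']) (rule f_nonneg[OF Q2])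
  \<comment> \<open>The distance grows at most at the rate
    \<open>8 * C ^ 3 * \<psi> + C * N\<close>. As the crossing is short, the second term contributes
    at most \<open>N / 2\<close> and is absorbed.\<close>
  have Nle: "N \<le> 16 * C ^ 3 * \<Phi>"
  proof (cases "ts = 0")
    case True
    then show ?thesis using \<Phi>0 C match by (simp add: N_def)
  next
    case False
    then have ts0: "0 < ts" "ts \<le> \<tau>" using ts(1) by auto
    define G where "G v = 8 * C ^ 3 * integral {0..v} (\<lambda>t. \<psi> (y t)) + C * N * v" for v
    have dG: "(G has_vector_derivative 8 * C ^ 3 * \<psi> (y t) + C * N) (at t within {0..\<tau>})" if t: "t \<in> {0..\<tau>}" for t
      unfolding G_def[abs_def]
      using integral_has_vector_derivative[OF c\<psi> t]
      by (auto intro!: derivative_eq_intros simp: has_real_derivative_iff_has_vector_derivative[symmetric])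
    have du: "(?u has_vector_derivative R' (y t) - R (y\<^sub>0 t)) (at t within {0..\<tau>})" if t: "t \<in> {0..\<tau>}" for t
      by (rule has_vector_derivative_diff[OF curveD(2)[OF y t] curveD(2)[OF y0' t]])
    have "norm (?u ts - ?u 0) \<le> G ts - G 0"
    proof (rule differentiable_bound_general[OF ts0(1)])
      show "continuous_on {0..ts} ?u" by (rule continuous_on_subset[OF cu]) (use ts0 in auto)
      show "continuous_on {0..ts} G"
        by (rule continuous_on_subset[OF has_vector_derivative_continuous_on'[OF dG]]) (use ts0 in auto)
      fix t assume t: "0 < t" "t < ts"
      then have t': "t \<in> {0..\<tau>}" and i: "at t within {0..\<tau>} = at t"
        using ts0 by (auto intro!: at_within_Icc_at)
      show "(?u has_vector_derivative R' (y t) - R (y\<^sub>0 t)) (at t)" using du[OF t'] i by simp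
      show "(G has_vector_derivative 8 * C ^ 3 * \<psi> (y t) + C * N) (at t)" using dG[OF t'] i by simp
      have "norm (R' (y t) - R (y\<^sub>0 t)) \<le> norm (R' (y t) - R (y t)) + norm (R (y t) - R (y\<^sub>0 t))"
        using norm_triangle_ineq[of "R' (y t) - R (y t)" "R (y t) - R (y\<^sub>0 t)"] by simp
      also have "\<dots> \<le> 8 * C ^ 3 * \<psi> (y t) + C * N"
        using R'_diff_\<psi>[OF Q2[OF t'] curveD(1)[OF y t']] R_lipschitz[OF curveD(1)[OF y t'] curveD(1)[OF y0' t']]
          mult_left_mono[OF N[OF t'], of C] C by linarith
      finally show "norm (R' (y t) - R (y\<^sub>0 t)) \<le> 8 * C ^ 3 * \<psi> (y t) + C * N" .
    qed
    moreover have "G ts \<le> 8 * C ^ 3 * \<Phi> + C * N * ts"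
      unfolding G_def \<Phi>_def using C ts0
      by (intro add_right_mono mult_left_mono integral_subset_le integrable_on_subinterval[OF i\<psi>] i\<psi>)
        (auto intro: \<psi>_nonneg[OF Q2])
    moreover have "C * N * ts \<le> C * N * (20 * \<sigma>)" using C N0 ts0 box(1) by (intro mult_left_mono) auto
    moreover have "(20 * C * \<sigma>) * N \<le> 1 / 2 * N" using \<sigma>_small(3) N0 by (rule mult_right_mono)
    then have "C * N * (20 * \<sigma>) \<le> N / 2" by (simp add: mult_ac)
    moreover have "G 0 = 0" "?u 0 = 0" using match by (simp_all add: G_def)
    ultimately show ?thesis by (simp add: N_def)
  qed
  let ?A = "\<lambda>t. a (y\<^sub>0 t) (?u t)"
  have "\<exists>D. \<forall>t\<in>{0..\<tau>}. (?A has_vector_derivative D t) (at t within {0..\<tau>}) \<and>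
      D t \<le> - f (y t) / 2 + (8 * C ^ 4 * N * \<psi> (y t) + 3 * C\<^sup>2 * N\<^sup>2)"
    by (rule bchoice) (use action_derivative[OF y y0' _ Q2 N] in blast)
  then obtain D where D: "\<And>t. t \<in> {0..\<tau>} \<Longrightarrow> (?A has_vector_derivative D t) (at t within {0..\<tau>})"
    "\<And>t. t \<in> {0..\<tau>} \<Longrightarrow> D t \<le> - f (y t) / 2 + (8 * C ^ 4 * N * \<psi> (y t) + 3 * C\<^sup>2 * N\<^sup>2)" by blast
  have "?A \<tau> - ?A 0 \<le> - F / 2 + (8 * C ^ 4 * N * \<Phi> + 3 * C\<^sup>2 * N\<^sup>2 * \<tau>)"
  proof (rule has_integral_le[OF fundamental_theorem_of_calculus[OF \<tau> D(1)]])
    show "((\<lambda>t. - f (y t) / 2 + (8 * C ^ 4 * N * \<psi> (y t) + 3 * C\<^sup>2 * N\<^sup>2)) has_integral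
        - F / 2 + (8 * C ^ 4 * N * \<Phi> + 3 * C\<^sup>2 * N\<^sup>2 * \<tau>)) {0..\<tau>}"
      unfolding F_def \<Phi>_def
      using has_integral_const_real[of "3 * C\<^sup>2 * N\<^sup>2" 0 \<tau>] \<tau>
      by (intro has_integral_add has_integral_divide has_integral_neg has_integral_mult_right
          integrable_integral i\<psi> if') (simp add: mult.commute)
  qed (use D(2) in auto)
  moreover have "?A 0 = 0" using match linear_0[OF a_linear[OF curveD(1)[OF y0', of 0]]] \<tau> by simp
  ultimately have A: "?A \<tau> \<le> - F / 2 + (8 * C ^ 4 * N * \<Phi> + 3 * C\<^sup>2 * N\<^sup>2 * \<tau>)" by simp
  have "8 * C ^ 4 * N * \<Phi> \<le> 8 * C ^ 4 * (16 * C ^ 3 * \<Phi>) * \<Phi>"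
    using Nle C \<Phi>0 by (intro mult_left_mono mult_right_mono) auto
  then have 1: "8 * C ^ 4 * N * \<Phi> \<le> 128 * (C ^ 7 * \<Phi>\<^sup>2)" by (simp add: power_numeral_reduce power2_eq_square mult_ac)
  have 2: "3 * C\<^sup>2 * N\<^sup>2 * \<tau> \<le> C ^ 7 * \<Phi>\<^sup>2"
  proof -
    have "3 * C\<^sup>2 * N\<^sup>2 * \<tau> \<le> 3 * C\<^sup>2 * (16 * C ^ 3 * \<Phi>)\<^sup>2 * (20 * \<sigma>)"
      using Nle N0 C box(1) \<tau> by (intro mult_mono power_mono) auto
    also have "\<dots> = (15360 * (C * \<sigma>)) * (C ^ 7 * \<Phi>\<^sup>2)" by (simp add: power_numeral_reduce power2_eq_square mult_ac)
    also have "\<dots> \<le> 1 * (C ^ 7 * \<Phi>\<^sup>2)"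
    proof (rule mult_right_mono)
      have "C * \<sigma> \<le> 1 / 10 ^ 10" using \<sigma>_small(1) C by (simp add: field_simps)
      then show "15360 * (C * \<sigma>) \<le> 1" by simp
    qed (use C in auto)
    finally show ?thesis by simp
  qed
  \<comment> \<open>Cauchy-Schwarz and \<open>\<psi>_square\<close> bound
    \<open>\<Phi>\<^sup>2\<close> by a multiple of
    \<open>\<sigma> * (h / \<rho>\<^sup>2) * F\<close>. The factor
    \<open>\<sigma> * h / \<rho>\<^sup>2\<close> is \<open>\<Delta> / \<rho>\<close>, small by the
    choice of \<open>K\<close>; the power \<open>C ^ 11\<close> in the bound for \<open>K\<close> is
    \<open>C ^ 7 * C ^ 4\<close> from here.\<close>
  have 3: "C ^ 7 * \<Phi>\<^sup>2 \<le> 1 / 1000 * F"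
  proof -
    have "\<Phi>\<^sup>2 \<le> \<tau> * integral {0..\<tau>} (\<lambda>t. (\<psi> (y t))\<^sup>2)"
      unfolding \<Phi>_def by (rule integral_square_le[OF c\<psi> box(2)])
    also have "\<dots> \<le> \<tau> * (225002 * C ^ 4 * (h / \<rho>\<^sup>2) * F)"
    proof (rule mult_left_mono[OF _ \<tau>])
      have "integral {0..\<tau>} (\<lambda>t. (\<psi> (y t))\<^sup>2) \<le> integral {0..\<tau>} (\<lambda>t. 225002 * C ^ 4 * (h / \<rho>\<^sup>2) * f (y t))"
        by (intro integral_le integrable_continuous_real continuous_intros c\<psi> cf \<psi>_square Q2)
      then show "integral {0..\<tau>} (\<lambda>t. (\<psi> (y t))\<^sup>2) \<le> 225002 * C ^ 4 * (h / \<rho>\<^sup>2) * F"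
        by (simp add: F_def)
    qed
    also have "\<dots> \<le> (20 * \<sigma>) * (225002 * C ^ 4 * (h / \<rho>\<^sup>2) * F)"
      using box(1) C pos F0 by (intro mult_right_mono) auto
    also have "\<dots> = 4500040 * C ^ 4 * (\<Delta> / \<rho>) * F"
      using pos by (simp add: \<Delta>_def power2_eq_square)
    finally have "C ^ 7 * \<Phi>\<^sup>2 \<le> C ^ 7 * (4500040 * C ^ 4 * (\<Delta> / \<rho>) * F)" using C by (intro mult_left_mono) auto
    also have "\<dots> = (4500040 * (C ^ 11 * \<Delta> / \<rho>)) * F"
      by (simp add: power_numeral_reduce mult_ac)
    also have "\<dots> \<le> 1 / 1000 * F"
    proof (rule mult_right_mono[OF _ F0])
      have "C ^ 11 * \<Delta> / \<rho> \<le> 1 / 10000000000" using scale_facts(3) pos by (simp add: field_simps)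
      then show "4500040 * (C ^ 11 * \<Delta> / \<rho>) \<le> 1 / 1000" by linarith
    qed
    finally show ?thesis .
  qed
  have "?A \<tau> \<le> 0" using A 1 2 3 F0 by linarith
  \<comment> \<open>On the remaining arc of the original orbit the covector is frozen at the
    starting point of the arc. The ball is so small that it still takes values of at least 1 / 2 on
    the Reeb vectors there.\<close>
  moreover have "1 / 2 * (\<tau>\<^sub>0 - \<tau>) \<le> ?A \<tau>"
  proof -
    let ?p = "y\<^sub>0 \<tau>"
    have p: "?p \<in> cball x\<^sub>0 r" using curveD(1)[OF y0, of \<tau>] \<tau> less by simp
    have bl: "bounded_linear (a ?p)" using a_linear[OF p] by (simp add: linear_conv_bounded_linear)
    have sub: "curve R \<tau> \<tau>\<^sub>0 y\<^sub>0" using curve_sub[OF y0, of \<tau> \<tau>\<^sub>0] \<tau> by simp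
    have "1 / 2 * (\<tau>\<^sub>0 - \<tau>) \<le> a ?p (y\<^sub>0 \<tau>\<^sub>0 - x\<^sub>0) - a ?p (?p - x\<^sub>0)"
    proof (rule growth_lower[OF less_imp_le[OF less] curve_linear[OF sub _ bl]])
      fix t assume t: "t \<in> {\<tau>..\<tau>\<^sub>0}"
      note x = curveD(1)[OF sub t]
      have "\<bar>a (y\<^sub>0 t) (R (y\<^sub>0 t)) - a ?p (R (y\<^sub>0 t))\<bar> \<le> C * norm (y\<^sub>0 t - ?p) * norm (R (y\<^sub>0 t))"
        by (rule a_lipschitz[OF x p])
      also have "\<dots> \<le> C * (2 * r) * C"
      proof (intro mult_mono)
        show "norm (y\<^sub>0 t - ?p) \<le> 2 * r"
          using dist_triangle2[of "y\<^sub>0 t" ?p x\<^sub>0] x p by (simp add: dist_norm norm_minus_commute)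
      qed (use C r R_bound[OF x] in auto)
      also have "\<dots> \<le> 1 / 2"
      proof -
        have "C\<^sup>2 * r \<le> C ^ 3 * r" using r by (intro mult_right_mono C_pow_mono) auto
        then show ?thesis using r_small by (simp add: power2_eq_square mult_ac)
      qed
      finally show "1 / 2 \<le> a ?p (R (y\<^sub>0 t))" using a_R[OF x] by linarith
    qed
    then show ?thesis by (simp add: linear_diff[OF a_linear[OF p]] match)
  qed
  ultimately show False using less by simp
qed

end

subsection \<open>Closed orbits of the perturbed flow\<close>

context closed_mfd
begin

text \<open>Coordinates make sense only in the chart, so leaving the chart has to be excluded
  together with leaving the ball. The part \<open>Z\<close> of the manifold over the closed ball is
  compact, hence closed: up to and including the first exit from the open ball the curve is in
  \<open>Z\<close>, where the speed bound holds, and the time is too short to reach the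
  boundary.\<close>

lemma stays_in_ball_forward:
  fixes \<gamma> :: "real \<Rightarrow> 'm"
  assumes c: "c \<in> A" and ball: "cball x\<^sub>0 r \<subseteq> chart_image c" and \<gamma>: "continuous_on UNIV \<gamma>"
    and speed: "\<And>t. \<gamma> t \<in> fst c \<Longrightarrow> snd c (\<gamma> t) \<in> cball x\<^sub>0 r \<Longrightarrow>
      \<exists>v. norm v \<le> B \<and> ((\<lambda>s. snd c (\<gamma> s)) has_vector_derivative v) (at t)"
    and start: "\<gamma> t\<^sub>0 \<in> fst c" "norm (snd c (\<gamma> t\<^sub>0) - x\<^sub>0) \<le> r / 2"
    and r: "r > 0" and B: "B \<ge> 0" and t: "t\<^sub>0 \<le> t" "B * (t - t\<^sub>0) < r / 2"
  shows "\<gamma> t \<in> fst c \<and> snd c (\<gamma> t) \<in> cball x\<^sub>0 r"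
proof -
  define W where "W = {m \<in> fst c. snd c m \<in> ball x\<^sub>0 r}"
  define Z where "Z = chart_inv c ` cball x\<^sub>0 r"
  have W: "open W" unfolding W_def by (rule chart_preimage_open[OF c]) simp
  have "compact Z" unfolding Z_def
    by (rule compact_continuous_image[OF continuous_on_subset[OF cont_chart_inv[OF c] ball]]) simp
  then have Z: "closed Z" by (rule compact_imp_closed)
  have Zmem: "m \<in> Z \<longleftrightarrow> m \<in> fst c \<and> snd c m \<in> cball x\<^sub>0 r" for m
  proof
    assume "m \<in> Z"
    then obtain x where x: "x \<in> cball x\<^sub>0 r" "m = chart_inv c x" unfolding Z_def by (rule imageE)
    moreover have "x \<in> chart_image c" using x ball by blast
    ultimately show "m \<in> fst c \<and> snd c m \<in> cball x\<^sub>0 r" by (simp add: chart_inv_mem[OF c] chart_chart_inv[OF c])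
  next
    assume m: "m \<in> fst c \<and> snd c m \<in> cball x\<^sub>0 r"
    then have "m = chart_inv c (snd c m)" by (simp add: chart_inv_chart[OF c])
    then show "m \<in> Z" unfolding Z_def by (rule image_eqI) (use m in simp)
  qed
  have WZ: "W \<subseteq> Z" by (rule subsetI) (simp add: W_def Zmem)
  have start_W: "\<gamma> t\<^sub>0 \<in> W" using start r by (simp add: W_def dist_norm norm_minus_commute)
  have "\<gamma> t \<in> W"
  proof (rule ccontr)
    assume not_W: "\<gamma> t \<notin> W"
    define H where "H = {t\<^sub>0..t} \<inter> \<gamma> -` (- W)"
    have "closed (\<gamma> -` (- W))" using W \<gamma> by (intro closed_vimage) auto
    then have "compact H" unfolding H_def by (intro compact_Int_closed) auto
    moreover have "H \<noteq> {}" using not_W t by (auto simp: H_def)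
    ultimately obtain t1 where t1: "t1 \<in> H" "\<And>s. s \<in> H \<Longrightarrow> t1 \<le> s" using compact_attains_inf by metis
    have t1': "t\<^sub>0 \<le> t1" "t1 \<le> t" "\<gamma> t1 \<notin> W" using t1(1) by (auto simp: H_def)
    have "t\<^sub>0 \<noteq> t1" using start_W t1'(3) by blast
    then have less: "t\<^sub>0 < t1" using t1'(1) by simp
    have "{t\<^sub>0..<t1} \<subseteq> \<gamma> -` Z"
    proof
      fix s assume s: "s \<in> {t\<^sub>0..<t1}"
      then have "s \<notin> H" using t1(2)[of s] by auto
      then have "\<gamma> s \<in> W" using s t1' by (auto simp: H_def)
      then show "s \<in> \<gamma> -` Z" using WZ by auto
    qed
    then have "closure {t\<^sub>0..<t1} \<subseteq> \<gamma> -` Z" using Z \<gamma> by (intro closure_minimal closed_vimage) auto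
    then have sub: "\<gamma> s \<in> Z" if "s \<in> {t\<^sub>0..t1}" for s using less that by auto
    have "\<exists>v. \<forall>s\<in>{t\<^sub>0..t1}. norm (v s) \<le> B \<and> ((\<lambda>s. snd c (\<gamma> s)) has_vector_derivative v s) (at s)"
      by (rule bchoice) (use speed sub Zmem in blast)
    then obtain v where v: "\<And>s. s \<in> {t\<^sub>0..t1} \<Longrightarrow> norm (v s) \<le> B"
      "\<And>s. s \<in> {t\<^sub>0..t1} \<Longrightarrow> ((\<lambda>s. snd c (\<gamma> s)) has_vector_derivative v s) (at s)" by blast
    have "norm (snd c (\<gamma> t1) - snd c (\<gamma> t\<^sub>0)) \<le> B * \<bar>t1 - t\<^sub>0\<bar>"
      by (rule vector_derivative_bound[of "{t\<^sub>0..t1}", OF _ has_vector_derivative_at_within[OF v(2)] v(1)])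
        (use t1' in auto)
    also have "\<dots> \<le> B * (t - t\<^sub>0)" using t1' B by (intro mult_left_mono) auto
    finally have "norm (snd c (\<gamma> t1) - x\<^sub>0) < r"
      using start(2) t(2) norm_triangle_ineq[of "snd c (\<gamma> t1) - snd c (\<gamma> t\<^sub>0)" "snd c (\<gamma> t\<^sub>0) - x\<^sub>0"] by simp
    then have "\<gamma> t1 \<in> W" using sub[of t1] t1'(1) by (simp add: W_def Zmem dist_norm norm_minus_commute)
    then show False using t1'(3) by blast
  qed
  then show ?thesis using WZ Zmem by blast
qed

lemma stays_in_ball:
  fixes \<gamma> :: "real \<Rightarrow> 'm"
  assumes c: "c \<in> A" and ball: "cball x\<^sub>0 r \<subseteq> chart_image c" and \<gamma>: "continuous_on UNIV \<gamma>"
    and speed: "\<And>t. \<gamma> t \<in> fst c \<Longrightarrow> snd c (\<gamma> t) \<in> cball x\<^sub>0 r \<Longrightarrow>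
      \<exists>v. norm v \<le> B \<and> ((\<lambda>s. snd c (\<gamma> s)) has_vector_derivative v) (at t)"
    and start: "\<gamma> t\<^sub>0 \<in> fst c" "norm (snd c (\<gamma> t\<^sub>0) - x\<^sub>0) \<le> r / 2"
    and r: "r > 0" and B: "B \<ge> 0" and t: "B * \<bar>t - t\<^sub>0\<bar> < r / 2"
  shows "\<gamma> t \<in> fst c \<and> snd c (\<gamma> t) \<in> cball x\<^sub>0 r"
proof (cases "t\<^sub>0 \<le> t")
  case True
  show ?thesis
    by (rule stays_in_ball_forward[where t\<^sub>0 = t\<^sub>0, OF c ball \<gamma> speed start r B True]) (use True t in auto)
next
  case False
  have "\<gamma> (- (- t)) \<in> fst c \<and> snd c (\<gamma> (- (- t))) \<in> cball x\<^sub>0 r"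
  proof (rule stays_in_ball_forward[where \<gamma> = "\<lambda>s. \<gamma> (- s)" and t\<^sub>0 = "- t\<^sub>0", OF c ball _ _ _ _ r B])
    show "continuous_on UNIV (\<lambda>s. \<gamma> (- s))" by (rule continuous_on_compose2[OF \<gamma>]) (auto intro: continuous_intros)
    show "B * (- t - - t\<^sub>0) < r / 2" "- t\<^sub>0 \<le> - t" using False t by auto
    show "\<gamma> (- (- t\<^sub>0)) \<in> fst c" "norm (snd c (\<gamma> (- (- t\<^sub>0))) - x\<^sub>0) \<le> r / 2" using start by simp_all
    fix s assume "\<gamma> (- s) \<in> fst c" "snd c (\<gamma> (- s)) \<in> cball x\<^sub>0 r"
    from speed[OF this] obtain v where v: "norm v \<le> B" "((\<lambda>s. snd c (\<gamma> s)) has_vector_derivative v) (at (- s))" by blast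
    have "((\<lambda>s. - s) has_vector_derivative (- 1 :: real)) (at s)" by (auto intro!: derivative_eq_intros)
    from vector_diff_chain_at[OF this v(2)]
    have "((\<lambda>s. snd c (\<gamma> (- s))) has_vector_derivative - v) (at s)" by (simp add: comp_def)
    then show "\<exists>v. norm v \<le> B \<and> ((\<lambda>s. snd c (\<gamma> (- s))) has_vector_derivative v) (at s)"
      using v(1) by (intro exI[of _ "- v"]) simp
  qed
  then show ?thesis by simp
qed

end

sublocale contact \<subseteq> reeb: vfield A R
proof
  fix c x\<^sub>0 assume c: "c \<in> A" and x0: "x\<^sub>0 \<in> chart_image c"
  obtain r where r: "r > 0" "cball x\<^sub>0 r \<subseteq> chart_image c"
    using open_chart_image[OF c] x0 open_contains_cball by metis
  have "\<forall>\<^sub>F C in at_top. (\<forall>x\<in>cball x\<^sub>0 r. norm (R c x) \<le> C \<and> (\<forall>y\<in>cball x\<^sub>0 r. norm (R c x - R c y) \<le> C * norm (x - y)) \<and>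
    (\<forall>r M. (\<forall>v. \<bar>E c x r v + \<alpha> c x r * \<alpha> c x v\<bar> \<le> M * norm v) \<longrightarrow> norm r \<le> C * M)) \<and> 0 \<le> C"
    using r by (intro eventually_conj reeb_bounds[OF c] eventually_ge_at_top) auto
  from eventually_at_top_ex[OF this]
  show "\<exists>r>0. \<exists>C\<ge>0. cball x\<^sub>0 r \<subseteq> chart_image c \<and>
      (\<forall>x\<in>cball x\<^sub>0 r. norm (R c x) \<le> C \<and> (\<forall>y\<in>cball x\<^sub>0 r. norm (R c x - R c y) \<le> C * norm (x - y)))"
    using r by blast
qed (rule reeb_pullback)

lemma (in contact) reeb_orbit_iff: "reeb_orbit A \<alpha> \<gamma> \<longleftrightarrow> reeb.integral_curve UNIV \<gamma>"
  by (simp add: reeb_orbit_def reeb.integral_curve_def)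

locale perturbed_zoll = conformal_contact A \<alpha> n g +
  bmp: bump "\<alpha> c\<^sub>0" da "ext_deriv \<alpha> c\<^sub>0" "reeb_field \<alpha> c\<^sub>0" x\<^sub>0 r C e \<sigma> \<rho> d h k K "reeb_field (conformal g \<alpha>) c\<^sub>0"
  for A :: "('m::t2_space, 'e::euclidean_space) chart set" and \<alpha> :: "('m, 'e) form1" and n g
    and c\<^sub>0 :: "('m, 'e) chart" and da x\<^sub>0 r C e \<sigma> \<rho> d h k K +
  fixes T :: real
  assumes c0: "c\<^sub>0 \<in> A" and ball: "cball x\<^sub>0 r \<subseteq> chart_image c\<^sub>0"
    and g_eq: "g m = (if m \<in> fst c\<^sub>0 then 1 + bmp.f (snd c\<^sub>0 m) else 1)"
    and zoll: "reeb_orbit A \<alpha> \<gamma> \<Longrightarrow> is_minimal_period \<gamma> T"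
    and \<sigma>_r': "160 * C * \<sigma> < r"
    and no_return: "x \<in> cball x\<^sub>0 (8 * C * \<sigma>) \<Longrightarrow> y \<in> cball x\<^sub>0 (8 * C * \<sigma>) \<Longrightarrow>
      t \<in> {r / (8 * C)..T - r / (8 * C)} \<Longrightarrow> reeb.flow (chart_inv c\<^sub>0 x) t \<noteq> chart_inv c\<^sub>0 y"
begin

text \<open>At speeds up to \<open>2 * C\<close> an orbit starting in the ball of radius
  \<open>r / 2\<close> moves by at most \<open>r / 4\<close> in this time, so it stays in the chart.
  On the other hand, \<tau> exceeds the time \<open>20 * \<sigma>\<close> that a crossing of the box
  can take.\<close>

definition \<tau> :: real where "\<tau> = r / (8 * C)"

lemma \<tau>_large: "20 * \<sigma> < \<tau>" "\<tau> > 0"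
  using \<sigma>_r' bmp.C bmp.r by (simp_all add: \<tau>_def field_simps)

definition chart_curve :: "('e \<Rightarrow> 'e) \<Rightarrow> (real \<Rightarrow> 'm) \<Rightarrow> bool" where
  "chart_curve X \<gamma> \<longleftrightarrow> continuous_on UNIV \<gamma> \<and>
     (\<forall>t. \<gamma> t \<in> fst c\<^sub>0 \<longrightarrow> ((\<lambda>s. snd c\<^sub>0 (\<gamma> s)) has_vector_derivative X (snd c\<^sub>0 (\<gamma> t))) (at t))"

abbreviation coord :: "(real \<Rightarrow> 'm) \<Rightarrow> real \<Rightarrow> 'e" where "coord \<gamma> t \<equiv> snd c\<^sub>0 (\<gamma> t)"

lemma chart_curve_integral: "reeb.integral_curve UNIV \<gamma> \<Longrightarrow> chart_curve (R c\<^sub>0) \<gamma>"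
  and chart_curve_integral_conf: "conf.reeb.integral_curve UNIV \<gamma> \<Longrightarrow> chart_curve (conf.R c\<^sub>0) \<gamma>"
  using c0 by (simp_all add: reeb.integral_curve_def conf.reeb.integral_curve_def chart_curve_def comp_def)

lemma near_chart_curve:
  assumes X: "bmp.near X" and \<gamma>: "chart_curve X \<gamma>" and start: "\<gamma> t\<^sub>0 \<in> fst c\<^sub>0" "norm (coord \<gamma> t\<^sub>0 - x\<^sub>0) \<le> r / 2"
  shows "t \<in> {t\<^sub>0 - \<tau>..t\<^sub>0 + \<tau>} \<Longrightarrow> \<gamma> t \<in> fst c\<^sub>0" "bmp.curve X (t\<^sub>0 - \<tau>) (t\<^sub>0 + \<tau>) (coord \<gamma>)"
proof -
  have *: "\<gamma> t \<in> fst c\<^sub>0 \<and> coord \<gamma> t \<in> cball x\<^sub>0 r" if t: "t \<in> {t\<^sub>0 - \<tau>..t\<^sub>0 + \<tau>}" for t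
  proof (rule stays_in_ball[where B = "2 * C" and \<gamma> = \<gamma> and t\<^sub>0 = t\<^sub>0, OF c0 ball _ _ start])
    have "2 * C * \<bar>t - t\<^sub>0\<bar> \<le> 2 * C * \<tau>" using t bmp.C by (intro mult_left_mono) auto
    also have "\<dots> < r / 2" using bmp.C bmp.r by (simp add: \<tau>_def)
    finally show "2 * C * \<bar>t - t\<^sub>0\<bar> < r / 2" .
    show "continuous_on UNIV \<gamma>" using \<gamma> by (simp add: chart_curve_def)
    fix t assume "\<gamma> t \<in> fst c\<^sub>0" "coord \<gamma> t \<in> cball x\<^sub>0 r"
    then show "\<exists>v. norm v \<le> 2 * C \<and> ((\<lambda>s. coord \<gamma> s) has_vector_derivative v) (at t)"
      using \<gamma> bmp.near_bounds(4)[OF X] unfolding chart_curve_def by blast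
  qed (use bmp.r bmp.C in auto)
  then show "t \<in> {t\<^sub>0 - \<tau>..t\<^sub>0 + \<tau>} \<Longrightarrow> \<gamma> t \<in> fst c\<^sub>0" by blast
  show "bmp.curve X (t\<^sub>0 - \<tau>) (t\<^sub>0 + \<tau>) (coord \<gamma>)"
    unfolding bmp.curve_def using * \<gamma> has_vector_derivative_at_within unfolding chart_curve_def by blast
qed

lemma drift:
  assumes X: "bmp.near X" and y: "bmp.curve X u v y" and uv: "u \<le> v" "v - u \<le> 20 * \<sigma>"
  shows "norm (bmp.z (y v) - bmp.z (y u)) \<le> \<sigma> / 2"
proof -
  have "norm (bmp.z (y v) - bmp.z (y u)) \<le> 1 / 40 * (v - u)"
    by (rule bmp.curve_z[OF y uv(1) bmp.near_bounds(3)[OF X bmp.curveD(1)[OF y]]])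
  then show ?thesis using uv by simp
qed

lemma box_half: "\<bar>bmp.s x\<bar> \<le> 5 * \<sigma> \<Longrightarrow> norm (bmp.z x) \<le> 3 * \<sigma> \<Longrightarrow> norm (x - x\<^sub>0) \<le> r / 2"
  using bmp.in_box_close[of x] \<sigma>_r' bmp.r by simp

text \<open>Within time \<open>20 * \<sigma>\<close> in both directions \<open>s\<close> runs
  through the whole length of the box, and \<open>drift\<close> widens the transversal bound by
  \<open>\<sigma> / 2\<close>. Applied twice, this leads from the width
  \<open>3 / 2 * \<sigma>\<close> of the support to \<open>2 * \<sigma>\<close> for the perturbed
  and \<open>5 / 2 * \<sigma>\<close> for the original crossing, both below
  \<open>3 * \<sigma>\<close>.\<close>

lemma crossing:
  assumes X: "bmp.near X" and \<gamma>: "chart_curve X \<gamma>" and start: "\<gamma> t\<^sub>0 \<in> fst c\<^sub>0"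
    and box: "\<bar>bmp.s (coord \<gamma> t\<^sub>0)\<bar> \<le> 5 * \<sigma>" "norm (bmp.z (coord \<gamma> t\<^sub>0)) \<le> \<zeta>" "\<zeta> \<le> 5 / 2 * \<sigma>"
  shows "\<exists>u v. t\<^sub>0 - \<tau> < u \<and> u \<le> t\<^sub>0 \<and> t\<^sub>0 \<le> v \<and> v < t\<^sub>0 + \<tau> \<and> u \<ge> t\<^sub>0 - 20 * \<sigma> \<and> v \<le> t\<^sub>0 + 20 * \<sigma> \<and>
    bmp.s (coord \<gamma> u) = - 5 * \<sigma> \<and> bmp.s (coord \<gamma> v) = 5 * \<sigma> \<and>
    (\<forall>t\<in>{u..v}. norm (bmp.z (coord \<gamma> t)) \<le> \<zeta> + \<sigma> / 2)"
proof -
  have "norm (coord \<gamma> t\<^sub>0 - x\<^sub>0) \<le> r / 2" using box bmp.pos by (intro box_half) auto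
  note y = near_chart_curve(2)[OF X \<gamma> start this]
  let ?u = "t\<^sub>0 - 20 * \<sigma>" and ?v = "t\<^sub>0 + 20 * \<sigma>"
  have sub: "bmp.curve X ?u t\<^sub>0 (coord \<gamma>)" "bmp.curve X t\<^sub>0 ?v (coord \<gamma>)"
    using \<tau>_large bmp.pos by (auto intro!: bmp.curve_sub[OF y])
  have "bmp.s (coord \<gamma> ?u) \<le> - 5 * \<sigma>" "5 * \<sigma> \<le> bmp.s (coord \<gamma> ?v)"
    using bmp.curve_s(1)[OF X sub(1)] bmp.curve_s(1)[OF X sub(2)] box(1) bmp.pos by auto
  moreover have c: "continuous_on {?u..t\<^sub>0} (\<lambda>t. bmp.s (coord \<gamma> t))" "continuous_on {t\<^sub>0..?v} (\<lambda>t. bmp.s (coord \<gamma> t))"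
    by (rule continuous_on_compose2[OF bmp.continuous_s[of UNIV] bmp.curve_continuous[OF sub(1)]], simp,
        rule continuous_on_compose2[OF bmp.continuous_s[of UNIV] bmp.curve_continuous[OF sub(2)]], simp)
  ultimately obtain u v where u: "?u \<le> u" "u \<le> t\<^sub>0" "bmp.s (coord \<gamma> u) = - 5 * \<sigma>"
    and v: "t\<^sub>0 \<le> v" "v \<le> ?v" "bmp.s (coord \<gamma> v) = 5 * \<sigma>"
    using IVT'[of "\<lambda>t. bmp.s (coord \<gamma> t)" ?u "- 5 * \<sigma>" t\<^sub>0] IVT'[of "\<lambda>t. bmp.s (coord \<gamma> t)" t\<^sub>0 "5 * \<sigma>" ?v]
      box(1) bmp.pos by (auto simp: abs_le_iff)
  have "norm (bmp.z (coord \<gamma> t)) \<le> \<zeta> + \<sigma> / 2" if t: "t \<in> {u..v}" for t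
  proof -
    have "norm (bmp.z (coord \<gamma> t) - bmp.z (coord \<gamma> t\<^sub>0)) \<le> \<sigma> / 2"
    proof (cases "t \<le> t\<^sub>0")
      case True
      have "bmp.curve X t t\<^sub>0 (coord \<gamma>)" by (rule bmp.curve_sub[OF sub(1)]) (use t u in auto)
      from drift[OF X this True] show ?thesis using t u by (simp add: norm_minus_commute)
    next
      case False
      have "bmp.curve X t\<^sub>0 t (coord \<gamma>)" by (rule bmp.curve_sub[OF sub(2)]) (use t v in auto)
      from drift[OF X this] show ?thesis using t v False by simp
    qed
    then show "norm (bmp.z (coord \<gamma> t)) \<le> \<zeta> + \<sigma> / 2"
      using box(2) norm_triangle_sub[of "bmp.z (coord \<gamma> t)" "bmp.z (coord \<gamma> t\<^sub>0)"] by linarith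
  qed
  then show ?thesis using u v \<tau>_large by (intro exI[of _ u] exI[of _ v]) auto
qed

text \<open>A closed set containing both bumps: on its open complement \<open>g\<close> is constant,
  so its derivatives vanish and the two Reeb fields agree. The faces of the box are at
  \<open>s = - 5 * \<sigma>\<close> and \<open>s = 5 * \<sigma>\<close>; the margin to
  \<open>4 * \<sigma>\<close> leaves room for small time intervals around the passages through the
  faces.\<close>

definition support :: "'m set" where
  "support = chart_inv c\<^sub>0 ` {x \<in> cball x\<^sub>0 r. \<bar>bmp.s x\<bar> \<le> 4 * \<sigma> \<and> norm (bmp.z x) \<le> 3 / 2 * \<sigma>}"

lemma support_iff: "m \<in> support \<longleftrightarrow>
    m \<in> fst c\<^sub>0 \<and> snd c\<^sub>0 m \<in> cball x\<^sub>0 r \<and> \<bar>bmp.s (snd c\<^sub>0 m)\<bar> \<le> 4 * \<sigma> \<and> norm (bmp.z (snd c\<^sub>0 m)) \<le> 3 / 2 * \<sigma>"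
proof
  assume "m \<in> support"
  then obtain x where x: "x \<in> cball x\<^sub>0 r" "\<bar>bmp.s x\<bar> \<le> 4 * \<sigma>" "norm (bmp.z x) \<le> 3 / 2 * \<sigma>" "m = chart_inv c\<^sub>0 x"
    unfolding support_def by blast
  moreover have "x \<in> chart_image c\<^sub>0" using x ball by blast
  ultimately show "m \<in> fst c\<^sub>0 \<and> snd c\<^sub>0 m \<in> cball x\<^sub>0 r \<and> \<bar>bmp.s (snd c\<^sub>0 m)\<bar> \<le> 4 * \<sigma> \<and> norm (bmp.z (snd c\<^sub>0 m)) \<le> 3 / 2 * \<sigma>"
    by (simp add: chart_inv_mem[OF c0] chart_chart_inv[OF c0])
next
  assume m: "m \<in> fst c\<^sub>0 \<and> snd c\<^sub>0 m \<in> cball x\<^sub>0 r \<and> \<bar>bmp.s (snd c\<^sub>0 m)\<bar> \<le> 4 * \<sigma> \<and> norm (bmp.z (snd c\<^sub>0 m)) \<le> 3 / 2 * \<sigma>"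
  then have "m = chart_inv c\<^sub>0 (snd c\<^sub>0 m)" by (simp add: chart_inv_chart[OF c0])
  then show "m \<in> support" unfolding support_def by (rule image_eqI) (use m in simp)
qed

lemma closed_support: "closed support"
proof (rule compact_imp_closed)
  let ?P = "{x \<in> cball x\<^sub>0 r. \<bar>bmp.s x\<bar> \<le> 4 * \<sigma> \<and> norm (bmp.z x) \<le> 3 / 2 * \<sigma>}"
  have "closed {x. \<bar>bmp.s x\<bar> \<le> 4 * \<sigma> \<and> norm (bmp.z x) \<le> 3 / 2 * \<sigma>}"
    by (intro closed_Collect_conj closed_Collect_le continuous_intros bmp.continuous_s bmp.continuous_z)
  then have "compact (cball x\<^sub>0 r \<inter> {x. \<bar>bmp.s x\<bar> \<le> 4 * \<sigma> \<and> norm (bmp.z x) \<le> 3 / 2 * \<sigma>})"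
    by (intro compact_Int_closed) auto
  then have "compact ?P" by (simp add: Int_def)
  then show "compact support" unfolding support_def
    by (rule compact_continuous_image[rotated]) (rule continuous_on_subset[OF cont_chart_inv[OF c0]], use ball in auto)
qed

lemma g_outside: "m \<notin> support \<Longrightarrow> g m = 1"
proof (rule ccontr)
  assume m: "m \<notin> support" and "g m \<noteq> 1"
  then have "m \<in> fst c\<^sub>0" "bmp.f (snd c\<^sub>0 m) \<noteq> 0" by (auto simp: g_eq split: if_splits)
  let ?x = "snd c\<^sub>0 m"
  have "bmp.Q1 ?x < 1 \<or> bmp.Q2 ?x < 1"
    using bmp.f_outside[of ?x] \<open>bmp.f ?x \<noteq> 0\<close> by (meson not_le)
  then have "\<bar>bmp.s ?x\<bar> \<le> 4 * \<sigma> \<and> norm (bmp.z ?x) \<le> 3 / 2 * \<sigma>"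
    using bmp.Q_support1[of ?x] bmp.Q_support2[of ?x] bmp.scales bmp.pos by force
  then have box: "\<bar>bmp.s ?x\<bar> \<le> 4 * \<sigma>" "norm (bmp.z ?x) \<le> 3 / 2 * \<sigma>" by blast+
  then have "norm (?x - x\<^sub>0) \<le> r / 2" using bmp.pos by (intro box_half) auto
  then have "?x \<in> cball x\<^sub>0 r" using bmp.r by (simp add: dist_norm norm_minus_commute)
  then show False using m box \<open>m \<in> fst c\<^sub>0\<close> by (simp add: support_iff)
qed

lemma conformal_reeb_outside:
  assumes c: "c \<in> A" and x: "x \<in> chart_image c" and out: "chart_inv c x \<notin> support"
  shows "conf.R c x = R c x"
proof (rule conf.reeb_eqI[OF c x])
  have "open (chart_image c \<inter> chart_inv c -` (- support))"
    by (rule continuous_open_preimage[OF cont_chart_inv[OF c] open_chart_image[OF c]]) (use closed_support in \<open>rule open_Compl\<close>)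
  moreover have "x \<in> chart_image c \<inter> chart_inv c -` (- support)" using x out by simp
  moreover have "1 = g (chart_inv c y)" if "y \<in> chart_image c \<inter> chart_inv c -` (- support)" for y
    using g_outside[of "chart_inv c y"] that by simp
  ultimately have "((\<lambda>x. g (chart_inv c x)) has_derivative (\<lambda>u. 0)) (at x)"
    by (rule has_derivative_transform_within_open[OF has_derivative_const])
  then have "dg c x = (\<lambda>u. 0)" using frechet_derivative_at by metis
  moreover have "g (chart_inv c x) = 1" by (rule g_outside[OF out])
  ultimately show "ext_deriv (conformal g \<alpha>) c x (R c x) v = 0" "conformal g \<alpha> c x (R c x) = 1" for v
    using conformal_ext_deriv[OF c x] E_reeb[OF c x] form_reeb[OF c x] by (simp_all add: conformal_def)
qed

lemma integral_curve_outside: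
  assumes "\<And>t. t \<in> S \<Longrightarrow> \<gamma> t \<notin> support"
  shows "conf.reeb.integral_curve S \<gamma> \<longleftrightarrow> reeb.integral_curve S \<gamma>"
proof -
  have "conf.R c (snd c (\<gamma> t)) = R c (snd c (\<gamma> t))" if "c \<in> A" "t \<in> S" "\<gamma> t \<in> fst c" for c t
    using assms[OF that(2)] by (intro conformal_reeb_outside that(1) chart_mem that(3)) (simp add: chart_inv_chart that)
  then show ?thesis unfolding reeb.integral_curve_def conf.reeb.integral_curve_def by auto
qed

section \<open>Periods of closed orbits through the box\<close>

lemma period: "reeb.flow q (t + T) = reeb.flow q t"
  using zoll[of "reeb.flow q"] reeb.flow_curve[of q] by (simp add: reeb_orbit_iff is_minimal_period_def is_period_def)

text \<open>\<open>\<tau>\<^sub>1\<close> is the time that the perturbed orbit spends in the box,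
  \<open>\<tau>\<^sub>0\<close> that of the original orbit with the same exit point. If
  \<open>S < T\<close>, the orbit closes up after exactly
  \<open>\<tau>\<^sub>1 + (T - \<tau>\<^sub>0)\<close>: it cannot be back earlier, and
  \<open>S < T\<close> bounds the excess by a time during which \<open>s\<close> increases strictly.
  Then \<open>crossing_time\<close> gives the contradiction.\<close>

lemma crossing_orbit_period:
  assumes \<gamma>: "conf.reeb.integral_curve UNIV \<gamma>" and S: "is_period \<gamma> S" and t: "\<gamma> t \<in> support"
  shows "T \<le> S"
proof (rule ccontr)
  assume "\<not> T \<le> S"
  then have ST: "S < T" by simp
  have S0: "S > 0" and S_per: "\<gamma> (t + S) = \<gamma> t" for t using S by (auto simp: is_period_def)
  note nR = bmp.near_R and nR' = bmp.near_R'
  note \<gamma>c = chart_curve_integral_conf[OF \<gamma>]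
  have tc: "\<gamma> t \<in> fst c\<^sub>0" "\<bar>bmp.s (coord \<gamma> t)\<bar> \<le> 5 * \<sigma>" "norm (bmp.z (coord \<gamma> t)) \<le> 3 / 2 * \<sigma>"
    using t bmp.pos by (auto simp: support_iff)
  have th: "norm (coord \<gamma> t - x\<^sub>0) \<le> r / 2" using tc bmp.pos by (intro box_half) auto
  have le: "3 / 2 * \<sigma> \<le> 5 / 2 * \<sigma>" "2 * \<sigma> \<le> 5 / 2 * \<sigma>" and sum: "3 / 2 * \<sigma> + \<sigma> / 2 = 2 * \<sigma>" "2 * \<sigma> + \<sigma> / 2 = 5 / 2 * \<sigma>"
    using bmp.pos by simp_all
  obtain ta tb where ab: "t - \<tau> < ta" "ta \<le> t" "t \<le> tb" "tb < t + \<tau>" and "ta \<ge> t - 20 * \<sigma>" "tb \<le> t + 20 * \<sigma>"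
    and ab_s: "bmp.s (coord \<gamma> ta) = - 5 * \<sigma>" "bmp.s (coord \<gamma> tb) = 5 * \<sigma>"
    and ab_z: "\<And>t. t \<in> {ta..tb} \<Longrightarrow> norm (bmp.z (coord \<gamma> t)) \<le> 2 * \<sigma>"
    using crossing[OF nR' \<gamma>c tc le(1), unfolded sum] by blast
  define \<tau>\<^sub>1 where "\<tau>\<^sub>1 = tb - ta"
  define q where "q = \<gamma> tb"
  have y1: "bmp.curve (conf.R c\<^sub>0) ta tb (coord \<gamma>)"
    by (rule bmp.curve_sub[OF near_chart_curve(2)[OF nR' \<gamma>c tc(1) th]]) (use ab in auto)
  have qc: "q \<in> fst c\<^sub>0" unfolding q_def by (rule near_chart_curve(1)[OF nR' \<gamma>c tc(1) th]) (use ab in auto)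
  define \<beta> where "\<beta> = reeb.flow q"
  have \<beta>: "reeb.integral_curve UNIV \<beta>" "\<beta> 0 = q" by (simp_all add: \<beta>_def reeb.flow_curve)
  have \<beta>_per: "\<beta> (t + T) = \<beta> t" for t by (simp add: \<beta>_def period)
  note \<beta>c = chart_curve_integral[OF \<beta>(1)]
  have q: "\<beta> 0 \<in> fst c\<^sub>0" "bmp.s (coord \<beta> 0) = 5 * \<sigma>" "norm (bmp.z (coord \<beta> 0)) \<le> 2 * \<sigma>"
    using qc ab(2,3) ab_s ab_z[of tb] \<beta>(2) by (auto simp: q_def)
  have qh: "norm (coord \<beta> 0 - x\<^sub>0) \<le> r / 2" using q bmp.pos by (intro box_half) auto
  have "\<bar>bmp.s (coord \<beta> 0)\<bar> \<le> 5 * \<sigma>" using q(2) bmp.pos by simp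
  \<comment> \<open>Backwards from the exit point the original orbit reaches the entrance face at
    time \<open>u\<close>; by periodicity it is there again at time \<open>T + u\<close>.\<close>
  then obtain u v where u': "0 - \<tau> < u" "u \<le> 0" "0 \<le> v" "v < 0 + \<tau>" "u \<ge> 0 - 20 * \<sigma>" "v \<le> 0 + 20 * \<sigma>"
    "bmp.s (coord \<beta> u) = - 5 * \<sigma>" "bmp.s (coord \<beta> v) = 5 * \<sigma>"
    "\<And>t. t \<in> {u..v} \<Longrightarrow> norm (bmp.z (coord \<beta> t)) \<le> 5 / 2 * \<sigma>"
    using crossing[OF nR \<beta>c q(1) _ q(3) le(2), unfolded sum] by blast
  then have u: "- \<tau> < u" "u \<le> 0" "u \<ge> - 20 * \<sigma>" "bmp.s (coord \<beta> u) = - 5 * \<sigma>"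
    and uz: "\<And>t. t \<in> {u..0} \<Longrightarrow> norm (bmp.z (coord \<beta> t)) \<le> 5 / 2 * \<sigma>" by auto
  define \<tau>\<^sub>0 where "\<tau>\<^sub>0 = - u"
  have \<tau>0: "0 \<le> \<tau>\<^sub>0" "\<tau>\<^sub>0 \<le> 20 * \<sigma>" "\<tau>\<^sub>0 < \<tau>" using u by (auto simp: \<tau>\<^sub>0_def)
  have \<beta>curve: "bmp.curve (R c\<^sub>0) (- \<tau>) \<tau> (coord \<beta>)" and \<beta>mem: "\<And>t. t \<in> {- \<tau>..\<tau>} \<Longrightarrow> \<beta> t \<in> fst c\<^sub>0"
    using near_chart_curve[OF nR \<beta>c q(1) qh] by simp_all
  have \<beta>s: "(t' - t) / 2 \<le> bmp.s (coord \<beta> t') - bmp.s (coord \<beta> t)"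
    "bmp.s (coord \<beta> t') - bmp.s (coord \<beta> t) \<le> 3 / 2 * (t' - t)" if "- \<tau> \<le> t" "t \<le> t'" "t' \<le> \<tau>" for t t'
    using bmp.curve_s[OF nR bmp.curve_sub[OF \<beta>curve that(1,3)] that(2)] by blast+
  \<comment> \<open>\<open>s\<close> grows strictly along the original orbit up to time \<tau>, so
    it cannot have closed up by then.\<close>
  have T\<tau>: "\<tau> < T"
  proof (rule ccontr)
    assume "\<not> \<tau> < T"
    then have "T / 2 \<le> bmp.s (coord \<beta> T) - bmp.s (coord \<beta> 0)" using \<beta>s(1)[of 0 T] ST S0 \<tau>_large by simp
    then show False using \<beta>_per[of 0] ST S0 by simp
  qed
  \<comment> \<open>Within this time of a passage through a face, \<open>s\<close> changes by at
    most \<open>3 / 4 * \<sigma>\<close> on the inner side, so \<beta> stays outside the support on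
    an open interval around the arc from exit to entrance. Uniqueness of integral curves is stated
    for open sets.\<close>
  define \<epsilon> where "\<epsilon> = \<sigma> / 2"
  have s_out: "\<bar>bmp.s (coord \<beta> t)\<bar> > 4 * \<sigma>" if "t \<in> {- \<epsilon>..\<tau>} \<or> t \<in> {- \<tau>..- \<tau>\<^sub>0 + \<epsilon>}" for t
    using that
  proof
    assume t: "t \<in> {- \<epsilon>..\<tau>}"
    show ?thesis
    proof (cases "t \<ge> 0")
      case True
      then show ?thesis using \<beta>s(1)[of 0 t] t q(2) bmp.pos \<tau>_large by simp
    next
      case False
      then show ?thesis using \<beta>s(2)[of t 0] t q(2) bmp.pos \<tau>_large by (simp add: \<epsilon>_def)
    qed
  next
    assume t: "t \<in> {- \<tau>..- \<tau>\<^sub>0 + \<epsilon>}"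
    have u': "bmp.s (coord \<beta> (- \<tau>\<^sub>0)) = - 5 * \<sigma>" using u(4) by (simp add: \<tau>\<^sub>0_def)
    show ?thesis
    proof (cases "t \<le> - \<tau>\<^sub>0")
      case True
      then show ?thesis using \<beta>s(1)[of t "- \<tau>\<^sub>0"] t u' bmp.pos \<tau>_large \<tau>0 by simp
    next
      case False
      then show ?thesis using \<beta>s(2)[of "- \<tau>\<^sub>0" t] t u' bmp.pos \<tau>_large \<tau>0 by (simp add: \<epsilon>_def)
    qed
  qed
  have not_box: "\<not> (\<beta> t \<in> fst c\<^sub>0 \<and> \<bar>bmp.s (coord \<beta> t)\<bar> \<le> 5 * \<sigma> \<and> norm (bmp.z (coord \<beta> t)) \<le> 3 * \<sigma>)"
    if t: "t \<in> {\<tau>..T - \<tau>}" for t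
  proof
    assume b: "\<beta> t \<in> fst c\<^sub>0 \<and> \<bar>bmp.s (coord \<beta> t)\<bar> \<le> 5 * \<sigma> \<and> norm (bmp.z (coord \<beta> t)) \<le> 3 * \<sigma>"
    then have 1: "coord \<beta> t \<in> cball x\<^sub>0 (8 * C * \<sigma>)"
      using bmp.in_box_close[of "coord \<beta> t"] by (simp add: dist_norm norm_minus_commute)
    have 2: "coord \<beta> 0 \<in> cball x\<^sub>0 (8 * C * \<sigma>)"
      using bmp.in_box_close[of "coord \<beta> 0"] q bmp.pos by (simp add: dist_norm norm_minus_commute)
    have "reeb.flow (chart_inv c\<^sub>0 (coord \<beta> 0)) t \<noteq> chart_inv c\<^sub>0 (coord \<beta> t)"
      by (rule no_return[OF 2 1]) (use t in \<open>simp add: \<tau>_def\<close>)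
    then show False using b q(1) by (simp add: chart_inv_chart[OF c0] \<beta>(2) \<beta>_def)
  qed
  have out: "\<beta> t \<notin> support" if t: "t \<in> {- \<epsilon>..T - \<tau>\<^sub>0 + \<epsilon>}" for t
  proof
    assume s: "\<beta> t \<in> support"
    consider "t \<in> {- \<epsilon>..\<tau>}" | "t \<in> {\<tau>..T - \<tau>}" | "t - T \<in> {- \<tau>..- \<tau>\<^sub>0 + \<epsilon>}" using t by fastforce
    then show False
    proof cases
      case 1
      then show False using s_out[of t] s by (simp add: support_iff)
    next
      case 2
      then show False using not_box[of t] s bmp.pos by (simp add: support_iff)
    next
      case 3
      then show False using s_out[of "t - T"] s \<beta>_per[of "t - T"] by (simp add: support_iff)
    qed
  qed
  have eq: "\<gamma> (tb + t) = \<beta> t" if t: "t \<in> {0..T - \<tau>\<^sub>0}" for t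
  proof -
    let ?J = "{- \<epsilon><..<T - \<tau>\<^sub>0 + \<epsilon>}"
    have \<epsilon>: "\<epsilon> > 0" using bmp.pos by (simp add: \<epsilon>_def)
    have \<beta>J: "conf.reeb.integral_curve ?J \<beta>"
      using integral_curve_outside[of ?J \<beta>] out reeb.integral_curve_subset[OF \<beta>(1)] by auto
    have \<gamma>J: "conf.reeb.integral_curve ?J (\<lambda>t. \<gamma> (t + tb))"
      using conf.reeb.integral_curve_subset[OF conf.reeb.integral_curve_shift[OF \<gamma>, of tb]] by simp
    have "\<beta> 0 = \<gamma> (0 + tb)" "0 \<in> ?J" "t \<in> ?J" using t \<epsilon> by (auto simp: \<beta>(2) q_def)
    then have "\<beta> t = \<gamma> (t + tb)"
      by (intro conf.reeb.integral_curve_unique[OF _ _ \<beta>J \<gamma>J, of 0 t]) auto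
    then show ?thesis by (simp add: add.commute)
  qed
  \<comment> \<open>The time by which the closing of the perturbed orbit lags behind the return of
    \<beta> to the entrance face; it turns out to vanish.\<close>
  define w where "w = S - \<tau>\<^sub>1 - (T - \<tau>\<^sub>0)"
  have p: "\<gamma> (ta + S) = \<gamma> ta" by (rule S_per)
  have ta: "bmp.s (coord \<gamma> (ta + S)) = - 5 * \<sigma>" "norm (bmp.z (coord \<gamma> (ta + S))) \<le> 2 * \<sigma>" "\<gamma> (ta + S) \<in> fst c\<^sub>0"
    unfolding p using ab(1-3) by (intro ab_s ab_z near_chart_curve(1)[OF nR' \<gamma>c tc(1) th]; simp)+
  have late: "\<tau>\<^sub>1 \<le> S"
  proof (rule ccontr)
    assume "\<not> \<tau>\<^sub>1 \<le> S"
    then have "bmp.curve (conf.R c\<^sub>0) ta (ta + S) (coord \<gamma>)" using bmp.curve_sub[OF y1] by (simp add: \<tau>\<^sub>1_def)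
    from bmp.curve_s(1)[OF nR' this] show False using S0 by (simp add: p)
  qed
  have \<tau>1: "0 \<le> \<tau>\<^sub>1" using ab by (simp add: \<tau>\<^sub>1_def)
  \<comment> \<open>If the orbit closed up earlier, its entrance point would lie on \<beta> before
    the time \<open>T - \<tau>\<^sub>0\<close>. Soon after the exit this contradicts the growth of
    \<open>s\<close> from \<open>5 * \<sigma>\<close>, in between it contradicts
    \<open>no_return\<close>, and shortly before the return it contradicts the growth of
    \<open>s\<close> towards the entrance face.\<close>
  have w0: "0 \<le> w"
  proof (rule ccontr)
    assume "\<not> 0 \<le> w"
    then have v: "S - \<tau>\<^sub>1 \<in> {0..T - \<tau>\<^sub>0}" "S - \<tau>\<^sub>1 < T - \<tau>\<^sub>0" using late by (auto simp: w_def)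
    have "\<gamma> (ta + S) = \<beta> (S - \<tau>\<^sub>1)" using eq[OF v(1)] by (simp add: \<tau>\<^sub>1_def add.commute)
    note b = ta[unfolded this]
    consider "S - \<tau>\<^sub>1 \<in> {0..\<tau>}" | "S - \<tau>\<^sub>1 \<in> {\<tau>..T - \<tau>}" | "S - \<tau>\<^sub>1 - T \<in> {- \<tau>..- \<tau>\<^sub>0}" using v by fastforce
    then show False
    proof cases
      case 1
      then show False using \<beta>s(1)[of 0 "S - \<tau>\<^sub>1"] b(1) q(2) bmp.pos \<tau>_large by simp
    next
      case 2
      then show False using not_box b bmp.pos by fastforce
    next
      case 3
      have "bmp.s (coord \<beta> (S - \<tau>\<^sub>1 - T)) = - 5 * \<sigma>" using b(1) \<beta>_per[of "S - \<tau>\<^sub>1 - T"] by simp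
      then show False using \<beta>s(1)[of "S - \<tau>\<^sub>1 - T" "- \<tau>\<^sub>0"] 3 u(4) v(2) \<tau>0 \<tau>_large by (simp add: \<tau>\<^sub>0_def)
    qed
  qed
  have w_le: "w \<le> \<tau>" using ST \<tau>1 \<tau>0 by (simp add: w_def)
  let ?t = "tb + (T - \<tau>\<^sub>0)"
  have p': "\<gamma> ?t = \<beta> (- \<tau>\<^sub>0)" using eq[of "T - \<tau>\<^sub>0"] \<beta>_per[of "- \<tau>\<^sub>0"] T\<tau> \<tau>0 by simp
  have p'c: "\<gamma> ?t \<in> fst c\<^sub>0" "bmp.s (coord \<gamma> ?t) = - 5 * \<sigma>" "norm (bmp.z (coord \<gamma> ?t)) \<le> 5 / 2 * \<sigma>"
    using \<beta>mem[of "- \<tau>\<^sub>0"] \<tau>0 u(2,4) uz[of u] \<tau>_large by (simp_all add: p') (simp_all add: \<tau>\<^sub>0_def)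
  have p'h: "norm (coord \<gamma> ?t - x\<^sub>0) \<le> r / 2" using p'c bmp.pos by (intro box_half) auto
  \<comment> \<open>At the times \<open>?t\<close> and \<open>?t + w\<close> the orbit is on the
    same face \<open>s = - 5 * \<sigma>\<close>. They are at most \<tau> apart, and \<open>s\<close>
    increases strictly in between.\<close>
  have "w = 0"
  proof (rule ccontr)
    assume "w \<noteq> 0"
    have "bmp.curve (conf.R c\<^sub>0) ?t (?t + w) (coord \<gamma>)"
      by (rule bmp.curve_sub[OF near_chart_curve(2)[OF nR' \<gamma>c p'c(1) p'h]]) (use w_le \<tau>_large in auto)
    from bmp.curve_s(1)[OF nR' this] w0
    have "w / 2 \<le> bmp.s (coord \<gamma> (?t + w)) - bmp.s (coord \<gamma> ?t)" by simp
    moreover have "?t + w = ta + S" by (simp add: w_def \<tau>\<^sub>1_def)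
    ultimately show False using ta(1) p'c(2) w0 \<open>w \<noteq> 0\<close> by simp
  qed
  then have S_eq: "S = T + \<tau>\<^sub>1 - \<tau>\<^sub>0" by (simp add: w_def)
  then have "ta + S = ?t" by (simp add: \<tau>\<^sub>1_def)
  then have start: "\<gamma> ta = \<beta> (- \<tau>\<^sub>0)" using p p' by simp
  have shift: "bmp.curve X 0 (v - u) (\<lambda>t. y (u + t))" if "bmp.curve X u v y" for X u v y
    unfolding bmp.curve_def
  proof
    fix t assume t: "t \<in> {0..v - u}"
    then have ut: "u + t \<in> {u..v}" by auto
    have "((\<lambda>t. u + t) has_vector_derivative 1) (at t within {0..v - u})" by (auto intro!: derivative_eq_intros)
    moreover have "(\<lambda>t. u + t) ` {0..v - u} = {u..v}" by simp
    ultimately have "(y \<circ> (\<lambda>t. u + t) has_vector_derivative 1 *\<^sub>R X (y (u + t))) (at t within {0..v - u})"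
      using bmp.curveD(2)[OF that ut] by (intro vector_diff_chain_within) simp_all
    then show "y (u + t) \<in> cball x\<^sub>0 r \<and> ((\<lambda>t. y (u + t)) has_vector_derivative X (y (u + t))) (at t within {0..v - u})"
      using bmp.curveD(1)[OF that ut] by (simp add: comp_def)
  qed
  have "\<tau>\<^sub>0 \<le> \<tau>\<^sub>1"
  proof (rule bmp.crossing_time)
    show "bmp.curve (conf.R c\<^sub>0) 0 \<tau>\<^sub>1 (\<lambda>t. coord \<gamma> (ta + t))" using shift[OF y1] by (simp add: \<tau>\<^sub>1_def)
    have "bmp.curve (R c\<^sub>0) (- \<tau>\<^sub>0) 0 (coord \<beta>)" by (rule bmp.curve_sub[OF \<beta>curve]) (use \<tau>0 \<tau>_large in auto)
    from shift[OF this] show "bmp.curve (R c\<^sub>0) 0 \<tau>\<^sub>0 (\<lambda>t. coord \<beta> (- \<tau>\<^sub>0 + t))" by simp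
    show "\<forall>t\<in>{0..\<tau>\<^sub>0}. norm (bmp.z (coord \<beta> (- \<tau>\<^sub>0 + t))) \<le> 3 * \<sigma>"
    proof
      fix t assume "t \<in> {0..\<tau>\<^sub>0}"
      then have "norm (bmp.z (coord \<beta> (- \<tau>\<^sub>0 + t))) \<le> 5 / 2 * \<sigma>" by (intro uz) (auto simp: \<tau>\<^sub>0_def)
      then show "norm (bmp.z (coord \<beta> (- \<tau>\<^sub>0 + t))) \<le> 3 * \<sigma>" using bmp.pos by simp
    qed
    show "\<forall>t\<in>{0..\<tau>\<^sub>1}. norm (bmp.z (coord \<gamma> (ta + t))) \<le> 3 * \<sigma>"
    proof
      fix t assume "t \<in> {0..\<tau>\<^sub>1}"
      then have "norm (bmp.z (coord \<gamma> (ta + t))) \<le> 2 * \<sigma>" by (intro ab_z) (auto simp: \<tau>\<^sub>1_def)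
      then show "norm (bmp.z (coord \<gamma> (ta + t))) \<le> 3 * \<sigma>" using bmp.pos by simp
    qed
  qed (use \<tau>1 \<tau>0 ab_s start \<beta>(2) in \<open>simp_all add: \<tau>\<^sub>1_def q_def\<close>)
  then show False using S_eq ST by simp
qed

theorem perturbed_period:
  assumes "reeb_orbit A (conformal g \<alpha>) \<gamma>" "is_period \<gamma> S"
  shows "T \<le> S"
proof (cases "\<exists>t. \<gamma> t \<in> support")
  case True
  then show ?thesis using crossing_orbit_period[of \<gamma> S] assms by (auto simp: conf.reeb_orbit_iff)
next
  case False
  then have "reeb_orbit A \<alpha> \<gamma>"
    using assms(1) integral_curve_outside[of UNIV \<gamma>] by (simp add: reeb_orbit_iff conf.reeb_orbit_iff)
  from zoll[OF this] show ?thesis using assms(2) by (simp add: is_minimal_period_def)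
qed

end

subsection \<open>The volume of the perturbed form\<close>

context conformal_contact
begin

lemma conformal_weight:
  assumes "c \<in> A" "x \<in> chart_image c"
  shows "conf.weight c x = g (chart_inv c x) ^ n * weight c x"
  using g_pos[of "chart_inv c x"] by (simp add: conf.weight_def weight_def conformal_volume[OF assms] abs_mult)

lemma conformal_volume_unchanged:
  assumes S: "S \<in> sets borel" and g: "\<And>m. m \<in> S \<Longrightarrow> g m = 1"
  shows "emeasure (contact_measure A n (conformal g \<alpha>)) S = emeasure (contact_measure A n \<alpha>) S"
proof -
  obtain k c U where U: "\<And>i. i < k \<Longrightarrow> c i \<in> A" "\<And>i. i < k \<Longrightarrow> U i \<subseteq> fst (c i)" "\<And>i. i < (k::nat) \<Longrightarrow> U i \<in> sets borel"
    "disjoint_family_on U {..<k}" "(\<Union>i<k. U i) = UNIV" using dens.finite_pieces by metis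
  have sets: "sets (contact_measure A n (conformal g \<alpha>)) = sets borel" "sets (contact_measure A n \<alpha>) = sets borel"
    using contact_measure conf.contact_measure by (simp_all add: dens.vol_measure_def conf.dens.vol_measure_def)
  have piece: "emeasure (contact_measure A n (conformal g \<alpha>)) (S \<inter> U i) = emeasure (contact_measure A n \<alpha>) (S \<inter> U i)" if i: "i < k" for i
  proof -
    have B: "S \<inter> U i \<in> sets borel" "S \<inter> U i \<subseteq> fst (c i)" using S U(2,3)[OF i] by auto
    have "conf.weight (c i) x = weight (c i) x" if "x \<in> snd (c i) ` (S \<inter> U i)" for x
    proof -
      obtain m where m: "m \<in> S" "m \<in> fst (c i)" "x = snd (c i) m" using \<open>x \<in> _\<close> B(2) by blast
      then show ?thesis
        using conformal_weight[OF U(1)[OF i] chart_mem[OF m(2)]] g[OF m(1)] by (simp add: chart_inv_chart[OF U(1)[OF i]])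
    qed
    then have "conf.dens.chart_vol (c i) (S \<inter> U i) = dens.chart_vol (c i) (S \<inter> U i)"
      unfolding conf.dens.chart_vol_def dens.chart_vol_def by (intro nn_integral_cong) (simp add: indicator_def)
    then show ?thesis
      using contact_measure conf.contact_measure U(1)[OF i] B
      by (simp add: dens.vol_measure_def conf.dens.vol_measure_def)
  qed
  have split: "emeasure \<mu> S = (\<Sum>i<k. emeasure \<mu> (S \<inter> U i))" if "sets \<mu> = sets borel" for \<mu> :: "'m measure"
  proof -
    have "S = (\<Union>i<k. S \<inter> U i)" using U(5) by auto
    moreover have "disjoint_family_on (\<lambda>i. S \<inter> U i) {..<k}"
      using U(4) by (auto simp: disjoint_family_on_def)
    ultimately show ?thesis using S U(3) that by (subst sum_emeasure) auto
  qed
  show ?thesis unfolding split[OF sets(1)] split[OF sets(2)] by (intro sum.cong refl piece) auto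
qed

lemma conformal_volume_less:
  assumes c: "c \<in> A" and ball: "cball x\<^sub>0 r \<subseteq> chart_image c"
    and g: "\<And>m. m \<notin> chart_inv c ` cball x\<^sub>0 r \<Longrightarrow> g m = 1"
    and less: "integral (cball x\<^sub>0 r) (conf.weight c) < integral (cball x\<^sub>0 r) (weight c)"
  shows "contact_volume A n (conformal g \<alpha>) < contact_volume A n \<alpha>" "contact_volume A n \<alpha> < \<infinity>"
proof -
  let ?Z = "chart_inv c ` cball x\<^sub>0 r" and ?\<mu> = "contact_measure A n \<alpha>" and ?\<mu>' = "contact_measure A n (conformal g \<alpha>)"
  have "compact ?Z"
    by (rule compact_continuous_image[OF continuous_on_subset[OF cont_chart_inv[OF c] ball]]) simp
  then have Z: "?Z \<in> sets borel" by (intro borel_closed compact_imp_closed)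
  have sub: "?Z \<subseteq> fst c" using ball chart_inv_mem[OF c] by blast
  have img: "snd c ` ?Z = cball x\<^sub>0 r"
  proof -
    have "(\<lambda>x. snd c (chart_inv c x)) ` cball x\<^sub>0 r = (\<lambda>x. x) ` cball x\<^sub>0 r"
      using ball by (intro image_cong refl chart_chart_inv[OF c]) blast
    then show ?thesis by (simp add: image_image)
  qed
  have sets: "sets ?\<mu>' = sets borel" "sets ?\<mu> = sets borel"
    using contact_measure conf.contact_measure by (simp_all add: dens.vol_measure_def conf.dens.vol_measure_def)
  have "emeasure ?\<mu> ?Z = dens.chart_vol c ?Z" "emeasure ?\<mu>' ?Z = conf.dens.chart_vol c ?Z"
    using contact_measure conf.contact_measure c Z sub by (simp_all add: dens.vol_measure_def conf.dens.vol_measure_def)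
  moreover have "dens.chart_vol c ?Z = ennreal (integral (cball x\<^sub>0 r) (weight c))"
    unfolding dens.chart_vol_def img
    by (intro nn_integral_absolutely_integrable absolutely_integrable_compact continuous_on_subset[OF weight_continuous[OF c] ball])
      (auto simp: weight_def)
  moreover have "conf.dens.chart_vol c ?Z = ennreal (integral (cball x\<^sub>0 r) (conf.weight c))"
    unfolding conf.dens.chart_vol_def img
    by (intro nn_integral_absolutely_integrable absolutely_integrable_compact continuous_on_subset[OF conf.weight_continuous[OF c] ball])
      (auto simp: conf.weight_def)
  moreover have "0 \<le> integral (cball x\<^sub>0 r) (conf.weight c)"
    by (intro integral_nonneg set_lebesgue_integral_eq_integral(1) absolutely_integrable_compact
        continuous_on_subset[OF conf.weight_continuous[OF c] ball]) (auto simp: conf.weight_def)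
  ultimately have lessZ: "emeasure ?\<mu>' ?Z < emeasure ?\<mu> ?Z" using less by (simp add: ennreal_lessI)
  show fin: "contact_volume A n \<alpha> < \<infinity>"
    unfolding contact_volume_def by (rule dens.vol_measure_finite[OF contact_measure])
  have split: "emeasure \<nu> UNIV = emeasure \<nu> ?Z + emeasure \<nu> (- ?Z)" if "sets \<nu> = sets borel" for \<nu> :: "'m measure"
    using plus_emeasure[of ?Z \<nu> "- ?Z"] Z that by (simp add: Compl_eq_Diff_UNIV)
  have outside: "emeasure ?\<mu>' (- ?Z) = emeasure ?\<mu> (- ?Z)"
    by (rule conformal_volume_unchanged) (use Z g in auto)
  \<comment> \<open>The common volume outside the ball can be added to a strict inequality in
    \<open>ennreal\<close> without losing strictness only if it is finite.\<close>
  have "emeasure ?\<mu> (- ?Z) < \<infinity>"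
    using fin emeasure_mono[of "- ?Z" UNIV ?\<mu>] sets unfolding contact_volume_def by (simp add: order_le_less_trans)
  then have "emeasure ?\<mu>' ?Z + emeasure ?\<mu> (- ?Z) < emeasure ?\<mu> ?Z + emeasure ?\<mu> (- ?Z)"
    using lessZ by (simp add: add.commute[of _ "emeasure ?\<mu> (- ?Z)"] ennreal_add_left_cancel_less)
  then show "contact_volume A n (conformal g \<alpha>) < contact_volume A n \<alpha>"
    unfolding contact_volume_def split[OF sets(1)] split[OF sets(2)] outside .
qed

end

text \<open>\<open>(1 + t) ^ n\<close> is convex in \<open>t\<close>, so on the unit interval it
  lies below its chord.\<close>

lemma one_plus_power_le:
  fixes t :: real
  assumes "0 \<le> t" "t \<le> 1"
  shows "(1 + t) ^ n \<le> 1 + (2 ^ n - 1) * t"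
proof (induction n)
  case (Suc n)
  have "(1 + t) ^ Suc n \<le> (1 + t) * (1 + (2 ^ n - 1) * t)" using Suc assms by (simp add: mult_left_mono)
  also have "\<dots> = 1 + 2 ^ n * t + (2 ^ n - 1) * (t * t)" by (simp add: algebra_simps)
  also have "\<dots> \<le> 1 + 2 ^ n * t + (2 ^ n - 1) * t"
    using assms mult_left_mono[of t 1 t] by (intro add_left_mono mult_left_mono) auto
  also have "\<dots> = 1 + (2 ^ Suc n - 1) * t" by (simp add: algebra_simps)
  finally show ?case .
qed simp

context bump_setup
begin

lemma s_affine: "s (x\<^sub>0 + u) = a x\<^sub>0 u" and z_affine: "z (x\<^sub>0 + u) = proj u"
  by (simp_all add: s_def z_def)

text \<open>An affine map contracting by the factor \<open>d / (2 \<rho>)\<close> carries the support of the first bump into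
  the region where the second bump is large.\<close>

lemma support_volumes:
  assumes d: "d \<le> \<rho>" and sub: "{x. Q1 x \<le> 1} \<subseteq> cball x\<^sub>0 r" "{x. Q2 x \<le> 1 / 2} \<subseteq> cball x\<^sub>0 r"
  shows "measure lebesgue {x. Q1 x \<le> 1} \<le> (2 * \<rho> / d) ^ DIM('e) * measure lebesgue {x. Q2 x \<le> 1 / 2}"
    and "measure lebesgue {x. Q2 x \<le> 1 / 2} > 0"
    and "{x. Q1 x \<le> 1} \<in> lmeasurable" "{x. Q2 x \<le> 1 / 2} \<in> lmeasurable"
proof -
  let ?S1 = "{x. Q1 x \<le> 1}" and ?S2 = "{x. Q2 x \<le> 1 / 2}"
  have "closed ?S1" "closed ?S2"
    by (intro closed_Collect_le continuous_intros continuous_Q1 continuous_Q2)+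
  then have "compact ?S1" "compact ?S2"
    using sub bounded_subset[OF bounded_cball] by (auto simp: compact_eq_bounded_closed)
  then show m: "?S1 \<in> lmeasurable" "?S2 \<in> lmeasurable" by (auto intro: lmeasurable_compact)
  have "open {x. Q2 x < 1 / 2}" by (intro open_Collect_less continuous_intros continuous_Q2)
  moreover have "Q2 (x\<^sub>0 + (- 3 * \<sigma>) *\<^sub>R R x\<^sub>0) = 0"
    unfolding Q2_def s_affine z_affine using pos
    by (simp add: linear_scale[OF ell_linear] ell_R linear_neg[OF ell_linear]
        linear_neg[OF bounded_linear.linear[OF proj_bounded_linear]]
        linear_scale[OF bounded_linear.linear[OF proj_bounded_linear]] proj_R0)
  then have "{x. Q2 x < 1 / 2} \<noteq> {}" by (auto intro!: exI[of _ "x\<^sub>0 + (- 3 * \<sigma>) *\<^sub>R R x\<^sub>0"])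
  ultimately have "\<not> negligible {x. Q2 x < 1 / 2}" by (rule open_not_negligible)
  then have "\<not> negligible ?S2" by (rule contrapos_nn) (auto elim: negligible_subset)
  then show "measure lebesgue ?S2 > 0"
    using negligible_iff_measure0[OF m(2)] measure_nonneg[of lebesgue ?S2] by linarith
  define \<mu> where "\<mu> = d / (2 * \<rho>)"
  have \<mu>: "\<mu> > 0" "\<mu> \<le> 1 / 2" using pos d by (simp_all add: \<mu>_def field_simps)
  define w where "w = x\<^sub>0 + (3 * \<sigma>) *\<^sub>R R x\<^sub>0 + \<rho> *\<^sub>R e"
  define \<delta> where "\<delta> = x\<^sub>0 - (3 * \<sigma>) *\<^sub>R R x\<^sub>0 - \<mu> *\<^sub>R w"
  have "(\<lambda>x. \<mu> *\<^sub>R x + \<delta>) ` ?S1 \<subseteq> ?S2"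
  proof (rule image_subsetI)
    fix x assume "x \<in> ?S1"
    then have Q: "(s x / \<sigma> - 3)\<^sup>2 \<le> 1" "(norm (z x - \<rho> *\<^sub>R e) / \<rho>)\<^sup>2 \<le> 1"
      using zero_le_power2[of "s x / \<sigma> - 3"] zero_le_power2[of "norm (z x - \<rho> *\<^sub>R e) / \<rho>"]
      unfolding Q1_def mem_Collect_eq by linarith+
    interpret l: linear "a x\<^sub>0" by (rule ell_linear)
    interpret p: linear proj by (rule bounded_linear.linear[OF proj_bounded_linear])
    define u where "u = x - x\<^sub>0"
    have su: "s x = a x\<^sub>0 u" "z x = proj u" by (simp_all add: s_def z_def u_def)
    have y: "\<mu> *\<^sub>R x + \<delta> = x\<^sub>0 + (\<mu> *\<^sub>R (u - (3 * \<sigma>) *\<^sub>R R x\<^sub>0 - \<rho> *\<^sub>R e) - (3 * \<sigma>) *\<^sub>R R x\<^sub>0)"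
      by (simp add: u_def \<delta>_def w_def algebra_simps)
    have "s (\<mu> *\<^sub>R x + \<delta>) / \<sigma> + 3 = \<mu> * (s x / \<sigma> - 3)"
      using pos unfolding y s_affine su by (simp add: l.add l.diff l.scale ell_R e_kernel field_simps)
    moreover have "z (\<mu> *\<^sub>R x + \<delta>) = \<mu> *\<^sub>R (z x - \<rho> *\<^sub>R e)"
      unfolding y z_affine su by (simp add: p.diff p.scale proj_R0 proj_e)
    then have "norm (z (\<mu> *\<^sub>R x + \<delta>)) / d = 1 / 2 * (norm (z x - \<rho> *\<^sub>R e) / \<rho>)"
      using pos by (simp add: \<mu>_def)
    ultimately have "Q2 (\<mu> *\<^sub>R x + \<delta>) = \<mu>\<^sup>2 * (s x / \<sigma> - 3)\<^sup>2 + (1 / 2)\<^sup>2 * (norm (z x - \<rho> *\<^sub>R e) / \<rho>)\<^sup>2"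
      unfolding Q2_def by (simp only: power_mult_distrib)
    also have "\<dots> \<le> (1 / 2)\<^sup>2 * 1 + (1 / 2)\<^sup>2 * 1"
      using Q \<mu> by (intro add_mono mult_mono power_mono) auto
    finally show "\<mu> *\<^sub>R x + \<delta> \<in> ?S2" by (simp add: power2_eq_square)
  qed
  moreover have "(\<lambda>x. \<mu> *\<^sub>R x + \<delta>) ` ?S1 \<in> sets lebesgue"
  proof -
    have "compact ((\<lambda>x. \<mu> *\<^sub>R x + \<delta>) ` ?S1)"
      by (intro compact_continuous_image continuous_intros) fact
    then show ?thesis using lmeasurable_compact by blast
  qed
  ultimately have "measure lebesgue ((\<lambda>x. \<mu> *\<^sub>R x + \<delta>) ` ?S1) \<le> measure lebesgue ?S2"
    by (rule measure_mono_fmeasurable[OF _ _ m(2)])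
  then have "\<mu> ^ DIM('e) * measure lebesgue ?S1 \<le> measure lebesgue ?S2"
    using \<mu> by (simp add: measure_lebesgue_affine)
  then have "(2 * \<rho> / d) ^ DIM('e) * (\<mu> ^ DIM('e) * measure lebesgue ?S1) \<le> (2 * \<rho> / d) ^ DIM('e) * measure lebesgue ?S2"
    using pos by (intro mult_left_mono) auto
  moreover have "(2 * \<rho> / d) ^ DIM('e) * \<mu> ^ DIM('e) = 1"
    using pos by (simp add: \<mu>_def power_mult_distrib[symmetric])
  ultimately show "measure lebesgue ?S1 \<le> (2 * \<rho> / d) ^ DIM('e) * measure lebesgue ?S2"
    by (simp only: mult.assoc[symmetric])
qed

text \<open>On the support of the first bump the integrand grows by at most \<open>P\<close>. Where
  \<open>Q2 \<le> 1 / 2\<close> it drops by at least \<open>N\<close>, with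
  \<open>exp (- 2) = flat (1 / 2)\<close>, and elsewhere it does not grow.
  \<open>support_volumes\<close> compares the two regions, and \<open>small\<close> says that the
  loss prevails.\<close>

lemma integral_decrease:
  fixes w :: "'e \<Rightarrow> real"
  assumes d: "d \<le> \<rho>" and sub: "{x. Q1 x \<le> 1} \<subseteq> cball x\<^sub>0 r" "{x. Q2 x \<le> 1 / 2} \<subseteq> cball x\<^sub>0 r"
    and w: "continuous_on (cball x\<^sub>0 r) w" "\<And>x. x \<in> cball x\<^sub>0 r \<Longrightarrow> m \<le> w x \<and> w x \<le> M" and m: "m > 0" and n: "n \<ge> 1"
    and hk: "h \<le> 1" "k \<le> 1" and small: "2 ^ n * h * M * (2 * \<rho> / d) ^ DIM('e) < k * exp (- 2) * m"
  shows "integral (cball x\<^sub>0 r) (\<lambda>x. (1 + f x) ^ n * w x) < integral (cball x\<^sub>0 r) w"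
proof -
  let ?B = "cball x\<^sub>0 r" and ?S1 = "{x. Q1 x \<le> 1}" and ?S2 = "{x. Q2 x \<le> 1 / 2}"
  note vol = support_volumes[OF d sub]
  define P where "P = 2 ^ n * h * M"
  define N where "N = k * exp (- 2) * m"
  have M: "M > 0" using w(2)[OF x0_mem] m by linarith
  have P: "P > 0" and N: "N > 0" using pos M m by (simp_all add: P_def N_def)
  have bound: "(1 + f x) ^ n * w x - w x \<le> P * indicator ?S1 x - N * indicator ?S2 x" if x: "x \<in> ?B" for x
  proof (cases "Q1 x < 1")
    case True
    then have Q2: "Q2 x \<ge> 1" using Q_support1[of x] Q_support2[of x] pos by linarith
    then have f: "f x = h * flat (1 - Q1 x)" by (simp add: f_def flat_eq_0)
    then have f1: "0 \<le> f x" "f x \<le> h" using pos flat_nonneg flat_le_1 by (simp_all add: mult_left_le)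
    have "(1 + f x) ^ n - 1 \<le> (2 ^ n - 1) * f x" using one_plus_power_le[of "f x" n] f1 hk by simp
    also have "\<dots> \<le> 2 ^ n * h" using f1 by (intro mult_mono) auto
    finally have "((1 + f x) ^ n - 1) * w x \<le> 2 ^ n * h * M"
      using w(2)[OF x] m pos by (intro mult_mono) auto
    then show ?thesis using True Q2 by (simp add: P_def algebra_simps)
  next
    case False
    then have f: "f x = - (k * flat (1 - Q2 x))" by (simp add: f_def flat_eq_0)
    have kf: "0 \<le> k * flat (1 - Q2 x)" "k * flat (1 - Q2 x) \<le> 1"
      using pos hk flat_nonneg flat_le_1 by (auto intro: mult_le_one)
    have "(1 + f x) ^ n \<le> (1 + f x) ^ 1" using kf n f by (intro power_decreasing) auto
    then have 1: "(1 + f x) ^ n - 1 \<le> - (k * flat (1 - Q2 x))" using f by simp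
    have w0: "0 \<le> w x" "m \<le> w x" using w(2)[OF x] m by auto
    have 2: "k * flat (1 - Q2 x) * w x \<ge> N * indicator ?S2 x"
    proof (cases "Q2 x \<le> 1 / 2")
      case True
      have "exp (- 2) = flat (1 / 2)" by (simp add: flat_def)
      also have "\<dots> \<le> flat (1 - Q2 x)" using True by (intro flat_mono) simp
      finally have "k * exp (- 2) * m \<le> k * flat (1 - Q2 x) * w x"
        using pos m w0 kf by (intro mult_mono mult_left_mono) auto
      then show ?thesis using True by (simp add: N_def)
    qed (use kf w0 in simp)
    have "((1 + f x) ^ n - 1) * w x \<le> - (k * flat (1 - Q2 x)) * w x" using 1 w0 by (intro mult_right_mono) auto
    then show ?thesis using 2 P by (simp add: algebra_simps indicator_def)
  qed
  have cf: "continuous_on ?B (\<lambda>x. (1 + f x) ^ n * w x)" by (intro continuous_intros continuous_f w(1))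
  have int: "(\<lambda>x. (1 + f x) ^ n * w x) integrable_on ?B" "w integrable_on ?B"
    using absolutely_integrable_compact[OF cf] absolutely_integrable_compact[OF w(1)]
    by (auto intro: set_lebesgue_integral_eq_integral(1))
  have iS: "indicat_real ?S1 integrable_on ?B" "indicat_real ?S2 integrable_on ?B"
    using vol(3,4) sub by (simp_all add: integrable_on_indicator Int_absorb2)
  have "integral ?B (\<lambda>x. (1 + f x) ^ n * w x) - integral ?B w = integral ?B (\<lambda>x. (1 + f x) ^ n * w x - w x)"
    by (rule integral_diff[OF int, symmetric])
  also have "\<dots> \<le> integral ?B (\<lambda>x. P * indicator ?S1 x - N * indicator ?S2 x)"
    by (intro integral_le integrable_diff int integrable_on_mult_right iS bound)
  also have "\<dots> = P * integral ?B (indicator ?S1) - N * integral ?B (indicator ?S2)"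
    by (simp only: integral_diff[OF integrable_on_mult_right[OF iS(1)] integrable_on_mult_right[OF iS(2)]]
        Henstock_Kurzweil_Integration.integral_mult_right)
  also have "\<dots> = P * measure lebesgue ?S1 - N * measure lebesgue ?S2"
    using vol(3,4) sub by (simp add: Equivalence_Lebesgue_Henstock_Integration.integral_indicator Int_absorb2)
  also have "\<dots> \<le> (P * (2 * \<rho> / d) ^ DIM('e) - N) * measure lebesgue ?S2"
    using mult_left_mono[OF vol(1), of P] P by (simp add: algebra_simps)
  also have "\<dots> < 0" using small vol(2) by (intro mult_neg_pos) (auto simp: P_def N_def)
  finally show ?thesis by simp
qed

end

subsection \<open>The family of perturbations\<close>

text \<open>The constant \<open>C\<close> is found first, on some ball; the radius is then made
  small in terms of \<open>C\<close>, which stays the same.\<close>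

lemma local_model_shrink:
  assumes "local_model a da E R x\<^sub>0 r C" "0 < r'" "r' \<le> r"
  shows "local_model a da E R x\<^sub>0 r' C"
proof -
  interpret l: local_model a da E R x\<^sub>0 r C by fact
  have sub: "x \<in> cball x\<^sub>0 r" if "x \<in> cball x\<^sub>0 r'" for x using that assms(3) by simp
  show ?thesis
    by (rule local_model.intro)
      (use assms(2) in \<open>(blast intro: sub l.C l.a_linear l.E_bilinear l.a_derivative l.E_eq l.E_R l.a_R l.a_lipschitz
        l.a_bound l.da_linear l.da_bound l.E_lipschitz l.E_bound l.R_bound l.R_lipschitz l.E_a_coercive l.a_taylor)+\<close>)
qed

lemma Ck_on_Pair:
  fixes f :: "'a::euclidean_space \<Rightarrow> 'b::euclidean_space" and g :: "'a \<Rightarrow> 'c::euclidean_space"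
  assumes "open U" "Ck_on k U f" "Ck_on k U g"
  shows "Ck_on k U (\<lambda>x. (f x, g x))"
proof -
  have "Ck_on k U (\<lambda>x. (f x, 0) + (0, g x))"
    by (intro Ck_on_add assms Ck_on_bounded_linear_compose[OF _ _ assms(2)] Ck_on_bounded_linear_compose[OF _ _ assms(3)]
        bounded_linear_Pair bounded_linear_ident bounded_linear_zero)
  then show ?thesis by simp
qed

text \<open>\<open>B\<close> has two roles: it is the constant \<open>K\<close> of the bump, and
  \<open>1 / B\<close> is the end of the parameter interval. Its lower bounds collect the conditions
  on the smallness of \<open>l\<close>. The balls in \<open>no_return\<close> have radius
  \<open>8 * C / B\<close> because \<sigma> is at most \<open>l\<close>.\<close>

locale zoll_chart = contact A \<alpha> n +
  lm: local_model "\<alpha> c\<^sub>0" da "ext_deriv \<alpha> c\<^sub>0" "reeb_field \<alpha> c\<^sub>0" x\<^sub>0 r C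
  for A :: "('m::t2_space, 'e::euclidean_space) chart set" and \<alpha> :: "('m, 'e) form1" and n
    and c\<^sub>0 :: "('m, 'e) chart" and da x\<^sub>0 r C +
  fixes e :: 'e and T m M B :: real
  assumes c0: "c\<^sub>0 \<in> A" and ball: "cball x\<^sub>0 r \<subseteq> chart_image c\<^sub>0" and n_pos: "n \<ge> 1"
    and e_kernel: "\<alpha> c\<^sub>0 x\<^sub>0 e = 0" and e_norm: "norm e = 1 / 2"
    and r_small: "160 * C ^ 3 * r \<le> 1"
    and zoll: "reeb_orbit A \<alpha> \<gamma> \<Longrightarrow> is_minimal_period \<gamma> T"
    and weight_bounds: "x \<in> cball x\<^sub>0 r \<Longrightarrow> m \<le> weight c\<^sub>0 x \<and> weight c\<^sub>0 x \<le> M" and m_pos: "m > 0"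
    and B: "10 ^ 10 * C ^ 11 \<le> B" "1280 * C ^ 5 * (324 * C\<^sup>2 + 2) \<le> B" "160 * C \<le> B * r"
      "2 ^ n * M * 2 ^ DIM('e) \<le> B * (exp (- 2) * m)"
    and no_return: "x \<in> cball x\<^sub>0 (8 * C / B) \<Longrightarrow> y \<in> cball x\<^sub>0 (8 * C / B) \<Longrightarrow>
      t \<in> {r / (8 * C)..T - r / (8 * C)} \<Longrightarrow> reeb.flow (chart_inv c\<^sub>0 x) t \<noteq> chart_inv c\<^sub>0 y"
begin

text \<open>The box has length \<open>\<sigma>\<close>, the bumps have widths \<open>\<rho>\<close> and \<open>d\<close> and heights \<open>h\<close> and \<open>k\<close>. With
  \<open>\<sigma> = l\<^sup>q\<close>, \<open>\<rho> = l\<^sup>p\<close> and \<open>d = l\<^sup>p * l\<^sup>2\<close>, the choice \<open>h = l * \<rho>\<^sup>2 / \<sigma>\<close>, \<open>k = l * d\<close> gives a displacement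
  \<open>\<sigma> * h / \<rho> = l * \<rho>\<close> lying strictly between \<open>d\<close> and \<open>\<rho>\<close>, and \<open>C\<^sup>1\<close>-smallness. The drift \<open>\<sigma>\<^sup>2\<close> is negligible if
  \<open>2 * q > p + 1\<close>, and the volume decreases if \<open>h * (\<rho> / d) ^ DIM('e)\<close> is much smaller than \<open>k\<close>, that is
  \<open>p > q + 2 + 2 * DIM('e)\<close>. The exponents below are the smallest solutions.\<close>

definition F :: "real \<Rightarrow> 'e \<Rightarrow> real" where
  "F l = bump_setup.f (\<alpha> c\<^sub>0) (reeb_field \<alpha> c\<^sub>0) x\<^sub>0 e (l ^ (2 * DIM('e) + 5)) (l ^ (4 * DIM('e) + 8)) (l ^ (4 * DIM('e) + 10))
    (l ^ (6 * DIM('e) + 12)) (l ^ (4 * DIM('e) + 11))"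

definition G :: "real \<Rightarrow> 'm \<Rightarrow> real" where
  "G l p = (if p \<in> fst c\<^sub>0 then 1 + F l (snd c\<^sub>0 p) else 1)"

text \<open>An open interval, so that joint smoothness in parameter and point can be tested on open
  sets; the half-open interval of the final family ends at \<open>1 / (2 * B)\<close>, inside
  it.\<close>

definition I :: "real set" where "I = {0<..<1 / B}"

lemma B_ge_1: "B \<ge> 1"
proof -
  have "1 \<le> C ^ 11" using lm.C by (rule one_le_power)
  then show ?thesis using B(1) by simp
qed

lemma I_D:
  assumes "l \<in> I"
  shows "0 < l" "B * l < 1" "l \<le> 1"
proof -
  show l: "0 < l" and Bl: "B * l < 1" using assms B_ge_1 by (simp_all add: I_def field_simps)
  have "1 * l \<le> B * l" using B_ge_1 l by (intro mult_right_mono) auto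
  then show "l \<le> 1" using Bl by simp
qed

lemma power_le_l:
  assumes "l \<in> I" "i > 0"
  shows "l ^ i \<le> l"
  using power_decreasing[of 1 i l] I_D[OF assms(1)] assms(2) by simp

lemma bump_setup:
  assumes "l > 0"
  shows "bump_setup (\<alpha> c\<^sub>0) da (ext_deriv \<alpha> c\<^sub>0) (reeb_field \<alpha> c\<^sub>0) x\<^sub>0 r C e (l ^ (2 * DIM('e) + 5)) (l ^ (4 * DIM('e) + 8))
    (l ^ (4 * DIM('e) + 10)) (l ^ (6 * DIM('e) + 12)) (l ^ (4 * DIM('e) + 11))"
  by unfold_locales (use assms e_kernel e_norm in auto)

lemma support_small:
  assumes l: "l \<in> I" and F: "F l x \<noteq> 0"
  shows "x \<in> cball x\<^sub>0 (r / 2)"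
proof -
  let ?\<sigma> = "l ^ (2 * DIM('e) + 5)" and ?\<rho> = "l ^ (4 * DIM('e) + 8)"
  interpret b: bump_setup "\<alpha> c\<^sub>0" da "ext_deriv \<alpha> c\<^sub>0" "reeb_field \<alpha> c\<^sub>0" x\<^sub>0 r C e ?\<sigma> ?\<rho>
    "l ^ (4 * DIM('e) + 10)" "l ^ (6 * DIM('e) + 12)" "l ^ (4 * DIM('e) + 11)" by (rule bump_setup[OF I_D(1)[OF l]])
  have scales: "?\<rho> \<le> ?\<sigma>" "l ^ (4 * DIM('e) + 10) \<le> ?\<rho>" using I_D[OF l] by (auto intro!: power_decreasing)
  have "b.Q1 x < 1 \<or> b.Q2 x < 1" using b.f_outside[of x] F unfolding F_def by (meson not_le)
  then have "\<bar>b.s x\<bar> \<le> 4 * ?\<sigma>" "norm (b.z x) \<le> 3 / 2 * ?\<sigma>"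
    using b.Q_support1[of x] b.Q_support2[of x] scales b.pos by fastforce+
  then have "norm (x - x\<^sub>0) \<le> C * (4 * ?\<sigma>) + 3 / 2 * ?\<sigma>"
    using b.dist_x0[of x] mult_left_mono[of "\<bar>b.s x\<bar>" "4 * ?\<sigma>" C] lm.C by linarith
  also have "\<dots> \<le> 8 * (C * l)"
  proof -
    have "C * ?\<sigma> \<le> C * l" using lm.C power_le_l[OF l] by (intro mult_left_mono) auto
    moreover have "1 * ?\<sigma> \<le> C * ?\<sigma>" using lm.C b.pos by (intro mult_right_mono) auto
    moreover have "0 \<le> C * l" using lm.C I_D[OF l] by simp
    ultimately show ?thesis by linarith
  qed
  also have "8 * (C * l) \<le> r / 2"
  proof -
    have "160 * C * l \<le> B * r * l" using B(3) I_D[OF l] by (intro mult_right_mono) auto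
    also have "\<dots> \<le> 1 * r" using I_D[OF l] lm.r mult_right_mono[of "B * l" 1 r] by (simp add: mult_ac)
    finally have "160 * (C * l) \<le> r" by simp
    moreover have "0 \<le> C * l" using lm.C I_D[OF l] by simp
    ultimately show ?thesis by linarith
  qed
  finally show ?thesis by (simp add: dist_norm norm_minus_commute)
qed

text \<open>One compact set outside of which all the functions \<open>G l\<close> with
  \<open>l \<in> I\<close> are 1, so that off this set the family is constant jointly in parameter
  and point.\<close>

definition core :: "'m set" where "core = chart_inv c\<^sub>0 ` cball x\<^sub>0 (r / 2)"

lemma half_ball: "cball x\<^sub>0 (r / 2) \<subseteq> chart_image c\<^sub>0"
  by (rule order_trans[OF subset_cball ball]) (use lm.r in simp)

lemma core_subset: "core \<subseteq> fst c\<^sub>0"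
  unfolding core_def using half_ball chart_inv_mem[OF c0] by blast

lemma closed_core: "closed core"
proof (rule compact_imp_closed)
  show "compact core" unfolding core_def
    by (rule compact_continuous_image[OF continuous_on_subset[OF cont_chart_inv[OF c0] half_ball]]) simp
qed

lemma G_outside:
  assumes l: "l \<in> I" and p: "p \<notin> core"
  shows "G l p = 1"
proof (rule ccontr)
  assume "G l p \<noteq> 1"
  then have "p \<in> fst c\<^sub>0" "F l (snd c\<^sub>0 p) \<noteq> 0" by (auto simp: G_def split: if_splits)
  then have "snd c\<^sub>0 p \<in> cball x\<^sub>0 (r / 2)" "p = chart_inv c\<^sub>0 (snd c\<^sub>0 p)"
    using support_small[OF l] by (simp_all add: chart_inv_chart[OF c0])
  then have "p \<in> core" unfolding core_def by (rule_tac image_eqI)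
  then show False using p by blast
qed

lemma F_smooth: "Ck_on k ({0<..} \<times> UNIV) (\<lambda>(l, x). F l x)"
proof -
  let ?U = "{0<..} \<times> UNIV :: (real \<times> 'e) set"
  have U: "open ?U" by (intro open_Times) auto
  define R0 where "R0 = reeb_field \<alpha> c\<^sub>0 x\<^sub>0"
  define s where "s x = \<alpha> c\<^sub>0 x\<^sub>0 (x - x\<^sub>0)" for x
  define z where "z x = (x - x\<^sub>0) - s x *\<^sub>R R0" for x
  have inv: "Ck_on k ?U (\<lambda>p. inverse (fst p))"
    by (rule Ck_on_compose[OF U Ck_on_fst[OF U] Ck_on_inverse]) auto
  have pw: "Ck_on k ?U (\<lambda>p. fst p ^ i)" "Ck_on k ?U (\<lambda>p. inverse (fst p) ^ i)" for i
    by (intro Ck_on_power U Ck_on_fst inv)+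
  have "bounded_linear (\<alpha> c\<^sub>0 x\<^sub>0)" using lm.a_linear[of x\<^sub>0] lm.r by (simp add: linear_conv_bounded_linear)
  then have s: "Ck_on k ?U (\<lambda>p. s (snd p))"
    unfolding s_def by (rule Ck_on_bounded_linear_compose[OF U]) (intro Ck_on_diff U Ck_on_snd Ck_on_const)
  have z: "Ck_on k ?U (\<lambda>p. z (snd p))"
    unfolding z_def by (intro Ck_on_diff U Ck_on_snd Ck_on_const Ck_on_bilinear[OF U bounded_bilinear_scaleR] s)
  have ze: "Ck_on k ?U (\<lambda>p. z (snd p) - fst p ^ i *\<^sub>R e)" for i
    by (intro Ck_on_diff U z Ck_on_bilinear[OF U bounded_bilinear_scaleR] pw Ck_on_const)
  \<comment> \<open>Divisions by powers of \<open>l\<close> and squares of norms are rewritten with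
    \<open>inverse\<close> and the inner product, to which the closure properties of
    \<open>Ck_on\<close> apply; the norm itself is not differentiable at 0.\<close>
  define Q1 where "Q1 p = (s (snd p) * inverse (fst p) ^ (2 * DIM('e) + 5) - 3)\<^sup>2 +
    ((z (snd p) - fst p ^ (4 * DIM('e) + 8) *\<^sub>R e) \<bullet> (z (snd p) - fst p ^ (4 * DIM('e) + 8) *\<^sub>R e)) * inverse (fst p) ^ (2 * (4 * DIM('e) + 8))" for p :: "real \<times> 'e"
  define Q2 where "Q2 p = (s (snd p) * inverse (fst p) ^ (2 * DIM('e) + 5) + 3)\<^sup>2 +
    (z (snd p) \<bullet> z (snd p)) * inverse (fst p) ^ (2 * (4 * DIM('e) + 10))" for p :: "real \<times> 'e"
  have Q: "Ck_on k ?U Q1" "Ck_on k ?U Q2"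
    unfolding Q1_def[abs_def] Q2_def[abs_def]
    by (intro Ck_on_add Ck_on_diff Ck_on_power U Ck_on_bilinear[OF U bounded_bilinear_mult]
        Ck_on_bilinear[OF U bounded_bilinear_inner] s z ze pw Ck_on_const)+
  have flat: "Ck_on k ?U (\<lambda>p. flat (1 - Q p))" if "Ck_on k ?U Q" for Q
    by (rule Ck_on_compose[OF U Ck_on_diff[OF U Ck_on_const[OF U] that] Ck_on_flat]) auto
  have "Ck_on k ?U (\<lambda>p. fst p ^ (6 * DIM('e) + 12) * flat (1 - Q1 p) - fst p ^ (4 * DIM('e) + 11) * flat (1 - Q2 p))"
    by (intro Ck_on_diff U Ck_on_bilinear[OF U bounded_bilinear_mult] pw flat Q)
  then show ?thesis
  proof (rule Ck_on_cong_imp[OF U, rotated])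
    fix p :: "real \<times> 'e" assume "p \<in> ?U"
    then obtain l x where p: "p = (l, x)" "l > 0" by (cases p) auto
    interpret b: bump_setup "\<alpha> c\<^sub>0" da "ext_deriv \<alpha> c\<^sub>0" "reeb_field \<alpha> c\<^sub>0" x\<^sub>0 r C e "l ^ (2 * DIM('e) + 5)" "l ^ (4 * DIM('e) + 8)"
      "l ^ (4 * DIM('e) + 10)" "l ^ (6 * DIM('e) + 12)" "l ^ (4 * DIM('e) + 11)" by (rule bump_setup[OF p(2)])
    have sz: "b.s x = s x" "b.z x = z x" by (simp_all add: b.s_def s_def b.z_def b.proj_def z_def R0_def)
    have nsq: "(norm w / l ^ i)\<^sup>2 = (w \<bullet> w) * inverse l ^ (2 * i)" for w :: 'e and i
    proof -
      have "(norm w / l ^ i)\<^sup>2 = (w \<bullet> w) / l ^ (2 * i)"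
        by (simp only: power_divide power2_norm_eq_inner power_mult[symmetric] mult.commute[of i])
      then show ?thesis by (simp add: divide_inverse power_inverse)
    qed
    have "b.Q1 x = Q1 p" "b.Q2 x = Q2 p"
      unfolding b.Q1_def b.Q2_def Q1_def Q2_def sz p(1) fst_conv snd_conv nsq by (simp_all add: divide_inverse power_inverse)
    then show "fst p ^ (6 * DIM('e) + 12) * flat (1 - Q1 p) - fst p ^ (4 * DIM('e) + 11) * flat (1 - Q2 p) = (case p of (l, x) \<Rightarrow> F l x)"
      by (simp add: p(1) F_def b.f_def)
  qed
qed

text \<open>Two open sets cover the domain: the part over the distinguished chart, where
  \<open>F\<close> and the transition map give a smooth formula, and the part off
  \<open>core\<close>, where the value is 1.\<close>

lemma G_smooth:
  assumes c: "c \<in> A"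
  shows "Ck_on k (I \<times> chart_image c) (\<lambda>(l, x). G l (chart_inv c x))"
proof (rule Ck_on_local)
  have I: "open I" by (simp add: I_def)
  show U: "open (I \<times> chart_image c)" by (rule open_Times[OF I open_chart_image[OF c]])
  fix p assume "p \<in> I \<times> chart_image c"
  then obtain l x where p: "p = (l, x)" "l \<in> I" "x \<in> chart_image c" by blast
  show "\<exists>V. open V \<and> p \<in> V \<and> Ck_on k (V \<inter> I \<times> chart_image c) (\<lambda>(l, x). G l (chart_inv c x))"
  proof (cases "chart_inv c x \<in> fst c\<^sub>0")
    case True
    let ?W = "I \<times> overlap c c\<^sub>0"
    have x: "x \<in> overlap c c\<^sub>0" using True p overlap_iff[OF c] by blast
    have W: "open ?W" by (rule open_Times[OF I open_overlap[OF c c0]])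
    have "Ck_on k ?W (\<lambda>p. transition c c\<^sub>0 (snd p))"
      by (rule Ck_on_compose[OF W Ck_on_snd[OF W] transition_smooth[OF c c0]]) auto
    then have "Ck_on k ?W (\<lambda>p. (fst p, transition c c\<^sub>0 (snd p)))"
      by (rule Ck_on_Pair[OF W Ck_on_fst[OF W]])
    then have "Ck_on k ?W (\<lambda>p. (\<lambda>(l, x). F l x) (fst p, transition c c\<^sub>0 (snd p)))"
      by (rule Ck_on_compose[OF W _ F_smooth]) (auto simp: I_def)
    then have "Ck_on k ?W (\<lambda>p. 1 + (\<lambda>(l, x). F l x) (fst p, transition c c\<^sub>0 (snd p)))"
      by (rule Ck_on_add[OF W Ck_on_const[OF W]])
    then have "Ck_on k ?W (\<lambda>(l, x). G l (chart_inv c x))"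
    proof (rule Ck_on_cong_imp[OF W, rotated])
      fix p assume "p \<in> ?W"
      then obtain l x where p: "p = (l, x)" "x \<in> overlap c c\<^sub>0" by blast
      then have "chart_inv c x \<in> fst c\<^sub>0" using overlap_iff[OF c] by blast
      then show "1 + (\<lambda>(l, x). F l x) (fst p, transition c c\<^sub>0 (snd p)) = (case p of (l, x) \<Rightarrow> G l (chart_inv c x))"
        by (simp add: p(1) G_def transition_eq)
    qed
    moreover have "?W \<inter> I \<times> chart_image c = ?W" using overlap_subset by fastforce
    ultimately show ?thesis using W x p by (intro exI[of _ ?W]) simp
  next
    case False
    let ?X = "chart_image c \<inter> chart_inv c -` (- core)"
    have X: "open ?X"
      by (rule continuous_open_preimage[OF cont_chart_inv[OF c] open_chart_image[OF c]]) (rule open_Compl[OF closed_core])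
    have W: "open (I \<times> ?X)" by (rule open_Times[OF I X])
    have "Ck_on k (I \<times> ?X) (\<lambda>p. 1 :: real)" by (rule Ck_on_const[OF W])
    then have "Ck_on k (I \<times> ?X) (\<lambda>(l, x). G l (chart_inv c x))"
      by (rule Ck_on_cong_imp[OF W, rotated]) (auto simp: G_outside)
    moreover have "I \<times> ?X \<inter> I \<times> chart_image c = I \<times> ?X" by blast
    moreover have "x \<in> ?X" using False core_subset p(3) by blast
    ultimately show ?thesis using W p by (intro exI[of _ "I \<times> ?X"]) simp
  qed
qed

lemma G_smooth_slice:
  assumes c: "c \<in> A" and l: "l \<in> I"
  shows "Ck_on k (chart_image c) (\<lambda>x. G l (chart_inv c x))"
proof -
  note U = open_chart_image[OF c]
  have "Ck_on k (chart_image c) (\<lambda>x. (l, x))" by (intro Ck_on_Pair U Ck_on_const Ck_on_id)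
  then have "Ck_on k (chart_image c) (\<lambda>x. (\<lambda>(l, x). G l (chart_inv c x)) (l, x))"
    by (rule Ck_on_compose[OF U _ G_smooth[OF c]]) (use l in auto)
  then show ?thesis by simp
qed

lemma conformal_contact:
  assumes l: "l \<in> I"
  shows "conformal_contact A \<alpha> n (G l)"
proof unfold_locales
  show "Ck_on k (chart_image c) (\<lambda>x. G l (chart_inv c x))" if "c \<in> A" for c k by (rule G_smooth_slice[OF that l])
  fix p
  interpret b: bump_setup "\<alpha> c\<^sub>0" da "ext_deriv \<alpha> c\<^sub>0" "reeb_field \<alpha> c\<^sub>0" x\<^sub>0 r C e "l ^ (2 * DIM('e) + 5)" "l ^ (4 * DIM('e) + 8)"
    "l ^ (4 * DIM('e) + 10)" "l ^ (6 * DIM('e) + 12)" "l ^ (4 * DIM('e) + 11)" by (rule bump_setup[OF I_D(1)[OF l]])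
  have l1: "l < 1" using I_D[OF l] B_ge_1 mult_right_mono[of 1 B l] by linarith
  have "l ^ (4 * DIM('e) + 11) < 1" using I_D[OF l] l1 by (simp add: power_less_one_iff)
  moreover have "l ^ (4 * DIM('e) + 11) * flat (1 - b.Q2 x) \<le> l ^ (4 * DIM('e) + 11)" "0 \<le> l ^ (6 * DIM('e) + 12) * flat (1 - b.Q1 x)" for x
    using b.pos flat_le_1 flat_nonneg by (simp_all add: mult_left_le)
  ultimately have "F l x > - 1" for x unfolding F_def b.f_def by (smt (verit))
  then show "G l p > 0" by (simp add: G_def) (smt (verit))
qed (rule n_pos)

lemma scales:
  assumes l: "l \<in> I"
  shows "l ^ (6 * DIM('e) + 12) / l ^ (4 * DIM('e) + 8) \<le> l" "l ^ (4 * DIM('e) + 11) / l ^ (4 * DIM('e) + 10) = l"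
    "l ^ (2 * DIM('e) + 5) * l ^ (6 * DIM('e) + 12) / l ^ (4 * DIM('e) + 8) = l ^ (4 * DIM('e) + 9)"
proof -
  note l0 = I_D(1)[OF l]
  have "l ^ (6 * DIM('e) + 12) = l ^ (4 * DIM('e) + 8) * l ^ (2 * DIM('e) + 4)" by (simp flip: power_add)
  then have 1: "l ^ (6 * DIM('e) + 12) / l ^ (4 * DIM('e) + 8) = l ^ (2 * DIM('e) + 4)" using l0 by simp
  then show "l ^ (6 * DIM('e) + 12) / l ^ (4 * DIM('e) + 8) \<le> l" using power_le_l[OF l] by simp
  have "l ^ (4 * DIM('e) + 11) = l ^ (4 * DIM('e) + 10) * l" using power_add[of l "4 * DIM('e) + 10" 1] by (simp add: add.commute)
  then show "l ^ (4 * DIM('e) + 11) / l ^ (4 * DIM('e) + 10) = l" using l0 by simp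
  have "l ^ (2 * DIM('e) + 5) * l ^ (6 * DIM('e) + 12) / l ^ (4 * DIM('e) + 8) = l ^ (2 * DIM('e) + 5) * l ^ (2 * DIM('e) + 4)"
    using 1 by (metis times_divide_eq_right)
  then show "l ^ (2 * DIM('e) + 5) * l ^ (6 * DIM('e) + 12) / l ^ (4 * DIM('e) + 8) = l ^ (4 * DIM('e) + 9)" by (simp flip: power_add)
qed

lemma perturbed_zoll:
  assumes l: "l \<in> I"
  shows "perturbed_zoll A \<alpha> n (G l) c\<^sub>0 da x\<^sub>0 r C e (l ^ (2 * DIM('e) + 5)) (l ^ (4 * DIM('e) + 8))
    (l ^ (4 * DIM('e) + 10)) (l ^ (6 * DIM('e) + 12)) (l ^ (4 * DIM('e) + 11)) B T"
proof -
  let ?\<sigma> = "l ^ (2 * DIM('e) + 5)" and ?\<rho> = "l ^ (4 * DIM('e) + 8)" and ?d = "l ^ (4 * DIM('e) + 10)" and ?h = "l ^ (6 * DIM('e) + 12)"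
    and ?k = "l ^ (4 * DIM('e) + 11)"
  note l0 = I_D[OF l]
  interpret g: conformal_contact A \<alpha> n "G l" by (rule conformal_contact[OF l])
  interpret b: bump_setup "\<alpha> c\<^sub>0" da "ext_deriv \<alpha> c\<^sub>0" "reeb_field \<alpha> c\<^sub>0" x\<^sub>0 r C e ?\<sigma> ?\<rho> ?d ?h ?k
    by (rule bump_setup[OF l0(1)])
  \<comment> \<open>With \<open>N = DIM('e)\<close>, both \<open>d\<close> and
    \<open>\<sigma>\<^sup>2\<close> are \<open>l ^ (4 * N + 10)\<close>, the displacement is
    \<open>l ^ (4 * N + 9)\<close>, and \<rho> is \<open>l ^ (4 * N + 8)\<close>. So the conditions
    relating these quantities through \<open>K\<close> compare consecutive powers.\<close>
  have Bl: "B * l ^ j \<le> l ^ i" if "j = Suc i" for i j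
    unfolding \<open>j = Suc i\<close> using l0 mult_right_mono[of "B * l" 1 "l ^ i"] by (simp add: mult.assoc)
  have g_in: "G l (chart_inv c\<^sub>0 x) = 1 + b.f x" if "x \<in> chart_image c\<^sub>0" for x
    using that by (simp add: G_def F_def chart_inv_mem[OF c0] chart_chart_inv[OF c0])
  have dg: "g.dg c\<^sub>0 x v = b.df x v" if x: "x \<in> chart_image c\<^sub>0" for x v
  proof -
    have "((\<lambda>x. 1 + b.f x) has_derivative b.df x) (at x)"
      using has_derivative_add[OF has_derivative_const[of 1] b.f_derivative[of x]] by simp
    then have "((\<lambda>x. G l (chart_inv c\<^sub>0 x)) has_derivative b.df x) (at x)"
      by (rule has_derivative_transform_within_open[OF _ open_chart_image[OF c0] x]) (simp add: g_in)
    from frechet_derivative_at[OF this] show ?thesis by simp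
  qed
  have \<sigma>l: "?\<sigma> \<le> l" by (rule power_le_l[OF l]) simp
  have B\<sigma>: "B * ?\<sigma> \<le> B * l" using \<sigma>l B_ge_1 by (intro mult_left_mono) auto
  have \<sigma>r: "160 * C * ?\<sigma> < r"
  proof -
    have "160 * C * ?\<sigma> \<le> B * r * l" by (rule mult_mono[OF B(3) \<sigma>l]) (use lm.r B_ge_1 l0 in auto)
    also have "\<dots> < r" using l0 lm.r mult_strict_right_mono[of "B * l" 1 r] by (simp add: mult_ac)
    finally show ?thesis .
  qed
  have C\<sigma>: "8 * C * ?\<sigma> \<le> 8 * C / B"
  proof -
    have "?\<sigma> * B \<le> 1" using B\<sigma> l0(2) by (simp add: mult.commute)
    then have "?\<sigma> \<le> 1 / B" using B_ge_1 by (subst pos_le_divide_eq) auto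
    then have "8 * C * ?\<sigma> \<le> 8 * C * (1 / B)" using lm.C by (intro mult_left_mono) auto
    then show ?thesis by simp
  qed
  show ?thesis
  proof unfold_locales
    show "160 * C ^ 3 * r \<le> 1" by (rule r_small)
    have "0 \<le> C * ?\<sigma>" using lm.C l0 by simp
    then show "8 * C * ?\<sigma> \<le> r" using \<sigma>r by linarith
    show "?d \<le> ?\<rho>" "?\<rho> \<le> ?\<sigma>" using l0 by (auto intro!: power_decreasing)
    show "16 * C ^ 5 * (162 * C\<^sup>2 * (?h / ?\<rho> + ?k / ?d) + ?h + ?k) \<le> 1 / 80"
    proof -
      have "162 * C\<^sup>2 * (?h / ?\<rho> + ?k / ?d) \<le> 162 * C\<^sup>2 * (l + l)"
        using scales(1,2)[OF l] by (intro mult_left_mono add_mono) auto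
      moreover have "?h \<le> l" "?k \<le> l" using power_le_l[OF l] by auto
      ultimately have "162 * C\<^sup>2 * (?h / ?\<rho> + ?k / ?d) + ?h + ?k \<le> (324 * C\<^sup>2 + 2) * l" by (simp add: algebra_simps)
      then have "16 * C ^ 5 * (162 * C\<^sup>2 * (?h / ?\<rho> + ?k / ?d) + ?h + ?k) \<le> 16 * C ^ 5 * ((324 * C\<^sup>2 + 2) * l)"
        using lm.C by (intro mult_left_mono) auto
      also have "\<dots> = 1 / 80 * ((1280 * C ^ 5 * (324 * C\<^sup>2 + 2)) * l)" by (simp add: algebra_simps)
      also have "\<dots> \<le> 1 / 80 * (B * l)" using B(2) l0 by (intro mult_left_mono mult_right_mono) auto
      also have "\<dots> \<le> 1 / 80" using l0 by simp
      finally show ?thesis .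
    qed
    show "10 ^ 10 * C ^ 11 \<le> B" by (rule B(1))
    show "B * ?d \<le> ?\<sigma> * ?h / ?\<rho>" unfolding scales(3)[OF l] by (rule Bl) simp
    have \<sigma>2: "?\<sigma>\<^sup>2 = l ^ (4 * DIM('e) + 10)" by (simp add: power2_eq_square flip: power_add)
    show "B * ?\<sigma>\<^sup>2 \<le> ?\<sigma> * ?h / ?\<rho>" unfolding scales(3)[OF l] \<sigma>2 by (rule Bl) simp
    show "B * (?\<sigma> * ?h / ?\<rho>) \<le> ?\<rho>" unfolding scales(3)[OF l] by (rule Bl) simp
    show "B * ?\<sigma> \<le> 1" using B\<sigma> l0 by simp
    show "160 * C * ?\<sigma> < r" by (rule \<sigma>r)
    show "c\<^sub>0 \<in> A" "cball x\<^sub>0 r \<subseteq> chart_image c\<^sub>0" by (rule c0, rule ball)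
    show "G l p = (if p \<in> fst c\<^sub>0 then 1 + b.f (snd c\<^sub>0 p) else 1)" for p by (simp add: G_def F_def)
    show "is_minimal_period \<gamma> T" if "reeb_orbit A \<alpha> \<gamma>" for \<gamma> by (rule zoll[OF that])
    show "reeb.flow (chart_inv c\<^sub>0 x) t \<noteq> chart_inv c\<^sub>0 y"
      if "x \<in> cball x\<^sub>0 (8 * C * ?\<sigma>)" "y \<in> cball x\<^sub>0 (8 * C * ?\<sigma>)" "t \<in> {r / (8 * C)..T - r / (8 * C)}" for x y t
      by (rule no_return) (use that C\<sigma> in auto)
    fix x assume "x \<in> cball x\<^sub>0 r"
    then have x: "x \<in> chart_image c\<^sub>0" using ball by blast
    show "\<alpha> c\<^sub>0 x (reeb_field (conformal (G l) \<alpha>) c\<^sub>0 x) = 1 / (1 + b.f x)"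
      using g.conformal_reeb_form[OF c0 x] by (simp add: g_in[OF x])
    show "ext_deriv \<alpha> c\<^sub>0 x (reeb_field (conformal (G l) \<alpha>) c\<^sub>0 x) v =
        b.df x v / (1 + b.f x)\<^sup>2 - b.df x (reeb_field \<alpha> c\<^sub>0 x) * \<alpha> c\<^sub>0 x v / (1 + b.f x)\<^sup>2" for v
      using g.conformal_reeb_E[OF c0 x] by (simp add: g_in[OF x] dg[OF x])
  qed
qed

lemma volume_less:
  assumes l: "l \<in> I"
  shows "contact_volume A n (conformal (G l) \<alpha>) < contact_volume A n \<alpha>" "contact_volume A n \<alpha> < \<infinity>"
proof -
  let ?\<sigma> = "l ^ (2 * DIM('e) + 5)" and ?\<rho> = "l ^ (4 * DIM('e) + 8)" and ?d = "l ^ (4 * DIM('e) + 10)" and ?h = "l ^ (6 * DIM('e) + 12)"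
    and ?k = "l ^ (4 * DIM('e) + 11)"
  note l0 = I_D[OF l]
  interpret p: perturbed_zoll A \<alpha> n "G l" c\<^sub>0 da x\<^sub>0 r C e ?\<sigma> ?\<rho> ?d ?h ?k B T by (rule perturbed_zoll[OF l])
  have box: "x \<in> cball x\<^sub>0 r" if "\<bar>p.bmp.s x\<bar> \<le> 5 * ?\<sigma>" "norm (p.bmp.z x) \<le> 3 * ?\<sigma>" for x
    using p.box_half[OF that] lm.r by (simp add: dist_norm norm_minus_commute)
  have sc: "?d \<le> ?\<rho>" "?\<rho> \<le> ?\<sigma>" using p.bmp.scales .
  have sub1: "{x. p.bmp.Q1 x \<le> 1} \<subseteq> cball x\<^sub>0 r"
  proof
    fix x assume "x \<in> {x. p.bmp.Q1 x \<le> 1}"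
    then have "(p.bmp.s x / ?\<sigma> - 3)\<^sup>2 \<le> 1" "(norm (p.bmp.z x - ?\<rho> *\<^sub>R e) / ?\<rho>)\<^sup>2 \<le> 1"
      using zero_le_power2[of "p.bmp.s x / ?\<sigma> - 3"] zero_le_power2[of "norm (p.bmp.z x - ?\<rho> *\<^sub>R e) / ?\<rho>"]
      unfolding p.bmp.Q1_def mem_Collect_eq by linarith+
    then have 1: "\<bar>p.bmp.s x / ?\<sigma> - 3\<bar> \<le> 1" "norm (p.bmp.z x - ?\<rho> *\<^sub>R e) \<le> ?\<rho>"
      using p.bmp.pos by (simp_all only: abs_square_le_1) simp_all
    have "p.bmp.s x / ?\<sigma> \<le> 4" "2 \<le> p.bmp.s x / ?\<sigma>" using 1(1) by linarith+
    then have "\<bar>p.bmp.s x\<bar> \<le> 5 * ?\<sigma>" using p.bmp.pos by (simp add: field_simps abs_le_iff)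
    moreover have "norm (?\<rho> *\<^sub>R e) = ?\<rho> / 2" using e_norm p.bmp.pos by (simp only: norm_scaleR)
    then have "norm (p.bmp.z x) \<le> 3 * ?\<sigma>"
      using 1(2) norm_triangle_sub[of "p.bmp.z x" "?\<rho> *\<^sub>R e"] sc p.bmp.pos by linarith
    ultimately show "x \<in> cball x\<^sub>0 r" by (rule box)
  qed
  have sub2: "{x. p.bmp.Q2 x \<le> 1 / 2} \<subseteq> cball x\<^sub>0 r"
  proof
    fix x assume "x \<in> {x. p.bmp.Q2 x \<le> 1 / 2}"
    then have "p.bmp.Q2 x < 1" by simp
    from p.bmp.Q_support2[OF this] show "x \<in> cball x\<^sub>0 r" using sc p.bmp.pos by (intro box) auto
  qed
  have "integral (cball x\<^sub>0 r) (p.conf.weight c\<^sub>0) = integral (cball x\<^sub>0 r) (\<lambda>x. (1 + p.bmp.f x) ^ n * weight c\<^sub>0 x)"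
  proof (rule integral_cong)
    fix x assume "x \<in> cball x\<^sub>0 r"
    then have x: "x \<in> chart_image c\<^sub>0" using ball by blast
    show "p.conf.weight c\<^sub>0 x = (1 + p.bmp.f x) ^ n * weight c\<^sub>0 x"
      using p.conformal_weight[OF c0 x] p.g_eq[of "chart_inv c\<^sub>0 x"] x by (simp add: chart_inv_mem[OF c0] chart_chart_inv[OF c0])
  qed
  also have "\<dots> < integral (cball x\<^sub>0 r) (weight c\<^sub>0)"
  proof (rule p.bmp.integral_decrease[OF sc(1) sub1 sub2 continuous_on_subset[OF weight_continuous[OF c0] ball] weight_bounds m_pos n_pos])
    show "?h \<le> 1" "?k \<le> 1" using l0 by (simp_all add: power_le_one)
    \<comment> \<open>Since \<open>\<rho> / d\<close> is the inverse of \<open>l\<^sup>2\<close>,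
      the ratio of the supports costs the inverse of \<open>l ^ (2 * DIM('e))\<close>, up to
      constants. Multiplied by \<open>h\<close> this is \<open>k * l\<close>, and the factor
      \<open>l\<close> left over beats all constants by the choice of \<open>B\<close>.\<close>
    have "?d = ?\<rho> * l\<^sup>2" using power_add[of l "4 * DIM('e) + 8" 2] by (simp add: add.commute)
    then have "2 * ?\<rho> / ?d = 2 / l\<^sup>2" using l0 by simp
    then have "(2 * ?\<rho> / ?d) ^ DIM('e) = 2 ^ DIM('e) / l ^ (2 * DIM('e))" by (simp add: power_divide power_mult)
    moreover have "?h = l ^ (2 * DIM('e)) * (?k * l)"
      using power_add[of l "2 * DIM('e)" "4 * DIM('e) + 12"] power_add[of l "4 * DIM('e) + 11" 1] by (simp add: add.commute)
    ultimately have "2 ^ n * ?h * M * (2 * ?\<rho> / ?d) ^ DIM('e) = ?k * ((2 ^ n * M * 2 ^ DIM('e)) * l)"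
      using l0 by simp
    also have "\<dots> \<le> ?k * (B * (exp (- 2) * m) * l)" using B(4) l0 by (intro mult_left_mono mult_right_mono) auto
    also have "\<dots> = (B * l) * (?k * exp (- 2) * m)" by simp
    also have "\<dots> < 1 * (?k * exp (- 2) * m)" using l0 m_pos by (intro mult_strict_right_mono) auto
    finally show "2 ^ n * ?h * M * (2 * ?\<rho> / ?d) ^ DIM('e) < ?k * exp (- 2) * m" by simp
  qed
  finally have less: "integral (cball x\<^sub>0 r) (p.conf.weight c\<^sub>0) < integral (cball x\<^sub>0 r) (weight c\<^sub>0)" .
  have out: "G l p = 1" if "p \<notin> chart_inv c\<^sub>0 ` cball x\<^sub>0 r" for p
  proof (rule G_outside[OF l])
    have "cball x\<^sub>0 (r / 2) \<subseteq> cball x\<^sub>0 r" using lm.r by (intro subset_cball) simp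
    then show "p \<notin> core" using that unfolding core_def by blast
  qed
  show "contact_volume A n (conformal (G l) \<alpha>) < contact_volume A n \<alpha>" "contact_volume A n \<alpha> < \<infinity>"
    using p.conformal_volume_less[OF c0 ball out less] by auto
qed

text \<open>\<open>T\<close> lies weakly between the two systoles, and the volumes differ strictly.
  Strictness survives the multiplication in \<open>ennreal\<close> because the power of
  \<open>T\<close> is positive and finite.\<close>

lemma systolic_ratio_less:
  assumes l: "l \<in> I"
  shows "systolic_ratio A n \<alpha> < systolic_ratio A n (conformal (G l) \<alpha>)"
proof -
  interpret p: perturbed_zoll A \<alpha> n "G l" c\<^sub>0 da x\<^sub>0 r C e "l ^ (2 * DIM('e) + 5)" "l ^ (4 * DIM('e) + 8)"
    "l ^ (4 * DIM('e) + 10)" "l ^ (6 * DIM('e) + 12)" "l ^ (4 * DIM('e) + 11)" B T by (rule perturbed_zoll[OF l])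
  obtain q :: 'm where True by blast
  have orbit: "reeb_orbit A \<alpha> (reeb.flow q)" by (simp add: reeb_orbit_iff reeb.flow_curve)
  then have period: "is_period (reeb.flow q) T" using zoll by (simp add: is_minimal_period_def)
  then have T: "T > 0" by (simp add: is_period_def)
  have "sys A \<alpha> \<le> ennreal T"
    unfolding sys_def using orbit period by (intro Inf_lower) blast
  moreover have "ennreal T \<le> sys A (conformal (G l) \<alpha>)"
    unfolding sys_def
  proof (rule Inf_greatest)
    fix t assume "t \<in> {ennreal S |S. \<exists>\<gamma>. reeb_orbit A (conformal (G l) \<alpha>) \<gamma> \<and> is_period \<gamma> S}"
    then obtain S \<gamma> where S: "t = ennreal S" "reeb_orbit A (conformal (G l) \<alpha>) \<gamma>" "is_period \<gamma> S" by blast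
    then show "ennreal T \<le> t" using p.perturbed_period[OF S(2,3)] by (simp add: ennreal_leI)
  qed
  ultimately have s: "sys A \<alpha> ^ n \<le> ennreal T ^ n" "ennreal T ^ n \<le> sys A (conformal (G l) \<alpha>) ^ n"
    by (auto intro: power_mono)
  note vol = volume_less[OF l]
  have "sys A \<alpha> ^ n / contact_volume A n \<alpha> \<le> ennreal T ^ n / contact_volume A n \<alpha>"
    using s(1) by (rule divide_right_mono_ennreal)
  also have "\<dots> < ennreal T ^ n / contact_volume A n (conformal (G l) \<alpha>)"
  proof -
    have inverse_less: "inverse b < inverse a" if "a < b" for a b :: ennreal
      using that
      by (cases a; cases b; cases "a = 0")
        (auto simp: inverse_ennreal ennreal_less_iff ennreal_inverse_positive top_unique ennreal_lessI less_top[symmetric])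
    have "inverse (contact_volume A n \<alpha>) < inverse (contact_volume A n (conformal (G l) \<alpha>))"
      by (rule inverse_less[OF vol(1)])
    then show ?thesis
      unfolding divide_ennreal_def using T by (intro ennreal_mult_strict_left_mono) (auto simp: ennreal_power)
  qed
  also have "\<dots> \<le> sys A (conformal (G l) \<alpha>) ^ n / contact_volume A n (conformal (G l) \<alpha>)"
    using s(2) by (rule divide_right_mono_ennreal)
  finally show ?thesis by (simp add: systolic_ratio_def)
qed

end

lemma uniform_limit_at_right_0:
  fixes u :: "real \<Rightarrow> 'a \<Rightarrow> real"
  assumes B: "B > 0" and bound: "\<And>l x. 0 < l \<Longrightarrow> l < 1 / B \<Longrightarrow> x \<in> K \<Longrightarrow> \<bar>u l x - u\<^sub>0 x\<bar> \<le> D * l"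
  shows "uniform_limit K u u\<^sub>0 (at_right 0)"
proof (rule uniform_limitI)
  fix \<epsilon> :: real assume \<epsilon>: "\<epsilon> > 0"
  define b where "b = min (1 / B) (\<epsilon> / (\<bar>D\<bar> + 1))"
  have "b > 0" using B \<epsilon> by (simp add: b_def)
  moreover have "\<forall>x\<in>K. dist (u l x) (u\<^sub>0 x) < \<epsilon>" if l: "0 < l" "l < b" for l
  proof
    fix x assume x: "x \<in> K"
    have "\<bar>u l x - u\<^sub>0 x\<bar> \<le> D * l" using bound[OF l(1) _ x] l by (simp add: b_def)
    also have "\<dots> \<le> (\<bar>D\<bar> + 1) * l" using l by (intro mult_right_mono) auto
    also have "\<dots> < \<epsilon>"
    proof -
      have "l < \<epsilon> / (\<bar>D\<bar> + 1)" using l by (simp add: b_def)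
      then have "l * (\<bar>D\<bar> + 1) < \<epsilon>" by (subst (asm) pos_less_divide_eq) auto
      then show ?thesis by (simp add: mult.commute)
    qed
    finally show "dist (u l x) (u\<^sub>0 x) < \<epsilon>" by (simp add: dist_real_def)
  qed
  ultimately show "\<forall>\<^sub>F l in at_right 0. \<forall>x\<in>K. dist (u l x) (u\<^sub>0 x) < \<epsilon>"
    unfolding eventually_at_right_field by (intro exI[of _ b]) auto
qed

lemma continuous_bounded_compact:
  fixes f :: "'a::topological_space \<Rightarrow> 'b::real_normed_vector"
  assumes "continuous_on K f" "compact K"
  shows "\<exists>M\<ge>0. \<forall>x\<in>K. norm (f x) \<le> M"
proof -
  have "bounded (f ` K)" using assms by (intro compact_imp_bounded compact_continuous_image)
  then obtain M where "\<forall>y\<in>f ` K. norm y \<le> M" by (auto simp: bounded_iff)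
  then show ?thesis by (intro exI[of _ "max M 0"]) (auto simp: le_max_iff_disj)
qed

context zoll_chart
begin

text \<open>The heights \<open>h\<close> and \<open>k\<close> and the slopes
  \<open>h / \<rho>\<close> and \<open>k / d\<close> are all at most \<open>l\<close>; 324 = 2 * 162
  adds the bounds for the two bumps.\<close>

lemma G_bounds:
  assumes l: "l \<in> I"
  shows "\<bar>G l p - 1\<bar> \<le> 2 * l" and "(F l has_derivative D) (at x) \<Longrightarrow> \<bar>D v\<bar> \<le> 324 * C\<^sup>2 * l * norm v"
proof -
  let ?\<rho> = "l ^ (4 * DIM('e) + 8)" and ?d = "l ^ (4 * DIM('e) + 10)" and ?h = "l ^ (6 * DIM('e) + 12)"
    and ?k = "l ^ (4 * DIM('e) + 11)"
  interpret p: perturbed_zoll A \<alpha> n "G l" c\<^sub>0 da x\<^sub>0 r C e "l ^ (2 * DIM('e) + 5)" ?\<rho> ?d ?h ?k B T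
    by (rule perturbed_zoll[OF l])
  have F: "F l = p.bmp.f" by (rule ext) (simp add: F_def)
  have "?h \<le> l" "?k \<le> l" using power_le_l[OF l] by auto
  then have "\<bar>F l x\<bar> \<le> 2 * l" for x using p.bmp.f_bound[of x] unfolding F by linarith
  then show "\<bar>G l p - 1\<bar> \<le> 2 * l" using I_D(1)[OF l] by (simp add: G_def)
  assume "(F l has_derivative D) (at x)"
  then have "D = p.bmp.df x" unfolding F by (rule has_derivative_unique[OF _ p.bmp.f_derivative])
  moreover have "p.bmp.B1 x + p.bmp.B2 x \<le> 162 * C\<^sup>2 * (?h / ?\<rho>) + 162 * C\<^sup>2 * (?k / ?d)"
    by (rule add_mono[OF p.bmp.B_le])
  moreover have "162 * C\<^sup>2 * (?h / ?\<rho>) \<le> 162 * C\<^sup>2 * l" using scales(1)[OF l] by (intro mult_left_mono) auto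
  moreover have "162 * C\<^sup>2 * (?k / ?d) = 162 * C\<^sup>2 * l" unfolding scales(2)[OF l] ..
  ultimately have "p.bmp.B1 x + p.bmp.B2 x \<le> 324 * C\<^sup>2 * l" by linarith
  then have "(p.bmp.B1 x + p.bmp.B2 x) * norm v \<le> 324 * C\<^sup>2 * l * norm v" by (rule mult_right_mono) simp
  then show "\<bar>D v\<bar> \<le> 324 * C\<^sup>2 * l * norm v"
    unfolding \<open>D = _\<close> using p.bmp.df_bound[of x v] by linarith
qed

text \<open>The derivative of the transition map to the distinguished chart may be unbounded on the
  part of \<open>K\<close> in the overlap, but it is bounded on the compact part over
  \<open>core\<close>. At the other points \<open>G l\<close> is locally constant.\<close>

lemma G_derivative_bound:
  assumes c: "c \<in> A" and K: "compact K" "K \<subseteq> chart_image c"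
  obtains D where "\<And>l x. l \<in> I \<Longrightarrow> x \<in> K \<Longrightarrow> \<bar>dir_deriv (\<lambda>x. G l (chart_inv c x)) u x\<bar> \<le> D * l"
proof -
  let ?K' = "K \<inter> chart_inv c -` core"
  have "closed ?K'"
    by (rule continuous_closed_preimage[OF continuous_on_subset[OF cont_chart_inv[OF c] K(2)] compact_imp_closed[OF K(1)] closed_core])
  then have K': "compact ?K'" using K(1) by (metis Int_absorb1 Int_lower1 compact_Int_closed)
  have K'_sub: "?K' \<subseteq> overlap c c\<^sub>0" using K(2) core_subset overlap_iff[OF c] by blast
  have "continuous_on (overlap c c\<^sub>0) (\<lambda>x. dir_deriv (transition c c\<^sub>0) u x)"
    using transition_smooth[OF c c0, of 1] by simp
  from continuous_on_subset[OF this K'_sub] obtain M' where M':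
    "M' \<ge> 0" "\<And>x. x \<in> ?K' \<Longrightarrow> norm (dir_deriv (transition c c\<^sub>0) u x) \<le> M'"
    using continuous_bounded_compact[OF _ K'] by blast
  show ?thesis
  proof (rule that[of "324 * C\<^sup>2 * M'"])
    fix l x assume l: "l \<in> I" and x: "x \<in> K"
    note l0 = I_D(1)[OF l]
    show "\<bar>dir_deriv (\<lambda>x. G l (chart_inv c x)) u x\<bar> \<le> 324 * C\<^sup>2 * M' * l"
    proof (cases "chart_inv c x \<in> core")
      case True
      then have x': "x \<in> ?K'" using x by simp
      then have xo: "x \<in> overlap c c\<^sub>0" using K'_sub by blast
      interpret b: bump_setup "\<alpha> c\<^sub>0" da "ext_deriv \<alpha> c\<^sub>0" "reeb_field \<alpha> c\<^sub>0" x\<^sub>0 r C e "l ^ (2 * DIM('e) + 5)" "l ^ (4 * DIM('e) + 8)"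
        "l ^ (4 * DIM('e) + 10)" "l ^ (6 * DIM('e) + 12)" "l ^ (4 * DIM('e) + 11)" by (rule bump_setup[OF l0])
      have F: "F l = b.f" by (rule ext) (simp add: F_def)
      have dF: "(F l has_derivative b.df (transition c c\<^sub>0 x)) (at (transition c c\<^sub>0 x))" unfolding F by (rule b.f_derivative)
      let ?D = "\<lambda>v. b.df (transition c c\<^sub>0 x) (dir_deriv (transition c c\<^sub>0) v x)"
      have "((\<lambda>x. 1 + F l (transition c c\<^sub>0 x)) has_derivative (\<lambda>v. 0 + ?D v)) (at x)"
        by (intro has_derivative_add has_derivative_const has_derivative_compose[OF transition_has_derivative[OF c c0 xo] dF])
      then have "((\<lambda>x. G l (chart_inv c x)) has_derivative (\<lambda>v. 0 + ?D v)) (at x)"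
      proof (rule has_derivative_transform_within_open[OF _ open_overlap[OF c c0] xo])
        fix y assume "y \<in> overlap c c\<^sub>0"
        then have "chart_inv c y \<in> fst c\<^sub>0" using overlap_iff[OF c] by blast
        then show "1 + F l (transition c c\<^sub>0 y) = G l (chart_inv c y)" by (simp add: G_def transition_eq)
      qed
      from fun_cong[OF frechet_derivative_at[OF this], of u]
      have "dir_deriv (\<lambda>x. G l (chart_inv c x)) u x = ?D u" by simp
      also have "\<bar>?D u\<bar> \<le> 324 * C\<^sup>2 * l * norm (dir_deriv (transition c c\<^sub>0) u x)" by (rule G_bounds(2)[OF l dF])
      also have "\<dots> \<le> 324 * C\<^sup>2 * l * M'" using M'(2)[OF x'] l0 by (intro mult_left_mono) auto
      finally show ?thesis by (simp add: mult_ac)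
    next
      case False
      let ?X = "chart_image c \<inter> chart_inv c -` (- core)"
      have X: "open ?X"
        by (rule continuous_open_preimage[OF cont_chart_inv[OF c] open_chart_image[OF c]]) (rule open_Compl[OF closed_core])
      have "x \<in> ?X" using False x K(2) by blast
      then have "((\<lambda>x. G l (chart_inv c x)) has_derivative (\<lambda>v. 0)) (at x)"
        by (rule has_derivative_transform_within_open[OF has_derivative_const X]) (simp add: G_outside[OF l])
      from fun_cong[OF frechet_derivative_at[OF this], of u]
      have "dir_deriv (\<lambda>x. G l (chart_inv c x)) u x = 0" by simp
      then show ?thesis using M'(1) l0 by simp
    qed
  qed
qed

lemma C1_convergence: "C1_converges A (\<lambda>l. conformal (G l) \<alpha>) \<alpha> (at_right 0)"
  unfolding C1_converges_def
proof (intro ballI allI impI conjI)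
  fix c and K :: "'e set" and v u
  assume c: "c \<in> A" and "compact K \<and> K \<subseteq> chart_image c"
  then have K: "compact K" "K \<subseteq> chart_image c" by blast+
  have B0: "B > 0" using B_ge_1 by simp
  have "continuous_on (chart_image c) (\<lambda>x. \<alpha> c x v)" using form_smooth[OF c, of 0 v] by simp
  from continuous_on_subset[OF this K(2)] obtain M0 where M0: "M0 \<ge> 0" "\<And>x. x \<in> K \<Longrightarrow> norm (\<alpha> c x v) \<le> M0"
    using continuous_bounded_compact[OF _ K(1)] by blast
  have "continuous_on (chart_image c) (\<lambda>x. dir_deriv (\<lambda>y. \<alpha> c y v) u x)" using form_smooth[OF c, of 1 v] by simp
  from continuous_on_subset[OF this K(2)] obtain M1 where M1: "M1 \<ge> 0" "\<And>x. x \<in> K \<Longrightarrow> norm (dir_deriv (\<lambda>y. \<alpha> c y v) u x) \<le> M1"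
    using continuous_bounded_compact[OF _ K(1)] by blast
  obtain D where D: "\<And>l x. l \<in> I \<Longrightarrow> x \<in> K \<Longrightarrow> \<bar>dir_deriv (\<lambda>x. G l (chart_inv c x)) u x\<bar> \<le> D * l"
    using G_derivative_bound[OF c K] by blast
  show "uniform_limit K (\<lambda>l x. conformal (G l) \<alpha> c x v) (\<lambda>x. \<alpha> c x v) (at_right 0)"
  proof (rule uniform_limit_at_right_0[OF B0])
    fix l x assume l: "0 < l" "l < 1 / B" and x: "x \<in> K"
    then have lI: "l \<in> I" by (simp add: I_def)
    have "\<bar>conformal (G l) \<alpha> c x v - \<alpha> c x v\<bar> = \<bar>G l (chart_inv c x) - 1\<bar> * \<bar>\<alpha> c x v\<bar>"
      by (simp add: conformal_def left_diff_distrib flip: abs_mult)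
    also have "\<dots> \<le> (2 * l) * M0" using G_bounds(1)[OF lI] M0(2)[OF x] l by (intro mult_mono) auto
    finally show "\<bar>conformal (G l) \<alpha> c x v - \<alpha> c x v\<bar> \<le> (2 * M0) * l" by (simp add: mult_ac)
  qed
  show "uniform_limit K (\<lambda>l x. dir_deriv (\<lambda>y. conformal (G l) \<alpha> c y v) u x) (\<lambda>x. dir_deriv (\<lambda>y. \<alpha> c y v) u x) (at_right 0)"
  proof (rule uniform_limit_at_right_0[OF B0])
    fix l x assume l: "0 < l" "l < 1 / B" and x: "x \<in> K"
    then have lI: "l \<in> I" by (simp add: I_def)
    have xc: "x \<in> chart_image c" using x K by blast
    interpret g: conformal_contact A \<alpha> n "G l" by (rule conformal_contact[OF lI])
    let ?g = "G l (chart_inv c x)" and ?dg = "dir_deriv (\<lambda>x. G l (chart_inv c x)) u x" and ?da = "dir_deriv (\<lambda>y. \<alpha> c y v) u x"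
    have "dir_deriv (\<lambda>y. conformal (G l) \<alpha> c y v) u x = ?g * ?da + ?dg * \<alpha> c x v"
      unfolding conformal_def
      using frechet_derivative_at[OF has_derivative_mult[OF g.g_has_derivative[OF c xc] form_has_derivative[OF c xc, of v]], symmetric]
      by (simp add: fun_eq_iff)
    then have "dir_deriv (\<lambda>y. conformal (G l) \<alpha> c y v) u x - ?da = (?g - 1) * ?da + ?dg * \<alpha> c x v" by (simp add: algebra_simps)
    then have "\<bar>dir_deriv (\<lambda>y. conformal (G l) \<alpha> c y v) u x - ?da\<bar> \<le> \<bar>?g - 1\<bar> * \<bar>?da\<bar> + \<bar>?dg\<bar> * \<bar>\<alpha> c x v\<bar>"
      using abs_triangle_ineq[of "(?g - 1) * ?da" "?dg * \<alpha> c x v"] by (simp add: abs_mult)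
    also have "\<dots> \<le> (2 * l) * M1 + (D * l) * M0"
      using G_bounds(1)[OF lI] M1(2)[OF x] M0(2)[OF x] D[OF lI x] l by (intro add_mono mult_mono) auto
    finally show "\<bar>dir_deriv (\<lambda>y. conformal (G l) \<alpha> c y v) u x - ?da\<bar> \<le> (2 * M1 + D * M0) * l" by (simp add: algebra_simps)
  qed
qed

lemma smooth_family: "smooth_family A {0<..1 / (2 * B)} (\<lambda>l. conformal (G l) \<alpha>)"
  unfolding smooth_family_def
proof (intro ballI allI)
  fix c v assume c: "c \<in> A"
  let ?U = "I \<times> chart_image c"
  have U: "open ?U" by (intro open_Times open_chart_image[OF c]) (simp add: I_def)
  have "Ck_on k ?U (\<lambda>p. \<alpha> c (snd p) v)" for k
    by (rule Ck_on_compose[OF U Ck_on_snd[OF U] form_smooth[OF c]]) auto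
  then have "Ck_on k ?U (\<lambda>p. (\<lambda>(l, x). G l (chart_inv c x)) p * \<alpha> c (snd p) v)" for k
    by (rule Ck_on_bilinear[OF U bounded_bilinear_mult G_smooth[OF c]])
  then have smooth: "Ck_on k ?U (\<lambda>(l, x). conformal (G l) \<alpha> c x v)" for k
    by (simp add: conformal_def case_prod_beta')
  have sub: "{0<..1 / (2 * B)} \<times> chart_image c \<subseteq> ?U"
  proof -
    have "1 / (2 * B) < 1 / B" using B_ge_1 by (simp add: field_simps)
    then show ?thesis by (auto simp: I_def)
  qed
  show "smooth_on ({0<..1 / (2 * B)} \<times> chart_image c) (\<lambda>(l, x). conformal (G l) \<alpha> c x v)"
    unfolding smooth_on_def
    using U sub smooth by (intro ballI exI[of _ ?U] exI[of _ "\<lambda>(l, x). conformal (G l) \<alpha> c x v"]) auto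
qed

end

theorem proposition3:
  fixes A :: "('m::t2_space, 'e::euclidean_space) chart set"
    and n :: nat
    and \<alpha>\<^sub>0 :: "('m, 'e) form1"
  assumes "closed_manifold A"
    and "n \<ge> 2"
    and "DIM('e) = 2 * n - 1"
    and "zoll_contact_form A n \<alpha>\<^sub>0"
  shows "\<exists>l\<^sub>0>0. \<exists>\<alpha> :: real \<Rightarrow> ('m, 'e) form1.
    smooth_family A {0<..l\<^sub>0} \<alpha> \<and>
    (\<forall>l\<in>{0<..l\<^sub>0}. contact_form A n (\<alpha> l)) \<and>
    C1_converges A \<alpha> \<alpha>\<^sub>0 (at_right 0) \<and>
    (\<forall>l\<in>{0<..l\<^sub>0}. systolic_ratio A n (\<alpha> l) > systolic_ratio A n \<alpha>\<^sub>0)"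
proof -
  have "contact_form A n \<alpha>\<^sub>0" using assms(4) by (simp add: zoll_contact_form_def)
  then interpret contact A \<alpha>\<^sub>0 n
    using assms(1-3) by unfold_locales (auto simp: contact_form_def)
  obtain T where zoll: "\<And>\<gamma>. reeb_orbit A \<alpha>\<^sub>0 \<gamma> \<Longrightarrow> is_minimal_period \<gamma> T"
    using assms(4) by (auto simp: zoll_contact_form_def)
  obtain p :: 'm where True by blast
  obtain c\<^sub>0 where c0: "c\<^sub>0 \<in> A" "p \<in> fst c\<^sub>0" using charts_cover by blast
  define x\<^sub>0 where "x\<^sub>0 = snd c\<^sub>0 p"
  have x0: "x\<^sub>0 \<in> chart_image c\<^sub>0" "chart_inv c\<^sub>0 x\<^sub>0 = p"
    using chart_mem[OF c0(2)] chart_inv_chart[OF c0] by (simp_all add: x\<^sub>0_def)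
  obtain r\<^sub>1 C where r1: "cball x\<^sub>0 r\<^sub>1 \<subseteq> chart_image c\<^sub>0"
    and lm1: "local_model (\<alpha>\<^sub>0 c\<^sub>0) (\<lambda>x v u. dir_deriv (\<lambda>y. \<alpha>\<^sub>0 c\<^sub>0 y v) u x) (E c\<^sub>0) (R c\<^sub>0) x\<^sub>0 r\<^sub>1 C"
    using local_model_exists[OF c0(1) x0(1)] by blast
  have C: "C \<ge> 1" and r1': "r\<^sub>1 > 0" using local_model.C[OF lm1] local_model.r[OF lm1] .
  define r where "r = min r\<^sub>1 (1 / (160 * C ^ 3))"
  have r: "r > 0" "r \<le> r\<^sub>1" "r \<le> 1 / (160 * C ^ 3)" using r1' C by (simp_all add: r_def)
  have r_small: "160 * C ^ 3 * r \<le> 1" using r(3) C by (simp add: field_simps)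
  have ball: "cball x\<^sub>0 r \<subseteq> chart_image c\<^sub>0" by (rule order_trans[OF subset_cball[OF r(2)] r1])
  interpret lm: local_model "\<alpha>\<^sub>0 c\<^sub>0" "\<lambda>x v u. dir_deriv (\<lambda>y. \<alpha>\<^sub>0 c\<^sub>0 y v) u x" "E c\<^sub>0" "R c\<^sub>0" x\<^sub>0 r C
    by (rule local_model_shrink[OF lm1 r(1,2)])
  \<comment> \<open>Here \<open>n \<ge> 2\<close> enters: in dimension at least 3 the Reeb direction
    does not span the space, so the contact hyperplane contains a nonzero vector, the direction
    \<open>e\<close> of the displacement after scaling.\<close>
  have "\<exists>v. v \<noteq> 0 \<and> \<alpha>\<^sub>0 c\<^sub>0 x\<^sub>0 v = 0"
  proof (rule ccontr)
    interpret a: linear "\<alpha>\<^sub>0 c\<^sub>0 x\<^sub>0" by (rule form_linear[OF c0(1) x0(1)])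
    assume none: "\<nexists>v. v \<noteq> 0 \<and> \<alpha>\<^sub>0 c\<^sub>0 x\<^sub>0 v = 0"
    have "v \<in> span {R c\<^sub>0 x\<^sub>0}" for v
    proof -
      have "\<alpha>\<^sub>0 c\<^sub>0 x\<^sub>0 (v - \<alpha>\<^sub>0 c\<^sub>0 x\<^sub>0 v *\<^sub>R R c\<^sub>0 x\<^sub>0) = 0"
        using form_reeb[OF c0(1) x0(1)] by (simp add: a.diff a.scale)
      then have "v = \<alpha>\<^sub>0 c\<^sub>0 x\<^sub>0 v *\<^sub>R R c\<^sub>0 x\<^sub>0" using none eq_iff_diff_eq_0 by blast
      then show ?thesis by (metis span_base span_scale singletonI)
    qed
    then have "dim (UNIV :: 'e set) \<le> card {R c\<^sub>0 x\<^sub>0}" by (intro dim_le_card) auto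
    then show False using assms(2,3) by simp
  qed
  then obtain v where v: "v \<noteq> 0" "\<alpha>\<^sub>0 c\<^sub>0 x\<^sub>0 v = 0" by blast
  define e where "e = (1 / (2 * norm v)) *\<^sub>R v"
  have e: "\<alpha>\<^sub>0 c\<^sub>0 x\<^sub>0 e = 0" "norm e = 1 / 2"
    using v linear_scale[OF form_linear[OF c0(1) x0(1)]] by (simp_all add: e_def)
  from continuous_bounded_compact[OF continuous_on_subset[OF weight_continuous[OF c0(1)] ball] compact_cball]
  obtain M where M: "M \<ge> 0" "\<And>x. x \<in> cball x\<^sub>0 r \<Longrightarrow> norm (weight c\<^sub>0 x) \<le> M" by blast
  have "cball x\<^sub>0 r \<noteq> {}" using r(1) by simp
  from continuous_attains_inf[OF compact_cball this continuous_on_subset[OF weight_continuous[OF c0(1)] ball]]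
  obtain y where y: "y \<in> cball x\<^sub>0 r" "\<And>x. x \<in> cball x\<^sub>0 r \<Longrightarrow> weight c\<^sub>0 y \<le> weight c\<^sub>0 x" by blast
  define m where "m = weight c\<^sub>0 y"
  have m: "m > 0" unfolding m_def using weight_pos[OF c0(1)] y(1) ball by blast
  \<comment> \<open>A return before \<open>T\<close> would give the orbit of \<open>p\<close> a
    period shorter than its minimal one. By \<open>no_early_return\<close> this extends to the
    orbits from a neighbourhood of \<open>p\<close>, at times bounded away from 0 and
    \<open>T\<close>.\<close>
  have no_ret: "reeb.flow p t \<noteq> p" if "t \<in> {r / (8 * C)..T - r / (8 * C)}" for t
  proof
    assume eq: "reeb.flow p t = p"
    have "r / (8 * C) > 0" using r(1) C by simp
    then have t: "0 < t" "t < T" using that by auto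
    have "reeb.flow p (s + t) = reeb.flow p s" for s
      using reeb.flow_add[of p t s] by (simp add: eq add.commute)
    then have "is_period (reeb.flow p) t" using t by (simp add: is_period_def)
    moreover have "is_minimal_period (reeb.flow p) T" by (rule zoll) (simp add: reeb_orbit_iff reeb.flow_curve)
    ultimately show False using t by (force simp: is_minimal_period_def)
  qed
  obtain W where W: "open W" "p \<in> W" "\<And>q t. q \<in> W \<Longrightarrow> t \<in> {r / (8 * C)..T - r / (8 * C)} \<Longrightarrow> reeb.flow q t \<notin> W"
    using reeb.no_early_return[OF no_ret] by blast
  have "open (chart_image c\<^sub>0 \<inter> chart_inv c\<^sub>0 -` W)"
    by (rule continuous_open_preimage[OF cont_chart_inv[OF c0(1)] open_chart_image[OF c0(1)] W(1)])
  moreover have "x\<^sub>0 \<in> chart_image c\<^sub>0 \<inter> chart_inv c\<^sub>0 -` W" using x0 W(2) by simp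
  ultimately obtain \<delta> where \<delta>: "\<delta> > 0" "cball x\<^sub>0 \<delta> \<subseteq> chart_image c\<^sub>0 \<inter> chart_inv c\<^sub>0 -` W"
    using open_contains_cball by metis
  \<comment> \<open>The first two entries serve the estimates for the bump, the third the size of
    the box relative to the ball, the fourth the volume. The last one makes the ball of radius
    \<open>8 * C / B\<close> lie in the coordinate image of the neighbourhood \<open>W\<close>
    without early returns.\<close>
  define B where "B = Max {10 ^ 10 * C ^ 11, 1280 * C ^ 5 * (324 * C\<^sup>2 + 2), 160 * C / r,
    2 ^ n * M * 2 ^ DIM('e) / (exp (- 2) * m), 8 * C / \<delta>}"
  have "10 ^ 10 * C ^ 11 \<le> B" "1280 * C ^ 5 * (324 * C\<^sup>2 + 2) \<le> B" "160 * C / r \<le> B"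
    "2 ^ n * M * 2 ^ DIM('e) / (exp (- 2) * m) \<le> B" "8 * C / \<delta> \<le> B"
    unfolding B_def by (rule Max_ge; simp)+
  moreover have "exp (- 2) * m > 0" using m by simp
  ultimately have B: "10 ^ 10 * C ^ 11 \<le> B" "1280 * C ^ 5 * (324 * C\<^sup>2 + 2) \<le> B" "160 * C \<le> B * r"
      "2 ^ n * M * 2 ^ DIM('e) \<le> B * (exp (- 2) * m)" "8 * C \<le> B * \<delta>"
    using r(1) \<delta>(1) by (simp_all only: pos_divide_le_eq)
  have "0 < 8 * C" using C by simp
  then have B0: "B > 0" using B(5) \<delta>(1) by (metis less_le_trans zero_less_mult_pos2)
  interpret z: zoll_chart A \<alpha>\<^sub>0 n c\<^sub>0 "\<lambda>x v u. dir_deriv (\<lambda>y. \<alpha>\<^sub>0 c\<^sub>0 y v) u x" x\<^sub>0 r C e T m M B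
  proof unfold_locales
    show "m \<le> weight c\<^sub>0 x \<and> weight c\<^sub>0 x \<le> M" if "x \<in> cball x\<^sub>0 r" for x
      using y(2)[OF that] M(2)[OF that] by (auto simp: m_def)
    show "reeb.flow (chart_inv c\<^sub>0 x) t \<noteq> chart_inv c\<^sub>0 y"
      if "x \<in> cball x\<^sub>0 (8 * C / B)" "y \<in> cball x\<^sub>0 (8 * C / B)" "t \<in> {r / (8 * C)..T - r / (8 * C)}" for x y t
    proof -
      have "8 * C / B \<le> \<delta>" using B(5) B0 by (simp add: field_simps)
      then have "cball x\<^sub>0 (8 * C / B) \<subseteq> cball x\<^sub>0 \<delta>" by (rule subset_cball)
      then have "chart_inv c\<^sub>0 x \<in> W" "chart_inv c\<^sub>0 y \<in> W" using that(1,2) \<delta>(2) by blast+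
      then show ?thesis using W(3)[OF _ that(3)] by metis
    qed
    show "n \<ge> 1" using assms(2) by simp
  qed (fact c0 ball e r_small zoll m B)+
  have I: "l \<in> z.I" if "l \<in> {0<..1 / (2 * B)}" for l
  proof -
    have "1 / (2 * B) < 1 / B" using B0 by (simp add: field_simps)
    then show ?thesis using that by (auto simp: z.I_def)
  qed
  have "contact_form A n (conformal (z.G l) \<alpha>\<^sub>0)" if "l \<in> {0<..1 / (2 * B)}" for l
  proof -
    interpret g: conformal_contact A \<alpha>\<^sub>0 n "z.G l" by (rule z.conformal_contact[OF I[OF that]])
    show ?thesis by (rule g.conf.contact)
  qed
  then show ?thesis
    using B0 z.smooth_family z.C1_convergence z.systolic_ratio_less[OF I]
    by (intro exI[of _ "1 / (2 * B)"] conjI exI[of _ "\<lambda>l. conformal (z.G l) \<alpha>\<^sub>0"]) auto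
qed

end
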